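(* Let $\theta_1 \in (0,\pi/2]$, $\theta_2 \in [0,\pi/2]$, $p \in \mathcal{C}^2([0,1])$ with $p>0$, and $\tilde q \in \mathcal{C}^0([0,1])$. Let $q \in \mathcal{C}^0([0,1])$ and $q_c \in \mathbb{R}$ be such that $\tilde q = q - q_c$ and $q>0$ on $[0,1]$. Let $\delta>0$ and $N_0 \ge 1$ be such that $-\lambda_n + q_c < -\delta$ for all $n \ge N_0+1$. Let $K \in \mathbb{R}^{1\times N_0}\setminus\{0\}$ and $L=(l_1,\dots,l_{N_0})^\top \in \mathbb{R}^{N_0}$ be such that $A_0+\mathfrak{B}_0K$ and $A_0 - LC_0$ are Hurwitz with all eigenvalues of real part strictly less than $-\delta$. Let $h>0$. For a given $N \ge N_0+1$, assume there exist a symmetric $P \succ 0$, $\alpha>1$ and $\beta,\gamma>0$ such that $$\Theta_1 \preceq 0, \qquad \Theta_2 \le 0,$$ where $$\Theta_1 = \begin{bmatrix} F^\top P + PF + 2\delta P + \alpha\gamma \|\mathcal{R}_N a\|_{L^2}^2 \tilde K^\top \tilde K & P\mathcal{L} \\ \mathcal{L}^\top P & -\beta e^{-2\delta h}\end{bmatrix} + \alpha\gamma\|\mathcal{R}_N b\|_{L^2}^2 E^\top E,$$ $$\Theta_2 = 2\gamma\left\{-\left(1-\tfrac{1}{\alpha}\right)\lambda_{N+1} + q_c + \delta\right\} + \beta M_\phi, \qquad M_\phi = \sum_{n\ge N+1}\frac{|\phi_n(0)|^2}{\lambda_n} < +\infty.$$ Then there exists $M>0$ such that for any initial condition $z_0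 \in H^2(0,1)$ and $\hat z_n(0)\in\mathbb{R}$ ($1\le n\le N$) with $\cos\theta_1 z_0(0) - \sin\theta_1 z_0'(0) = 0$ and $\cos\theta_2 z_0(1) + \sin\theta_2 z_0'(1) = u_0 = K\hat Z_A^{N_0}(0)$, and any Lipschitz continuous $y_0 \in \mathcal{C}^0([-h,0])$ with $y_0(0)=z_0(0)$, the (classical) trajectories of the closed-loop system consisting of the plant, the delayed Dirichlet measurement $y_D$, and the controller described in the context satisfy $$\|z(t,\cdot)\|_{H^1}^2 + \sum_{n=1}^N \hat z_n(t)^2 \le M e^{-2\delta t}\left(\|z_0\|_{H^1}^2 + \sum_{n=1}^N \hat z_n(0)^2 + u_0^2 + \|y_0\|_\infty^2\right)\quad \text{for all } t\ge 0.$$ Moreover, for any given $h>0$, the constraints $\Theta_1\preceq 0$, $\Theta_2\le 0$ are feasible (for some $P\succ0$, $\alpha>1$, $\beta,\gamma>0$) provided $N$ is selected large enough.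
   Context: Notation: $c_{\theta_i}=\cos\theta_i$, $s_{\theta_i}=\sin\theta_i$; $L^2(0,1)$ with inner product $\langle f,g\rangle=\int_0^1 fg\,dx$. The Sturm–Liouville operator $\mathcal{A}f = -(pf')' + qf$ on $D(\mathcal{A}) = \{f\in H^2(0,1): c_{\theta_1}f(0)-s_{\theta_1}f'(0) = c_{\theta_2}f(1)+s_{\theta_2}f'(1)=0\}$ has simple eigenvalues $0<\lambda_1<\lambda_2<\dots\to+\infty$ with associated unit eigenfunctions $\phi_n$ forming a Hilbert basis of $L^2(0,1)$. For $f\in L^2(0,1)$, $\mathcal{R}_N f = \sum_{n\ge N+1}\langle f,\phi_n\rangle\phi_n$. Plant: for $t>0$, $x\in(0,1)$: $z_t = (p z_x)_x - \tilde q z$, $c_{\theta_1}z(t,0)-s_{\theta_1}z_x(t,0)=0$, $c_{\theta_2}z(t,1)+s_{\theta_2}z_x(t,1)=u(t)$, $z(0,\cdot)=z_0$; $u_0 = c_{\theta_2}z_0(1)+s_{\theta_2}z_0'(1)$. Delayed Dirichlet measurement: $y_D(t) = z(t-h,0)$ for $t\ge h$ and $y_D(t)=y_0(t-h)$ for $0\le t\le h$. Coefficients: $a(x) = \frac{2p(x)+2xp'(x)-x^2\tilde q(x)}{c_{\theta_2}+2s_{\theta_2}}$, $b(x) = -\frac{x^2}{c_{\theta_2}+2s_{\theta_2}}$, $a_n=\langle a,\phi_n\rangle$, $b_n=\langle b,\phi_n\rangle$, $\beta_n = p(1)\{-c_{\theta_2}\phi_n'(1)+s_{\theta_2}\phi_n(1)\}$.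 Controller (for $t\ge0$, with convention $u(\tau)=u_0$ for $\tau\le 0$): $\hat w_n(t) = \hat z_n(t) + b_n u(t-h)$; for $1\le n\le N_0$: $\dot{\hat z}_n = (-\lambda_n+q_c)\hat z_n + \beta_n u(t-h) - l_n\{\sum_{k=1}^N \hat w_k(t)\phi_k(0) - y_D(t)\}$; for $N_0+1\le n\le N$: $\dot{\hat z}_n = (-\lambda_n+q_c)\hat z_n + \beta_n u(t-h)$. With $\hat Z^{N_0} = (\hat z_1,\dots,\hat z_{N_0})^\top$, $A_0 = \mathrm{diag}(-\lambda_1+q_c,\dots,-\lambda_{N_0}+q_c)$, $\mathfrak{B}_0 = (\beta_1,\dots,\beta_{N_0})^\top$, the predictor is $\hat Z_A^{N_0}(t) = e^{A_0h}\hat Z^{N_0}(t) + \int_{t-h}^t e^{A_0(t-s)}\mathfrak{B}_0u(s)\,ds$ and the control is $u(t) = K\hat Z_A^{N_0}(t)$ for $t\ge 0$. Matrices: $C_0 = [\phi_1(0)\ \cdots\ \phi_{N_0}(0)]$, $\tilde C_1 = [\phi_{N_0+1}(0)/\sqrt{\lambda_{N_0+1}}\ \cdots\ \phi_N(0)/\sqrt{\lambda_N}]$, $A_1 = \mathrm{diag}(-\lambda_{N_0+1}+q_c,\dots,-\lambda_N+q_c)$, $\tilde{\mathfrak{B}}_1 = (\beta_{N_0+1}/\lambda_{N_0+1},\dots,\beta_N/\lambda_N)^\top$, $$F = \begin{bmatrix} A_0+\mathfrak{B}_0K & e^{A_0h}LC_0 & 0 & e^{A_0h}L\tilde C_1\\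 0 & A_0-LC_0 & 0 & -L\tilde C_1\\ \tilde{\mathfrak{B}}_1K & 0 & A_1 & 0\\ 0&0&0&A_1\end{bmatrix},\quad \mathcal{L} = \begin{bmatrix} e^{A_0h}L\\ -L\\ 0\\ 0\end{bmatrix},$$ $\tilde K = [K\ 0\ 0\ 0]$ (size compatible with $F$), and $E = K\,[A_0+\mathfrak{B}_0K\ \ e^{A_0h}LC_0\ \ 0\ \ e^{A_0h}L\tilde C_1\ \ e^{A_0h}L]$ (a row vector of size $1\times(2N+1)$). *)

theory Defs
  imports "HOL-Analysis.Analysis" "Jordan_Normal_Form.Matrix" "Jordan_Normal_Form.Char_Poly"
begin

definition L2 :: "(real \<Rightarrow> real) \<Rightarrow> bool" where
  "L2 f \<longleftrightarrow> set_borel_measurable lborel {0..1} f \<and> set_integrable lborel {0..1} (\<lambda>x. (f x)^2)"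

definition ip :: "(real \<Rightarrow> real) \<Rightarrow> (real \<Rightarrow> real) \<Rightarrow> real" where
  "ip f g = (LINT x:{0..1}|lborel. f x * g x)"

definition dx :: "(real \<Rightarrow> real) \<Rightarrow> real \<Rightarrow> real" where
  "dx f x = vector_derivative f (at x within {0..1})"

text \<open>H^2(0,1) (continuous representative): f is C^1 on [0,1] with derivative g, and g is
  absolutely continuous with derivative w in L^2(0,1).\<close>
definition H2_wit :: "(real \<Rightarrow> real) \<Rightarrow> (real \<Rightarrow> real) \<Rightarrow> (real \<Rightarrow> real) \<Rightarrow> bool" where
  "H2_wit f g w \<longleftrightarrow> L2 w \<and>
     (\<forall>x\<in>{0..1}. (f has_real_derivative g x) (at x within {0..1})) \<and>
     (\<forall>x\<in>{0..1}. g x = g 0 + (LINT s:{0..x}|lborel. w s))"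

definition H2 :: "(real \<Rightarrow> real) \<Rightarrow> bool" where
  "H2 f \<longleftrightarrow> (\<exists>g w. H2_wit f g w)"

definition H1_norm_sq :: "(real \<Rightarrow> real) \<Rightarrow> real" where
  "H1_norm_sq f = (LINT x:{0..1}|lborel. (f x)^2 + (dx f x)^2)"

definition C2_on01 :: "(real \<Rightarrow> real) \<Rightarrow> bool" where
  "C2_on01 p \<longleftrightarrow> (\<exists>p1 p2. continuous_on {0..1} p2 \<and>
     (\<forall>x\<in>{0..1}. (p has_real_derivative p1 x) (at x within {0..1})) \<and>
     (\<forall>x\<in>{0..1}. (p1 has_real_derivative p2 x) (at x within {0..1})))"

definition in_DA :: "real \<Rightarrow> real \<Rightarrow> (real \<Rightarrow> real) \<Rightarrow> bool" where
  "in_DA th1 th2 f \<longleftrightarrow> H2 f \<and> cos th1 * f 0 - sin th1 * dx f 0 = 0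
      \<and> cos th2 * f 1 + sin th2 * dx f 1 = 0"

text \<open>f is an eigenfunction of A f = -(p f')' + q f with eigenvalue lam (equality in L^2).\<close>
definition SL_eigen :: "(real \<Rightarrow> real) \<Rightarrow> (real \<Rightarrow> real) \<Rightarrow> real \<Rightarrow> real \<Rightarrow> real \<Rightarrow> (real \<Rightarrow> real) \<Rightarrow> bool" where
  "SL_eigen p q th1 th2 lam f \<longleftrightarrow> in_DA th1 th2 f \<and>
     (\<exists>g w. H2_wit f g w \<and>
        (AE x in lborel. x \<in> {0..1} \<longrightarrow> - (dx p x * g x + p x * w x) + q x * f x = lam * f x))"

definition SL_eigenbasis :: "(real \<Rightarrow> real) \<Rightarrow> (real \<Rightarrow> real) \<Rightarrow> real \<Rightarrow> real \<Rightarrow> (nat \<Rightarrow> real) \<Rightarrow> (nat \<Rightarrow> real \<Rightarrow> real) \<Rightarrow> bool" where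
  "SL_eigenbasis p q th1 th2 lam phi \<longleftrightarrow>
     (\<forall>n\<ge>1. 0 < lam n \<and> lam n < lam (Suc n)) \<and> filterlim lam at_top sequentially \<and>
     (\<forall>n\<ge>1. SL_eigen p q th1 th2 (lam n) (phi n)) \<and>
     (\<forall>n\<ge>1. \<forall>m\<ge>1. ip (phi n) (phi m) = (if n = m then 1 else 0)) \<and>
     (\<forall>f. L2 f \<longrightarrow>
        (\<lambda>M. LINT x:{0..1}|lborel. (f x - (\<Sum>k=1..M. ip f (phi k) * phi k x))^2) \<longlonglongrightarrow> 0)"

text \<open>Squared L^2 norm of R_N f = sum_{n \<ge> N+1} <f,phi_n> phi_n (Parseval).\<close>
definition RN_norm_sq :: "(nat \<Rightarrow> real \<Rightarrow> real) \<Rightarrow> nat \<Rightarrow> (real \<Rightarrow> real) \<Rightarrow> real" where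
  "RN_norm_sq phi N f = (\<Sum>n. (ip f (phi (n + N + 1)))^2)"

definition M_phi :: "(nat \<Rightarrow> real) \<Rightarrow> (nat \<Rightarrow> real \<Rightarrow> real) \<Rightarrow> nat \<Rightarrow> real" where
  "M_phi lam phi N = (\<Sum>n. (phi (n + N + 1) 0)^2 / lam (n + N + 1))"

definition a_fun :: "(real \<Rightarrow> real) \<Rightarrow> (real \<Rightarrow> real) \<Rightarrow> real \<Rightarrow> real \<Rightarrow> real" where
  "a_fun p qt th2 x = (2 * p x + 2 * x * dx p x - x^2 * qt x) / (cos th2 + 2 * sin th2)"

definition b_fun :: "real \<Rightarrow> real \<Rightarrow> real" where
  "b_fun th2 x = - (x^2) / (cos th2 + 2 * sin th2)"

definition beta_n :: "(real \<Rightarrow> real) \<Rightarrow> real \<Rightarrow> (nat \<Rightarrow> real \<Rightarrow> real) \<Rightarrow> nat \<Rightarrow> real" where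
  "beta_n p th2 phi n = p 1 * (- cos th2 * dx (phi n) 1 + sin th2 * phi n 1)"

section \<open>Matrices (Jordan_Normal_Form, 0-based indices; index i corresponds to mode n = i+1)\<close>

definition hstack :: "real mat \<Rightarrow> real mat \<Rightarrow> real mat" where
  "hstack A B = four_block_mat A B (0\<^sub>m 0 (dim_col A)) (0\<^sub>m 0 (dim_col B))"

definition vstack :: "real mat \<Rightarrow> real mat \<Rightarrow> real mat" where
  "vstack A B = A @\<^sub>r B"

definition A0m :: "(nat \<Rightarrow> real) \<Rightarrow> real \<Rightarrow> nat \<Rightarrow> real mat" where
  "A0m lam qc N0 = mat N0 N0 (\<lambda>(i,j). if i = j then - lam (i+1) + qc else 0)"

definition expA0h :: "(nat \<Rightarrow> real) \<Rightarrow> real \<Rightarrow> nat \<Rightarrow> real \<Rightarrow> real mat" where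
  "expA0h lam qc N0 h = mat N0 N0 (\<lambda>(i,j). if i = j then exp ((- lam (i+1) + qc) * h) else 0)"

definition B0m :: "(nat \<Rightarrow> real) \<Rightarrow> nat \<Rightarrow> real mat" where
  "B0m beta N0 = mat N0 1 (\<lambda>(i,j). beta (i+1))"

definition C0m :: "(nat \<Rightarrow> real \<Rightarrow> real) \<Rightarrow> nat \<Rightarrow> real mat" where
  "C0m phi N0 = mat 1 N0 (\<lambda>(i,j). phi (j+1) 0)"

definition C1tm :: "(nat \<Rightarrow> real) \<Rightarrow> (nat \<Rightarrow> real \<Rightarrow> real) \<Rightarrow> nat \<Rightarrow> nat \<Rightarrow> real mat" where
  "C1tm lam phi N0 N = mat 1 (N - N0) (\<lambda>(i,j). phi (N0+j+1) 0 / sqrt (lam (N0+j+1)))"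

definition A1m :: "(nat \<Rightarrow> real) \<Rightarrow> real \<Rightarrow> nat \<Rightarrow> nat \<Rightarrow> real mat" where
  "A1m lam qc N0 N = mat (N - N0) (N - N0) (\<lambda>(i,j). if i = j then - lam (N0+i+1) + qc else 0)"

definition B1tm :: "(nat \<Rightarrow> real) \<Rightarrow> (nat \<Rightarrow> real) \<Rightarrow> nat \<Rightarrow> nat \<Rightarrow> real mat" where
  "B1tm lam beta N0 N = mat (N - N0) 1 (\<lambda>(i,j). beta (N0+i+1) / lam (N0+i+1))"

definition Fm :: "(nat \<Rightarrow> real) \<Rightarrow> (nat \<Rightarrow> real \<Rightarrow> real) \<Rightarrow> (nat \<Rightarrow> real) \<Rightarrow> real \<Rightarrow> nat \<Rightarrow> nat \<Rightarrow> real \<Rightarrow> real mat \<Rightarrow> real mat \<Rightarrow> real mat" where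
  "Fm lam phi beta qc N0 N h K L =
    (let A0 = A0m lam qc N0; E0 = expA0h lam qc N0 h; B0 = B0m beta N0; C0 = C0m phi N0;
         C1 = C1tm lam phi N0 N; A1 = A1m lam qc N0 N; B1 = B1tm lam beta N0 N; M = N - N0 in
     four_block_mat
       (four_block_mat (A0 + B0 * K) (E0 * L * C0) (0\<^sub>m N0 N0) (A0 - L * C0))
       (four_block_mat (0\<^sub>m N0 M) (E0 * L * C1) (0\<^sub>m N0 M) (- (L * C1)))
       (four_block_mat (B1 * K) (0\<^sub>m M N0) (0\<^sub>m M N0) (0\<^sub>m M N0))
       (four_block_mat A1 (0\<^sub>m M M) (0\<^sub>m M M) A1))"

definition Lcalm :: "(nat \<Rightarrow> real) \<Rightarrow> real \<Rightarrow> nat \<Rightarrow> nat \<Rightarrow> real \<Rightarrow> real mat \<Rightarrow> real mat" where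
  "Lcalm lam qc N0 N h L =
     vstack (vstack (expA0h lam qc N0 h * L) (- L)) (vstack (0\<^sub>m (N - N0) 1) (0\<^sub>m (N - N0) 1))"

definition Ktm :: "nat \<Rightarrow> nat \<Rightarrow> real mat \<Rightarrow> real mat" where
  "Ktm N0 N K = hstack K (0\<^sub>m 1 (2 * N - N0))"

definition Em :: "(nat \<Rightarrow> real) \<Rightarrow> (nat \<Rightarrow> real \<Rightarrow> real) \<Rightarrow> (nat \<Rightarrow> real) \<Rightarrow> real \<Rightarrow> nat \<Rightarrow> nat \<Rightarrow> real \<Rightarrow> real mat \<Rightarrow> real mat \<Rightarrow> real mat" where
  "Em lam phi beta qc N0 N h K L =
    (let A0 = A0m lam qc N0; E0 = expA0h lam qc N0 h; B0 = B0m beta N0; C0 = C0m phi N0;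
         C1 = C1tm lam phi N0 N in
     K * hstack (hstack (hstack (A0 + B0 * K) (E0 * L * C0)) (hstack (0\<^sub>m N0 (N - N0)) (E0 * L * C1)))
                (E0 * L))"

definition pos_def :: "real mat \<Rightarrow> bool" where
  "pos_def P \<longleftrightarrow> (\<forall>v\<in>carrier_vec (dim_row P). v \<noteq> 0\<^sub>v (dim_row P) \<longrightarrow> scalar_prod v (P *\<^sub>v v) > 0)"

definition neg_semidef :: "real mat \<Rightarrow> bool" where
  "neg_semidef P \<longleftrightarrow> (\<forall>v\<in>carrier_vec (dim_row P). scalar_prod v (P *\<^sub>v v) \<le> 0)"

definition eigs_below :: "real mat \<Rightarrow> real \<Rightarrow> bool" where
  "eigs_below A d \<longleftrightarrow> (\<forall>\<mu>. eigenvalue (map_mat complex_of_real A) \<mu> \<longrightarrow> Re \<mu> < d)"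

definition Theta1 :: "(real \<Rightarrow> real) \<Rightarrow> (real \<Rightarrow> real) \<Rightarrow> real \<Rightarrow> (nat \<Rightarrow> real) \<Rightarrow> (nat \<Rightarrow> real \<Rightarrow> real)
    \<Rightarrow> real \<Rightarrow> real \<Rightarrow> nat \<Rightarrow> nat \<Rightarrow> real \<Rightarrow> real mat \<Rightarrow> real mat
    \<Rightarrow> real mat \<Rightarrow> real \<Rightarrow> real \<Rightarrow> real \<Rightarrow> real mat" where
  "Theta1 p qt th2 lam phi qc \<delta> N0 N h K L P \<alpha> \<beta> \<gamma> =
    (let beta = beta_n p th2 phi; F = Fm lam phi beta qc N0 N h K L; Lc = Lcalm lam qc N0 N h L;
         Kt = Ktm N0 N K; E = Em lam phi beta qc N0 N h K L in
     four_block_mat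
       (F\<^sup>T * P + P * F + (2 * \<delta>) \<cdot>\<^sub>m P
          + (\<alpha> * \<gamma> * RN_norm_sq phi N (a_fun p qt th2)) \<cdot>\<^sub>m (Kt\<^sup>T * Kt))
       (P * Lc) (Lc\<^sup>T * P) (mat 1 1 (\<lambda>_. - \<beta> * exp (- 2 * \<delta> * h)))
     + (\<alpha> * \<gamma> * RN_norm_sq phi N (b_fun th2)) \<cdot>\<^sub>m (E\<^sup>T * E))"

definition Theta2 :: "(nat \<Rightarrow> real) \<Rightarrow> (nat \<Rightarrow> real \<Rightarrow> real) \<Rightarrow> real \<Rightarrow> real \<Rightarrow> nat \<Rightarrow> real \<Rightarrow> real \<Rightarrow> real \<Rightarrow> real" where
  "Theta2 lam phi qc \<delta> N \<alpha> \<beta> \<gamma> =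
     2 * \<gamma> * (- (1 - 1 / \<alpha>) * lam (N + 1) + qc + \<delta>) + \<beta> * M_phi lam phi N"

definition LMI_feasible :: "(real \<Rightarrow> real) \<Rightarrow> (real \<Rightarrow> real) \<Rightarrow> real \<Rightarrow> (nat \<Rightarrow> real) \<Rightarrow> (nat \<Rightarrow> real \<Rightarrow> real)
    \<Rightarrow> real \<Rightarrow> real \<Rightarrow> nat \<Rightarrow> nat \<Rightarrow> real \<Rightarrow> real mat \<Rightarrow> real mat \<Rightarrow> bool" where
  "LMI_feasible p qt th2 lam phi qc \<delta> N0 N h K L \<longleftrightarrow>
     (\<exists>P \<alpha> \<beta> \<gamma>. P \<in> carrier_mat (2 * N) (2 * N) \<and> P\<^sup>T = P \<and> pos_def P \<and>
        \<alpha> > 1 \<and> \<beta> > 0 \<and> \<gamma> > 0 \<and>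
        neg_semidef (Theta1 p qt th2 lam phi qc \<delta> N0 N h K L P \<alpha> \<beta> \<gamma>) \<and>
        Theta2 lam phi qc \<delta> N \<alpha> \<beta> \<gamma> \<le> 0)"

definition uext :: "(real \<Rightarrow> real) \<Rightarrow> real \<Rightarrow> real \<Rightarrow> real" where
  "uext u u0 \<tau> = (if \<tau> \<le> 0 then u0 else u \<tau>)"

definition ZA :: "(nat \<Rightarrow> real) \<Rightarrow> (nat \<Rightarrow> real) \<Rightarrow> real \<Rightarrow> real \<Rightarrow> (nat \<Rightarrow> real \<Rightarrow> real)
     \<Rightarrow> (real \<Rightarrow> real) \<Rightarrow> real \<Rightarrow> nat \<Rightarrow> real \<Rightarrow> real" where
  "ZA lam beta qc h zh u u0 n t =
     exp ((- lam n + qc) * h) * zh n t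
     + (LINT s:{t-h..t}|lborel. exp ((- lam n + qc) * (t - s)) * beta n * uext u u0 s)"

definition Kpred :: "real mat \<Rightarrow> nat \<Rightarrow> (nat \<Rightarrow> real) \<Rightarrow> (nat \<Rightarrow> real) \<Rightarrow> real \<Rightarrow> real
     \<Rightarrow> (nat \<Rightarrow> real \<Rightarrow> real) \<Rightarrow> (real \<Rightarrow> real) \<Rightarrow> real \<Rightarrow> real \<Rightarrow> real" where
  "Kpred K N0 lam beta qc h zh u u0 t = (\<Sum>i<N0. K $$ (0, i) * ZA lam beta qc h zh u u0 (i+1) t)"

definition yD :: "real \<Rightarrow> (real \<Rightarrow> real \<Rightarrow> real) \<Rightarrow> (real \<Rightarrow> real) \<Rightarrow> real \<Rightarrow> real" where
  "yD h z y0 t = (if t \<ge> h then z (t - h) 0 else y0 (t - h))"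

definition closed_loop_sol where
  "closed_loop_sol th1 th2 p qt lam phi qc N0 N h K L z0 y0 u0 z zh u \<longleftrightarrow>
    (let beta = beta_n p th2 phi; b = b_fun th2;
         ue = uext u u0;
         what = (\<lambda>k t. zh k t + ip b (phi k) * ue (t - h)) in
     (\<forall>x\<in>{0..1}. z 0 x = z0 x) \<and>
     (\<forall>t\<ge>0. H2 (z t)) \<and>
     (\<forall>t\<ge>0. ((\<lambda>s. LINT x:{0..1}|lborel. (z s x - z t x)^2) \<longlongrightarrow> 0) (at t within {0..})) \<and>
     (\<forall>t>0. \<exists>zt. L2 zt \<and>
        ((\<lambda>s. LINT x:{0..1}|lborel. ((z s x - z t x) / (s - t) - zt x)^2) \<longlongrightarrow> 0) (at t) \<and>
        (\<exists>g w. H2_wit (z t) g w \<and>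
           (AE x in lborel. x \<in> {0..1} \<longrightarrow> zt x = dx p x * g x + p x * w x - qt x * z t x))) \<and>
     (\<forall>t\<ge>0. cos th1 * z t 0 - sin th1 * dx (z t) 0 = 0) \<and>
     (\<forall>t\<ge>0. cos th2 * z t 1 + sin th2 * dx (z t) 1 = u t) \<and>
     continuous_on {0..} u \<and>
     (\<forall>t\<ge>0. u t = Kpred K N0 lam beta qc h zh u u0 t) \<and>
     (\<forall>n\<in>{1..N}. continuous_on {0..} (zh n)) \<and>
     (\<forall>n\<in>{1..N0}. \<forall>t>0. (zh n has_real_derivative
         ((- lam n + qc) * zh n t + beta n * ue (t - h)
          - L $$ (n - 1, 0) * ((\<Sum>k=1..N. what k t * phi k 0) - yD h z y0 t))) (at t)) \<and>
     (\<forall>n\<in>{N0+1..N}. \<forall>t>0. (zh n has_real_derivative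
         ((- lam n + qc) * zh n t + beta n * ue (t - h))) (at t)))"

end

theory Submission
  imports Defs "Jordan_Normal_Form.Spectral_Radius"
begin

text \<open>Subtracting the boundary lift, \<open>w = z + u * b\<close> lies in the domain of the Sturm--Liouville operator, so
  its energy \<open>\<Sum>n. \<lambda>\<^sub>n \<langle>w, \<phi>\<^sub>n\<rangle>\<^sup>2\<close> is equivalent to its squared \<open>H\<^sup>1\<close> norm and its trace at \<open>0\<close> is the sum of its
  modal expansion. The predictor modes \<open>Z\<^sub>n\<close> and the delayed errors \<open>e\<^sub>n t = z\<^sub>n (t - h) - zh\<^sub>n t\<close> of the observer form
  a vector \<open>X\<close> with \<open>X' = F X + \<L> \<zeta>\<close>, where \<open>\<zeta>\<close> is the delayed trace of the modes above \<open>N\<close>, so that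
  \<open>\<zeta>\<^sup>2\<close> is at most \<open>M\<^sub>\<phi>\<close> times the delayed tail energy. For \<open>t \<ge> h\<close> the functional
  \<open>X\<^sup>T P X + \<gamma> * tail energy + \<beta> * M\<^sub>\<phi> * \<integral> exp (- 2 \<delta> (t - s)) * tail energy (s) ds\<close> over \<open>t - h \<le> s \<le> t\<close> decays like
  \<open>exp (- 2 \<delta> t)\<close> by \<open>\<Theta>\<^sub>1\<close> and \<open>\<Theta>\<^sub>2\<close>; on \<open>[0, h]\<close> Gronwall's inequality suffices.

  For feasibility, \<open>P\<close> is taken block diagonal, from the Lyapunov inequalities of the two Hurwitz matrices and
  multiples of the identity on the modes between \<open>N\<^sub>0\<close> and \<open>N\<close>. The multiples do not depend on \<open>N\<close>, while the
  norms of the remainders \<open>R\<^sub>N a\<close>, \<open>R\<^sub>N b\<close> vanish and \<open>\<lambda>\<close> tends to infinity.\<close>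

section \<open>Square integrable and weakly differentiable functions\<close>

text \<open>The obstacle is the boundary input: it enters mode \<open>n\<close> through
  \<open>beta_n\<close>, and these coefficients are controlled only after division by
  \<open>lam n\<close>. The lift replaces them by the coefficients of \<open>a\<close> and
  \<open>b\<close>, which are square summable, at the price of a term in the derivative of
  \<open>u\<close>. That derivative exists for positive times because the control is built from
  predictors, in whose equations the delayed input has cancelled; from time \<open>h\<close> on it
  is a fixed linear function of \<open>X\<close> and of the trace of the tail, which is where the
  row \<open>E\<close> in \<open>\<Theta>\<^sub>1\<close> comes from. The number
  \<open>\<alpha>\<close> divides the dissipation of the tail between these two inputs and its own
  decay. The observer errors compare an estimate with the plant at time \<open>t - h\<close>, so the
  functional makes sense from time \<open>h\<close> on only. The measurement is a point value, which
  the energy is strong enough to control because the weights \<open>(phi n 0)^2 / lam n\<close> are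
  summable.\<close>

lemma L2_measurable: "L2 f \<Longrightarrow> (\<lambda>x. indicator {0..1} x * f x) \<in> borel_measurable borel"
  by (simp add: L2_def set_borel_measurable_def)

lemma L2_mult_integrable:
  assumes "L2 f" "L2 g" shows "set_integrable lborel {0..1} (\<lambda>x. f x * g x)"
proof -
  have i: "integrable lborel (\<lambda>x. indicator {0..1} x * (f x)^2 + indicator {0..1} x * (g x)^2)"
    using assms by (auto simp: L2_def set_integrable_def)
  \<comment> \<open>Membership in \<open>L2\<close> only makes the product with the indicator
    measurable, so both factors carry one.\<close>
  have m: "(\<lambda>x. (indicator {0..1} x * f x) * (indicator {0..1} x * g x)) \<in> borel_measurable borel"
    by (intro borel_measurable_times L2_measurable assms)
  have "integrable lborel (\<lambda>x. (indicator {0..1} x * f x) * (indicator {0..1} x * g x))"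
  proof (rule Bochner_Integration.integrable_bound[OF i])
    show "(\<lambda>x. (indicator {0..1} x * f x) * (indicator {0..1} x * g x)) \<in> borel_measurable lborel"
      using m by simp
    have "\<bar>a * b\<bar> \<le> a^2 + b^2" for a b :: real
    proof -
      have "0 \<le> (\<bar>a\<bar> - \<bar>b\<bar>)^2 + \<bar>a * b\<bar>" by simp
      also have "\<dots> = a^2 + b^2 - \<bar>a * b\<bar>" by (simp add: power2_diff abs_mult)
      finally show ?thesis by simp
    qed
    then show "AE x in lborel. norm ((indicator {0..1} x * f x) * (indicator {0..1} x * g x))
        \<le> norm (indicator {0..1} x * (f x)^2 + indicator {0..1} x * (g x)^2)"
      by (intro AE_I2) (auto simp: indicator_def)
  qed
  moreover have "(\<lambda>x. (indicator {0..1} x * f x) * (indicator {0..1} x * g x)) = (\<lambda>x. indicator {0..1} x * (f x * g x))"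
    by (auto simp: indicator_def)
  ultimately show ?thesis by (simp add: set_integrable_def)
qed

lemma continuous_L2:
  assumes "continuous_on {0..1} f" shows "L2 f"
proof -
  have "set_integrable lborel {0..1} f"
    by (rule borel_integrable_atLeastAtMost') (rule assms)
  then have "set_borel_measurable lborel {0..1} f"
    by (auto simp: set_integrable_def set_borel_measurable_def)
  moreover have "set_integrable lborel {0..1} (\<lambda>x. (f x)^2)"
    by (rule borel_integrable_atLeastAtMost') (intro continuous_intros assms)
  ultimately show ?thesis by (simp add: L2_def)
qed

lemma L2_integrable: "L2 f \<Longrightarrow> set_integrable lborel {0..1} f"
  using L2_mult_integrable[of f "\<lambda>_. 1"] continuous_L2[of "\<lambda>_. 1"] by simp

lemma L2_add: assumes "L2 f" "L2 g" shows "L2 (\<lambda>x. f x + g x)"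
proof -
  have "(\<lambda>x. indicator {0..1} x * f x + indicator {0..1} x * g x) \<in> borel_measurable borel"
    by (intro borel_measurable_add L2_measurable assms)
  then have "set_borel_measurable lborel {0..1} (\<lambda>x. f x + g x)"
    by (simp add: set_borel_measurable_def distrib_left)
  moreover have "set_integrable lborel {0..1} (\<lambda>x. f x * f x + (g x * g x + (f x * g x + f x * g x)))"
    by (intro set_integral_add L2_mult_integrable assms)
  moreover have "(\<lambda>x. (f x + g x)^2) = (\<lambda>x. f x * f x + (g x * g x + (f x * g x + f x * g x)))"
    by (rule ext) (simp add: power2_eq_square algebra_simps)
  ultimately show ?thesis by (simp only: L2_def)
qed

lemma L2_scale: assumes "L2 f" shows "L2 (\<lambda>x. c * f x)"
proof -
  have "(\<lambda>x. c * (indicator {0..1} x * f x)) \<in> borel_measurable borel"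
    by (intro borel_measurable_times L2_measurable assms borel_measurable_const)
  then have "set_borel_measurable lborel {0..1} (\<lambda>x. c * f x)"
    by (simp add: set_borel_measurable_def mult_ac)
  moreover have "set_integrable lborel {0..1} (\<lambda>x. c^2 * (f x)^2)"
    using assms by (intro set_integrable_mult_right) (auto simp: L2_def)
  ultimately show ?thesis by (simp add: L2_def power_mult_distrib)
qed

lemma L2_diff: "L2 f \<Longrightarrow> L2 g \<Longrightarrow> L2 (\<lambda>x. f x - g x)"
  using L2_add[of f "\<lambda>x. -1 * g x"] L2_scale[of g "-1"] by simp

lemma L2_sum: "(\<And>i. i \<in> I \<Longrightarrow> L2 (f i)) \<Longrightarrow> L2 (\<lambda>x. \<Sum>i\<in>I. f i x)"
proof (induction I rule: infinite_finite_induct)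
  case (insert i I) then show ?case by (simp add: L2_add)
qed (simp_all add: continuous_L2)

lemma L2_mult_continuous:
  assumes c: "continuous_on {0..1} c" and "L2 f" shows "L2 (\<lambda>x. c x * f x)"
proof -
  obtain B where B: "\<And>x. x \<in> {0..1} \<Longrightarrow> \<bar>c x\<bar> \<le> B"
    using compact_imp_bounded[OF compact_continuous_image[OF c]] unfolding bounded_iff
    by (metis compact_Icc image_eqI real_norm_def)
  have m: "(\<lambda>x. (indicator {0..1} x * c x) * (indicator {0..1} x * f x)) \<in> borel_measurable borel"
    by (intro borel_measurable_times L2_measurable assms continuous_L2)
  have eq: "(\<lambda>x. (indicator {0..1} x * c x) * (indicator {0..1} x * f x)) = (\<lambda>x. indicator {0..1} x * (c x * f x))"
    by (auto simp: indicator_def)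
  have m': "(\<lambda>x. indicator {0..1} x * (c x * f x)) \<in> borel_measurable borel" using m unfolding eq .
  have i: "integrable lborel (\<lambda>x. B^2 * (indicator {0..1} x * (f x)^2))"
    using assms by (auto simp: L2_def set_integrable_def)
  have eq2: "(\<lambda>x. (indicator {0..1} x * (c x * f x))^2) = (\<lambda>x. indicator {0..1} x * (c x * f x)^2)"
    by (auto simp: indicator_def)
  have m2: "(\<lambda>x. indicator {0..1} x * (c x * f x)^2) \<in> borel_measurable borel"
    unfolding eq2[symmetric] by (intro borel_measurable_power m')
  have "integrable lborel (\<lambda>x. indicator {0..1} x * (c x * f x)^2)"
  proof (rule Bochner_Integration.integrable_bound[OF i])
    show "AE x in lborel. norm (indicator {0..1} x * (c x * f x)^2) \<le> norm (B^2 * (indicator {0..1} x * (f x)^2))"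
    proof (intro AE_I2)
      fix x show "norm (indicator {0..1} x * (c x * f x)^2) \<le> norm (B^2 * (indicator {0..1} x * (f x)^2))"
      proof (cases "x \<in> {0..1}")
        case True
        then have "(c x)^2 \<le> B^2" using B[OF True] by (metis abs_ge_zero power2_abs power_mono)
        then show ?thesis using True by (simp add: power_mult_distrib mult_right_mono)
      qed simp
    qed
  qed (use m2 in simp)
  then show ?thesis using m' by (simp add: L2_def set_borel_measurable_def set_integrable_def)
qed

lemma ip_commute: "ip f g = ip g f" by (simp add: ip_def mult.commute)

lemma ip_cong: "(\<And>x. x \<in> {0..1} \<Longrightarrow> f x = f' x) \<Longrightarrow> (\<And>x. x \<in> {0..1} \<Longrightarrow> g x = g' x) \<Longrightarrow> ip f g = ip f' g'"
  unfolding ip_def by (rule set_lebesgue_integral_cong) auto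

lemma ip_add: "L2 f \<Longrightarrow> L2 g \<Longrightarrow> L2 k \<Longrightarrow> ip (\<lambda>x. f x + g x) k = ip f k + ip g k"
  unfolding ip_def by (simp add: distrib_right set_integral_add(2) L2_mult_integrable)

lemma ip_diff: "L2 f \<Longrightarrow> L2 g \<Longrightarrow> L2 k \<Longrightarrow> ip (\<lambda>x. f x - g x) k = ip f k - ip g k"
  unfolding ip_def by (simp add: left_diff_distrib set_integral_diff(2) L2_mult_integrable)

lemma ip_scale: "ip (\<lambda>x. c * f x) k = c * ip f k"
  unfolding ip_def by (simp add: mult.assoc)

lemma ip_sum:
  assumes "L2 k" shows "(\<And>i. i \<in> I \<Longrightarrow> L2 (f i)) \<Longrightarrow> ip (\<lambda>x. \<Sum>i\<in>I. f i x) k = (\<Sum>i\<in>I. ip (f i) k)"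
proof (induction I rule: infinite_finite_induct)
  case (insert i I) then show ?case using assms by (simp add: ip_add L2_sum)
qed (simp_all add: ip_def)

lemma ip_self: "ip f f = (LINT x:{0..1}|lborel. (f x)^2)"
  by (simp add: ip_def power2_eq_square)

lemma ip_self_nonneg: "ip f f \<ge> 0"
  unfolding ip_def set_lebesgue_integral_def by (rule Bochner_Integration.integral_nonneg) simp

text \<open>The polynomial \<open>ip (f + t g) (f + t g)\<close> in \<open>t\<close> is nonnegative.
  Its leading coefficient can vanish for a function \<open>g\<close> that is not zero; the
  polynomial is then affine and must have slope zero.\<close>

lemma ip_Cauchy_Schwarz:
  assumes "L2 f" "L2 g" shows "(ip f g)^2 \<le> ip f f * ip g g"
proof -
  have q: "ip f f + 2 * t * ip f g + t^2 * ip g g \<ge> 0" for t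
  proof -
    have tg: "L2 (\<lambda>x. t * g x)" using assms by (intro L2_scale)
    have "ip (\<lambda>x. f x + t * g x) (\<lambda>x. f x + t * g x) = ip f (\<lambda>x. f x + t * g x) + t * ip g (\<lambda>x. f x + t * g x)"
      using assms tg by (simp add: ip_add L2_add ip_scale)
    also have "\<dots> = ip (\<lambda>x. f x + t * g x) f + t * ip (\<lambda>x. f x + t * g x) g" by (simp add: ip_commute)
    also have "\<dots> = ip f f + 2 * t * ip f g + t^2 * ip g g"
      using assms tg by (simp add: ip_add ip_scale ip_commute[of g f] algebra_simps power2_eq_square)
    finally show ?thesis using ip_self_nonneg[of "\<lambda>x. f x + t * g x"] by simp
  qed
  show ?thesis
  proof (cases "ip g g = 0")
    case True
    have "ip f g = 0"
    proof (rule ccontr)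
      assume "ip f g \<noteq> 0"
      \<comment> \<open>At this \<open>t\<close> the affine polynomial equals -1.\<close>
      then show False using q[of "- (ip f f + 1) / (2 * ip f g)"] True by (simp add: field_simps)
    qed
    then show ?thesis by (simp add: True)
  next
    case False
    then have "ip g g > 0" using ip_self_nonneg[of g] by simp
    then show ?thesis using q[of "- ip f g / ip g g"]
      by (simp add: field_simps power2_eq_square)
  qed
qed

section \<open>Integration by parts for an integrable function\<close>

lemma LINT_FTC:
  fixes F f :: "real \<Rightarrow> real"
  assumes "a \<le> b" "\<And>x. x \<in> {a..b} \<Longrightarrow> (F has_real_derivative f x) (at x within {a..b})" "continuous_on {a..b} f"
  shows "(LINT x:{a..b}|lborel. f x) = F b - F a"
  unfolding set_lebesgue_integral_def
  by (rule integral_FTC_atLeastAtMost)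
    (use assms in \<open>auto simp: has_real_derivative_iff_has_vector_derivative\<close>)

lemma integrable_lborel_prod:
  fixes f g :: "real \<Rightarrow> real"
  assumes "integrable lborel f" "integrable lborel g"
  shows "integrable (lborel \<Otimes>\<^sub>M lborel) (\<lambda>(x, y). f x * g y)"
proof (rule lborel_pair.Fubini_integrable)
  have [measurable]: "f \<in> borel_measurable borel" "g \<in> borel_measurable borel"
    using assms by (auto dest: borel_measurable_integrable)
  show "(\<lambda>(x, y). f x * g y) \<in> borel_measurable (lborel \<Otimes>\<^sub>M lborel)" by measurable
  show "integrable lborel (\<lambda>x. \<integral> y. norm (case (x, y) of (x, y) \<Rightarrow> f x * g y) \<partial>lborel)"
    using assms by (simp add: abs_mult)
  show "AE x in lborel. integrable lborel (\<lambda>y. case (x, y) of (x, y) \<Rightarrow> f x * g y)"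
    using assms by simp
qed

text \<open>The primitive of an integrable \<open>w\<close> need not be differentiable everywhere,
  so the fundamental theorem of calculus is applied to \<open>\<phi>\<close> only. The double
  integral of \<open>w s * \<phi>' x\<close> over the triangle \<open>s \<le> x\<close> is computed
  in both orders; the kernel \<open>?f\<close> is supported on that triangle.\<close>

lemma LINT_by_parts:
  fixes \<phi> \<phi>' w :: "real \<Rightarrow> real"
  assumes w: "set_integrable lborel {0..1} w"
    and der: "\<And>x. x \<in> {0..1} \<Longrightarrow> (\<phi> has_real_derivative \<phi>' x) (at x within {0..1})"
    and cont: "continuous_on {0..1} \<phi>'"
  shows "(LINT s:{0..1}|lborel. w s * \<phi> s)
    = \<phi> 1 * (LINT s:{0..1}|lborel. w s) - (LINT x:{0..1}|lborel. (LINT s:{0..x}|lborel. w s) * \<phi>' x)"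
proof -
  let ?w = "\<lambda>s. indicator {0..1} s * w s" and ?g = "\<lambda>x. indicator {0..1} x * \<phi>' x"
  let ?f = "\<lambda>s x. indicator {0..1} s * w s * (indicator {0..1} x * \<phi>' x) * indicator {s..} x"
  have iw: "integrable lborel ?w" using w by (simp add: set_integrable_def)
  have ig: "integrable lborel ?g"
    using borel_integrable_atLeastAtMost'[OF cont] by (simp add: set_integrable_def)
  have iwg: "integrable (lborel \<Otimes>\<^sub>M lborel) (\<lambda>(s, x). ?w s * ?g x)" by (rule integrable_lborel_prod[OF iw ig])
  have int: "integrable (lborel \<Otimes>\<^sub>M lborel) (\<lambda>(s, x). ?f s x)"
  proof (rule Bochner_Integration.integrable_bound[OF iwg])
    have [measurable]: "?w \<in> borel_measurable borel" "?g \<in> borel_measurable borel"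
      using borel_measurable_integrable[OF iw] borel_measurable_integrable[OF ig] by simp_all
    have "(\<lambda>(s, x). ?w s * ?g x * (if s \<le> x then 1 else 0)) \<in> borel_measurable (lborel \<Otimes>\<^sub>M lborel)" by measurable
    moreover have "(\<lambda>(s, x). ?w s * ?g x * (if s \<le> x then 1 else 0)) = (\<lambda>(s, x). ?f s x)"
      by (auto simp: indicator_def fun_eq_iff)
    ultimately show "(\<lambda>(s, x). ?f s x) \<in> borel_measurable (lborel \<Otimes>\<^sub>M lborel)" by simp
  qed (auto simp: indicator_def)
  have fub: "(\<integral>x. (\<integral>s. ?f s x \<partial>lborel) \<partial>lborel) = (\<integral>s. (\<integral>x. ?f s x \<partial>lborel) \<partial>lborel)"
    by (rule lborel_pair.Fubini_integral[OF int])
  have 1: "(\<integral>s. ?f s x \<partial>lborel) = indicator {0..1} x * ((LINT s:{0..x}|lborel. w s) * \<phi>' x)" for x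
  proof -
    have "(\<lambda>s. ?f s x) = (\<lambda>s. (indicator {0..x} s * w s) * (indicator {0..1} x * \<phi>' x))"
      by (rule ext) (auto simp: indicator_def)
    then have "(\<integral>s. ?f s x \<partial>lborel) = (\<integral>s. (indicator {0..x} s * w s) * (indicator {0..1} x * \<phi>' x) \<partial>lborel)"
      by (rule arg_cong)
    also have "\<dots> = (\<integral>s. indicator {0..x} s * w s \<partial>lborel) * (indicator {0..1} x * \<phi>' x)"
      by (rule integral_mult_left_zero)
    finally show ?thesis by (simp add: set_lebesgue_integral_def)
  qed
  have 2: "(\<integral>x. ?f s x \<partial>lborel) = indicator {0..1} s * (w s * (\<phi> 1 - \<phi> s))" for s
  proof (cases "s \<in> {0..1}")
    case True
    have "(\<lambda>x. ?f s x) = (\<lambda>x. w s * (indicator {s..1} x * \<phi>' x))"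
      using True by (auto simp: indicator_def)
    moreover have "(LINT x:{s..1}|lborel. \<phi>' x) = \<phi> 1 - \<phi> s"
      by (rule LINT_FTC) (use True in \<open>auto intro!: continuous_on_subset[OF cont] has_field_derivative_subset[OF der]\<close>)
    ultimately show ?thesis using True by (simp add: set_lebesgue_integral_def)
  qed simp
  have wl: "L2 \<phi>"
    by (intro continuous_L2 DERIV_continuous_on[of _ _ \<phi>'] der)
  have c: "continuous_on {0..1} \<phi>" by (intro DERIV_continuous_on[of _ _ \<phi>'] der)
  obtain B where B: "\<And>x. x \<in> {0..1} \<Longrightarrow> \<bar>\<phi> x\<bar> \<le> B"
    using compact_imp_bounded[OF compact_continuous_image[OF c]] unfolding bounded_iff
    by (metis compact_Icc image_eqI real_norm_def)
  have iwp: "set_integrable lborel {0..1} (\<lambda>s. w s * \<phi> s)"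
    unfolding set_integrable_def
  proof (rule Bochner_Integration.integrable_bound)
    show "integrable lborel (\<lambda>s. B * ?w s)" using iw by simp
    have "(\<lambda>s. ?w s * (indicator {0..1} s * \<phi> s)) \<in> borel_measurable borel"
      using borel_measurable_times[OF _ L2_measurable[OF wl]] borel_measurable_integrable[OF iw] by simp
    moreover have "(\<lambda>s. ?w s * (indicator {0..1} s * \<phi> s)) = (\<lambda>s. indicator {0..1} s *\<^sub>R (w s * \<phi> s))"
      by (auto simp: indicator_def)
    ultimately show "(\<lambda>s. indicator {0..1} s *\<^sub>R (w s * \<phi> s)) \<in> borel_measurable lborel" by simp
    show "AE s in lborel. norm (indicator {0..1} s *\<^sub>R (w s * \<phi> s)) \<le> norm (B * ?w s)"
    proof (intro AE_I2)
      fix s :: real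
      show "norm (indicator {0..1} s *\<^sub>R (w s * \<phi> s)) \<le> norm (B * ?w s)"
      proof (cases "s \<in> {0..1}")
        case True
        then have "\<bar>\<phi> s\<bar> \<le> \<bar>B\<bar>" using B by fastforce
        then show ?thesis using True by (simp add: abs_mult mult.commute[of "\<bar>w s\<bar>"] mult_right_mono)
      qed simp
    qed
  qed
  have "(LINT x:{0..1}|lborel. (LINT s:{0..x}|lborel. w s) * \<phi>' x) = (LINT s:{0..1}|lborel. w s * (\<phi> 1 - \<phi> s))"
    using fub unfolding 1 2 by (simp add: set_lebesgue_integral_def)
  also have "\<dots> = (LINT s:{0..1}|lborel. \<phi> 1 * w s - w s * \<phi> s)"
    by (simp add: algebra_simps)
  also have "\<dots> = \<phi> 1 * (LINT s:{0..1}|lborel. w s) - (LINT s:{0..1}|lborel. w s * \<phi> s)"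
    using w iwp by (subst set_integral_diff(2)) auto
  finally show ?thesis by simp
qed

section \<open>Calculus in H2, boundary traces and the operator domain\<close>

lemma H2_witD:
  assumes "H2_wit f g w"
  shows "L2 w" "\<And>x. x \<in> {0..1} \<Longrightarrow> (f has_real_derivative g x) (at x within {0..1})"
    and "\<And>x. x \<in> {0..1} \<Longrightarrow> g x = g 0 + (LINT s:{0..x}|lborel. w s)"
    and "continuous_on {0..1} f" "continuous_on {0..1} g" "\<And>x. x \<in> {0..1} \<Longrightarrow> dx f x = g x"
    and "L2 f" "L2 g"
proof -
  show w: "L2 w" and d: "\<And>x. x \<in> {0..1} \<Longrightarrow> (f has_real_derivative g x) (at x within {0..1})"
    and g: "\<And>x. x \<in> {0..1} \<Longrightarrow> g x = g 0 + (LINT s:{0..x}|lborel. w s)"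
    using assms unfolding H2_wit_def by blast+
  show cf: "continuous_on {0..1} f" by (intro DERIV_continuous_on[of _ _ g] d)
  show "dx f x = g x" if "x \<in> {0..1}" for x
    unfolding dx_def
    by (rule vector_derivative_within_closed_interval)
      (use d[OF that] that in \<open>auto simp: has_real_derivative_iff_has_vector_derivative\<close>)
  have wi: "set_integrable lborel {0..1} w" by (rule L2_integrable[OF w])
  have wi': "set_integrable lborel {0..x} w" if "x \<in> {0..1}" for x
    by (rule set_integrable_subset[OF wi]) (use that in auto)
  have "continuous_on {0..1} (\<lambda>x. g 0 + integral {0..x} w)"
    by (intro continuous_intros indefinite_integral_continuous_1 set_borel_integral_eq_integral(1) wi)
  then show cg: "continuous_on {0..1} g"
  proof (rule continuous_on_eq)
    show "g 0 + integral {0..x} w = g x" if "x \<in> {0..1}" for x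
      using g[OF that] set_borel_integral_eq_integral(2)[OF wi'[OF that]] by linarith
  qed
  show "L2 f" "L2 g" by (intro continuous_L2 cf cg)+
qed

text \<open>\<open>g\<close> is the primitive of \<open>w\<close> up to the constant
  \<open>g 0\<close>; pairing this constant with \<open>\<phi>'\<close> produces the boundary term
  at 0.\<close>

lemma H2_by_parts:
  assumes f: "H2_wit f g w"
    and der: "\<And>x. x \<in> {0..1} \<Longrightarrow> (\<phi> has_real_derivative \<phi>' x) (at x within {0..1})"
    and cont: "continuous_on {0..1} \<phi>'"
  shows "ip w \<phi> = g 1 * \<phi> 1 - g 0 * \<phi> 0 - ip g \<phi>'"
proof -
  note F = H2_witD[OF f]
  let ?W = "\<lambda>x. LINT s:{0..x}|lborel. w s"
  have W: "?W x = g x - g 0" if "x \<in> {0..1}" for x using F(3)[OF that] by simp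
  have L: "L2 \<phi>'" by (rule continuous_L2[OF cont])
  have "ip w \<phi> = \<phi> 1 * ?W 1 - (LINT x:{0..1}|lborel. ?W x * \<phi>' x)"
    unfolding ip_def by (rule LINT_by_parts[OF L2_integrable[OF F(1)] der cont])
  also have "(LINT x:{0..1}|lborel. ?W x * \<phi>' x) = ip (\<lambda>x. g x - g 0) \<phi>'"
    unfolding ip_def by (rule set_lebesgue_integral_cong) (auto simp: W)
  also have "\<dots> = ip g \<phi>' - g 0 * ip (\<lambda>_. 1) \<phi>'"
    using ip_diff[OF F(8) continuous_L2[of "\<lambda>_. g 0"] L] ip_scale[of "g 0" "\<lambda>_. 1" \<phi>'] by simp
  also have "ip (\<lambda>_. 1) \<phi>' = \<phi> 1 - \<phi> 0"
    unfolding ip_def by (simp, rule LINT_FTC) (auto intro: der cont)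
  also have "?W 1 = g 1 - g 0" by (simp add: W)
  finally show ?thesis by (simp add: algebra_simps)
qed

lemma H2_wit_add:
  assumes "H2_wit f g w" "H2_wit f' g' w'"
  shows "H2_wit (\<lambda>x. f x + f' x) (\<lambda>x. g x + g' x) (\<lambda>x. w x + w' x)"
proof -
  note F = H2_witD[OF assms(1)] and F' = H2_witD[OF assms(2)]
  have "g x + g' x = g 0 + g' 0 + (LINT s:{0..x}|lborel. w s + w' s)" if x: "x \<in> {0..1}" for x
  proof -
    have "set_integrable lborel {0..x} w" "set_integrable lborel {0..x} w'"
      using x by (auto intro!: set_integrable_subset[OF L2_integrable[OF F(1)]] set_integrable_subset[OF L2_integrable[OF F'(1)]])
    then have "(LINT s:{0..x}|lborel. w s + w' s) = (LINT s:{0..x}|lborel. w s) + (LINT s:{0..x}|lborel. w' s)"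
      by (rule set_integral_add(2))
    then show ?thesis using F(3)[OF x] F'(3)[OF x] by linarith
  qed
  then show ?thesis unfolding H2_wit_def using F(1,2) F'(1,2) by (blast intro: L2_add DERIV_add)
qed

lemma H2_wit_scale:
  assumes "H2_wit f g w" shows "H2_wit (\<lambda>x. c * f x) (\<lambda>x. c * g x) (\<lambda>x. c * w x)"
proof -
  note F = H2_witD[OF assms]
  have "c * g x = c * g 0 + (LINT s:{0..x}|lborel. c * w s)" if x: "x \<in> {0..1}" for x
    using arg_cong[OF F(3)[OF x], of "\<lambda>r. c * r"] unfolding set_integral_mult_right distrib_left .
  then show ?thesis unfolding H2_wit_def using F(1,2) by (blast intro: L2_scale DERIV_cmult)
qed

lemma H2_wit_sum:
  assumes "finite I" "\<And>i. i \<in> I \<Longrightarrow> H2_wit (f i) (g i) (w i)"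
  shows "H2_wit (\<lambda>x. \<Sum>i\<in>I. c i * f i x) (\<lambda>x. \<Sum>i\<in>I. c i * g i x) (\<lambda>x. \<Sum>i\<in>I. c i * w i x)"
  using assms
proof (induction I rule: finite_induct)
  case empty
  show ?case by (auto simp: H2_wit_def continuous_L2)
next
  case (insert i I)
  then show ?case by (simp add: H2_wit_add H2_wit_scale)
qed

text \<open>The weights \<open>1 - x\<close> and \<open>x\<close> vanish at the opposite end point,
  so the fundamental theorem applied to the weighted square of \<open>f\<close> expresses a single
  end point value as an integral of \<open>f^2\<close> and \<open>f * g\<close>.\<close>

lemma trace_bounds:
  assumes d: "\<And>x. x \<in> {0..1} \<Longrightarrow> (f has_real_derivative g x) (at x within {0..1})"
    and g: "continuous_on {0..1} g"
  shows "(f 0)^2 \<le> 2 * (LINT x:{0..1}|lborel. (f x)^2 + (g x)^2)"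
    and "(f 1)^2 \<le> 2 * (LINT x:{0..1}|lborel. (f x)^2 + (g x)^2)"
proof -
  have f: "continuous_on {0..1} f" by (intro DERIV_continuous_on[of _ _ g] d)
  have R: "2 * (LINT x:{0..1}|lborel. (f x)^2 + (g x)^2) = (LINT x:{0..1}|lborel. 2 * ((f x)^2 + (g x)^2))"
    by (rule set_integral_mult_right[symmetric])
  have b: "2 * \<bar>s * (a * b)\<bar> \<le> a^2 + b^2" if "\<bar>s\<bar> \<le> 1" for s a b :: real
  proof -
    have "2 * \<bar>s * (a * b)\<bar> \<le> 2 * (\<bar>a\<bar> * \<bar>b\<bar>)" using that by (simp add: abs_mult mult_left_le_one_le)
    also have "\<dots> \<le> a^2 + b^2" using sum_squares_bound[of "\<bar>a\<bar>" "\<bar>b\<bar>"] by simp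
    finally show ?thesis .
  qed
  have cs: "set_integrable lborel {0..1} (\<lambda>x. 2 * ((f x)^2 + (g x)^2))"
    by (rule borel_integrable_atLeastAtMost') (intro continuous_intros f g)
  have c0: "continuous_on {0..1} (\<lambda>x. (f x)^2 - 2 * (1 - x) * (f x * g x))"
    by (intro continuous_intros f g)
  have dc0: "((\<lambda>x. - (1 - x) * (f x)^2) has_real_derivative (f x)^2 - 2 * (1 - x) * (f x * g x)) (at x within {0..1})" if "x \<in> {0..1}" for x
    by (rule derivative_eq_intros d that refl)+ (simp add: algebra_simps)
  have "(LINT x:{0..1}|lborel. (f x)^2 - 2 * (1 - x) * (f x * g x)) = (- (1 - 1) * (f 1)^2) - (- (1 - 0) * (f 0)^2)"
    by (rule LINT_FTC) (simp_all only: dc0 c0 zero_le_one)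
  then have "(f 0)^2 = (LINT x:{0..1}|lborel. (f x)^2 - 2 * (1 - x) * (f x * g x))" by simp
  also have "\<dots> \<le> (LINT x:{0..1}|lborel. 2 * ((f x)^2 + (g x)^2))"
  proof (rule set_integral_mono[OF borel_integrable_atLeastAtMost'[OF c0] cs])
    fix x :: real assume "x \<in> {0..1}"
    then have "2 * \<bar>(1 - x) * (f x * g x)\<bar> \<le> (f x)^2 + (g x)^2" by (intro b) auto
    then show "(f x)^2 - 2 * (1 - x) * (f x * g x) \<le> 2 * ((f x)^2 + (g x)^2)"
      using zero_le_power2[of "f x"] zero_le_power2[of "g x"] by (simp only: mult.assoc abs_le_iff abs_mult_pos mult_2) argo
  qed
  finally show "(f 0)^2 \<le> 2 * (LINT x:{0..1}|lborel. (f x)^2 + (g x)^2)" using R by simp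
  have c1: "continuous_on {0..1} (\<lambda>x. (f x)^2 + 2 * x * (f x * g x))"
    by (intro continuous_intros f g)
  have dc1: "((\<lambda>x. x * (f x)^2) has_real_derivative (f x)^2 + 2 * x * (f x * g x)) (at x within {0..1})" if "x \<in> {0..1}" for x
    by (rule derivative_eq_intros d that refl)+ (simp add: algebra_simps)
  have "(LINT x:{0..1}|lborel. (f x)^2 + 2 * x * (f x * g x)) = 1 * (f 1)^2 - 0 * (f 0)^2"
    by (rule LINT_FTC) (simp_all only: dc1 c1 zero_le_one)
  then have "(f 1)^2 = (LINT x:{0..1}|lborel. (f x)^2 + 2 * x * (f x * g x))" by simp
  also have "\<dots> \<le> (LINT x:{0..1}|lborel. 2 * ((f x)^2 + (g x)^2))"
  proof (rule set_integral_mono[OF borel_integrable_atLeastAtMost'[OF c1] cs])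
    fix x :: real assume "x \<in> {0..1}"
    then have "2 * \<bar>x * (f x * g x)\<bar> \<le> (f x)^2 + (g x)^2" by (intro b) auto
    then show "(f x)^2 + 2 * x * (f x * g x) \<le> 2 * ((f x)^2 + (g x)^2)"
      using zero_le_power2[of "f x"] zero_le_power2[of "g x"] by (simp only: mult.assoc abs_le_iff abs_mult_pos mult_2) argo
  qed
  finally show "(f 1)^2 \<le> 2 * (LINT x:{0..1}|lborel. (f x)^2 + (g x)^2)" using R by simp
qed

lemma ip_cong_AE:
  assumes "L2 f" "L2 g" "L2 k" "AE x in lborel. x \<in> {0..1} \<longrightarrow> f x = g x"
  shows "ip f k = ip g k"
proof -
  have "integrable lborel (\<lambda>x. indicator {0..1} x * (f x * k x))" "integrable lborel (\<lambda>x. indicator {0..1} x * (g x * k x))"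
    using L2_mult_integrable[OF assms(1,3)] L2_mult_integrable[OF assms(2,3)] by (simp_all add: set_integrable_def)
  moreover have "AE x in lborel. indicator {0..1} x * (f x * k x) = indicator {0..1} x * (g x * k x)"
    using assms(4) by eventually_elim (auto simp: indicator_def)
  ultimately show ?thesis
    unfolding ip_def set_lebesgue_integral_def real_scaleR_def
    by (intro integral_cong_AE) (auto dest: borel_measurable_integrable)
qed

text \<open>On the unit interval every derivative witness coincides with \<open>dx f\<close>, and
  \<open>H2_wit\<close> evaluates the witness at no other points.\<close>

lemma H2_obtain:
  assumes "H2 f" obtains w where "H2_wit f (dx f) w"
proof -
  obtain g w where H: "H2_wit f g w" using assms by (auto simp: H2_def)
  have "H2_wit f (dx f) w"
    using H2_witD(1,2,3)[OF H] H2_witD(6)[OF H] unfolding H2_wit_def by (metis atLeastAtMost_iff order_refl zero_le_one)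
  then show thesis by (rule that)
qed

text \<open>With the derivative as a witness in place of \<open>dx f\<close>, the boundary
  conditions are linear in the pair of function and derivative, so sums and differences can be
  formed witness by witness.\<close>

lemma in_DA_iff:
  "in_DA th1 th2 f \<longleftrightarrow> (\<exists>g w. H2_wit f g w \<and> cos th1 * f 0 - sin th1 * g 0 = 0 \<and> cos th2 * f 1 + sin th2 * g 1 = 0)"
  (is "?l \<longleftrightarrow> ?r")
proof
  assume ?l then show ?r unfolding in_DA_def by (metis H2_obtain)
next
  assume ?r
  then obtain g w where H: "H2_wit f g w" and bc: "cos th1 * f 0 - sin th1 * g 0 = 0" "cos th2 * f 1 + sin th2 * g 1 = 0"
    by blast
  have "dx f 0 = g 0" "dx f 1 = g 1" using H2_witD(6)[OF H] by auto
  then show ?l using H bc by (auto simp: in_DA_def H2_def)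
qed

lemma in_DA_sum:
  assumes "finite I" "\<And>i. i \<in> I \<Longrightarrow> in_DA th1 th2 (f i)" shows "in_DA th1 th2 (\<lambda>x. \<Sum>i\<in>I. c i * f i x)"
proof -
  have "\<forall>i. \<exists>g w. i \<in> I \<longrightarrow> H2_wit (f i) g w \<and> cos th1 * f i 0 - sin th1 * g 0 = 0 \<and> cos th2 * f i 1 + sin th2 * g 1 = 0"
    using assms(2) unfolding in_DA_iff by blast
  then obtain g w where H: "\<And>i. i \<in> I \<Longrightarrow> H2_wit (f i) (g i) (w i)"
    and b0: "\<And>i. i \<in> I \<Longrightarrow> cos th1 * f i 0 = sin th1 * g i 0"
    and b1: "\<And>i. i \<in> I \<Longrightarrow> cos th2 * f i 1 + sin th2 * g i 1 = 0"
    by (metis eq_iff_diff_eq_0)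
  have "cos th1 * (\<Sum>i\<in>I. c i * f i 0) - sin th1 * (\<Sum>i\<in>I. c i * g i 0) = (\<Sum>i\<in>I. c i * (cos th1 * f i 0 - sin th1 * g i 0))"
    unfolding sum_distrib_left sum_subtractf[symmetric] by (simp add: algebra_simps)
  also have "\<dots> = 0" using b0 by simp
  finally have B0: "cos th1 * (\<Sum>i\<in>I. c i * f i 0) - sin th1 * (\<Sum>i\<in>I. c i * g i 0) = 0" .
  have "cos th2 * (\<Sum>i\<in>I. c i * f i 1) + sin th2 * (\<Sum>i\<in>I. c i * g i 1) = (\<Sum>i\<in>I. c i * (cos th2 * f i 1 + sin th2 * g i 1))"
    unfolding sum_distrib_left sum.distrib[symmetric] by (simp add: algebra_simps)
  also have "\<dots> = 0" using b1 by simp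
  finally have B1: "cos th2 * (\<Sum>i\<in>I. c i * f i 1) + sin th2 * (\<Sum>i\<in>I. c i * g i 1) = 0" .
  show ?thesis unfolding in_DA_iff using H2_wit_sum[OF assms(1), of f g w c] H B0 B1 by blast
qed

lemma in_DA_diff: assumes "in_DA th1 th2 f" "in_DA th1 th2 g" shows "in_DA th1 th2 (\<lambda>x. f x - g x)"
  using in_DA_sum[of "{True, False}" th1 th2 "\<lambda>i. if i then f else g" "\<lambda>i. if i then 1 else -1"] assms by simp

lemma H1_norm_sq_wit: "H2_wit f g w \<Longrightarrow> H1_norm_sq f = (LINT x:{0..1}|lborel. (f x)^2 + (g x)^2)"
  unfolding H1_norm_sq_def by (rule set_lebesgue_integral_cong) (auto dest: H2_witD(6))

lemma in_DA_L2: "in_DA th1 th2 f \<Longrightarrow> L2 f" by (auto simp: in_DA_def H2_def dest: H2_witD)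

section \<open>Modal expansions of Sturm--Liouville operators\<close>

locale sturm_liouville =
  fixes th1 th2 qc :: real and p qt q :: "real \<Rightarrow> real"
    and lam :: "nat \<Rightarrow> real" and phi :: "nat \<Rightarrow> real \<Rightarrow> real"
  assumes th1: "0 < th1" "th1 \<le> pi / 2" and th2: "0 \<le> th2" "th2 \<le> pi / 2"
    and p: "C2_on01 p" "\<forall>x\<in>{0..1}. p x > 0"
    and qt: "continuous_on {0..1} qt" and q: "continuous_on {0..1} q"
    and qtq: "\<forall>x\<in>{0..1}. qt x = q x - qc" and qpos: "\<forall>x\<in>{0..1}. q x > 0"
    and eig: "SL_eigenbasis p q th1 th2 lam phi"
begin

lemma p_deriv: "x \<in> {0..1} \<Longrightarrow> (p has_real_derivative dx p x) (at x within {0..1})"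
  and dx_p_cont: "continuous_on {0..1} (dx p)"
proof -
  obtain p1 p2 where P: "\<forall>x\<in>{0..1}. (p has_real_derivative p1 x) (at x within {0..1})"
    "\<forall>x\<in>{0..1}. (p1 has_real_derivative p2 x) (at x within {0..1})"
    using p(1) by (auto simp: C2_on01_def)
  have e: "dx p x = p1 x" if "x \<in> {0..1}" for x
    unfolding dx_def
    by (rule vector_derivative_within_closed_interval)
      (use P that in \<open>auto simp: has_real_derivative_iff_has_vector_derivative\<close>)
  show "x \<in> {0..1} \<Longrightarrow> (p has_real_derivative dx p x) (at x within {0..1})" using P e by auto
  have "continuous_on {0..1} p1" by (rule DERIV_continuous_on) (use P in auto)
  then show "continuous_on {0..1} (dx p)" by (rule continuous_on_eq) (simp add: e)
qed

lemma p_cont: "continuous_on {0..1} p"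
  by (rule DERIV_continuous_on) (rule p_deriv)

lemma lam_pos: "n \<ge> 1 \<Longrightarrow> 0 < lam n" and lam_less_Suc: "n \<ge> 1 \<Longrightarrow> lam n < lam (Suc n)"
  and lam_at_top: "filterlim lam at_top sequentially"
  and phi_eigen: "n \<ge> 1 \<Longrightarrow> SL_eigen p q th1 th2 (lam n) (phi n)"
  and phi_ortho: "n \<ge> 1 \<Longrightarrow> m \<ge> 1 \<Longrightarrow> ip (phi n) (phi m) = (if n = m then 1 else 0)"
  and phi_complete: "L2 f \<Longrightarrow> (\<lambda>M. LINT x:{0..1}|lborel. (f x - (\<Sum>k=1..M. ip f (phi k) * phi k x))^2) \<longlonglongrightarrow> 0"
  using eig unfolding SL_eigenbasis_def by blast+

lemma phi_DA: "n \<ge> 1 \<Longrightarrow> in_DA th1 th2 (phi n)"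
  using phi_eigen by (auto simp: SL_eigen_def)

lemma phi_L2: "n \<ge> 1 \<Longrightarrow> L2 (phi n)" by (rule in_DA_L2[OF phi_DA])

lemma partial_sum_L2: "L2 (\<lambda>x. \<Sum>k=1..M. c k * phi k x)"
  by (intro L2_sum L2_scale phi_L2) auto

lemma ip_partial_sum:
  assumes "L2 g" shows "ip (\<lambda>x. \<Sum>k=1..M. c k * phi k x) g = (\<Sum>k=1..M. c k * ip (phi k) g)"
  by (subst ip_sum[OF assms]) (auto intro!: L2_scale phi_L2 simp: ip_scale)

lemma coeff_partial_sum:
  assumes "n \<ge> 1" shows "ip (\<lambda>x. \<Sum>k=1..M. c k * phi k x) (phi n) = (if n \<le> M then c n else 0)"
proof -
  have "ip (\<lambda>x. \<Sum>k=1..M. c k * phi k x) (phi n) = (\<Sum>k=1..M. if k = n then c k else 0)"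
    unfolding ip_partial_sum[OF phi_L2[OF assms]] by (rule sum.cong) (auto simp: phi_ortho[OF _ assms])
  then show ?thesis using assms by simp
qed

text \<open>Completeness is assumed as convergence of the partial sums in mean square; by
  Cauchy-Schwarz the inner product of the remainder with \<open>g\<close> then tends to
  zero.\<close>

lemma parseval:
  assumes f: "L2 f" and g: "L2 g"
  shows "(\<lambda>n. ip f (phi (Suc n)) * ip g (phi (Suc n))) sums ip f g"
proof -
  let ?r = "\<lambda>M x. f x - (\<Sum>k=1..M. ip f (phi k) * phi k x)"
  have rL: "L2 (?r M)" for M by (intro L2_diff f partial_sum_L2)
  have b: "\<bar>ip (?r M) g\<bar> \<le> sqrt (ip (?r M) (?r M) * ip g g)" for M
    using ip_Cauchy_Schwarz[OF rL[of M] g] real_le_rsqrt[of "\<bar>ip (?r M) g\<bar>"] by simp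
  have "(\<lambda>M. sqrt (ip (?r M) (?r M) * ip g g)) \<longlonglongrightarrow> sqrt (0 * ip g g)"
    using phi_complete[OF f] unfolding ip_self[symmetric] by (intro tendsto_intros)
  then have lim: "(\<lambda>M. sqrt (ip (?r M) (?r M) * ip g g)) \<longlonglongrightarrow> 0" by simp
  have "(\<lambda>M. ip (?r M) g) \<longlonglongrightarrow> 0"
    by (rule Lim_null_comparison[OF _ lim]) (simp only: real_norm_def b eventually_True)
  then have "(\<lambda>M. ip f g - ip (?r M) g) \<longlonglongrightarrow> ip f g - 0" by (intro tendsto_intros)
  then have "(\<lambda>M. ip f g - ip (?r M) g) \<longlonglongrightarrow> ip f g" by (simp only: diff_zero)
  moreover have "ip f g - ip (?r M) g = (\<Sum>n<M. ip f (phi (Suc n)) * ip g (phi (Suc n)))" for M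
  proof -
    have "ip (?r M) g = ip f g - (\<Sum>k=1..M. ip f (phi k) * ip (phi k) g)"
      unfolding ip_diff[OF f partial_sum_L2 g] ip_partial_sum[OF g] ..
    also have "(\<Sum>k=1..M. ip f (phi k) * ip (phi k) g) = (\<Sum>n<M. ip f (phi (Suc n)) * ip g (phi (Suc n)))"
      by (simp add: sum.atLeast1_atMost_eq ip_commute[of _ g])
    finally show ?thesis by simp
  qed
  ultimately show ?thesis by (simp add: sums_def)
qed

lemma bessel_summable: "L2 f \<Longrightarrow> summable (\<lambda>n. (ip f (phi (Suc n)))^2)"
  using parseval[of f f] by (simp add: sums_iff power2_eq_square)

section \<open>Green's formulas and the modal coefficients of the differential operator\<close>

lemma div_L2: "H2_wit f g w \<Longrightarrow> L2 (\<lambda>x. dx p x * g x + p x * w x)"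
  by (intro L2_add L2_mult_continuous dx_p_cont p_cont) (auto dest: H2_witD)

text \<open>Moving the coefficient \<open>p\<close> onto the test function leaves
  \<open>ip w (p * \<phi>)\<close>, which can be integrated by parts; the two terms with
  \<open>dx p\<close> cancel.\<close>

lemma green1:
  assumes H: "H2_wit f g w"
    and der: "\<And>x. x \<in> {0..1} \<Longrightarrow> (\<phi> has_real_derivative \<phi>' x) (at x within {0..1})"
    and cont: "continuous_on {0..1} \<phi>'"
  shows "ip (\<lambda>x. dx p x * g x + p x * w x) \<phi> = p 1 * g 1 * \<phi> 1 - p 0 * g 0 * \<phi> 0 - ip (\<lambda>x. p x * g x) \<phi>'"
proof -
  note F = H2_witD[OF H]
  have c\<phi>: "continuous_on {0..1} \<phi>" by (rule DERIV_continuous_on) (rule der)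
  note L = continuous_L2[OF c\<phi>] continuous_L2[OF cont]
  have "ip (\<lambda>x. dx p x * g x + p x * w x) \<phi> = ip (\<lambda>x. dx p x * g x) \<phi> + ip (\<lambda>x. p x * w x) \<phi>"
    by (intro ip_add L2_mult_continuous dx_p_cont p_cont F L)
  also have "ip (\<lambda>x. p x * w x) \<phi> = ip w (\<lambda>x. p x * \<phi> x)"
    by (simp add: ip_def mult_ac)
  also have "\<dots> = g 1 * (p 1 * \<phi> 1) - g 0 * (p 0 * \<phi> 0) - ip g (\<lambda>x. dx p x * \<phi> x + p x * \<phi>' x)"
  proof (rule H2_by_parts[OF H])
    show "((\<lambda>x. p x * \<phi> x) has_real_derivative dx p x * \<phi> x + p x * \<phi>' x) (at x within {0..1})"
      if "x \<in> {0..1}" for x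
      by (rule derivative_eq_intros p_deriv der that refl)+ simp
    show "continuous_on {0..1} (\<lambda>x. dx p x * \<phi> x + p x * \<phi>' x)"
      by (intro continuous_intros dx_p_cont p_cont c\<phi> cont)
  qed
  also have "ip g (\<lambda>x. dx p x * \<phi> x + p x * \<phi>' x) = ip (\<lambda>x. dx p x * \<phi> x) g + ip (\<lambda>x. p x * \<phi>' x) g"
    unfolding ip_commute[of g] by (intro ip_add L2_mult_continuous dx_p_cont p_cont F L)
  also have "ip (\<lambda>x. dx p x * \<phi> x) g = ip (\<lambda>x. dx p x * g x) \<phi>" by (simp add: ip_def mult_ac)
  also have "ip (\<lambda>x. p x * \<phi>' x) g = ip (\<lambda>x. p x * g x) \<phi>'" by (simp add: ip_def mult_ac)
  finally show ?thesis by (simp add: algebra_simps)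
qed

text \<open>Lagrange's identity: the integrated terms of the two Green formulas are symmetric in the
  two functions, so only the boundary remains.\<close>

lemma green2:
  assumes H: "H2_wit f g w" and H': "H2_wit f' g' w'"
  shows "ip (\<lambda>x. dx p x * g x + p x * w x) f' - ip (\<lambda>x. dx p x * g' x + p x * w' x) f
    = p 1 * (g 1 * f' 1 - f 1 * g' 1) - p 0 * (g 0 * f' 0 - f 0 * g' 0)"
proof -
  have "ip (\<lambda>x. p x * g x) g' = ip (\<lambda>x. p x * g' x) g" by (simp add: ip_def mult_ac)
  then show ?thesis
    using green1[OF H H2_witD(2)[OF H'] H2_witD(5)[OF H']] green1[OF H' H2_witD(2)[OF H] H2_witD(5)[OF H]]
    by (simp add: algebra_simps)
qed

lemma sin_th1: "sin th1 > 0" using th1 pi_gt_zero by (intro sin_gt_zero) linarith+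

lemma cos_th1: "cos th1 \<ge> 0" using th1 by (intro cos_ge_zero) auto

lemma sin_th2: "sin th2 \<ge> 0" using th2 by (intro sin_ge_zero) auto

lemma cos_th2: "cos th2 \<ge> 0" using th2 by (intro cos_ge_zero) auto

text \<open>The Wronskian is a determinant and may be computed in the orthonormal frame given by
  \<open>(c, s)\<close> and its rotation. The homogeneous condition on the second pair kills one of
  the two products and leaves \<open>u\<close> times the complementary boundary value.\<close>

lemma wronskian_bc:
  fixes c s f g f' g' u :: real
  assumes "c^2 + s^2 = 1" "c * f + s * g = u" "c * f' + s * g' = 0"
  shows "g * f' - f * g' = u * (- c * g' + s * f')"
proof -
  have "u * (- c * g' + s * f') = (c^2 + s^2) * (g * f' - f * g') + (c * f' + s * g') * (s * f - c * g)"
    unfolding assms(2)[symmetric] by (simp add: power2_eq_square algebra_simps)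
  then show ?thesis using assms by simp
qed

text \<open>Lagrange's identity against \<open>phi n\<close>: the eigenvalue equation turns the
  volume term into the factor \<open>- lam n\<close>, the boundary term at 0 vanishes, and the one
  at 1 is the input times \<open>beta_n\<close>. The shift \<open>qc\<close> comes from
  \<open>qt = q - qc\<close>.\<close>

lemma coeff_dynamics:
  assumes n: "n \<ge> 1" and H: "H2_wit f g w" and b0: "cos th1 * f 0 - sin th1 * g 0 = 0"
    and b1: "cos th2 * f 1 + sin th2 * g 1 = u"
  shows "ip (\<lambda>x. dx p x * g x + p x * w x - qt x * f x) (phi n)
    = (- lam n + qc) * ip f (phi n) + beta_n p th2 phi n * u"
proof -
  note F = H2_witD[OF H]
  obtain g' w' where H': "H2_wit (phi n) g' w'"
    and ae: "AE x in lborel. x \<in> {0..1} \<longrightarrow> - (dx p x * g' x + p x * w' x) + q x * phi n x = lam n * phi n x"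
    using phi_eigen[OF n] by (auto simp: SL_eigen_def)
  note F' = H2_witD[OF H']
  have d: "dx (phi n) 1 = g' 1" "dx (phi n) 0 = g' 0" using F'(6) by auto
  have b0': "cos th1 * phi n 0 - sin th1 * g' 0 = 0" and b1': "cos th2 * phi n 1 + sin th2 * g' 1 = 0"
    using phi_DA[OF n] d by (auto simp: in_DA_def)
  \<comment> \<open>At the left end both conditions are homogeneous; the sign of
    \<open>cos th1\<close> is flipped to fit the form of \<open>wronskian_bc\<close>.\<close>
  have W0: "g 0 * phi n 0 - f 0 * g' 0 = 0"
    using wronskian_bc[of "- cos th1" "sin th1" "f 0" "g 0" 0 "phi n 0" "g' 0"] b0 b0' by simp
  have W1: "p 1 * (g 1 * phi n 1 - f 1 * g' 1) = beta_n p th2 phi n * u"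
    using wronskian_bc[OF _ b1 b1'] by (simp add: beta_n_def d)
  have qL: "L2 (\<lambda>x. q x * phi n x)" and lL: "L2 (\<lambda>x. lam n * phi n x)"
    by (intro L2_mult_continuous q L2_scale F')+
  have "ip (\<lambda>x. dx p x * g' x + p x * w' x) f = ip (\<lambda>x. q x * phi n x - lam n * phi n x) f"
  proof (rule ip_cong_AE[OF div_L2[OF H'] L2_diff[OF qL lL] F(7)])
    show "AE x in lborel. x \<in> {0..1} \<longrightarrow> dx p x * g' x + p x * w' x = q x * phi n x - lam n * phi n x"
      using ae by eventually_elim auto
  qed
  also have "\<dots> = ip (\<lambda>x. q x * phi n x) f - lam n * ip (phi n) f"
    by (simp add: ip_diff qL lL F ip_scale)
  also have "ip (\<lambda>x. q x * phi n x) f = ip (\<lambda>x. q x * f x) (phi n)" by (simp add: ip_def mult_ac)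
  finally have e: "ip (\<lambda>x. dx p x * g' x + p x * w' x) f = ip (\<lambda>x. q x * f x) (phi n) - lam n * ip f (phi n)"
    by (simp add: ip_commute)
  have "ip (\<lambda>x. dx p x * g x + p x * w x - qt x * f x) (phi n)
      = ip (\<lambda>x. dx p x * g x + p x * w x) (phi n) - ip (\<lambda>x. qt x * f x) (phi n)"
    by (intro ip_diff div_L2[OF H] L2_mult_continuous qt F F')
  also have "ip (\<lambda>x. qt x * f x) (phi n) = ip (\<lambda>x. q x * f x - qc * f x) (phi n)"
    by (rule ip_cong) (use qtq in \<open>simp_all add: left_diff_distrib\<close>)
  also have "\<dots> = ip (\<lambda>x. q x * f x) (phi n) - qc * ip f (phi n)"
    by (subst ip_diff) (auto intro!: L2_mult_continuous q F F' L2_scale simp: ip_scale)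
  finally show ?thesis using green2[OF H H'] e W0 W1 by (simp add: algebra_simps)
qed

end

lemma H1_norm_sq_nonneg: "H1_norm_sq f \<ge> 0"
  unfolding H1_norm_sq_def set_lebesgue_integral_def by (rule Bochner_Integration.integral_nonneg) simp

text \<open>\<open>dx\<close> is taken within the unit interval, the only place where a trajectory
  at time 0 is known to agree with its initial state.\<close>

lemma H1_norm_sq_cong:
  assumes "\<And>x. x \<in> {0..1} \<Longrightarrow> f x = f' x" and H: "H2_wit f g w"
  shows "H2_wit f' g w" "H1_norm_sq f' = H1_norm_sq f"
proof -
  have "(f' has_real_derivative g x) (at x within {0..1})" if "x \<in> {0..1}" for x
    by (rule has_field_derivative_transform_within[where f=f and d=1]) (use H2_witD(2)[OF H that] that assms(1) in auto)
  then show H': "H2_wit f' g w" using H unfolding H2_wit_def by blast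
  show "H1_norm_sq f' = H1_norm_sq f"
    unfolding H1_norm_sq_wit[OF H] H1_norm_sq_wit[OF H']
    by (rule set_lebesgue_integral_cong) (auto simp: assms(1))
qed

lemma H1_norm_sq_add_le:
  assumes H: "H2_wit f g w" and H': "H2_wit f' g' w'"
  shows "H1_norm_sq (\<lambda>x. f x + f' x) \<le> 2 * H1_norm_sq f + 2 * H1_norm_sq f'"
proof -
  note F = H2_witD[OF H] and F' = H2_witD[OF H']
  have s: "(a + b)^2 \<le> 2 * a^2 + 2 * b^2" for a b :: real
    using sum_squares_bound[of a b] by (simp add: power2_sum)
  have i: "set_integrable lborel {0..1} (\<lambda>x. (f x)^2 + (g x)^2)" "set_integrable lborel {0..1} (\<lambda>x. (f' x)^2 + (g' x)^2)"
    by (intro borel_integrable_atLeastAtMost' continuous_intros F F')+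
  have "H1_norm_sq (\<lambda>x. f x + f' x) = (LINT x:{0..1}|lborel. (f x + f' x)^2 + (g x + g' x)^2)"
    by (rule H1_norm_sq_wit[OF H2_wit_add[OF H H']])
  also have "\<dots> \<le> (LINT x:{0..1}|lborel. 2 * ((f x)^2 + (g x)^2) + 2 * ((f' x)^2 + (g' x)^2))"
  proof (rule set_integral_mono)
    fix x show "(f x + f' x)^2 + (g x + g' x)^2 \<le> 2 * ((f x)^2 + (g x)^2) + 2 * ((f' x)^2 + (g' x)^2)"
      using s[of "f x" "f' x"] s[of "g x" "g' x"] by simp
  qed (intro borel_integrable_atLeastAtMost' continuous_intros F F')+
  also have "\<dots> = 2 * H1_norm_sq f + 2 * H1_norm_sq f'"
    unfolding H1_norm_sq_wit[OF H] H1_norm_sq_wit[OF H']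
    using i by (subst set_integral_add(2)) (simp_all only: set_integrable_mult_right set_integral_mult_right)
  finally show ?thesis .
qed

lemma H1_norm_sq_scale:
  assumes H: "H2_wit f g w" shows "H1_norm_sq (\<lambda>x. c * f x) = c^2 * H1_norm_sq f"
proof -
  have "(\<lambda>x. (c * f x)^2 + (c * g x)^2) = (\<lambda>x. c^2 * ((f x)^2 + (g x)^2))"
    by (auto simp: power_mult_distrib algebra_simps)
  then show ?thesis
    unfolding H1_norm_sq_wit[OF H] H1_norm_sq_wit[OF H2_wit_scale[OF H]] by (simp only: set_integral_mult_right)
qed

lemma continuous_bounds:
  fixes f :: "real \<Rightarrow> real"
  assumes "continuous_on {0..1} f" "\<forall>x\<in>{0..1}. f x > 0"
  obtains m M where "m > 0" "M > 0" "\<And>x. x \<in> {0..1} \<Longrightarrow> m \<le> f x \<and> f x \<le> M"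
proof -
  obtain a where a: "a \<in> {0..1}" "\<forall>x\<in>{0..1}. f a \<le> f x"
    using continuous_attains_inf[OF _ _ assms(1)] by auto
  obtain b where b: "b \<in> {0..1}" "\<forall>x\<in>{0..1}. f x \<le> f b"
    using continuous_attains_sup[OF _ _ assms(1)] by auto
  show thesis by (rule that[of "f a" "f b"]) (use a b assms(2) in auto)
qed

section \<open>The energy form and pointwise convergence of modal expansions\<close>

context sturm_liouville begin

text \<open>The quadratic form of the Sturm-Liouville operator in modal coordinates;
  \<open>energy_identity\<close> gives it as an integral with boundary terms.\<close>

definition energy :: "(real \<Rightarrow> real) \<Rightarrow> real" where
  "energy f = (\<Sum>n. lam (Suc n) * (ip f (phi (Suc n)))^2)"

text \<open>Parseval for \<open>f\<close> and its image under the differential operator: each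
  coefficient of the image is \<open>- lam + qc\<close> times that of \<open>f\<close>, and Green's
  formula evaluates the inner product.\<close>

lemma energy_identity:
  assumes H: "H2_wit f g w" and b0: "cos th1 * f 0 - sin th1 * g 0 = 0" and b1: "cos th2 * f 1 + sin th2 * g 1 = 0"
  shows "(\<lambda>n. lam (Suc n) * (ip f (phi (Suc n)))^2) sums
    ((LINT x:{0..1}|lborel. p x * (g x)^2 + q x * (f x)^2) - p 1 * g 1 * f 1 + p 0 * g 0 * f 0)"
proof -
  note F = H2_witD[OF H]
  let ?A = "\<lambda>x. dx p x * g x + p x * w x - qt x * f x"
  have AL: "L2 ?A" by (intro L2_diff div_L2[OF H] L2_mult_continuous qt F)
  have qL: "L2 (\<lambda>x. q x * f x)" "L2 (\<lambda>x. qt x * f x)" by (intro L2_mult_continuous q qt F)+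
  have "(\<lambda>n. qc * (ip f (phi (Suc n)) * ip f (phi (Suc n))) - ip ?A (phi (Suc n)) * ip f (phi (Suc n))) sums (qc * ip f f - ip ?A f)"
    by (intro sums_diff sums_mult parseval AL F)
  moreover have "ip ?A (phi (Suc n)) = (- lam (Suc n) + qc) * ip f (phi (Suc n))" for n
    using coeff_dynamics[OF _ H b0 b1, of "Suc n"] by simp
  moreover have "qc * ip f f - ip ?A f = (LINT x:{0..1}|lborel. p x * (g x)^2 + q x * (f x)^2) - p 1 * g 1 * f 1 + p 0 * g 0 * f 0"
  proof -
    have "ip ?A f = ip (\<lambda>x. dx p x * g x + p x * w x) f - ip (\<lambda>x. qt x * f x) f"
      by (intro ip_diff div_L2[OF H] qL F)
    also have "ip (\<lambda>x. qt x * f x) f = ip (\<lambda>x. q x * f x - qc * f x) f"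
      by (rule ip_cong) (use qtq in \<open>simp_all add: left_diff_distrib\<close>)
    also have "\<dots> = ip (\<lambda>x. q x * f x) f - qc * ip f f"
      by (subst ip_diff[OF qL(1) L2_scale[OF F(7)] F(7)]) (simp only: ip_scale)
    also have "ip (\<lambda>x. dx p x * g x + p x * w x) f = p 1 * g 1 * f 1 - p 0 * g 0 * f 0 - ip (\<lambda>x. p x * g x) g"
      by (rule green1[OF H F(2) F(5)])
    finally have "qc * ip f f - ip ?A f = (ip (\<lambda>x. p x * g x) g + ip (\<lambda>x. q x * f x) f) - p 1 * g 1 * f 1 + p 0 * g 0 * f 0"
      by simp
    also have "ip (\<lambda>x. p x * g x) g + ip (\<lambda>x. q x * f x) f = (LINT x:{0..1}|lborel. p x * g x * g x + q x * f x * f x)"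
      unfolding ip_def
      by (rule set_integral_add(2)[symmetric]; intro L2_mult_integrable L2_mult_continuous p_cont q F)
    finally show ?thesis by (simp only: power2_eq_square mult.assoc)
  qed
  moreover have "qc * (a * a) - (- l + qc) * a * a = l * a^2" for a l :: real
    by (simp add: power2_eq_square algebra_simps)
  ultimately show ?thesis by simp
qed

text \<open>Both angles lie in the first quadrant, so the boundary conditions turn the boundary
  terms of the form into nonnegative multiples of \<open>(f 0)^2\<close> and \<open>(f 1)^2\<close>.
  The lower bound drops them; the upper bound uses the trace inequality.\<close>

lemma energy_bounds:
  obtains c C where "c > 0" "C > 0"
    "\<And>f. in_DA th1 th2 f \<Longrightarrow> c * H1_norm_sq f \<le> energy f \<and> energy f \<le> C * H1_norm_sq f"
proof -
  obtain mp Mp where mp: "mp > 0" "Mp > 0" "\<And>x. x \<in> {0..1} \<Longrightarrow> mp \<le> p x \<and> p x \<le> Mp"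
    using continuous_bounds[OF p_cont p(2)] by blast
  obtain mq Mq where mq: "mq > 0" "Mq > 0" "\<And>x. x \<in> {0..1} \<Longrightarrow> mq \<le> q x \<and> q x \<le> Mq"
    using continuous_bounds[OF q qpos] by blast
  define k0 where "k0 = p 0 * cos th1 / sin th1"
  \<comment> \<open>For \<open>sin th2 = 0\<close> the condition at 1 is of Dirichlet type and the
    boundary term is zero. This cannot occur at 0, where \<open>sin th1 > 0\<close>.\<close>
  define k1 where "k1 = (if sin th2 = 0 then 0 else p 1 * cos th2 / sin th2)"
  have p01: "p 0 > 0" "p 1 > 0" using p(2) by auto
  have k0: "k0 \<ge> 0" and k1: "k1 \<ge> 0"
    using p01 sin_th1 sin_th2 cos_th1 cos_th2 by (auto simp: k0_def k1_def intro!: divide_nonneg_nonneg mult_nonneg_nonneg)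
  let ?c = "min mp mq" and ?C = "Mp + Mq + 2 * k0 + 2 * k1"
  show thesis
  proof (rule that)
    show "?c > 0" "?C > 0" using mp mq k0 k1 by auto
    fix f assume "in_DA th1 th2 f"
    then obtain g w where H: "H2_wit f g w" and b0: "cos th1 * f 0 - sin th1 * g 0 = 0"
      and b1: "cos th2 * f 1 + sin th2 * g 1 = 0" by (auto simp: in_DA_iff)
    note F = H2_witD[OF H]
    have g0: "p 0 * g 0 * f 0 = k0 * (f 0)^2"
    proof -
      have "g 0 = cos th1 * f 0 / sin th1" using b0 sin_th1 by (simp add: field_simps)
      then show ?thesis by (simp add: k0_def power2_eq_square)
    qed
    have g1: "- (p 1 * g 1 * f 1) = k1 * (f 1)^2"
    proof (cases "sin th2 = 0")
      case True
      then have "cos th2 \<noteq> 0" using sin_cos_squared_add[of th2] by auto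
      then show ?thesis using b1 True by (simp add: k1_def)
    next
      case False
      then have "g 1 = - (cos th2 * f 1) / sin th2" using b1 by (simp add: field_simps)
      then show ?thesis using False by (simp add: k1_def power2_eq_square)
    qed
    let ?I = "LINT x:{0..1}|lborel. p x * (g x)^2 + q x * (f x)^2"
    have E: "energy f = ?I + k1 * (f 1)^2 + k0 * (f 0)^2"
      using sums_unique[OF energy_identity[OF H b0 b1]] g0 g1 unfolding energy_def by linarith
    have i: "set_integrable lborel {0..1} (\<lambda>x. p x * (g x)^2 + q x * (f x)^2)"
      "set_integrable lborel {0..1} (\<lambda>x. c * ((f x)^2 + (g x)^2))" for c
      by (intro borel_integrable_atLeastAtMost' continuous_intros F p_cont q)+
    have lo: "?c * H1_norm_sq f \<le> ?I"
      unfolding H1_norm_sq_wit[OF H] set_integral_mult_right[symmetric]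
    proof (rule set_integral_mono[OF i(2) i(1)])
      fix x :: real assume x: "x \<in> {0..1}"
      have "?c * (g x)^2 \<le> p x * (g x)^2" "?c * (f x)^2 \<le> q x * (f x)^2"
        using mp(3)[OF x] mq(3)[OF x] by (auto intro!: mult_right_mono)
      then show "?c * ((f x)^2 + (g x)^2) \<le> p x * (g x)^2 + q x * (f x)^2" unfolding distrib_left by linarith
    qed
    have up: "?I \<le> (Mp + Mq) * H1_norm_sq f"
      unfolding H1_norm_sq_wit[OF H] set_integral_mult_right[symmetric]
    proof (rule set_integral_mono[OF i(1) i(2)])
      fix x :: real assume x: "x \<in> {0..1}"
      have "p x * (g x)^2 \<le> (Mp + Mq) * (g x)^2" "q x * (f x)^2 \<le> (Mp + Mq) * (f x)^2"
        using mp(2) mp(3)[OF x] mq(2) mq(3)[OF x] by (auto intro!: mult_right_mono)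
      then show "p x * (g x)^2 + q x * (f x)^2 \<le> (Mp + Mq) * ((f x)^2 + (g x)^2)" unfolding distrib_left by linarith
    qed
    have t: "(f 0)^2 \<le> 2 * H1_norm_sq f" "(f 1)^2 \<le> 2 * H1_norm_sq f"
      using trace_bounds[OF F(2) F(5)] by (simp_all add: H1_norm_sq_wit[OF H])
    have t': "k1 * (f 1)^2 \<le> k1 * (2 * H1_norm_sq f)" "k0 * (f 0)^2 \<le> k0 * (2 * H1_norm_sq f)"
      using t k0 k1 by (auto intro: mult_left_mono)
    have t0: "0 \<le> k1 * (f 1)^2" "0 \<le> k0 * (f 0)^2" using k0 k1 by auto
    show "?c * H1_norm_sq f \<le> energy f \<and> energy f \<le> ?C * H1_norm_sq f"
      using E lo up t' t0 by (simp add: algebra_simps)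
  qed
qed

lemma energy_sums:
  assumes "in_DA th1 th2 f" shows "(\<lambda>n. lam (Suc n) * (ip f (phi (Suc n)))^2) sums energy f"
proof -
  obtain g w where "H2_wit f g w" "cos th1 * f 0 - sin th1 * g 0 = 0"
      "cos th2 * f 1 + sin th2 * g 1 = 0" using assms by (auto simp: in_DA_iff)
  from energy_identity[OF this] show ?thesis by (auto simp: energy_def sums_iff)
qed

lemma point_value_bound:
  obtains C where "C > 0" "\<And>f. in_DA th1 th2 f \<Longrightarrow> (f 0)^2 \<le> C * energy f"
proof -
  obtain c C where c: "c > 0" "\<And>f. in_DA th1 th2 f \<Longrightarrow> c * H1_norm_sq f \<le> energy f"
    using energy_bounds by metis
  show thesis
  proof (rule that)
    show "2 / c > 0" using c by simp
    fix f assume f: "in_DA th1 th2 f"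
    then obtain g w where H: "H2_wit f g w" by (auto simp: in_DA_iff)
    have "(f 0)^2 \<le> 2 * H1_norm_sq f"
      using trace_bounds(1)[OF H2_witD(2,5)[OF H]] by (simp add: H1_norm_sq_wit[OF H])
    also have "\<dots> \<le> 2 / c * energy f" using c(1) c(2)[OF f] by (simp add: field_simps)
    finally show "(f 0)^2 \<le> 2 / c * energy f" .
  qed
qed

lemma partial_sum_DA: "in_DA th1 th2 (\<lambda>x. \<Sum>k=1..M. c k * phi k x)"
  by (intro in_DA_sum phi_DA) auto

lemma energy_partial_sum: "energy (\<lambda>x. \<Sum>k=1..M. c k * phi k x) = (\<Sum>k=1..M. lam k * (c k)^2)"
proof -
  have "energy (\<lambda>x. \<Sum>k=1..M. c k * phi k x) = (\<Sum>n. if n < M then lam (Suc n) * (c (Suc n))^2 else 0)"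
    unfolding energy_def by (rule suminf_cong) (subst coeff_partial_sum, auto)
  also have "\<dots> = (\<Sum>n<M. if n < M then lam (Suc n) * (c (Suc n))^2 else 0)"
    by (rule suminf_finite) auto
  also have "\<dots> = (\<Sum>k=1..M. lam k * (c k)^2)"
    by (simp add: sum.atLeast1_atMost_eq)
  finally show ?thesis .
qed

text \<open>The test function is the truncated eigenfunction expansion of the Green's function at \<open>0\<close>:
  its value at \<open>0\<close> and its energy are both the partial sum, so a bound \<open>(f 0)^2 \<le> C * energy f\<close>
  bounds the partial sums by \<open>C\<close>.\<close>
lemma point_weights_summable: "summable (\<lambda>n. (phi (Suc n) 0)^2 / lam (Suc n))"
proof -
  obtain C where C: "C > 0" "\<And>f. in_DA th1 th2 f \<Longrightarrow> (f 0)^2 \<le> C * energy f" using point_value_bound by blast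
  have "(\<Sum>n<M. (phi (Suc n) 0)^2 / lam (Suc n)) \<le> C" for M
  proof -
    let ?s = "\<Sum>k=1..M. (phi k 0)^2 / lam k"
    let ?f = "\<lambda>x. \<Sum>k=1..M. phi k 0 / lam k * phi k x"
    have "energy ?f = ?s"
      unfolding energy_partial_sum
      by (rule sum.cong) (use lam_pos in \<open>force simp: power2_eq_square\<close>)+
    moreover have "?f 0 = ?s" by (simp add: power2_eq_square)
    ultimately have "?s^2 \<le> C * ?s" using C(2)[OF partial_sum_DA, of "\<lambda>k. phi k 0 / lam k" M] by metis
    moreover have "?s \<ge> 0" by (rule sum_nonneg) (use lam_pos in \<open>force intro: divide_nonneg_pos\<close>)
    ultimately have "?s \<le> C" using C(1) by (cases "?s = 0") (auto simp: power2_eq_square)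
    then show ?thesis by (simp add: sum.atLeast1_atMost_eq)
  qed
  then show ?thesis using lam_pos by (intro summableI_nonneg_bounded[where x=C]) (simp_all add: less_imp_le)
qed

text \<open>Mean square convergence says nothing about the value at 0. But the remainder stays in
  the operator domain and its energy is the tail of a convergent series, so the bound of
  \<open>(f 0)^2\<close> by the energy forces the point values to converge.\<close>

lemma point_value_sums:
  assumes f: "in_DA th1 th2 f" shows "(\<lambda>n. ip f (phi (Suc n)) * phi (Suc n) 0) sums f 0"
proof -
  obtain C where C: "C > 0" "\<And>f. in_DA th1 th2 f \<Longrightarrow> (f 0)^2 \<le> C * energy f" using point_value_bound by blast
  let ?S = "\<lambda>M x. \<Sum>k=1..M. ip f (phi k) * phi k x"
  let ?r = "\<lambda>M x. f x - ?S M x"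
  let ?e = "\<lambda>n. lam (Suc n) * (ip f (phi (Suc n)))^2"
  have co: "ip (?r M) (phi (Suc n)) = (if n < M then 0 else ip f (phi (Suc n)))" for M n
    using ip_diff[OF in_DA_L2[OF f] partial_sum_L2 phi_L2, of "Suc n"] coeff_partial_sum[of "Suc n"] by auto
  have er: "energy (?r M) = energy f - (\<Sum>n<M. ?e n)" for M
  proof -
    have "(\<lambda>n. ?e n - (if n < M then ?e n else 0)) sums (energy f - (\<Sum>n<M. if n < M then ?e n else 0))"
      by (intro sums_diff energy_sums f sums_finite) auto
    moreover have "?e n - (if n < M then ?e n else 0) = lam (Suc n) * (ip (?r M) (phi (Suc n)))^2" for n
      unfolding co by simp
    ultimately show ?thesis unfolding energy_def by (simp add: sums_iff)
  qed
  have "(\<lambda>M. C * (energy f - (\<Sum>n<M. ?e n))) \<longlonglongrightarrow> C * (energy f - energy f)"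
    using energy_sums[OF f] unfolding sums_def by (intro tendsto_intros)
  then have lim: "(\<lambda>M. C * (energy f - (\<Sum>n<M. ?e n))) \<longlonglongrightarrow> 0" by simp
  have "(\<lambda>M. (?r M 0)^2) \<longlonglongrightarrow> 0"
  proof (rule Lim_null_comparison[OF _ lim])
    have "(?r M 0)^2 \<le> C * (energy f - (\<Sum>n<M. ?e n))" for M
      using C(2)[OF in_DA_diff[OF f partial_sum_DA[of "\<lambda>k. ip f (phi k)" M]]] unfolding er .
    then show "\<forall>\<^sub>F M in sequentially. norm ((?r M 0)^2) \<le> C * (energy f - (\<Sum>n<M. ?e n))" by simp
  qed
  then have "(\<lambda>M. sqrt ((?r M 0)^2)) \<longlonglongrightarrow> sqrt 0" by (rule tendsto_real_sqrt)
  then have "(\<lambda>M. ?r M 0) \<longlonglongrightarrow> 0" by (simp add: tendsto_rabs_zero_iff)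
  then have "(\<lambda>M. f 0 - ?r M 0) \<longlonglongrightarrow> f 0 - 0" by (intro tendsto_intros)
  then show ?thesis by (simp add: sums_def sum.atLeast1_atMost_eq)
qed

section \<open>The boundary lift\<close>

lemma denom_pos: "cos th2 + 2 * sin th2 > 0"
proof (rule ccontr)
  assume "\<not> cos th2 + 2 * sin th2 > 0"
  then have "cos th2 = 0" "sin th2 = 0" using sin_th2 cos_th2 by linarith+
  then show False using sin_cos_squared_add[of th2] by simp
qed

text \<open>The normalisation of \<open>b\<close>: adding \<open>u * b\<close> to the state removes
  the boundary value \<open>u\<close> at 1.\<close>

lemma b_fun_bc: "cos th2 * b_fun th2 1 + sin th2 * (- (2 * 1) / (cos th2 + 2 * sin th2)) = - 1"
proof -
  let ?d = "cos th2 + 2 * sin th2"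
  have "cos th2 * b_fun th2 1 + sin th2 * (- (2 * 1) / ?d) = - ?d / ?d"
    unfolding b_fun_def by (simp add: diff_divide_distrib)
  also have "\<dots> = - 1" using denom_pos by (simp only: divide_minus_left) simp
  finally show ?thesis .
qed

lemma b_fun_wit:
  "H2_wit (b_fun th2) (\<lambda>x. - (2 * x) / (cos th2 + 2 * sin th2)) (\<lambda>x. - 2 / (cos th2 + 2 * sin th2))"
proof -
  let ?d = "cos th2 + 2 * sin th2"
  have d: "((\<lambda>x. - (2 * x) / ?d) has_real_derivative - 2 / ?d) (at x within A)" for x A
    using DERIV_cmult[OF DERIV_ident, of "- 2 / ?d"] by simp
  have "(LINT s:{0..x}|lborel. - 2 / ?d) = - (2 * x) / ?d - - (2 * 0) / ?d" if "x \<in> {0..1}" for x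
    by (rule LINT_FTC) (use that d in auto)
  moreover have "(b_fun th2 has_real_derivative - (2 * x) / ?d) (at x within A)" for x A
    using DERIV_cmult[OF DERIV_power[OF DERIV_ident, of 2], of "- 1 / ?d"] by (simp add: b_fun_def[abs_def])
  ultimately show ?thesis unfolding H2_wit_def by (auto intro!: continuous_L2)
qed

lemma b_fun_L2: "L2 (b_fun th2)" and b_fun_0: "b_fun th2 0 = 0"
  using H2_witD(7)[OF b_fun_wit] by (auto simp: b_fun_def)

lemma a_fun_L2: "L2 (a_fun p qt th2)"
  unfolding a_fun_def[abs_def] using denom_pos
  by (intro continuous_L2 continuous_intros p_cont dx_p_cont qt) auto

text \<open>\<open>- a\<close> is the differential expression of the plant applied to
  \<open>b\<close>, and \<open>b\<close> has boundary value -1 at the right end, so this is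
  \<open>coeff_dynamics\<close> for \<open>b\<close> itself.\<close>

lemma coeff_a:
  assumes n: "n \<ge> 1"
  shows "ip (a_fun p qt th2) (phi n) = beta_n p th2 phi n + (lam n - qc) * ip (b_fun th2) (phi n)"
proof -
  let ?d = "cos th2 + 2 * sin th2"
  from b_fun_bc have "ip (\<lambda>x. dx p x * (- (2 * x) / ?d) + p x * (- 2 / ?d) - qt x * b_fun th2 x) (phi n)
    = (- lam n + qc) * ip (b_fun th2) (phi n) + beta_n p th2 phi n * (- 1)"
    by (intro coeff_dynamics[OF n b_fun_wit]) (auto simp: b_fun_0)
  moreover have "ip (a_fun p qt th2) (phi n)
    = ip (\<lambda>x. - 1 * (dx p x * (- (2 * x) / ?d) + p x * (- 2 / ?d) - qt x * b_fun th2 x)) (phi n)"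
    by (rule ip_cong) (auto simp: a_fun_def b_fun_def add_divide_distrib diff_divide_distrib algebra_simps)
  ultimately show ?thesis unfolding ip_scale by (simp add: algebra_simps)
qed

lemma lift_DA:
  assumes z: "H2 z" and b0: "cos th1 * z 0 - sin th1 * dx z 0 = 0" and b1: "cos th2 * z 1 + sin th2 * dx z 1 = u"
  shows "in_DA th1 th2 (\<lambda>x. z x + u * b_fun th2 x)"
proof -
  let ?d = "cos th2 + 2 * sin th2"
  obtain w where H: "H2_wit z (dx z) w" using z by (rule H2_obtain)
  from b_fun_bc have "cos th2 * (u * b_fun th2 1) + sin th2 * (u * (- (2 * 1) / ?d)) = - u"
    by (metis mult.left_commute distrib_left mult_minus1_right)
  then have "cos th2 * (z 1 + u * b_fun th2 1) + sin th2 * (dx z 1 + u * (- (2 * 1) / ?d)) = 0"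
    using b1 by (simp only: distrib_left)
  moreover have "cos th1 * (z 0 + u * b_fun th2 0) - sin th1 * (dx z 0 + u * (- (2 * 0) / ?d)) = 0"
    using b0 by (simp add: b_fun_0)
  ultimately show ?thesis unfolding in_DA_iff
    using H2_wit_add[OF H H2_wit_scale[OF b_fun_wit, of u]] by blast
qed

lemma lift_norm_bounds:
  obtains C where "C > 0"
    "\<And>z u. H2 z \<Longrightarrow> H1_norm_sq (\<lambda>x. z x + u * b_fun th2 x) \<le> C * (H1_norm_sq z + u^2)
       \<and> H1_norm_sq z \<le> C * (H1_norm_sq (\<lambda>x. z x + u * b_fun th2 x) + u^2)"
proof -
  let ?B = "H1_norm_sq (b_fun th2)"
  let ?C = "2 + 2 * ?B"
  have B: "?B \<ge> 0" by (rule H1_norm_sq_nonneg)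
  show thesis
  proof (rule that)
    show "?C > 0" using B by simp
    fix z u assume z: "H2 z"
    obtain g w where H: "H2_wit z g w" using z by (auto simp: H2_def)
    have Z: "H1_norm_sq z \<ge> 0" "H1_norm_sq (\<lambda>x. z x + u * b_fun th2 x) \<ge> 0" by (rule H1_norm_sq_nonneg)+
    have 1: "H1_norm_sq (\<lambda>x. z x + u * b_fun th2 x) \<le> 2 * H1_norm_sq z + 2 * (u^2 * ?B)"
      using H1_norm_sq_add_le[OF H H2_wit_scale[OF b_fun_wit, of u]] by (simp only: H1_norm_sq_scale[OF b_fun_wit])
    have "H1_norm_sq (\<lambda>x. (z x + u * b_fun th2 x) + (- u) * b_fun th2 x) \<le> 2 * H1_norm_sq (\<lambda>x. z x + u * b_fun th2 x) + 2 * ((- u)^2 * ?B)"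
      using H1_norm_sq_add_le[OF H2_wit_add[OF H H2_wit_scale[OF b_fun_wit]] H2_wit_scale[OF b_fun_wit, of "- u"]]
      by (simp only: H1_norm_sq_scale[OF b_fun_wit])
    then have 2: "H1_norm_sq z \<le> 2 * H1_norm_sq (\<lambda>x. z x + u * b_fun th2 x) + 2 * (u^2 * ?B)" by simp
    have 3: "2 * Z + 2 * (u^2 * ?B) \<le> ?C * (Z + u^2)" if "Z \<ge> 0" for Z
    proof -
      have "?B * Z \<ge> 0" "u^2 \<ge> 0" using B that by auto
      then show ?thesis by (simp add: algebra_simps)
    qed
    show "H1_norm_sq (\<lambda>x. z x + u * b_fun th2 x) \<le> ?C * (H1_norm_sq z + u^2)
       \<and> H1_norm_sq z \<le> ?C * (H1_norm_sq (\<lambda>x. z x + u * b_fun th2 x) + u^2)"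
      using order_trans[OF 1 3[OF Z(1)]] order_trans[OF 2 3[OF Z(2)]] ..
  qed
qed

end

section \<open>The matrix inequality as a dissipation inequality\<close>

text \<open>The state of the finite-dimensional part, with \<open>n = N0\<close> and
  \<open>m = N - N0\<close>: predictors and observer errors of the first \<open>N0\<close> modes,
  then scaled predictors and scaled errors of the modes up to \<open>N\<close>.\<close>

definition stk :: "nat \<Rightarrow> nat \<Rightarrow> (nat \<Rightarrow> real) \<Rightarrow> (nat \<Rightarrow> real) \<Rightarrow> (nat \<Rightarrow> real) \<Rightarrow> (nat \<Rightarrow> real) \<Rightarrow> real vec" where
  "stk n m x1 x2 x3 x4 = (vec n x1 @\<^sub>v vec n x2) @\<^sub>v (vec m x3 @\<^sub>v vec m x4)"

lemma stk_carrier: "stk n m x1 x2 x3 x4 \<in> carrier_vec ((n + n) + (m + m))"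
  by (simp add: stk_def)

lemma scalar_prod_vec: "scalar_prod (vec n x) (vec n y) = (\<Sum>i<n. x i * y i)"
  by (simp add: scalar_prod_def atLeast0LessThan)

lemma diag_mult_vec: "mat n n (\<lambda>(i,j). if i = j then d i else (0::real)) *\<^sub>v vec n x = vec n (\<lambda>i. d i * x i)"
proof (rule eq_vecI)
  fix i assume "i < dim_vec (vec n (\<lambda>i. d i * x i))"
  then have i: "i < n" by simp
  have "(mat n n (\<lambda>(i,j). if i = j then d i else 0) *\<^sub>v vec n x) $ i = (\<Sum>j<n. (if i = j then d i else 0) * x j)"
    using i by (simp add: scalar_prod_def atLeast0LessThan)
  also have "\<dots> = (\<Sum>j<n. if j = i then d i * x j else 0)" by (rule sum.cong) auto
  also have "\<dots> = d i * x i" using i by simp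
  finally show "(mat n n (\<lambda>(i,j). if i = j then d i else 0) *\<^sub>v vec n x) $ i = vec n (\<lambda>i. d i * x i) $ i"
    using i by simp
qed simp

lemma row_mult_vec:
  fixes B :: "real mat"
  assumes "B \<in> carrier_mat 1 m" shows "B *\<^sub>v vec m x = vec 1 (\<lambda>_. \<Sum>j<m. B $$ (0,j) * x j)"
  using assms by (intro eq_vecI) (auto simp: scalar_prod_def atLeast0LessThan)

lemma col_mult_vec:
  fixes A :: "real mat"
  assumes "A \<in> carrier_mat n 1" shows "A *\<^sub>v vec 1 (\<lambda>_. c) = vec n (\<lambda>i. A $$ (i,0) * c)"
  using assms by (intro eq_vecI) (auto simp: scalar_prod_def)

lemma outer_mult_vec:
  fixes A B :: "real mat"
  assumes "A \<in> carrier_mat n 1" "B \<in> carrier_mat 1 m"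
  shows "(A * B) *\<^sub>v vec m x = vec n (\<lambda>i. A $$ (i,0) * (\<Sum>j<m. B $$ (0,j) * x j))"
  unfolding assoc_mult_mat_vec[OF assms vec_carrier] row_mult_vec[OF assms(2)] col_mult_vec[OF assms(1)] ..

lemma diag_mult_col:
  fixes L :: "real mat"
  assumes "L \<in> carrier_mat n 1"
  shows "mat n n (\<lambda>(i,j). if i = j then d i else 0) * L = mat n 1 (\<lambda>(i,j). d i * L $$ (i,0))"
proof (rule eq_matI)
  fix i j assume "i < dim_row (mat n 1 (\<lambda>(i,j). d i * L $$ (i,0)))" "j < dim_col (mat n 1 (\<lambda>(i,j). d i * L $$ (i,0)))"
  then have i: "i < n" and j: "j = 0" by auto
  have "(mat n n (\<lambda>(i,j). if i = j then d i else 0) * L) $$ (i,0) = (\<Sum>k<n. (if i = k then d i else 0) * L $$ (k,0))"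
    using i assms by (simp add: scalar_prod_def atLeast0LessThan)
  also have "\<dots> = (\<Sum>k<n. if k = i then d i * L $$ (k,0) else 0)" by (rule sum.cong) auto
  also have "\<dots> = d i * L $$ (i,0)" using i by simp
  finally show "(mat n n (\<lambda>(i,j). if i = j then d i else 0) * L) $$ (i,j) = mat n 1 (\<lambda>(i,j). d i * L $$ (i,0)) $$ (i,j)"
    using i j by simp
qed (use assms in auto)

lemma vec_add_vec: "vec n x + vec n y = vec n (\<lambda>i. x i + y i :: real)"
  and vec_minus_vec: "vec n x - vec n y = vec n (\<lambda>i. x i - y i :: real)"
  and vec_uminus: "- vec n x = vec n (\<lambda>i. - x i :: real)"
  and vec_smult: "c \<cdot>\<^sub>v vec n x = vec n (\<lambda>i. c * x i :: real)"
  by (auto intro!: eq_vecI)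

lemma vec_eq_cong: "(\<And>i. i < n \<Longrightarrow> x i = y i) \<Longrightarrow> vec n x = vec n y"
  by (auto intro!: eq_vecI)

lemma append_add_append:
  "(vec n a @\<^sub>v vec m b) + (vec n c @\<^sub>v vec m d) = vec n (\<lambda>i. a i + c i :: real) @\<^sub>v vec m (\<lambda>i. b i + d i)"
  by (subst append_vec_add[of _ n _ _ m]) (simp_all add: vec_add_vec)

lemma stk_add:
  "stk n m a1 a2 a3 a4 + stk n m b1 b2 b3 b4
    = stk n m (\<lambda>i. a1 i + b1 i) (\<lambda>i. a2 i + b2 i) (\<lambda>i. a3 i + b3 i) (\<lambda>i. a4 i + b4 i)"
  unfolding stk_def by (subst append_vec_add[of _ "n + n" _ _ "m + m"]) (simp_all add: append_add_append)

lemma stk_cong: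
  assumes "\<And>i. i < n \<Longrightarrow> a1 i = b1 i" "\<And>i. i < n \<Longrightarrow> a2 i = b2 i" "\<And>i. i < m \<Longrightarrow> a3 i = b3 i" "\<And>i. i < m \<Longrightarrow> a4 i = b4 i"
  shows "stk n m a1 a2 a3 a4 = stk n m b1 b2 b3 b4"
  unfolding stk_def using vec_eq_cong[of n a1 b1] vec_eq_cong[of n a2 b2] vec_eq_cong[of m a3 b3] vec_eq_cong[of m a4 b4] assms by metis

lemma zero_vec_eq: "0\<^sub>v n = vec n (\<lambda>_. 0)" by (auto intro!: eq_vecI)

lemma minus_mult_distrib_mat_vec:
  fixes A :: "real mat"
  assumes "A \<in> carrier_mat nr nc" "B \<in> carrier_mat nr nc" "v \<in> carrier_vec nc"
  shows "(A - B) *\<^sub>v v = A *\<^sub>v v - B *\<^sub>v v"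
  using assms by (intro eq_vecI) (auto simp: scalar_prod_def sum_subtractf[symmetric] left_diff_distrib)

lemma smult_mat_mult_vec:
  fixes A :: "real mat"
  assumes "A \<in> carrier_mat nr nc" "v \<in> carrier_vec nc"
  shows "(c \<cdot>\<^sub>m A) *\<^sub>v v = c \<cdot>\<^sub>v (A *\<^sub>v v)"
  using assms by (intro eq_vecI) auto

lemma hstack_carrier: "A \<in> carrier_mat n a \<Longrightarrow> B \<in> carrier_mat n b \<Longrightarrow> hstack A B \<in> carrier_mat n (a + b)"
  unfolding hstack_def by auto

lemma hstack_mult_vec:
  assumes A: "A \<in> carrier_mat n a" and B: "B \<in> carrier_mat n b" and x: "x \<in> carrier_vec a" and y: "y \<in> carrier_vec b"
  shows "hstack A B *\<^sub>v (x @\<^sub>v y) = A *\<^sub>v x + B *\<^sub>v y"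
proof -
  have "hstack A B *\<^sub>v (x @\<^sub>v y) = (A *\<^sub>v x + B *\<^sub>v y) @\<^sub>v (0\<^sub>m 0 (dim_col A) *\<^sub>v x + 0\<^sub>m 0 (dim_col B) *\<^sub>v y)"
    unfolding hstack_def using A B x y by (intro four_block_mat_mult_vec) auto
  also have "\<dots> = A *\<^sub>v x + B *\<^sub>v y" using A B by (intro eq_vecI) auto
  finally show ?thesis .
qed

lemma transpose_scalar:
  fixes A :: "real mat"
  assumes "A \<in> carrier_mat nr nc" "x \<in> carrier_vec nc" "y \<in> carrier_vec nr"
  shows "scalar_prod x (A\<^sup>T *\<^sub>v y) = scalar_prod (A *\<^sub>v x) y"
  using transpose_vec_mult_scalar[OF assms] assms
  by (metis comm_scalar_prod mult_mat_vec_carrier transpose_carrier_mat)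

lemma gram_scalar:
  fixes A :: "real mat"
  assumes A: "A \<in> carrier_mat nr nc" and x: "x \<in> carrier_vec nc"
  shows "scalar_prod x ((A\<^sup>T * A) *\<^sub>v x) = scalar_prod (A *\<^sub>v x) (A *\<^sub>v x)"
  by (simp add: assoc_mult_mat_vec[OF transpose_carrier_mat[THEN iffD2, OF A] A x] A x)
    (rule transpose_scalar[OF A x mult_mat_vec_carrier[OF A x]])

lemma four_block_mult_vec:
  fixes A B C D :: "real mat"
  assumes "A \<in> carrier_mat n a" "B \<in> carrier_mat n b" "C \<in> carrier_mat m a" "D \<in> carrier_mat m b"
    and "A *\<^sub>v vec a x = vec n p1" "B *\<^sub>v vec b y = vec n p2" "C *\<^sub>v vec a x = vec m q1" "D *\<^sub>v vec b y = vec m q2"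
  shows "four_block_mat A B C D *\<^sub>v (vec a x @\<^sub>v vec b y) = vec n (\<lambda>i. p1 i + p2 i) @\<^sub>v vec m (\<lambda>i. q1 i + q2 i)"
  unfolding four_block_mat_mult_vec[OF assms(1-4) vec_carrier vec_carrier] assms(5-8) vec_add_vec ..

lemma zero_mult_vec: "0\<^sub>m a b *\<^sub>v vec b x = vec a (\<lambda>_. 0::real)"
  by (auto intro!: eq_vecI)

section \<open>The closed-loop matrices in components\<close>

locale controller =
  fixes lam beta :: "nat \<Rightarrow> real" and phi :: "nat \<Rightarrow> real \<Rightarrow> real" and qc h :: real
    and N0 N :: nat and K L :: "real mat"
  assumes NN: "N0 \<le> N" and K: "K \<in> carrier_mat 1 N0" and L: "L \<in> carrier_mat N0 1"
begin

definition kap :: "nat \<Rightarrow> real" where "kap n = - lam n + qc"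
definition gain :: "(nat \<Rightarrow> real) \<Rightarrow> real" where "gain x1 = (\<Sum>j<N0. K $$ (0,j) * x1 j)"
text \<open>The output error in these coordinates, measured output minus its estimate. The fourth
  block carries a factor \<open>sqrt lam\<close>, so its output weights are divided by it.\<close>

definition innov :: "(nat \<Rightarrow> real) \<Rightarrow> (nat \<Rightarrow> real) \<Rightarrow> real \<Rightarrow> real" where
  "innov x2 x4 \<zeta> = (\<Sum>j<N0. phi (j+1) 0 * x2 j) + (\<Sum>j<N-N0. phi (N0+j+1) 0 / sqrt (lam (N0+j+1)) * x4 j) + \<zeta>"
text \<open>\<open>d1\<close> to \<open>d4\<close> are the four block rows of
  \<open>F X + Lc \<zeta>\<close>, hence the time derivatives of the four blocks.\<close>

definition d1 :: "(nat \<Rightarrow> real) \<Rightarrow> (nat \<Rightarrow> real) \<Rightarrow> (nat \<Rightarrow> real) \<Rightarrow> real \<Rightarrow> nat \<Rightarrow> real" where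
  "d1 x1 x2 x4 \<zeta> i = kap (i+1) * x1 i + beta (i+1) * gain x1 + exp (kap (i+1) * h) * L $$ (i,0) * innov x2 x4 \<zeta>"
definition d2 :: "(nat \<Rightarrow> real) \<Rightarrow> (nat \<Rightarrow> real) \<Rightarrow> real \<Rightarrow> nat \<Rightarrow> real" where
  "d2 x2 x4 \<zeta> i = kap (i+1) * x2 i - L $$ (i,0) * innov x2 x4 \<zeta>"
definition d3 :: "(nat \<Rightarrow> real) \<Rightarrow> (nat \<Rightarrow> real) \<Rightarrow> nat \<Rightarrow> real" where
  "d3 x1 x3 i = kap (N0+i+1) * x3 i + beta (N0+i+1) / lam (N0+i+1) * gain x1"
definition d4 :: "(nat \<Rightarrow> real) \<Rightarrow> nat \<Rightarrow> real" where "d4 x4 i = kap (N0+i+1) * x4 i"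

abbreviation "MM \<equiv> N - N0"
abbreviation "F \<equiv> Fm lam phi beta qc N0 N h K L"
abbreviation "Lc \<equiv> Lcalm lam qc N0 N h L"
abbreviation "E \<equiv> Em lam phi beta qc N0 N h K L"

lemma A0m_eq: "A0m lam qc N0 = mat N0 N0 (\<lambda>(i,j). if i = j then kap (i+1) else 0)"
  and expA0h_eq: "expA0h lam qc N0 h = mat N0 N0 (\<lambda>(i,j). if i = j then exp (kap (i+1) * h) else 0)"
  and A1m_eq: "A1m lam qc N0 N = mat MM MM (\<lambda>(i,j). if i = j then kap (N0+i+1) else 0)"
  by (auto simp: A0m_def expA0h_def A1m_def kap_def)

lemma eL_eq: "expA0h lam qc N0 h * L = mat N0 1 (\<lambda>(i,j). exp (kap (i+1) * h) * L $$ (i,0))"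
  unfolding expA0h_eq by (rule diag_mult_col[OF L])

lemma carriers:
  "A0m lam qc N0 \<in> carrier_mat N0 N0" "expA0h lam qc N0 h * L \<in> carrier_mat N0 1"
  "B0m beta N0 \<in> carrier_mat N0 1" "C0m phi N0 \<in> carrier_mat 1 N0" "C1tm lam phi N0 N \<in> carrier_mat 1 MM"
  "A1m lam qc N0 N \<in> carrier_mat MM MM" "B1tm lam beta N0 N \<in> carrier_mat MM 1"
  by (auto simp: eL_eq A0m_def B0m_def C0m_def C1tm_def A1m_def B1tm_def)

lemma block_products:
  "(A0m lam qc N0 + B0m beta N0 * K) *\<^sub>v vec N0 x1 = vec N0 (\<lambda>i. kap (i+1) * x1 i + beta (i+1) * gain x1)"
  "(expA0h lam qc N0 h * L * C0m phi N0) *\<^sub>v vec N0 x2 = vec N0 (\<lambda>i. exp (kap (i+1) * h) * L $$ (i,0) * (\<Sum>j<N0. phi (j+1) 0 * x2 j))"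
  "(expA0h lam qc N0 h * L * C1tm lam phi N0 N) *\<^sub>v vec MM x4 =
     vec N0 (\<lambda>i. exp (kap (i+1) * h) * L $$ (i,0) * (\<Sum>j<MM. phi (N0+j+1) 0 / sqrt (lam (N0+j+1)) * x4 j))"
  "(A0m lam qc N0 - L * C0m phi N0) *\<^sub>v vec N0 x2 = vec N0 (\<lambda>i. kap (i+1) * x2 i - L $$ (i,0) * (\<Sum>j<N0. phi (j+1) 0 * x2 j))"
  "(- (L * C1tm lam phi N0 N)) *\<^sub>v vec MM x4 = vec N0 (\<lambda>i. - (L $$ (i,0) * (\<Sum>j<MM. phi (N0+j+1) 0 / sqrt (lam (N0+j+1)) * x4 j)))"
  "(B1tm lam beta N0 N * K) *\<^sub>v vec N0 x1 = vec MM (\<lambda>i. beta (N0+i+1) / lam (N0+i+1) * gain x1)"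
  "A1m lam qc N0 N *\<^sub>v vec MM x3 = vec MM (\<lambda>i. kap (N0+i+1) * x3 i)"
  "(expA0h lam qc N0 h * L) *\<^sub>v vec 1 (\<lambda>_. \<zeta>) = vec N0 (\<lambda>i. exp (kap (i+1) * h) * L $$ (i,0) * \<zeta>)"
  "L *\<^sub>v vec 1 (\<lambda>_. \<zeta>) = vec N0 (\<lambda>i. L $$ (i,0) * \<zeta>)"
proof -
  note C = carriers
  have A0: "A0m lam qc N0 *\<^sub>v vec N0 x = vec N0 (\<lambda>i. kap (i+1) * x i)" for x
    unfolding A0m_eq by (rule diag_mult_vec)
  show "(A0m lam qc N0 + B0m beta N0 * K) *\<^sub>v vec N0 x1 = vec N0 (\<lambda>i. kap (i+1) * x1 i + beta (i+1) * gain x1)"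
    unfolding add_mult_distrib_mat_vec[OF C(1) mult_carrier_mat[OF C(3) K] vec_carrier] A0 outer_mult_vec[OF C(3) K] vec_add_vec
    by (rule vec_eq_cong) (simp add: gain_def B0m_def)
  show "(expA0h lam qc N0 h * L * C0m phi N0) *\<^sub>v vec N0 x2 = vec N0 (\<lambda>i. exp (kap (i+1) * h) * L $$ (i,0) * (\<Sum>j<N0. phi (j+1) 0 * x2 j))"
    unfolding outer_mult_vec[OF C(2) C(4)] by (rule vec_eq_cong) (simp add: eL_eq C0m_def)
  show "(expA0h lam qc N0 h * L * C1tm lam phi N0 N) *\<^sub>v vec MM x4 =
     vec N0 (\<lambda>i. exp (kap (i+1) * h) * L $$ (i,0) * (\<Sum>j<MM. phi (N0+j+1) 0 / sqrt (lam (N0+j+1)) * x4 j))"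
    unfolding outer_mult_vec[OF C(2) C(5)] by (rule vec_eq_cong) (simp add: eL_eq C1tm_def)
  show "(A0m lam qc N0 - L * C0m phi N0) *\<^sub>v vec N0 x2 = vec N0 (\<lambda>i. kap (i+1) * x2 i - L $$ (i,0) * (\<Sum>j<N0. phi (j+1) 0 * x2 j))"
    unfolding minus_mult_distrib_mat_vec[OF C(1) mult_carrier_mat[OF L C(4)] vec_carrier] A0 outer_mult_vec[OF L C(4)] vec_minus_vec
    by (rule vec_eq_cong) (simp add: C0m_def)
  show "(- (L * C1tm lam phi N0 N)) *\<^sub>v vec MM x4 = vec N0 (\<lambda>i. - (L $$ (i,0) * (\<Sum>j<MM. phi (N0+j+1) 0 / sqrt (lam (N0+j+1)) * x4 j)))"
  proof -
    have "dim_vec (vec MM x4) = dim_col (L * C1tm lam phi N0 N)" using C(5) by simp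
    then show ?thesis
      by (subst uminus_mult_mat_vec, assumption, unfold outer_mult_vec[OF L C(5)] vec_uminus) (rule vec_eq_cong, simp add: C1tm_def)
  qed
  show "(B1tm lam beta N0 N * K) *\<^sub>v vec N0 x1 = vec MM (\<lambda>i. beta (N0+i+1) / lam (N0+i+1) * gain x1)"
    unfolding outer_mult_vec[OF C(7) K] gain_def by (rule vec_eq_cong) (simp add: B1tm_def)
  show "A1m lam qc N0 N *\<^sub>v vec MM x3 = vec MM (\<lambda>i. kap (N0+i+1) * x3 i)"
    unfolding A1m_eq by (rule diag_mult_vec)
  show "(expA0h lam qc N0 h * L) *\<^sub>v vec 1 (\<lambda>_. \<zeta>) = vec N0 (\<lambda>i. exp (kap (i+1) * h) * L $$ (i,0) * \<zeta>)"
    unfolding col_mult_vec[OF C(2)] by (rule vec_eq_cong) (simp add: eL_eq)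
  show "L *\<^sub>v vec 1 (\<lambda>_. \<zeta>) = vec N0 (\<lambda>i. L $$ (i,0) * \<zeta>)" by (rule col_mult_vec[OF L])
qed

lemma F_carrier: "F \<in> carrier_mat ((N0 + N0) + (MM + MM)) ((N0 + N0) + (MM + MM))"
  and Lc_carrier: "Lc \<in> carrier_mat ((N0 + N0) + (MM + MM)) 1"
proof -
  note C = carriers
  show "F \<in> carrier_mat ((N0 + N0) + (MM + MM)) ((N0 + N0) + (MM + MM))"
    unfolding Fm_def Let_def using C K L by (intro four_block_carrier_mat) auto
  show "Lc \<in> carrier_mat ((N0 + N0) + (MM + MM)) 1"
    unfolding Lcalm_def vstack_def using C L by (intro carrier_append_rows) auto
qed

text \<open>The link between the block matrices of the matrix inequality and the scalar fields in
  which both the trajectories and the feasibility are treated.\<close>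

lemma closed_loop_product:
  "F *\<^sub>v stk N0 MM x1 x2 x3 x4 + Lc *\<^sub>v vec 1 (\<lambda>_. \<zeta>) = stk N0 MM (d1 x1 x2 x4 \<zeta>) (d2 x2 x4 \<zeta>) (d3 x1 x3) (d4 x4)"
proof -
  note C = carriers
  let ?T = "four_block_mat (A0m lam qc N0 + B0m beta N0 * K) (expA0h lam qc N0 h * L * C0m phi N0) (0\<^sub>m N0 N0) (A0m lam qc N0 - L * C0m phi N0)"
  let ?U = "four_block_mat (0\<^sub>m N0 MM) (expA0h lam qc N0 h * L * C1tm lam phi N0 N) (0\<^sub>m N0 MM) (- (L * C1tm lam phi N0 N))"
  let ?V = "four_block_mat (B1tm lam beta N0 N * K) (0\<^sub>m MM N0) (0\<^sub>m MM N0) (0\<^sub>m MM N0)"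
  let ?W = "four_block_mat (A1m lam qc N0 N) (0\<^sub>m MM MM) (0\<^sub>m MM MM) (A1m lam qc N0 N)"
  let ?x = "vec N0 x1 @\<^sub>v vec N0 x2" and ?y = "vec MM x3 @\<^sub>v vec MM x4"
  have T: "?T \<in> carrier_mat (N0+N0) (N0+N0)" and U: "?U \<in> carrier_mat (N0+N0) (MM+MM)"
    and V: "?V \<in> carrier_mat (MM+MM) (N0+N0)" and W: "?W \<in> carrier_mat (MM+MM) (MM+MM)"
    using C K L by (auto intro!: four_block_carrier_mat)
  have F: "F *\<^sub>v (?x @\<^sub>v ?y) = (?T *\<^sub>v ?x + ?U *\<^sub>v ?y) @\<^sub>v (?V *\<^sub>v ?x + ?W *\<^sub>v ?y)"
    unfolding Fm_def Let_def by (rule four_block_mat_mult_vec[OF T U V W]) auto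
  have carr: "A0m lam qc N0 + B0m beta N0 * K \<in> carrier_mat N0 N0" "expA0h lam qc N0 h * L * C0m phi N0 \<in> carrier_mat N0 N0"
    "A0m lam qc N0 - L * C0m phi N0 \<in> carrier_mat N0 N0" "expA0h lam qc N0 h * L * C1tm lam phi N0 N \<in> carrier_mat N0 MM"
    "- (L * C1tm lam phi N0 N) \<in> carrier_mat N0 MM" "B1tm lam beta N0 N * K \<in> carrier_mat MM N0"
    using mult_carrier_mat[OF C(3) K] mult_carrier_mat[OF C(2) C(4)] mult_carrier_mat[OF L C(4)] mult_carrier_mat[OF C(2) C(5)]
      mult_carrier_mat[OF L C(5)] mult_carrier_mat[OF C(7) K] C(1) by (auto intro: minus_carrier_mat)
  let ?p = "\<lambda>i. kap (i+1) * x1 i + beta (i+1) * gain x1" and ?s = "\<Sum>j<N0. phi (j+1) 0 * x2 j"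
    and ?t = "\<Sum>j<MM. phi (N0+j+1) 0 / sqrt (lam (N0+j+1)) * x4 j" and ?l = "\<lambda>i. exp (kap (i+1) * h) * L $$ (i,0)"
  have Tx: "?T *\<^sub>v ?x = vec N0 (\<lambda>i. ?p i + ?l i * ?s) @\<^sub>v vec N0 (\<lambda>i. 0 + (kap (i+1) * x2 i - L $$ (i,0) * ?s))"
    by (rule four_block_mult_vec[OF carr(1,2) zero_carrier_mat carr(3)]) (fact block_products zero_mult_vec)+
  have Uy: "?U *\<^sub>v ?y = vec N0 (\<lambda>i. 0 + ?l i * ?t) @\<^sub>v vec N0 (\<lambda>i. 0 + - (L $$ (i,0) * ?t))"
    by (rule four_block_mult_vec[OF zero_carrier_mat carr(4) zero_carrier_mat carr(5)]) (fact block_products zero_mult_vec)+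
  have Vx: "?V *\<^sub>v ?x = vec MM (\<lambda>i. beta (N0+i+1) / lam (N0+i+1) * gain x1 + 0) @\<^sub>v vec MM (\<lambda>i. 0 + 0)"
    by (rule four_block_mult_vec[OF carr(6) zero_carrier_mat zero_carrier_mat zero_carrier_mat]) (fact block_products zero_mult_vec)+
  have Wy: "?W *\<^sub>v ?y = vec MM (\<lambda>i. kap (N0+i+1) * x3 i + 0) @\<^sub>v vec MM (\<lambda>i. 0 + kap (N0+i+1) * x4 i)"
    by (rule four_block_mult_vec[OF C(6) zero_carrier_mat zero_carrier_mat C(6)]) (fact block_products zero_mult_vec)+
  have Lz: "Lc *\<^sub>v vec 1 (\<lambda>_. \<zeta>) = (vec N0 (\<lambda>i. exp (kap (i+1) * h) * L $$ (i,0) * \<zeta>) @\<^sub>v vec N0 (\<lambda>i. - (L $$ (i,0) * \<zeta>)))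
      @\<^sub>v (vec MM (\<lambda>_. 0) @\<^sub>v vec MM (\<lambda>_. 0))"
  proof -
    have L': "- L \<in> carrier_mat N0 1" using L by simp
    have "Lc *\<^sub>v vec 1 (\<lambda>_. \<zeta>) = ((expA0h lam qc N0 h * L @\<^sub>r - L) *\<^sub>v vec 1 (\<lambda>_. \<zeta>)) @\<^sub>v ((0\<^sub>m MM 1 @\<^sub>r 0\<^sub>m MM 1) *\<^sub>v vec 1 (\<lambda>_. \<zeta>))"
      unfolding Lcalm_def vstack_def
      by (rule mat_mult_append[OF carrier_append_rows[OF C(2) L'] carrier_append_rows[OF zero_carrier_mat zero_carrier_mat] vec_carrier])
    also have "(expA0h lam qc N0 h * L @\<^sub>r - L) *\<^sub>v vec 1 (\<lambda>_. \<zeta>) = ((expA0h lam qc N0 h * L) *\<^sub>v vec 1 (\<lambda>_. \<zeta>)) @\<^sub>v ((- L) *\<^sub>v vec 1 (\<lambda>_. \<zeta>))"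
      by (rule mat_mult_append[OF C(2) L' vec_carrier])
    also have "(0\<^sub>m MM 1 @\<^sub>r 0\<^sub>m MM 1) *\<^sub>v vec 1 (\<lambda>_. \<zeta>) = (0\<^sub>m MM 1 *\<^sub>v vec 1 (\<lambda>_. \<zeta>)) @\<^sub>v (0\<^sub>m MM 1 *\<^sub>v vec 1 (\<lambda>_. \<zeta>))"
      by (rule mat_mult_append[OF zero_carrier_mat zero_carrier_mat vec_carrier])
    also have "(- L) *\<^sub>v vec 1 (\<lambda>_. \<zeta>) = vec N0 (\<lambda>i. - (L $$ (i,0) * \<zeta>))"
      using L by (subst uminus_mult_mat_vec, simp, unfold block_products(9) vec_uminus, simp)
    finally show ?thesis by (simp only: block_products(8) zero_mult_vec)
  qed
  show ?thesis
    unfolding stk_def[of _ _ x1 x2 x3 x4] F Tx Uy Vx Wy Lz append_add_append unfolding stk_def[symmetric] stk_add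
    by (rule stk_cong) (auto simp: d1_def d2_def d3_def d4_def innov_def algebra_simps)
qed

end

lemma append_vec_assoc: "(a @\<^sub>v b) @\<^sub>v c = a @\<^sub>v (b @\<^sub>v c)"
  by (rule eq_vecI) (auto simp: add.assoc less_diff_conv2 not_less)

context controller begin

abbreviation "DD \<equiv> (N0 + N0) + (MM + MM)"

lemma DD_eq: "DD = 2 * N" using NN by simp

lemma gain_product: "Ktm N0 N K *\<^sub>v stk N0 MM x1 x2 x3 x4 = vec 1 (\<lambda>_. gain x1)"
proof -
  have e: "2 * N - N0 = N0 + (MM + MM)" using NN by simp
  have "Ktm N0 N K *\<^sub>v stk N0 MM x1 x2 x3 x4
    = K *\<^sub>v vec N0 x1 + 0\<^sub>m 1 (2 * N - N0) *\<^sub>v (vec N0 x2 @\<^sub>v (vec MM x3 @\<^sub>v vec MM x4))"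
    unfolding Ktm_def stk_def append_vec_assoc by (rule hstack_mult_vec[OF K zero_carrier_mat]) (simp_all add: e)
  also have "0\<^sub>m 1 (2 * N - N0) *\<^sub>v (vec N0 x2 @\<^sub>v (vec MM x3 @\<^sub>v vec MM x4)) = vec 1 (\<lambda>_. 0)"
    by (rule eq_vecI) (simp_all add: e)
  finally show ?thesis unfolding row_mult_vec[OF K] vec_add_vec gain_def by simp
qed

lemma Ktm_carrier: "Ktm N0 N K \<in> carrier_mat 1 DD"
proof -
  have "Ktm N0 N K \<in> carrier_mat 1 (N0 + (2 * N - N0))"
    unfolding Ktm_def by (rule hstack_carrier[OF K zero_carrier_mat])
  moreover have "N0 + (2 * N - N0) = DD" using NN by simp
  ultimately show ?thesis by (simp only:)
qed

text \<open>\<open>E\<close> is \<open>K\<close> times the top block row of \<open>F\<close>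
  bordered by that of \<open>Lc\<close>, so on \<open>(X, \<zeta>)\<close> it returns the gain of
  \<open>d1\<close>.\<close>

lemma E_carrier: "E \<in> carrier_mat 1 (DD + 1)"
  and E_product: "E *\<^sub>v (stk N0 MM x1 x2 x3 x4 @\<^sub>v vec 1 (\<lambda>_. \<zeta>)) = vec 1 (\<lambda>_. gain (d1 x1 x2 x4 \<zeta>))"
proof -
  note C = carriers
  let ?A1 = "A0m lam qc N0 + B0m beta N0 * K" and ?A2 = "expA0h lam qc N0 h * L * C0m phi N0"
    and ?A4 = "expA0h lam qc N0 h * L * C1tm lam phi N0 N" and ?A5 = "expA0h lam qc N0 h * L"
  have carr: "?A1 \<in> carrier_mat N0 N0" "?A2 \<in> carrier_mat N0 N0" "?A4 \<in> carrier_mat N0 MM"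
    using mult_carrier_mat[OF C(3) K] mult_carrier_mat[OF C(2) C(4)] mult_carrier_mat[OF C(2) C(5)] C(1) by auto
  note h12 = hstack_carrier[OF carr(1,2)] and h34 = hstack_carrier[OF zero_carrier_mat carr(3), of MM]
  note h = hstack_carrier[OF h12 h34]
  let ?H = "hstack (hstack (hstack ?A1 ?A2) (hstack (0\<^sub>m N0 MM) ?A4)) ?A5"
  have H: "?H \<in> carrier_mat N0 (DD + 1)" by (rule hstack_carrier[OF h C(2)])
  have E: "E = K * ?H" by (simp add: Em_def Let_def)
  show "E \<in> carrier_mat 1 (DD + 1)" unfolding E by (rule mult_carrier_mat[OF K H])
  have v: "stk N0 MM x1 x2 x3 x4 @\<^sub>v vec 1 (\<lambda>_. \<zeta>) \<in> carrier_vec (DD + 1)"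
    by (rule append_carrier_vec[OF stk_carrier vec_carrier])
  have "?H *\<^sub>v (stk N0 MM x1 x2 x3 x4 @\<^sub>v vec 1 (\<lambda>_. \<zeta>))
      = hstack (hstack ?A1 ?A2) (hstack (0\<^sub>m N0 MM) ?A4) *\<^sub>v stk N0 MM x1 x2 x3 x4 + ?A5 *\<^sub>v vec 1 (\<lambda>_. \<zeta>)"
    by (rule hstack_mult_vec[OF h C(2) stk_carrier vec_carrier])
  also have "hstack (hstack ?A1 ?A2) (hstack (0\<^sub>m N0 MM) ?A4) *\<^sub>v stk N0 MM x1 x2 x3 x4
      = hstack ?A1 ?A2 *\<^sub>v (vec N0 x1 @\<^sub>v vec N0 x2) + hstack (0\<^sub>m N0 MM) ?A4 *\<^sub>v (vec MM x3 @\<^sub>v vec MM x4)"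
    unfolding stk_def by (rule hstack_mult_vec[OF h12 h34 append_carrier_vec append_carrier_vec]) (rule vec_carrier)+
  also have "hstack ?A1 ?A2 *\<^sub>v (vec N0 x1 @\<^sub>v vec N0 x2) = ?A1 *\<^sub>v vec N0 x1 + ?A2 *\<^sub>v vec N0 x2"
    by (rule hstack_mult_vec[OF carr(1,2) vec_carrier vec_carrier])
  also have "hstack (0\<^sub>m N0 MM) ?A4 *\<^sub>v (vec MM x3 @\<^sub>v vec MM x4) = 0\<^sub>m N0 MM *\<^sub>v vec MM x3 + ?A4 *\<^sub>v vec MM x4"
    by (rule hstack_mult_vec[OF zero_carrier_mat carr(3) vec_carrier vec_carrier])
  finally have "?H *\<^sub>v (stk N0 MM x1 x2 x3 x4 @\<^sub>v vec 1 (\<lambda>_. \<zeta>)) = vec N0 (d1 x1 x2 x4 \<zeta>)"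
    unfolding block_products zero_mult_vec vec_add_vec
    by (simp only:) (rule vec_eq_cong, simp add: d1_def innov_def algebra_simps)
  then show "E *\<^sub>v (stk N0 MM x1 x2 x3 x4 @\<^sub>v vec 1 (\<lambda>_. \<zeta>)) = vec 1 (\<lambda>_. gain (d1 x1 x2 x4 \<zeta>))"
    unfolding E assoc_mult_mat_vec[OF K H v] by (simp only: row_mult_vec[OF K] gain_def)
qed

lemma Theta1_carrier:
  assumes P: "P \<in> carrier_mat DD DD" and bet: "beta = beta_n p th2 phi"
  shows "Theta1 p qt th2 lam phi qc \<delta> N0 N h K L P \<alpha> \<beta> \<gamma> \<in> carrier_mat (DD + 1) (DD + 1)"
  unfolding Theta1_def Let_def bet[symmetric] using P E_carrier mult_carrier_mat[OF transpose_carrier_mat[THEN iffD2, OF E_carrier] E_carrier]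
  by auto

text \<open>Evaluated at \<open>(X, \<zeta>)\<close>, the matrix \<open>\<Theta>\<^sub>1\<close> only sees the vector field \<open>F X + \<L> \<zeta>\<close> of the
  finite-dimensional part, the control \<open>gain x1\<close> and its time derivative \<open>gain (d1 \<dots>)\<close>.\<close>
lemma Theta1_form:
  fixes x1 x2 x3 x4 :: "nat \<Rightarrow> real" and \<zeta> :: real and X X' :: "real vec"
  assumes P: "P \<in> carrier_mat DD DD" and sym: "P\<^sup>T = P" and bet: "beta = beta_n p th2 phi"
  defines "X \<equiv> stk N0 MM x1 x2 x3 x4"
  defines "X' \<equiv> stk N0 MM (d1 x1 x2 x4 \<zeta>) (d2 x2 x4 \<zeta>) (d3 x1 x3) (d4 x4)"
  shows "scalar_prod (X @\<^sub>v vec 1 (\<lambda>_. \<zeta>)) (Theta1 p qt th2 lam phi qc \<delta> N0 N h K L P \<alpha> \<beta> \<gamma> *\<^sub>v (X @\<^sub>v vec 1 (\<lambda>_. \<zeta>)))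
    = 2 * scalar_prod X' (P *\<^sub>v X) + 2 * \<delta> * scalar_prod X (P *\<^sub>v X)
      + \<alpha> * \<gamma> * RN_norm_sq phi N (a_fun p qt th2) * (gain x1)^2 - \<beta> * exp (- 2 * \<delta> * h) * \<zeta>^2
      + \<alpha> * \<gamma> * RN_norm_sq phi N (b_fun th2) * (gain (d1 x1 x2 x4 \<zeta>))^2"
proof -
  define z where "z = vec 1 (\<lambda>_. \<zeta>)"
  have z: "z \<in> carrier_vec 1" by (simp add: z_def)
  have X: "X \<in> carrier_vec DD" and X': "X' \<in> carrier_vec DD" unfolding X_def X'_def by (rule stk_carrier)+
  note Fc = F_carrier and Lcc = Lc_carrier and Kc = Ktm_carrier and Ec = E_carrier
  let ?Kt = "Ktm N0 N K"
  let ?ra = "\<alpha> * \<gamma> * RN_norm_sq phi N (a_fun p qt th2)" and ?rb = "\<alpha> * \<gamma> * RN_norm_sq phi N (b_fun th2)"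
  let ?A = "F\<^sup>T * P + P * F + (2 * \<delta>) \<cdot>\<^sub>m P + ?ra \<cdot>\<^sub>m (?Kt\<^sup>T * ?Kt)"
  let ?D = "mat 1 1 (\<lambda>_. - \<beta> * exp (- 2 * \<delta> * h))"
  let ?B = "four_block_mat ?A (P * Lc) (Lc\<^sup>T * P) ?D"
  have FT: "F\<^sup>T \<in> carrier_mat DD DD" and LT: "Lc\<^sup>T \<in> carrier_mat 1 DD"
    using Fc Lcc by (simp_all only: transpose_carrier_mat)
  have KK: "?Kt\<^sup>T * ?Kt \<in> carrier_mat DD DD"
    by (rule mult_carrier_mat[OF _ Kc]) (simp only: transpose_carrier_mat Kc)
  have EE: "E\<^sup>T * E \<in> carrier_mat (DD + 1) (DD + 1)"
    by (rule mult_carrier_mat[OF _ Ec]) (simp only: transpose_carrier_mat Ec)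
  have c1: "F\<^sup>T * P \<in> carrier_mat DD DD" "P * F \<in> carrier_mat DD DD" "(2 * \<delta>) \<cdot>\<^sub>m P \<in> carrier_mat DD DD"
    "?ra \<cdot>\<^sub>m (?Kt\<^sup>T * ?Kt) \<in> carrier_mat DD DD"
    using mult_carrier_mat[OF FT P] mult_carrier_mat[OF P Fc] P KK by simp_all
  have c2: "F\<^sup>T * P + P * F \<in> carrier_mat DD DD" by (rule add_carrier_mat[OF c1(2)])
  have c3: "F\<^sup>T * P + P * F + (2 * \<delta>) \<cdot>\<^sub>m P \<in> carrier_mat DD DD" by (rule add_carrier_mat[OF c1(3)])
  have A: "?A \<in> carrier_mat DD DD" by (rule add_carrier_mat[OF c1(4)])
  have D: "?D \<in> carrier_mat 1 1" by simp
  have PL: "P * Lc \<in> carrier_mat DD 1" and LP: "Lc\<^sup>T * P \<in> carrier_mat 1 DD"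
    by (rule mult_carrier_mat[OF P Lcc], rule mult_carrier_mat[OF LT P])
  have Bc: "?B \<in> carrier_mat (DD + 1) (DD + 1)" by (rule four_block_carrier_mat[OF A D])
  have v: "X @\<^sub>v z \<in> carrier_vec (DD + 1)" by (rule append_carrier_vec[OF X z])
  have PX: "P *\<^sub>v X \<in> carrier_vec DD" and FX: "F *\<^sub>v X \<in> carrier_vec DD" and Lz: "Lc *\<^sub>v z \<in> carrier_vec DD"
    by (rule mult_mat_vec_carrier[OF P X] mult_mat_vec_carrier[OF Fc X] mult_mat_vec_carrier[OF Lcc z])+
  have T: "Theta1 p qt th2 lam phi qc \<delta> N0 N h K L P \<alpha> \<beta> \<gamma> = ?B + ?rb \<cdot>\<^sub>m (E\<^sup>T * E)"
    unfolding Theta1_def Let_def bet[symmetric] ..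
  have Tv: "scalar_prod (X @\<^sub>v z) ((?B + ?rb \<cdot>\<^sub>m (E\<^sup>T * E)) *\<^sub>v (X @\<^sub>v z))
      = scalar_prod (X @\<^sub>v z) (?B *\<^sub>v (X @\<^sub>v z)) + ?rb * scalar_prod (E *\<^sub>v (X @\<^sub>v z)) (E *\<^sub>v (X @\<^sub>v z))"
  proof -
    have "(?B + ?rb \<cdot>\<^sub>m (E\<^sup>T * E)) *\<^sub>v (X @\<^sub>v z) = ?B *\<^sub>v (X @\<^sub>v z) + ?rb \<cdot>\<^sub>v ((E\<^sup>T * E) *\<^sub>v (X @\<^sub>v z))"
      using add_mult_distrib_mat_vec[OF Bc smult_carrier_mat[OF EE] v] smult_mat_mult_vec[OF EE v] by simp
    then show ?thesis
      using scalar_prod_add_distrib[OF v mult_mat_vec_carrier[OF Bc v] smult_carrier_vec[THEN iffD2, OF mult_mat_vec_carrier[OF EE v]]]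
        scalar_prod_smult_distrib[OF v mult_mat_vec_carrier[OF EE v]] gram_scalar[OF Ec v] by simp
  qed
  have Bv: "scalar_prod (X @\<^sub>v z) (?B *\<^sub>v (X @\<^sub>v z))
      = scalar_prod X (?A *\<^sub>v X) + scalar_prod X ((P * Lc) *\<^sub>v z) + scalar_prod z ((Lc\<^sup>T * P) *\<^sub>v X) + scalar_prod z (?D *\<^sub>v z)"
  proof -
    have "?B *\<^sub>v (X @\<^sub>v z) = (?A *\<^sub>v X + (P * Lc) *\<^sub>v z) @\<^sub>v ((Lc\<^sup>T * P) *\<^sub>v X + ?D *\<^sub>v z)"
      by (rule four_block_mat_mult_vec[OF A PL LP D X z])
    moreover have "scalar_prod (X @\<^sub>v z) ((?A *\<^sub>v X + (P * Lc) *\<^sub>v z) @\<^sub>v ((Lc\<^sup>T * P) *\<^sub>v X + ?D *\<^sub>v z))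
       = scalar_prod X (?A *\<^sub>v X + (P * Lc) *\<^sub>v z) + scalar_prod z ((Lc\<^sup>T * P) *\<^sub>v X + ?D *\<^sub>v z)"
      using mult_mat_vec_carrier[OF A X] mult_mat_vec_carrier[OF PL z] mult_mat_vec_carrier[OF LP X] mult_mat_vec_carrier[OF D z]
      by (intro scalar_prod_append[OF X z]) (auto intro: add_carrier_vec)
    ultimately show ?thesis
      using scalar_prod_add_distrib[OF X mult_mat_vec_carrier[OF A X] mult_mat_vec_carrier[OF PL z]]
        scalar_prod_add_distrib[OF z mult_mat_vec_carrier[OF LP X] mult_mat_vec_carrier[OF D z]] by simp
  qed
  have sP: "scalar_prod x (P *\<^sub>v y) = scalar_prod (P *\<^sub>v x) y" if "x \<in> carrier_vec DD" "y \<in> carrier_vec DD" for x y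
    using transpose_scalar[OF P that] unfolding sym .
  have AX: "scalar_prod X (?A *\<^sub>v X) = 2 * scalar_prod (F *\<^sub>v X) (P *\<^sub>v X) + 2 * \<delta> * scalar_prod X (P *\<^sub>v X) + ?ra * scalar_prod (?Kt *\<^sub>v X) (?Kt *\<^sub>v X)"
  proof -
    have "?A *\<^sub>v X = F\<^sup>T *\<^sub>v (P *\<^sub>v X) + P *\<^sub>v (F *\<^sub>v X) + (2 * \<delta>) \<cdot>\<^sub>v (P *\<^sub>v X) + ?ra \<cdot>\<^sub>v ((?Kt\<^sup>T * ?Kt) *\<^sub>v X)"
      unfolding add_mult_distrib_mat_vec[OF c3 c1(4) X] add_mult_distrib_mat_vec[OF c2 c1(3) X] add_mult_distrib_mat_vec[OF c1(1) c1(2) X]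
        assoc_mult_mat_vec[OF FT P X] assoc_mult_mat_vec[OF P Fc X] smult_mat_mult_vec[OF P X] smult_mat_mult_vec[OF KK X] ..
    moreover have "scalar_prod X (F\<^sup>T *\<^sub>v (P *\<^sub>v X) + P *\<^sub>v (F *\<^sub>v X) + (2 * \<delta>) \<cdot>\<^sub>v (P *\<^sub>v X) + ?ra \<cdot>\<^sub>v ((?Kt\<^sup>T * ?Kt) *\<^sub>v X))
      = scalar_prod X (F\<^sup>T *\<^sub>v (P *\<^sub>v X)) + scalar_prod X (P *\<^sub>v (F *\<^sub>v X)) + 2 * \<delta> * scalar_prod X (P *\<^sub>v X) + ?ra * scalar_prod X ((?Kt\<^sup>T * ?Kt) *\<^sub>v X)"
    proof -
      have a: "F\<^sup>T *\<^sub>v (P *\<^sub>v X) \<in> carrier_vec DD" "P *\<^sub>v (F *\<^sub>v X) \<in> carrier_vec DD" "(2 * \<delta>) \<cdot>\<^sub>v (P *\<^sub>v X) \<in> carrier_vec DD"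
        "(?Kt\<^sup>T * ?Kt) *\<^sub>v X \<in> carrier_vec DD" "?ra \<cdot>\<^sub>v ((?Kt\<^sup>T * ?Kt) *\<^sub>v X) \<in> carrier_vec DD"
        using mult_mat_vec_carrier[OF FT PX] mult_mat_vec_carrier[OF P FX] PX mult_mat_vec_carrier[OF KK X] by simp_all
      show ?thesis
        unfolding scalar_prod_add_distrib[OF X add_carrier_vec[OF add_carrier_vec[OF a(1,2)] a(3)] a(5)]
          scalar_prod_add_distrib[OF X add_carrier_vec[OF a(1,2)] a(3)] scalar_prod_add_distrib[OF X a(1,2)]
          scalar_prod_smult_distrib[OF X PX] scalar_prod_smult_distrib[OF X a(4)] ..
    qed
    moreover have "scalar_prod X (F\<^sup>T *\<^sub>v (P *\<^sub>v X)) = scalar_prod (F *\<^sub>v X) (P *\<^sub>v X)" by (rule transpose_scalar[OF Fc X PX])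
    moreover have "scalar_prod X (P *\<^sub>v (F *\<^sub>v X)) = scalar_prod (F *\<^sub>v X) (P *\<^sub>v X)"
      using sP[OF X FX] comm_scalar_prod[OF PX FX] by simp
    ultimately show ?thesis using gram_scalar[OF Kc X] by simp
  qed
  have XPL: "scalar_prod X ((P * Lc) *\<^sub>v z) = scalar_prod (Lc *\<^sub>v z) (P *\<^sub>v X)"
    unfolding assoc_mult_mat_vec[OF P Lcc z] using sP[OF X Lz] comm_scalar_prod[OF PX Lz] by simp
  have zLP: "scalar_prod z ((Lc\<^sup>T * P) *\<^sub>v X) = scalar_prod (Lc *\<^sub>v z) (P *\<^sub>v X)"
    unfolding assoc_mult_mat_vec[OF LT P X] by (rule transpose_scalar[OF Lcc z PX])
  have zD: "scalar_prod z (?D *\<^sub>v z) = - \<beta> * exp (- 2 * \<delta> * h) * \<zeta>^2"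
    by (simp add: z_def scalar_prod_def power2_eq_square)
  have KX: "scalar_prod (?Kt *\<^sub>v X) (?Kt *\<^sub>v X) = (gain x1)^2"
    unfolding X_def gain_product by (simp add: scalar_prod_def power2_eq_square)
  have EX: "scalar_prod (E *\<^sub>v (X @\<^sub>v z)) (E *\<^sub>v (X @\<^sub>v z)) = (gain (d1 x1 x2 x4 \<zeta>))^2"
    unfolding X_def z_def E_product by (simp add: scalar_prod_def power2_eq_square)
  have "scalar_prod X' (P *\<^sub>v X) = scalar_prod (F *\<^sub>v X) (P *\<^sub>v X) + scalar_prod (Lc *\<^sub>v z) (P *\<^sub>v X)"
    unfolding X'_def closed_loop_product[symmetric] X_def[symmetric] z_def[symmetric]
    by (rule add_scalar_prod_distrib[OF FX Lz PX])
  then show ?thesis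
    unfolding T z_def[symmetric] Tv Bv AX XPL zLP zD KX EX by simp
qed

end

section \<open>Lyapunov matrices\<close>

lemma bilinear_sum:
  fixes G :: "real mat"
  assumes "G \<in> carrier_mat n n" "x \<in> carrier_vec n" "y \<in> carrier_vec n"
  shows "scalar_prod y (G *\<^sub>v x) = (\<Sum>i<n. \<Sum>j<n. y $ i * G $$ (i,j) * x $ j)"
  using assms by (auto simp: scalar_prod_def atLeast0LessThan sum_distrib_left mult_ac intro!: sum.cong)

lemma transpose_smult_mat: "(c \<cdot>\<^sub>m A)\<^sup>T = c \<cdot>\<^sub>m A\<^sup>T"
  by (intro eq_matI) auto

text \<open>The square of the modulus of \<open>1 + \<tau> \<nu>\<close> is
  \<open>1 + \<tau> (2 Re \<nu> + \<tau> |\<nu>|^2)\<close>, and the bracket is negative for small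
  \<open>\<tau>\<close>. A finite set admits a common \<open>\<tau>\<close> and then a uniform
  margin below one.\<close>

lemma finite_shrink_factor:
  fixes S :: "complex set"
  assumes "finite S" "\<And>\<nu>. \<nu> \<in> S \<Longrightarrow> Re \<nu> < 0"
  obtains \<tau> \<rho> :: real where "\<tau> > 0" "0 < \<rho>" "\<rho> < 1" "\<And>\<nu>. \<nu> \<in> S \<Longrightarrow> cmod (1 + of_real \<tau> * \<nu>) < \<rho>"
proof -
  have "\<forall>\<nu>\<in>S. \<forall>\<^sub>F \<tau> in at_right 0. cmod (1 + of_real \<tau> * \<nu>) < 1"
  proof
    fix \<nu> assume "\<nu> \<in> S"
    then have re: "Re \<nu> < 0" by (rule assms)
    \<comment> \<open>Below this threshold \<open>\<tau> |\<nu>|^2 < - 2 Re \<nu>\<close>; the added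
      1 makes the denominator positive at once.\<close>
    let ?b = "- 2 * Re \<nu> / ((cmod \<nu>)^2 + 1)"
    have d: "(cmod \<nu>)^2 + 1 > 0" by (simp add: add_nonneg_pos)
    have "?b > 0" using re d by (intro divide_pos_pos) auto
    then have "\<forall>\<^sub>F \<tau> in at_right 0. \<tau> \<in> {0<..<?b}" by (rule eventually_at_right_real)
    then show "\<forall>\<^sub>F \<tau> in at_right 0. cmod (1 + of_real \<tau> * \<nu>) < 1"
    proof eventually_elim
      case (elim \<tau>)
      then have \<tau>: "\<tau> > 0" and "\<tau> * ((cmod \<nu>)^2 + 1) < - 2 * Re \<nu>" using d by (simp_all only: greaterThanLessThan_iff pos_less_divide_eq)
      then have "\<tau> * (2 * Re \<nu> + \<tau> * (cmod \<nu>)^2) < 0" by (intro mult_pos_neg) (auto simp: algebra_simps)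
      moreover have "(cmod (1 + of_real \<tau> * \<nu>))^2 = 1 + \<tau> * (2 * Re \<nu> + \<tau> * (cmod \<nu>)^2)"
        unfolding cmod_power2 by (simp add: power2_eq_square algebra_simps)
      ultimately have "(cmod (1 + of_real \<tau> * \<nu>))^2 < 1^2" by simp
      then show ?case by (rule power2_less_imp_less) simp
    qed
  qed
  then have "\<forall>\<^sub>F \<tau> in at_right 0. \<forall>\<nu>\<in>S. cmod (1 + of_real \<tau> * \<nu>) < 1"
    by (rule eventually_ball_finite[OF assms(1)])
  moreover have "\<forall>\<^sub>F \<tau> in at_right (0::real). \<tau> \<in> {0<..<1}" by (rule eventually_at_right_real) simp
  ultimately have "\<forall>\<^sub>F \<tau> in at_right 0. (\<forall>\<nu>\<in>S. cmod (1 + of_real \<tau> * \<nu>) < 1) \<and> \<tau> \<in> {0<..<1}"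
    by (rule eventually_conj)
  from eventually_happens'[OF trivial_limit_at_right_real this]
  obtain \<tau> :: real where \<tau>: "\<tau> > 0" and lt: "\<And>\<nu>. \<nu> \<in> S \<Longrightarrow> cmod (1 + of_real \<tau> * \<nu>) < 1"
    by auto
  \<comment> \<open>Inserting 0 keeps the maximum defined and nonnegative, so the midpoint between
    it and 1 is a valid \<open>\<rho>\<close> even for an empty set.\<close>
  let ?T = "insert 0 ((\<lambda>\<nu>. cmod (1 + of_real \<tau> * \<nu>)) ` S)"
  have fin: "finite ?T" "?T \<noteq> {}" using assms(1) by auto
  have m: "Max ?T < 1" using lt fin by (subst Max_less_iff) auto
  have m0: "0 \<le> Max ?T" using fin by (intro Max_ge) auto
  show thesis
  proof (rule that[OF \<tau>])
    show "0 < (1 + Max ?T) / 2" "(1 + Max ?T) / 2 < 1" using m m0 by auto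
    fix \<nu> assume "\<nu> \<in> S"
    then have "cmod (1 + of_real \<tau> * \<nu>) \<le> Max ?T" using fin by (intro Max_ge) auto
    then show "cmod (1 + of_real \<tau> * \<nu>) < (1 + Max ?T) / 2" using m by simp
  qed
qed

text \<open>With \<open>M = 1 + \<tau> (A + \<delta>)\<close> of spectral radius below one, \<open>\<tau> * (\<Sum>k. (M\<^sup>T)^k M^k)\<close> solves the
  Lyapunov inequality, since \<open>M\<^sup>T P M = P - \<tau>\<close> for it.\<close>
lemma lyapunov_exists:
  fixes A :: "real mat"
  assumes A: "A \<in> carrier_mat n n" and n: "n > 0" and eigs: "eigs_below A (- \<delta>)"
  obtains P where "P \<in> carrier_mat n n" "P\<^sup>T = P"
    "\<And>x. x \<in> carrier_vec n \<Longrightarrow> x \<noteq> 0\<^sub>v n \<Longrightarrow> scalar_prod x (P *\<^sub>v x) > 0"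
    "\<And>x. x \<in> carrier_vec n \<Longrightarrow> 2 * scalar_prod (A *\<^sub>v x) (P *\<^sub>v x) + 2 * \<delta> * scalar_prod x (P *\<^sub>v x) \<le> - scalar_prod x x"
proof -
  let ?cA = "map_mat complex_of_real A"
  have cA: "?cA \<in> carrier_mat n n" using A by simp
  have "finite ((\<lambda>\<mu>. \<mu> + of_real \<delta>) ` spectrum ?cA)" using card_finite_spectrum[OF cA] by simp
  moreover have "Re \<nu> < 0" if "\<nu> \<in> (\<lambda>\<mu>. \<mu> + of_real \<delta>) ` spectrum ?cA" for \<nu>
    using eigs that unfolding eigs_below_def spectrum_def by force
  ultimately obtain \<tau> \<rho> :: real where \<tau>: "\<tau> > 0" and \<rho>: "0 < \<rho>" "\<rho> < 1"
    and small: "\<And>\<mu>. \<mu> \<in> spectrum ?cA \<Longrightarrow> cmod (1 + of_real \<tau> * (\<mu> + of_real \<delta>)) < \<rho>"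
    using finite_shrink_factor[of "(\<lambda>\<mu>. \<mu> + of_real \<delta>) ` spectrum ?cA"] by (metis imageI)
  \<comment> \<open>\<open>C\<close> is \<open>M / \<rho>\<close> for
    \<open>M = 1 + \<tau> (A + \<delta>)\<close>. Its spectral radius is still below one, so its
    powers stay bounded, and the factor \<open>\<rho>\<close> that was split off supplies the
    geometric weights that make the series for \<open>Q\<close> converge.\<close>
  define C where "C = (1 / \<rho>) \<cdot>\<^sub>m (1\<^sub>m n + \<tau> \<cdot>\<^sub>m (A + \<delta> \<cdot>\<^sub>m 1\<^sub>m n))"
  have C: "C \<in> carrier_mat n n" using A by (simp add: C_def)
  let ?cC = "map_mat complex_of_real C"
  have cC: "?cC \<in> carrier_mat n n" using C by simp
  have cv: "?cC *\<^sub>v v = (1 / of_real \<rho>) \<cdot>\<^sub>v (v + of_real \<tau> \<cdot>\<^sub>v (?cA *\<^sub>v v + of_real \<delta> \<cdot>\<^sub>v v))" if v: "v \<in> carrier_vec n" for v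
  proof -
    have "?cC = (1 / of_real \<rho>) \<cdot>\<^sub>m (1\<^sub>m n + of_real \<tau> \<cdot>\<^sub>m (?cA + of_real \<delta> \<cdot>\<^sub>m 1\<^sub>m n))"
      using A unfolding C_def by (intro eq_matI) auto
    moreover have "((1 / of_real \<rho>) \<cdot>\<^sub>m B) *\<^sub>v v = (1 / of_real \<rho>) \<cdot>\<^sub>v (B *\<^sub>v v)" if "B \<in> carrier_mat n n" for B :: "complex mat"
      using that v by (intro eq_vecI) auto
    moreover have "(of_real \<tau> \<cdot>\<^sub>m B) *\<^sub>v v = of_real \<tau> \<cdot>\<^sub>v (B *\<^sub>v v)" if "B \<in> carrier_mat n n" for B :: "complex mat"
      using that v by (intro eq_vecI) auto
    moreover have "(of_real \<delta> \<cdot>\<^sub>m 1\<^sub>m n) *\<^sub>v v = of_real \<delta> \<cdot>\<^sub>v v"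
      using v by (intro eq_vecI) auto
    ultimately show ?thesis using cA v by (simp add: add_mult_distrib_mat_vec[of _ n n])
  qed
  have sr: "spectral_radius ?cC < 1"
  proof -
    obtain \<mu> where "\<mu> \<in> spectrum ?cC" and \<mu>: "spectral_radius ?cC = norm \<mu>"
      using spectral_radius_mem_max(1)[OF cC n] by auto
    then obtain v where "eigenvector ?cC v \<mu>" by (auto simp: spectrum_def eigenvalue_def)
    then have v: "v \<in> carrier_vec n" "v \<noteq> 0\<^sub>v n" and ev: "?cC *\<^sub>v v = \<mu> \<cdot>\<^sub>v v"
      using C by (auto simp: eigenvector_def)
    \<comment> \<open>The eigenvalue of \<open>A\<close> that the affine map behind \<open>C\<close>
      sends to \<open>\<mu>\<close>.\<close>
    let ?k = "(of_real \<rho> * \<mu> - 1) / of_real \<tau> - of_real \<delta>"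
    have "?cA *\<^sub>v v = ?k \<cdot>\<^sub>v v"
    proof (rule eq_vecI)
      fix i assume "i < dim_vec (?k \<cdot>\<^sub>v v)"
      then have i: "i < n" using v by simp
      have "(?cC *\<^sub>v v) $ i = (1 / of_real \<rho>) * (v $ i + of_real \<tau> * ((?cA *\<^sub>v v) $ i + of_real \<delta> * v $ i))"
        unfolding cv[OF v(1)] using i v A by (simp del: index_mult_mat_vec)
      then have "\<mu> * v $ i = (1 / of_real \<rho>) * (v $ i + of_real \<tau> * ((?cA *\<^sub>v v) $ i + of_real \<delta> * v $ i))"
        unfolding ev using i v by simp
      then show "(?cA *\<^sub>v v) $ i = (?k \<cdot>\<^sub>v v) $ i"
        using \<tau> \<rho> i v by (simp add: field_simps del: index_mult_mat_vec)
    qed (use A v in auto)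
    then have "?k \<in> spectrum ?cA"
      using v A unfolding spectrum_def eigenvalue_def eigenvector_def by auto
    from small[OF this] have "cmod (of_real \<rho> * \<mu>) < \<rho>" using \<tau> by simp
    then show ?thesis unfolding \<mu> using \<rho> by (simp add: norm_mult)
  qed
  obtain c where "\<forall>k. norm_bound (?cC ^\<^sub>m k) c"
    using spectral_radius_jnf_norm_bound_less_1_upper_triangular[OF cC sr] by blast
  moreover have "?cC ^\<^sub>m k = map_mat complex_of_real (C ^\<^sub>m k)" for k
    by (rule of_real_hom.mat_hom_pow[OF C, symmetric])
  ultimately have cb: "\<bar>(C ^\<^sub>m k) $$ (i,j)\<bar> \<le> c" if "i < n" "j < n" for k i j
    using that C pow_carrier_mat[OF C, of k] by (auto simp: norm_bound_def)
  have Ck: "C ^\<^sub>m k \<in> carrier_mat n n" for k by (rule pow_carrier_mat[OF C])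
  define G where "G k = (C ^\<^sub>m k)\<^sup>T * (C ^\<^sub>m k)" for k
  have Gk: "G k \<in> carrier_mat n n" for k unfolding G_def using Ck by (intro mult_carrier_mat) auto
  have G_entry: "G k $$ (i,j) = (\<Sum>l<n. (C ^\<^sub>m k) $$ (l,i) * (C ^\<^sub>m k) $$ (l,j))" if "i < n" "j < n" for k i j
    unfolding G_def using that carrier_matD[OF Ck[of k]] by (simp add: scalar_prod_def atLeast0LessThan)
  have c0: "c \<ge> 0" using cb[of 0 0 0] n by (meson abs_ge_zero order_trans)
  have sm: "summable (\<lambda>k. (\<rho>^2)^k * G k $$ (i,j))" if ij: "i < n" "j < n" for i j
  proof (rule summable_comparison_test')
    show "summable (\<lambda>k. (\<rho>^2)^k * (real n * (c * c)))"
      using \<rho> by (intro summable_mult2 summable_geometric) (auto simp: power_less_one_iff abs_square_less_1)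
    fix k
    have "\<bar>G k $$ (i,j)\<bar> \<le> (\<Sum>l<n. c * c)" unfolding G_entry[OF ij]
    proof (rule order_trans[OF sum_abs sum_mono])
      fix l assume "l \<in> {..<n}"
      then show "\<bar>(C ^\<^sub>m k) $$ (l,i) * (C ^\<^sub>m k) $$ (l,j)\<bar> \<le> c * c"
        unfolding abs_mult using cb ij c0 by (intro mult_mono) auto
    qed
    then show "norm ((\<rho>^2)^k * G k $$ (i,j)) \<le> (\<rho>^2)^k * (real n * (c * c))"
      by (simp add: abs_mult mult_left_mono)
  qed
  define Q where "Q = mat n n (\<lambda>(i,j). \<Sum>k. (\<rho>^2)^k * G k $$ (i,j))"
  have Q: "Q \<in> carrier_mat n n" by (simp add: Q_def)
  have Qs: "(\<lambda>k. (\<rho>^2)^k * scalar_prod ((C ^\<^sub>m k) *\<^sub>v y) ((C ^\<^sub>m k) *\<^sub>v x)) sums scalar_prod y (Q *\<^sub>v x)"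
    if x: "x \<in> carrier_vec n" and y: "y \<in> carrier_vec n" for x y
  proof -
    have "(\<lambda>k. \<Sum>i<n. \<Sum>j<n. y $ i * ((\<rho>^2)^k * G k $$ (i,j)) * x $ j) sums (\<Sum>i<n. \<Sum>j<n. y $ i * Q $$ (i,j) * x $ j)"
      by (intro sums_sum sums_mult sums_mult2) (auto simp: Q_def intro: summable_sums sm)
    also have "(\<Sum>i<n. \<Sum>j<n. y $ i * Q $$ (i,j) * x $ j) = scalar_prod y (Q *\<^sub>v x)"
      by (rule bilinear_sum[OF Q x y, symmetric])
    also have "(\<lambda>k. \<Sum>i<n. \<Sum>j<n. y $ i * ((\<rho>^2)^k * G k $$ (i,j)) * x $ j) = (\<lambda>k. (\<rho>^2)^k * scalar_prod y (G k *\<^sub>v x))"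
      unfolding bilinear_sum[OF Gk x y] by (simp add: sum_distrib_left mult_ac)
    also have "(\<lambda>k. (\<rho>^2)^k * scalar_prod y (G k *\<^sub>v x)) = (\<lambda>k. (\<rho>^2)^k * scalar_prod ((C ^\<^sub>m k) *\<^sub>v y) ((C ^\<^sub>m k) *\<^sub>v x))"
    proof
      fix k
      have "G k *\<^sub>v x = (C ^\<^sub>m k)\<^sup>T *\<^sub>v ((C ^\<^sub>m k) *\<^sub>v x)"
        unfolding G_def by (rule assoc_mult_mat_vec[OF transpose_carrier_mat[THEN iffD2, OF Ck] Ck x])
      then show "(\<rho>^2)^k * scalar_prod y (G k *\<^sub>v x) = (\<rho>^2)^k * scalar_prod ((C ^\<^sub>m k) *\<^sub>v y) ((C ^\<^sub>m k) *\<^sub>v x)"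
        using transpose_scalar[OF Ck y mult_mat_vec_carrier[OF Ck x]] by simp
    qed
    finally show ?thesis .
  qed
  have QT: "Q\<^sup>T = Q"
  proof (rule eq_matI)
    fix i j assume "i < dim_row Q" "j < dim_col Q"
    then have ij: "i < n" "j < n" using Q by auto
    have "G k $$ (j,i) = G k $$ (i,j)" for k unfolding G_entry[OF ij] G_entry[OF ij(2,1)] by (simp add: mult.commute)
    then show "Q\<^sup>T $$ (i,j) = Q $$ (i,j)" using ij by (simp add: Q_def)
  qed (simp_all add: Q_def)
  have Qsym: "scalar_prod y (Q *\<^sub>v x) = scalar_prod x (Q *\<^sub>v y)" if "x \<in> carrier_vec n" "y \<in> carrier_vec n" for x y
    using transpose_scalar[OF Q that(2) that(1)] comm_scalar_prod[OF mult_mat_vec_carrier[OF Q that(2)] that(1)] unfolding QT by simp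
  have nn: "scalar_prod v v \<ge> 0" for v :: "real vec"
    by (simp add: scalar_prod_def sum_nonneg)
  have C1: "(C ^\<^sub>m 0) *\<^sub>v x = x" if "x \<in> carrier_vec n" for x using C that by simp
  have Qlo: "scalar_prod x x \<le> scalar_prod x (Q *\<^sub>v x)" if x: "x \<in> carrier_vec n" for x
  proof -
    have "(\<Sum>k<1. (\<rho>^2)^k * scalar_prod ((C ^\<^sub>m k) *\<^sub>v x) ((C ^\<^sub>m k) *\<^sub>v x)) \<le> scalar_prod x (Q *\<^sub>v x)"
      using Qs[OF x x] nn by (subst sums_unique[OF Qs[OF x x]]) (intro sum_le_suminf, auto simp: sums_iff)
    then show ?thesis by (simp add: C1[OF x] del: pow_mat.simps)
  qed
  \<comment> \<open>Removing the term \<open>k = 0\<close> from the series shifts every power by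
    one: this is the discrete Lyapunov equation for \<open>M = \<rho> C\<close>.\<close>
  have shift: "\<rho>^2 * scalar_prod (C *\<^sub>v x) (Q *\<^sub>v (C *\<^sub>v x)) = scalar_prod x (Q *\<^sub>v x) - scalar_prod x x" if x: "x \<in> carrier_vec n" for x
  proof -
    have Cx: "C *\<^sub>v x \<in> carrier_vec n" by (rule mult_mat_vec_carrier[OF C x])
    have p: "(C ^\<^sub>m Suc k) *\<^sub>v x = (C ^\<^sub>m k) *\<^sub>v (C *\<^sub>v x)" for k
      using assoc_mult_mat_vec[OF Ck C x] by simp
    have "(\<lambda>k. (\<rho>^2)^(Suc k) * scalar_prod ((C ^\<^sub>m Suc k) *\<^sub>v x) ((C ^\<^sub>m Suc k) *\<^sub>v x)) sums
       (scalar_prod x (Q *\<^sub>v x) - scalar_prod x x)"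
      using Qs[OF x x] by (subst sums_Suc_iff) (simp add: C1[OF x] del: pow_mat.simps)
    moreover have "(\<lambda>k. \<rho>^2 * ((\<rho>^2)^k * scalar_prod ((C ^\<^sub>m k) *\<^sub>v (C *\<^sub>v x)) ((C ^\<^sub>m k) *\<^sub>v (C *\<^sub>v x)))) sums
       (\<rho>^2 * scalar_prod (C *\<^sub>v x) (Q *\<^sub>v (C *\<^sub>v x)))"
      by (rule sums_mult[OF Qs[OF Cx Cx]])
    ultimately show ?thesis unfolding p by (simp add: mult.assoc sums_unique2)
  qed
  show thesis
  proof (rule that[of "\<tau> \<cdot>\<^sub>m Q"])
    show "\<tau> \<cdot>\<^sub>m Q \<in> carrier_mat n n" using Q by simp
    show "(\<tau> \<cdot>\<^sub>m Q)\<^sup>T = \<tau> \<cdot>\<^sub>m Q" using arg_cong[OF QT, of "\<lambda>B. \<tau> \<cdot>\<^sub>m B"] by (metis transpose_smult_mat)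
    have PQ: "scalar_prod y ((\<tau> \<cdot>\<^sub>m Q) *\<^sub>v x) = \<tau> * scalar_prod y (Q *\<^sub>v x)" if "x \<in> carrier_vec n" "y \<in> carrier_vec n" for x y
      using smult_mat_mult_vec[OF Q that(1)] scalar_prod_smult_distrib[OF that(2) mult_mat_vec_carrier[OF Q that(1)]] by simp
    fix x :: "real vec" assume x: "x \<in> carrier_vec n"
    show "x \<noteq> 0\<^sub>v n \<Longrightarrow> scalar_prod x ((\<tau> \<cdot>\<^sub>m Q) *\<^sub>v x) > 0"
    proof -
      assume "x \<noteq> 0\<^sub>v n"
      then obtain i where i: "i < n" "x $ i \<noteq> 0" using x by (metis carrier_vecD eq_vecI index_zero_vec)
      then have "scalar_prod x x > 0"
        using x unfolding scalar_prod_def by (intro sum_pos2[of _ i]) (auto simp: zero_less_mult_iff linorder_neq_iff)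
      then show ?thesis using Qlo[OF x] \<tau> by (simp add: PQ[OF x x])
    qed
    \<comment> \<open>\<open>b\<close> is \<open>(A + \<delta>) x\<close>, so
      \<open>\<rho> C x = x + \<tau> b\<close>. Expanding the form at this vector gives the Lyapunov
      expression for \<open>A\<close> plus a nonnegative quadratic term that is dropped.\<close>
    define b where "b = A *\<^sub>v x + \<delta> \<cdot>\<^sub>v x"
    have Ax: "A *\<^sub>v x \<in> carrier_vec n" by (rule mult_mat_vec_carrier[OF A x])
    have b: "b \<in> carrier_vec n" using Ax x by (simp add: b_def)
    have tb: "\<tau> \<cdot>\<^sub>v b \<in> carrier_vec n" using b by simp
    have Cx: "C *\<^sub>v x = (1 / \<rho>) \<cdot>\<^sub>v (x + \<tau> \<cdot>\<^sub>v b)"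
    proof -
      have e: "(\<delta> \<cdot>\<^sub>m 1\<^sub>m n) *\<^sub>v x = \<delta> \<cdot>\<^sub>v x" using x by (intro eq_vecI) auto
      have "C *\<^sub>v x = (1 / \<rho>) \<cdot>\<^sub>v ((1\<^sub>m n + \<tau> \<cdot>\<^sub>m (A + \<delta> \<cdot>\<^sub>m 1\<^sub>m n)) *\<^sub>v x)"
        unfolding C_def using A by (intro smult_mat_mult_vec[OF _ x]) auto
      also have "(1\<^sub>m n + \<tau> \<cdot>\<^sub>m (A + \<delta> \<cdot>\<^sub>m 1\<^sub>m n)) *\<^sub>v x = 1\<^sub>m n *\<^sub>v x + (\<tau> \<cdot>\<^sub>m (A + \<delta> \<cdot>\<^sub>m 1\<^sub>m n)) *\<^sub>v x"
        using A by (intro add_mult_distrib_mat_vec[OF _ _ x]) auto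
      also have "(\<tau> \<cdot>\<^sub>m (A + \<delta> \<cdot>\<^sub>m 1\<^sub>m n)) *\<^sub>v x = \<tau> \<cdot>\<^sub>v ((A + \<delta> \<cdot>\<^sub>m 1\<^sub>m n) *\<^sub>v x)"
        using A by (intro smult_mat_mult_vec[OF _ x]) auto
      also have "(A + \<delta> \<cdot>\<^sub>m 1\<^sub>m n) *\<^sub>v x = b"
        unfolding b_def using A e by (subst add_mult_distrib_mat_vec[OF A _ x]) auto
      finally show ?thesis using x by simp
    qed
    have xtb: "x + \<tau> \<cdot>\<^sub>v b \<in> carrier_vec n" using x tb by simp
    have Qxb: "Q *\<^sub>v x \<in> carrier_vec n" "Q *\<^sub>v b \<in> carrier_vec n" using Q x b by auto
    have QQ: "Q *\<^sub>v (x + \<tau> \<cdot>\<^sub>v b) = Q *\<^sub>v x + \<tau> \<cdot>\<^sub>v (Q *\<^sub>v b)"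
      using mult_add_distrib_mat_vec[OF Q x tb] mult_mat_vec[OF Q b] by simp
    have "\<rho>^2 * scalar_prod (C *\<^sub>v x) (Q *\<^sub>v (C *\<^sub>v x)) = scalar_prod (x + \<tau> \<cdot>\<^sub>v b) (Q *\<^sub>v (x + \<tau> \<cdot>\<^sub>v b))"
      unfolding Cx mult_mat_vec[OF Q xtb] using \<rho> xtb Q by (simp add: power2_eq_square)
    also have "\<dots> = scalar_prod x (Q *\<^sub>v x) + 2 * \<tau> * scalar_prod b (Q *\<^sub>v x) + \<tau>^2 * scalar_prod b (Q *\<^sub>v b)"
      unfolding QQ using x b tb Qxb Qsym[OF x b]
      by (simp add: add_scalar_prod_distrib[of _ n] scalar_prod_add_distrib[of _ n] power2_eq_square algebra_simps)
    finally have "2 * \<tau> * scalar_prod b (Q *\<^sub>v x) = - scalar_prod x x - \<tau>^2 * scalar_prod b (Q *\<^sub>v b)"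
      using shift[OF x] by simp
    also have "\<dots> \<le> - scalar_prod x x" using Qlo[OF b] nn[of b] by simp
    finally have "2 * \<tau> * scalar_prod b (Q *\<^sub>v x) \<le> - scalar_prod x x" .
    moreover have "scalar_prod b (Q *\<^sub>v x) = scalar_prod (A *\<^sub>v x) (Q *\<^sub>v x) + \<delta> * scalar_prod x (Q *\<^sub>v x)"
      unfolding b_def using Ax x Qxb by (subst add_scalar_prod_distrib[of _ n]) auto
    ultimately show "2 * scalar_prod (A *\<^sub>v x) ((\<tau> \<cdot>\<^sub>m Q) *\<^sub>v x) + 2 * \<delta> * scalar_prod x ((\<tau> \<cdot>\<^sub>m Q) *\<^sub>v x) \<le> - scalar_prod x x"
      unfolding PQ[OF x Ax] PQ[OF x x] by (simp add: algebra_simps)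
  qed
qed

section \<open>Elementary bounds and the block diagonal matrix\<close>

lemma young: fixes a b e :: real assumes "e > 0" shows "2 * a * b \<le> e * a^2 + b^2 / e"
proof -
  have "0 \<le> (e * a - b)^2 / e" using assms by simp
  also have "\<dots> = e * a^2 + b^2 / e - 2 * a * b" using assms by (simp add: power2_eq_square field_simps)
  finally show ?thesis by simp
qed

lemma CS_sum: "(\<Sum>i<n. a i * b i :: real)^2 \<le> (\<Sum>i<n. (a i)^2) * (\<Sum>i<n. (b i)^2)"
  by (rule Cauchy_Schwarz_ineq_sum)

lemma square_add_le: "(a + b :: real)^2 \<le> 2 * a^2 + 2 * b^2"
  using sum_squares_bound[of a b] by (simp add: power2_sum)

lemma sq_vec: "scalar_prod (vec n x) (vec n x) = (\<Sum>i<n. (x i)^2 :: real)"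
  by (simp only: scalar_prod_vec power2_eq_square)

text \<open>Symmetry moves \<open>P\<close> onto the fixed vector \<open>l\<close>, so the constant
  depends on \<open>l\<close> and not on the state \<open>x\<close>.\<close>

lemma scalar_prod_P_bound:
  fixes P :: "real mat"
  assumes P: "P \<in> carrier_mat n n" and PT: "P\<^sup>T = P"
  shows "(scalar_prod (vec n l) (P *\<^sub>v vec n x))^2 \<le> scalar_prod (P *\<^sub>v vec n l) (P *\<^sub>v vec n l) * (\<Sum>i<n. (x i)^2)"
proof -
  have c: "P *\<^sub>v vec n l \<in> carrier_vec n" by (rule mult_mat_vec_carrier[OF P vec_carrier])
  have d: "dim_vec (P *\<^sub>v vec n l) = n" using P by simp
  have "scalar_prod (vec n l) (P *\<^sub>v vec n x) = scalar_prod (P *\<^sub>v vec n l) (vec n x)"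
    using transpose_scalar[OF P, of "vec n l" "vec n x"] unfolding PT by simp
  also have "\<dots> = (\<Sum>i<n. (P *\<^sub>v vec n l) $ i * x i)" by (simp add: scalar_prod_def atLeast0LessThan del: index_mult_mat_vec)
  also have "\<dots>^2 \<le> (\<Sum>i<n. ((P *\<^sub>v vec n l) $ i)^2) * (\<Sum>i<n. (x i)^2)" by (rule CS_sum)
  also have "(\<Sum>i<n. ((P *\<^sub>v vec n l) $ i)^2) = scalar_prod (P *\<^sub>v vec n l) (P *\<^sub>v vec n l)"
    unfolding scalar_prod_def d atLeast0LessThan by (simp only: power2_eq_square)
  finally show ?thesis .
qed

definition blockP :: "nat \<Rightarrow> nat \<Rightarrow> real mat \<Rightarrow> real mat \<Rightarrow> real \<Rightarrow> real \<Rightarrow> real mat" where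
  "blockP n m P1 P2 k3 k4 = four_block_mat (four_block_mat P1 (0\<^sub>m n n) (0\<^sub>m n n) P2) (0\<^sub>m (n + n) (m + m)) (0\<^sub>m (m + m) (n + n))
     (four_block_mat (k3 \<cdot>\<^sub>m 1\<^sub>m m) (0\<^sub>m m m) (0\<^sub>m m m) (k4 \<cdot>\<^sub>m 1\<^sub>m m))"

lemma four_block_diag_form:
  fixes A D :: "real mat"
  assumes A: "A \<in> carrier_mat n n" and D: "D \<in> carrier_mat m m" and x: "x \<in> carrier_vec n" "x' \<in> carrier_vec n"
    and y: "y \<in> carrier_vec m" "y' \<in> carrier_vec m"
  shows "scalar_prod (x' @\<^sub>v y') (four_block_mat A (0\<^sub>m n m) (0\<^sub>m m n) D *\<^sub>v (x @\<^sub>v y))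
    = scalar_prod x' (A *\<^sub>v x) + scalar_prod y' (D *\<^sub>v y)"
proof -
  have "four_block_mat A (0\<^sub>m n m) (0\<^sub>m m n) D *\<^sub>v (x @\<^sub>v y) = (A *\<^sub>v x) @\<^sub>v (D *\<^sub>v y)"
    by (rule mult_mat_vec_split[OF A D x(1) y(1)])
  then show ?thesis
    using scalar_prod_append[OF x(2) y(2) mult_mat_vec_carrier[OF A x(1)] mult_mat_vec_carrier[OF D y(1)]] by simp
qed

lemma
  assumes P1: "P1 \<in> carrier_mat n n" and P2: "P2 \<in> carrier_mat n n"
  shows blockP_carrier: "blockP n m P1 P2 k3 k4 \<in> carrier_mat ((n + n) + (m + m)) ((n + n) + (m + m))"
    and blockP_transpose: "P1\<^sup>T = P1 \<Longrightarrow> P2\<^sup>T = P2 \<Longrightarrow> (blockP n m P1 P2 k3 k4)\<^sup>T = blockP n m P1 P2 k3 k4"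
    and blockP_form: "scalar_prod (stk n m y1 y2 y3 y4) (blockP n m P1 P2 k3 k4 *\<^sub>v stk n m x1 x2 x3 x4)
      = scalar_prod (vec n y1) (P1 *\<^sub>v vec n x1) + scalar_prod (vec n y2) (P2 *\<^sub>v vec n x2)
        + k3 * (\<Sum>i<m. y3 i * x3 i) + k4 * (\<Sum>i<m. y4 i * x4 i)"
proof -
  let ?A = "four_block_mat P1 (0\<^sub>m n n) (0\<^sub>m n n) P2" and ?D = "four_block_mat (k3 \<cdot>\<^sub>m 1\<^sub>m m) (0\<^sub>m m m) (0\<^sub>m m m) (k4 \<cdot>\<^sub>m 1\<^sub>m m)"
  have I: "k \<cdot>\<^sub>m 1\<^sub>m m \<in> carrier_mat m m" for k :: real by simp
  have A: "?A \<in> carrier_mat (n + n) (n + n)" by (rule four_block_carrier_mat[OF P1 P2])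
  have D: "?D \<in> carrier_mat (m + m) (m + m)" by (rule four_block_carrier_mat[OF I I])
  show "blockP n m P1 P2 k3 k4 \<in> carrier_mat ((n + n) + (m + m)) ((n + n) + (m + m))"
    unfolding blockP_def by (rule four_block_carrier_mat[OF A D])
  have IT: "(k \<cdot>\<^sub>m 1\<^sub>m m)\<^sup>T = k \<cdot>\<^sub>m 1\<^sub>m m" for k :: real by (simp add: transpose_smult_mat)
  have ZT: "(0\<^sub>m a b)\<^sup>T = 0\<^sub>m b a" for a b by (rule eq_matI) auto
  show "P1\<^sup>T = P1 \<Longrightarrow> P2\<^sup>T = P2 \<Longrightarrow> (blockP n m P1 P2 k3 k4)\<^sup>T = blockP n m P1 P2 k3 k4"
    unfolding blockP_def transpose_four_block_mat[OF A zero_carrier_mat zero_carrier_mat D]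
      transpose_four_block_mat[OF P1 zero_carrier_mat zero_carrier_mat P2] transpose_four_block_mat[OF I zero_carrier_mat zero_carrier_mat I] IT ZT
    by simp
  have If: "scalar_prod (vec m y) ((k \<cdot>\<^sub>m 1\<^sub>m m) *\<^sub>v vec m x) = k * (\<Sum>i<m. y i * x i)" for y x and k :: real
  proof -
    have "k \<cdot>\<^sub>m 1\<^sub>m m = mat m m (\<lambda>(i,j). if i = j then k else 0)" by (rule eq_matI) auto
    then show ?thesis by (simp only: diag_mult_vec scalar_prod_vec sum_distrib_left mult.left_commute)
  qed
  show "scalar_prod (stk n m y1 y2 y3 y4) (blockP n m P1 P2 k3 k4 *\<^sub>v stk n m x1 x2 x3 x4)
      = scalar_prod (vec n y1) (P1 *\<^sub>v vec n x1) + scalar_prod (vec n y2) (P2 *\<^sub>v vec n x2)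
        + k3 * (\<Sum>i<m. y3 i * x3 i) + k4 * (\<Sum>i<m. y4 i * x4 i)"
    unfolding blockP_def stk_def
    by (simp only: four_block_diag_form[OF A D append_carrier_vec append_carrier_vec append_carrier_vec append_carrier_vec] vec_carrier
      four_block_diag_form[OF P1 P2 vec_carrier vec_carrier vec_carrier vec_carrier]
      four_block_diag_form[OF I I vec_carrier vec_carrier vec_carrier vec_carrier] If add.assoc)
qed

lemma vec_as_stk:
  assumes "v \<in> carrier_vec ((n + n) + (m + m))"
  obtains x1 x2 x3 x4 where "v = stk n m x1 x2 x3 x4"
proof
  show "v = stk n m (\<lambda>i. v $ i) (\<lambda>i. v $ (n + i)) (\<lambda>i. v $ (n + n + i)) (\<lambda>i. v $ (n + n + m + i))"
    using assms by (intro eq_vecI) (auto simp: stk_def)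
qed

lemma vec_as_stk_append:
  assumes "v \<in> carrier_vec ((n + n) + (m + m) + 1)"
  obtains x1 x2 x3 x4 \<zeta> where "v = stk n m x1 x2 x3 x4 @\<^sub>v vec 1 (\<lambda>_. \<zeta>)"
proof -
  have v: "v = vec_first v ((n + n) + (m + m)) @\<^sub>v vec_last v 1" using vec_first_last_append[OF assms] by simp
  obtain x1 x2 x3 x4 where "vec_first v ((n + n) + (m + m)) = stk n m x1 x2 x3 x4"
    using vec_as_stk[OF vec_first_carrier] by metis
  moreover have "vec_last v 1 = vec 1 (\<lambda>_. vec_last v 1 $ 0)" by (rule eq_vecI) auto
  ultimately show thesis using that v by metis
qed

lemma stk_eq_0:
  "stk n m x1 x2 x3 x4 = 0\<^sub>v ((n + n) + (m + m)) \<longleftrightarrow> (\<forall>i<n. x1 i = 0 \<and> x2 i = 0) \<and> (\<forall>i<m. x3 i = 0 \<and> x4 i = 0)"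
proof -
  have z: "0\<^sub>v ((n + n) + (m + m)) = stk n m (\<lambda>_. 0) (\<lambda>_. 0) (\<lambda>_. 0) (\<lambda>_. 0)"
    by (rule eq_vecI) (auto simp: stk_def)
  have e: "vec k x = vec k (\<lambda>_. 0) \<longleftrightarrow> (\<forall>i<k. x i = 0)" for k and x :: "nat \<Rightarrow> real"
    by (metis index_vec vec_eq_cong)
  show ?thesis
    unfolding z stk_def append_vec_eq[OF append_carrier_vec[OF vec_carrier vec_carrier] append_carrier_vec[OF vec_carrier vec_carrier]]
      append_vec_eq[OF vec_carrier vec_carrier] e by blast
qed

lemma two_mult_le_add:
  fixes r u v :: real
  assumes "r^2 \<le> u * v" "0 \<le> u" "0 \<le> v" shows "2 * r \<le> u + v"
proof (rule power2_le_imp_le)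
  have "0 \<le> (u - v)^2" by simp
  then have "4 * (u * v) \<le> (u + v)^2" by (simp add: power2_eq_square algebra_simps)
  then show "(2 * r)^2 \<le> (u + v)^2" using assms(1) by (simp add: power_mult_distrib)
qed (use assms in simp)

section \<open>A block diagonal solution with constants independent of \<open>N\<close>\<close>

context controller begin

text \<open>\<open>\<Theta>\<^sub>1 \<preceq> 0\<close> follows from this once
  \<open>\<alpha> * \<gamma>\<close> times each of the two squared remainder norms is at most
  \<open>\<epsilon>\<close> and \<open>\<beta> * exp (- 2 * \<delta> * h)\<close> equals
  \<open>D\<close>.\<close>

definition dissipative :: "real \<Rightarrow> real mat \<Rightarrow> real \<Rightarrow> real \<Rightarrow> bool" where
  "dissipative \<delta> P \<epsilon> D \<longleftrightarrow> (\<forall>x1 x2 x3 x4 \<zeta>.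
     2 * scalar_prod (stk N0 MM (d1 x1 x2 x4 \<zeta>) (d2 x2 x4 \<zeta>) (d3 x1 x3) (d4 x4)) (P *\<^sub>v stk N0 MM x1 x2 x3 x4)
     + 2 * \<delta> * scalar_prod (stk N0 MM x1 x2 x3 x4) (P *\<^sub>v stk N0 MM x1 x2 x3 x4)
     + \<epsilon> * (gain x1)^2 + \<epsilon> * (gain (d1 x1 x2 x4 \<zeta>))^2 \<le> D * \<zeta>^2)"

text \<open>The blocks form a cascade: \<open>x4\<close> is autonomous, it drives \<open>x2\<close>
  together with \<open>\<zeta>\<close>, both drive \<open>x1\<close>, and \<open>x1\<close> drives
  \<open>x3\<close>. The weights are chosen against this order. \<open>k2\<close> is so large that
  the decay of \<open>x2\<close> pays for its output in the first block. \<open>D1\<close> collects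
  the resulting weight on the square of the remaining output, made up of the \<open>x4\<close> part
  and \<open>\<zeta>\<close>, and \<open>k4\<close> pays for the former. \<open>k3\<close> is so
  small that the control entering the third block costs at most a quarter of the decay of
  \<open>x1\<close>. \<open>\<epsilon>\<close> keeps the two control terms below a quarter of
  \<open>s1 + s2 + s4 + \<zeta>^2\<close>. The modes beyond \<open>N0\<close> enter through the
  bounds \<open>Cp\<close> and \<open>Cb\<close> and the gap \<open>\<eta>\<close>, so none of the
  constants depends on \<open>N\<close>.\<close>

lemma dissipative_blockP:
  fixes P1 P2 :: "real mat" and \<eta> Cp Cb \<delta> :: real
  assumes P1: "P1 \<in> carrier_mat N0 N0" "P1\<^sup>T = P1" and P2: "P2 \<in> carrier_mat N0 N0" "P2\<^sup>T = P2"
    and ly1: "\<And>x. x \<in> carrier_vec N0 \<Longrightarrow> 2 * scalar_prod ((A0m lam qc N0 + B0m beta N0 * K) *\<^sub>v x) (P1 *\<^sub>v x)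
      + 2 * \<delta> * scalar_prod x (P1 *\<^sub>v x) \<le> - scalar_prod x x"
    and ly2: "\<And>x. x \<in> carrier_vec N0 \<Longrightarrow> 2 * scalar_prod ((A0m lam qc N0 - L * C0m phi N0) *\<^sub>v x) (P2 *\<^sub>v x)
      + 2 * \<delta> * scalar_prod x (P2 *\<^sub>v x) \<le> - scalar_prod x x"
    and \<eta>: "\<eta> > 0" "\<And>n. n \<ge> N0 + 1 \<Longrightarrow> - lam n + qc + \<delta> \<le> - \<eta>" and lam: "\<And>n. n \<ge> 1 \<Longrightarrow> lam n > 0"
    and Cp: "(\<Sum>j<N-N0. (phi (N0+j+1) 0)^2 / lam (N0+j+1)) \<le> Cp" "Cp \<ge> 0"
    and Cb: "(\<Sum>j<N-N0. (beta (N0+j+1) / lam (N0+j+1))^2) \<le> Cb" "Cb \<ge> 0"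
  defines "ell \<equiv> vec N0 (\<lambda>i. exp (kap (i+1) * h) * L $$ (i,0))" and "Lv \<equiv> vec N0 (\<lambda>i. L $$ (i,0))"
  defines "c0 \<equiv> \<Sum>j<N0. (phi (j+1) 0)^2" and "kk \<equiv> \<Sum>j<N0. (K $$ (0,j))^2"
  defines "C1 \<equiv> 4 * scalar_prod (P1 *\<^sub>v ell) (P1 *\<^sub>v ell)" and "C2 \<equiv> 2 * scalar_prod (P2 *\<^sub>v Lv) (P2 *\<^sub>v Lv)"
  defines "ka \<equiv> 2 * (\<Sum>j<N0. (K $$ (0,j) * kap (j+1))^2) + 2 * (\<Sum>j<N0. K $$ (0,j) * beta (j+1))^2 * kk"
    and "kl \<equiv> (\<Sum>j<N0. K $$ (0,j) * (exp (kap (j+1) * h) * L $$ (j,0)))^2"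
  defines "k2 \<equiv> 4 * C1 * c0 + 2" and "k3 \<equiv> \<eta> / (4 * (Cb * kk + 1))"
  defines "D1 \<equiv> 2 * C1 + k2 * C2"
  defines "k4 \<equiv> (2 * D1 * Cp + 1) / (2 * \<eta>)"
    and "\<epsilon> \<equiv> 1 / (4 * (kk + (2 * ka + 2 * kl * (2 * c0 + 4 * Cp + 4)) + 1))"
  shows "dissipative \<delta> (blockP N0 MM P1 (k2 \<cdot>\<^sub>m P2) k3 k4) \<epsilon> (2 * D1 + 1)"
    and "k2 > 0" "k3 > 0" "k4 > 0" "\<epsilon> > 0" "2 * D1 + 1 > 0"
proof -
  have nn: "0 \<le> scalar_prod v v" for v :: "real vec" by (simp add: scalar_prod_def sum_nonneg)
  have c0: "c0 \<ge> 0" and kk: "kk \<ge> 0" and kl: "kl \<ge> 0" by (simp_all add: c0_def kk_def kl_def sum_nonneg)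
  have ka: "ka \<ge> 0" using kk by (simp add: ka_def sum_nonneg)
  have C1: "C1 \<ge> 0" and C2: "C2 \<ge> 0" using nn by (simp_all add: C1_def C2_def)
  show k2: "k2 > 0" using C1 c0 by (simp add: k2_def add_nonneg_pos)
  have ckp: "Cb * kk + 1 > 0" using Cb kk by (simp add: add_nonneg_pos)
  show k3: "k3 > 0" using \<eta> ckp by (simp add: k3_def)
  have D1: "D1 \<ge> 0" using C1 C2 k2 by (simp add: D1_def)
  then show "2 * D1 + 1 > 0" by simp
  show k4: "k4 > 0" using D1 Cp \<eta> by (simp add: k4_def add_nonneg_pos)
  \<comment> \<open>The squared control and the squared gain of \<open>d1\<close> together are at
    most \<open>CE\<close> times \<open>s1 + s2 + s4 + \<zeta>^2\<close>, and
    \<open>\<epsilon>\<close> is a quarter of \<open>1 / (CE + 1)\<close>.\<close>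
  define CE where "CE = kk + (2 * ka + 2 * kl * (2 * c0 + 4 * Cp + 4))"
  have CEp: "2 * kl * (2 * c0 + 4 * Cp + 4) \<ge> 0" using kl c0 Cp by simp
  have CE: "CE \<ge> 0" using kk ka CEp by (simp add: CE_def)
  show \<epsilon>: "\<epsilon> > 0" using CE by (simp add: \<epsilon>_def CE_def)
  have \<epsilon>CE: "\<epsilon> * CE \<le> 1 / 4"
  proof -
    have "\<epsilon> = 1 / (4 * (CE + 1))" unfolding \<epsilon>_def CE_def ..
    then have "\<epsilon> * CE = CE / (CE + 1) / 4" by simp
    also have "CE / (CE + 1) \<le> 1" using CE by simp
    finally show ?thesis by simp
  qed
  show "dissipative \<delta> (blockP N0 MM P1 (k2 \<cdot>\<^sub>m P2) k3 k4) \<epsilon> (2 * D1 + 1)"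
    unfolding dissipative_def
  proof (intro allI)
    fix x1 x2 x3 x4 :: "nat \<Rightarrow> real" and \<zeta> :: real
    define s1 s2 s3 s4 where "s1 = (\<Sum>i<N0. (x1 i)^2)" and "s2 = (\<Sum>i<N0. (x2 i)^2)"
      and "s3 = (\<Sum>i<MM. (x3 i)^2)" and "s4 = (\<Sum>i<MM. (x4 i)^2)"
    have s: "s1 \<ge> 0" "s2 \<ge> 0" "s3 \<ge> 0" "s4 \<ge> 0" by (simp_all add: s1_def s2_def s3_def s4_def sum_nonneg)
    define y0 w where "y0 = (\<Sum>j<N0. phi (j+1) 0 * x2 j)"
      and "w = (\<Sum>j<N-N0. phi (N0+j+1) 0 / sqrt (lam (N0+j+1)) * x4 j)"
    \<comment> \<open>\<open>y0\<close> is already part of the error dynamics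
      \<open>A0 - L C0\<close>, whose Lyapunov inequality is assumed; only \<open>y'\<close>
      perturbs it.\<close>
    define y' where "y' = w + \<zeta>"
    define y where "y = innov x2 x4 \<zeta>"
    have y: "y = y0 + y'" by (simp add: y_def y'_def innov_def y0_def w_def)
    define g where "g = gain x1"
    have y0: "y0^2 \<le> c0 * s2" unfolding y0_def c0_def s2_def by (rule CS_sum)
    have w: "w^2 \<le> Cp * s4"
    proof -
      have "w^2 \<le> (\<Sum>j<N-N0. (phi (N0+j+1) 0 / sqrt (lam (N0+j+1)))^2) * s4" unfolding w_def s4_def by (rule CS_sum)
      also have "(\<Sum>j<N-N0. (phi (N0+j+1) 0 / sqrt (lam (N0+j+1)))^2) = (\<Sum>j<N-N0. (phi (N0+j+1) 0)^2 / lam (N0+j+1))"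
        using lam by (intro sum.cong refl) (simp add: power_divide less_imp_le)
      also have "\<dots> * s4 \<le> Cp * s4" using Cp s by (intro mult_right_mono) auto
      finally show ?thesis .
    qed
    have yp: "y'^2 \<le> 2 * Cp * s4 + 2 * \<zeta>^2" using square_add_le[of w \<zeta>] w by (simp add: y'_def)
    have yy: "y^2 \<le> 2 * c0 * s2 + 2 * y'^2" using square_add_le[of y0 y'] y0 by (simp add: y)
    have g2: "g^2 \<le> kk * s1" unfolding g_def gain_def kk_def s1_def by (rule CS_sum)
    have T1: "2 * scalar_prod (vec N0 (d1 x1 x2 x4 \<zeta>)) (P1 *\<^sub>v vec N0 x1) + 2 * \<delta> * scalar_prod (vec N0 x1) (P1 *\<^sub>v vec N0 x1)
        \<le> - s1 + s1 / 4 + C1 * y^2"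
    proof -
      have e: "vec N0 (d1 x1 x2 x4 \<zeta>) = (A0m lam qc N0 + B0m beta N0 * K) *\<^sub>v vec N0 x1 + y \<cdot>\<^sub>v ell"
        unfolding block_products ell_def vec_smult vec_add_vec by (rule vec_eq_cong) (simp add: d1_def y_def)
      have c: "(A0m lam qc N0 + B0m beta N0 * K) *\<^sub>v vec N0 x1 \<in> carrier_vec N0" "y \<cdot>\<^sub>v ell \<in> carrier_vec N0" "ell \<in> carrier_vec N0"
        "P1 *\<^sub>v vec N0 x1 \<in> carrier_vec N0"
        using P1 by (simp_all add: block_products ell_def)
      have "scalar_prod (vec N0 (d1 x1 x2 x4 \<zeta>)) (P1 *\<^sub>v vec N0 x1)
        = scalar_prod ((A0m lam qc N0 + B0m beta N0 * K) *\<^sub>v vec N0 x1) (P1 *\<^sub>v vec N0 x1) + y * scalar_prod ell (P1 *\<^sub>v vec N0 x1)"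
        unfolding e add_scalar_prod_distrib[OF c(1,2,4)] smult_scalar_prod_distrib[OF c(3,4)] ..
      moreover have "2 * (y * scalar_prod ell (P1 *\<^sub>v vec N0 x1)) \<le> C1 * y^2 + s1 / 4"
      proof (rule two_mult_le_add)
        have "(scalar_prod ell (P1 *\<^sub>v vec N0 x1))^2 \<le> C1 / 4 * s1"
          using scalar_prod_P_bound[OF P1, of "\<lambda>i. exp (kap (i+1) * h) * L $$ (i,0)" x1] by (simp add: C1_def ell_def s1_def)
        then have "y^2 * (scalar_prod ell (P1 *\<^sub>v vec N0 x1))^2 \<le> y^2 * (C1 / 4 * s1)" by (rule mult_left_mono) simp
        then show "(y * scalar_prod ell (P1 *\<^sub>v vec N0 x1))^2 \<le> C1 * y^2 * (s1 / 4)" by (simp add: power_mult_distrib mult_ac)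
      qed (use C1 s in auto)
      ultimately show ?thesis using ly1[of "vec N0 x1"] by (simp add: sq_vec s1_def)
    qed
    have T2: "2 * scalar_prod (vec N0 (d2 x2 x4 \<zeta>)) (P2 *\<^sub>v vec N0 x2) + 2 * \<delta> * scalar_prod (vec N0 x2) (P2 *\<^sub>v vec N0 x2)
        \<le> - s2 + s2 / 2 + C2 * y'^2"
    proof -
      have e: "vec N0 (d2 x2 x4 \<zeta>) = (A0m lam qc N0 - L * C0m phi N0) *\<^sub>v vec N0 x2 + (- y') \<cdot>\<^sub>v Lv"
        unfolding block_products Lv_def vec_smult vec_add_vec y0_def[symmetric]
        by (rule vec_eq_cong) (simp add: d2_def y_def[symmetric] y algebra_simps)
      have c: "(A0m lam qc N0 - L * C0m phi N0) *\<^sub>v vec N0 x2 \<in> carrier_vec N0" "(- y') \<cdot>\<^sub>v Lv \<in> carrier_vec N0" "Lv \<in> carrier_vec N0"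
        "P2 *\<^sub>v vec N0 x2 \<in> carrier_vec N0"
        using P2 by (simp_all add: block_products Lv_def)
      have "scalar_prod (vec N0 (d2 x2 x4 \<zeta>)) (P2 *\<^sub>v vec N0 x2)
        = scalar_prod ((A0m lam qc N0 - L * C0m phi N0) *\<^sub>v vec N0 x2) (P2 *\<^sub>v vec N0 x2) + - y' * scalar_prod Lv (P2 *\<^sub>v vec N0 x2)"
        unfolding e add_scalar_prod_distrib[OF c(1,2,4)] smult_scalar_prod_distrib[OF c(3,4)] ..
      moreover have "2 * (- y' * scalar_prod Lv (P2 *\<^sub>v vec N0 x2)) \<le> C2 * y'^2 + s2 / 2"
      proof (rule two_mult_le_add)
        have "(scalar_prod Lv (P2 *\<^sub>v vec N0 x2))^2 \<le> C2 / 2 * s2"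
          using scalar_prod_P_bound[OF P2, of "\<lambda>i. L $$ (i,0)" x2] by (simp add: C2_def Lv_def s2_def)
        then have "y'^2 * (scalar_prod Lv (P2 *\<^sub>v vec N0 x2))^2 \<le> y'^2 * (C2 / 2 * s2)" by (rule mult_left_mono) simp
        then show "(- y' * scalar_prod Lv (P2 *\<^sub>v vec N0 x2))^2 \<le> C2 * y'^2 * (s2 / 2)" by (simp add: power_mult_distrib mult_ac)
      qed (use C2 s in auto)
      ultimately show ?thesis using ly2[of "vec N0 x2"] by (simp add: sq_vec s2_def)
    qed
    have kb: "2 * (kap (N0+i+1) + \<delta>) \<le> 2 * (- \<eta>)" for i using \<eta>(2)[of "N0+i+1"] by (simp add: kap_def)
    \<comment> \<open>Half of the decay \<open>2 * \<eta> * s3\<close> absorbs the coupling with the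
      control, of which Young's inequality leaves \<open>Cb / \<eta> * g^2\<close>.\<close>
    have T3: "2 * (\<Sum>i<MM. d3 x1 x3 i * x3 i) + 2 * \<delta> * (\<Sum>i<MM. x3 i * x3 i) \<le> - \<eta> * s3 + Cb / \<eta> * g^2"
    proof -
      define r where "r = (\<Sum>i<MM. beta (N0+i+1) / lam (N0+i+1) * x3 i)"
      have "2 * (\<Sum>i<MM. d3 x1 x3 i * x3 i) + 2 * \<delta> * (\<Sum>i<MM. x3 i * x3 i)
        = (\<Sum>i<MM. 2 * (d3 x1 x3 i * x3 i) + 2 * \<delta> * (x3 i * x3 i))"
        by (simp only: sum_distrib_left sum.distrib)
      also have "\<dots> = (\<Sum>i<MM. 2 * (kap (N0+i+1) + \<delta>) * (x3 i)^2 + 2 * (g * (beta (N0+i+1) / lam (N0+i+1) * x3 i)))"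
        unfolding d3_def g_def[symmetric] power2_eq_square distrib_left distrib_right by (simp only: mult_ac add_ac)
      also have "\<dots> = (\<Sum>i<MM. 2 * (kap (N0+i+1) + \<delta>) * (x3 i)^2) + 2 * (g * r)"
        by (simp only: r_def sum_distrib_left sum.distrib)
      also have "(\<Sum>i<MM. 2 * (kap (N0+i+1) + \<delta>) * (x3 i)^2) \<le> (\<Sum>i<MM. 2 * (- \<eta>) * (x3 i)^2)"
        by (intro sum_mono mult_right_mono kb) simp
      also have "\<dots> = - 2 * \<eta> * s3" by (simp add: s3_def sum_distrib_left)
      also have "2 * (g * r) \<le> \<eta> * s3 + Cb / \<eta> * g^2"
      proof (rule two_mult_le_add)
        have "r^2 \<le> (\<Sum>i<MM. (beta (N0+i+1) / lam (N0+i+1))^2) * s3" unfolding r_def s3_def by (rule CS_sum)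
        also have "\<dots> \<le> Cb * s3" using Cb s by (intro mult_right_mono) auto
        finally have "g^2 * r^2 \<le> g^2 * (Cb * s3)" by (rule mult_left_mono) simp
        then show "(g * r)^2 \<le> \<eta> * s3 * (Cb / \<eta> * g^2)" using \<eta> by (simp add: power_mult_distrib mult_ac)
      qed (use \<eta> Cb s in auto)
      finally show ?thesis by simp
    qed
    have T4: "2 * (\<Sum>i<MM. d4 x4 i * x4 i) + 2 * \<delta> * (\<Sum>i<MM. x4 i * x4 i) \<le> - 2 * \<eta> * s4"
    proof -
      have "2 * (\<Sum>i<MM. d4 x4 i * x4 i) + 2 * \<delta> * (\<Sum>i<MM. x4 i * x4 i) = (\<Sum>i<MM. 2 * (d4 x4 i * x4 i) + 2 * \<delta> * (x4 i * x4 i))"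
        by (simp only: sum_distrib_left sum.distrib)
      also have "\<dots> = (\<Sum>i<MM. 2 * (kap (N0+i+1) + \<delta>) * (x4 i)^2)"
        unfolding d4_def power2_eq_square distrib_left distrib_right by (simp only: mult_ac add_ac)
      also have "\<dots> \<le> (\<Sum>i<MM. 2 * (- \<eta>) * (x4 i)^2)"
        by (intro sum_mono mult_right_mono kb) simp
      also have "\<dots> = - 2 * \<eta> * s4" by (simp add: s4_def sum_distrib_left)
      finally show ?thesis .
    qed
    have gd: "(gain (d1 x1 x2 x4 \<zeta>))^2 \<le> 2 * ka * s1 + 2 * kl * y^2"
    proof -
      define a where "a = (\<Sum>j<N0. K $$ (0,j) * kap (j+1) * x1 j)"
      define b where "b = (\<Sum>j<N0. K $$ (0,j) * beta (j+1)) * g"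
      define l where "l = (\<Sum>j<N0. K $$ (0,j) * (exp (kap (j+1) * h) * L $$ (j,0)))"
      have e: "gain (d1 x1 x2 x4 \<zeta>) = (a + b) + l * y"
        unfolding gain_def[of "d1 x1 x2 x4 \<zeta>"] a_def b_def l_def
        unfolding d1_def y_def[symmetric] g_def[symmetric] sum_distrib_right sum.distrib[symmetric] distrib_left
        by (simp only: mult_ac)
      have "a^2 \<le> (\<Sum>j<N0. (K $$ (0,j) * kap (j+1))^2) * s1" unfolding a_def s1_def by (rule CS_sum)
      moreover have "b^2 \<le> (\<Sum>j<N0. K $$ (0,j) * beta (j+1))^2 * (kk * s1)"
        unfolding b_def power_mult_distrib by (rule mult_left_mono[OF g2]) simp
      ultimately have "(a + b)^2 \<le> ka * s1" using square_add_le[of a b] by (simp add: ka_def algebra_simps)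
      then show ?thesis using square_add_le[of "a + b" "l * y"] unfolding e kl_def l_def[symmetric] by (simp add: power_mult_distrib)
    qed
    have m1: "C1 * y^2 \<le> 2 * C1 * c0 * s2 + 2 * C1 * y'^2"
      using mult_left_mono[OF yy C1] by (simp add: algebra_simps)
    have m2: "k2 * (2 * scalar_prod (vec N0 (d2 x2 x4 \<zeta>)) (P2 *\<^sub>v vec N0 x2) + 2 * \<delta> * scalar_prod (vec N0 x2) (P2 *\<^sub>v vec N0 x2))
      \<le> - (2 * C1 * c0 + 1) * s2 + k2 * C2 * y'^2"
      using mult_left_mono[OF T2 less_imp_le[OF k2]] by (simp add: k2_def algebra_simps)
    have m3: "k3 * (2 * (\<Sum>i<MM. d3 x1 x3 i * x3 i) + 2 * \<delta> * (\<Sum>i<MM. x3 i * x3 i)) \<le> s1 / 4"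
    proof -
      have "Cb / \<eta> * g^2 \<le> Cb / \<eta> * (kk * s1)" using g2 Cb \<eta> by (intro mult_left_mono) auto
      then have "2 * (\<Sum>i<MM. d3 x1 x3 i * x3 i) + 2 * \<delta> * (\<Sum>i<MM. x3 i * x3 i) \<le> Cb / \<eta> * (kk * s1)"
        using T3 mult_nonneg_nonneg[OF less_imp_le[OF \<eta>(1)] s(3)] by linarith
      then have "k3 * (2 * (\<Sum>i<MM. d3 x1 x3 i * x3 i) + 2 * \<delta> * (\<Sum>i<MM. x3 i * x3 i)) \<le> k3 * (Cb / \<eta> * (kk * s1))"
        using k3 by (intro mult_left_mono) auto
      also have "\<dots> = (Cb * kk) / (Cb * kk + 1) * s1 / 4" using \<eta> ckp by (simp add: k3_def field_simps)
      also have "\<dots> \<le> 1 * s1 / 4" using ckp s by (intro divide_right_mono mult_right_mono) simp_all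
      finally show ?thesis by simp
    qed
    have m4: "k4 * (2 * (\<Sum>i<MM. d4 x4 i * x4 i) + 2 * \<delta> * (\<Sum>i<MM. x4 i * x4 i)) \<le> - (2 * D1 * Cp + 1) * s4"
    proof -
      have "k4 * (2 * (\<Sum>i<MM. d4 x4 i * x4 i) + 2 * \<delta> * (\<Sum>i<MM. x4 i * x4 i)) \<le> k4 * (- 2 * \<eta> * s4)"
        using T4 k4 by (intro mult_left_mono) auto
      also have "\<dots> = - (k4 * (2 * \<eta>)) * s4" by simp
      also have "k4 * (2 * \<eta>) = 2 * D1 * Cp + 1" using \<eta>(1) by (simp add: k4_def)
      finally show ?thesis .
    qed
    have m5: "D1 * y'^2 \<le> 2 * D1 * Cp * s4 + 2 * D1 * \<zeta>^2" using mult_left_mono[OF yp D1] by (simp add: algebra_simps)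
    have m6: "\<epsilon> * g^2 + \<epsilon> * (gain (d1 x1 x2 x4 \<zeta>))^2 \<le> (s1 + s2 + s4 + \<zeta>^2) / 4"
    proof -
      let ?S = "s1 + s2 + s4 + \<zeta>^2"
      have "y^2 \<le> 2 * c0 * s2 + 4 * Cp * s4 + 4 * \<zeta>^2" using yy yp by simp
      also have "\<dots> \<le> (2 * c0 + 4 * Cp + 4) * ?S"
      proof -
        have "0 \<le> c0 * s1" "0 \<le> c0 * s4" "0 \<le> c0 * \<zeta>^2" "0 \<le> Cp * s1" "0 \<le> Cp * s2" "0 \<le> Cp * \<zeta>^2"
          using c0 Cp s by auto
        then show ?thesis using s by (simp add: algebra_simps)
      qed
      finally have "2 * kl * y^2 \<le> 2 * kl * ((2 * c0 + 4 * Cp + 4) * ?S)" using kl by (intro mult_left_mono) auto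
      moreover have "2 * ka * s1 \<le> 2 * ka * ?S" "kk * s1 \<le> kk * ?S" using ka kk s by (auto intro!: mult_left_mono)
      ultimately have "g^2 + (gain (d1 x1 x2 x4 \<zeta>))^2 \<le> CE * ?S"
        using g2 gd by (simp add: CE_def algebra_simps)
      then have "\<epsilon> * (g^2 + (gain (d1 x1 x2 x4 \<zeta>))^2) \<le> \<epsilon> * (CE * ?S)" using \<epsilon> by (intro mult_left_mono) auto
      also have "\<dots> = (\<epsilon> * CE) * ?S" by simp
      also have "\<dots> \<le> 1 / 4 * ?S" using \<epsilon>CE s by (intro mult_right_mono) auto
      finally show ?thesis by (simp add: distrib_left)
    qed
    have P2': "scalar_prod (vec N0 u) ((k2 \<cdot>\<^sub>m P2) *\<^sub>v vec N0 v) = k2 * scalar_prod (vec N0 u) (P2 *\<^sub>v vec N0 v)" for u v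
      using smult_mat_mult_vec[OF P2(1) vec_carrier] scalar_prod_smult_distrib[OF vec_carrier mult_mat_vec_carrier[OF P2(1) vec_carrier]] by metis
    have kP2: "k2 \<cdot>\<^sub>m P2 \<in> carrier_mat N0 N0" using P2 by simp
    have regroup: "2 * (u1 + k2 * u2 + k3 * u3 + k4 * u4) + 2 * \<delta> * (v1 + k2 * v2 + k3 * v3 + k4 * v4)
      = (2 * u1 + 2 * \<delta> * v1) + k2 * (2 * u2 + 2 * \<delta> * v2) + k3 * (2 * u3 + 2 * \<delta> * v3) + k4 * (2 * u4 + 2 * \<delta> * v4)"
      for u1 u2 u3 u4 v1 v2 v3 v4 by (simp add: algebra_simps)
    have D1s: "- (2 * C1 * c0 + 1) * s2 = - (2 * C1 * c0 * s2) - s2" "- (2 * D1 * Cp + 1) * s4 = - (2 * D1 * Cp * s4) - s4"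
      by (simp_all add: algebra_simps)
    \<comment> \<open>The bookkeeping of the estimates, stated for abstract reals so that the
      nonlinear terms are hidden from linear arithmetic.\<close>
    have combine: "A1 + A2 + A3 + A4 + e1 + e2 \<le> v + 1 * \<zeta>^2"
      if "A1 \<le> - s1 + s1 / 4 + c" "c \<le> r + t" "A2 \<le> - r - s2 + t'" "A3 \<le> s1 / 4" "A4 \<le> - r' - s4"
        "dy \<le> r' + v" "dy = t + t'" "e1 + e2 \<le> (s1 + s2 + s4 + \<zeta>^2) / 4" for A1 A2 A3 A4 e1 e2 v c r t t' r' dy :: real
      using that s zero_le_power2[of \<zeta>] unfolding mult_1 by argo
    have D1e: "D1 * y'^2 = 2 * C1 * y'^2 + k2 * C2 * y'^2" by (simp add: D1_def algebra_simps)
    show "2 * scalar_prod (stk N0 MM (d1 x1 x2 x4 \<zeta>) (d2 x2 x4 \<zeta>) (d3 x1 x3) (d4 x4)) (blockP N0 MM P1 (k2 \<cdot>\<^sub>m P2) k3 k4 *\<^sub>v stk N0 MM x1 x2 x3 x4)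
     + 2 * \<delta> * scalar_prod (stk N0 MM x1 x2 x3 x4) (blockP N0 MM P1 (k2 \<cdot>\<^sub>m P2) k3 k4 *\<^sub>v stk N0 MM x1 x2 x3 x4)
     + \<epsilon> * (gain x1)^2 + \<epsilon> * (gain (d1 x1 x2 x4 \<zeta>))^2 \<le> (2 * D1 + 1) * \<zeta>^2"
      unfolding blockP_form[OF P1(1) kP2] P2' g_def[symmetric] regroup distrib_right[of "2 * D1" 1]
      by (rule combine[OF T1 m1 m2[unfolded D1s] m3 m4[unfolded D1s] m5 D1e m6])
  qed
qed

end

section \<open>Feasibility for large observer dimension\<close>

lemma shifted_sum_le_suminf:
  fixes f :: "nat \<Rightarrow> real"
  assumes "summable f" "\<And>n. f n \<ge> 0" shows "(\<Sum>j<m. f (k + j)) \<le> suminf f"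
proof -
  have "(\<Sum>j<m. f (k + j)) = sum f {k..<k+m}"
    using sum.shift_bounds_nat_ivl[of f 0 k m] by (simp add: atLeast0LessThan add.commute)
  also have "\<dots> \<le> suminf f" by (rule sum_le_suminf[OF assms(1)]) (use assms(2) in auto)
  finally show ?thesis .
qed

lemma suminf_tail_tendsto_0:
  fixes f :: "nat \<Rightarrow> real"
  assumes "summable f" shows "(\<lambda>N. \<Sum>n. f (n + N)) \<longlonglongrightarrow> 0"
proof -
  have "(\<lambda>N. suminf f - (\<Sum>i<N. f i)) \<longlonglongrightarrow> suminf f - suminf f"
    by (intro tendsto_intros summable_LIMSEQ assms)
  then show ?thesis by (simp add: suminf_minus_initial_segment[OF assms])
qed

lemma suminf_tail_le:
  fixes f :: "nat \<Rightarrow> real"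
  assumes "summable f" "\<And>n. f n \<ge> 0" shows "(\<Sum>n. f (n + N)) \<le> suminf f"
  using suminf_minus_initial_segment[OF assms(1), of N] sum_nonneg[of "{..<N}" f] assms(2) by simp

lemma blockP_pos_def:
  assumes P1: "P1 \<in> carrier_mat n n" and P2: "P2 \<in> carrier_mat n n"
    and pos: "\<And>x. x \<in> carrier_vec n \<Longrightarrow> x \<noteq> 0\<^sub>v n \<Longrightarrow> scalar_prod x (P1 *\<^sub>v x) > 0"
      "\<And>x. x \<in> carrier_vec n \<Longrightarrow> x \<noteq> 0\<^sub>v n \<Longrightarrow> scalar_prod x (P2 *\<^sub>v x) > 0" and k: "k3 > 0" "k4 > 0"
  shows "pos_def (blockP n m P1 P2 k3 k4)"
  unfolding pos_def_def
proof (intro ballI impI)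
  let ?B = "blockP n m P1 P2 k3 k4" and ?d = "(n + n) + (m + m)"
  have B: "?B \<in> carrier_mat ?d ?d" by (rule blockP_carrier[OF P1 P2])
  fix v :: "real vec" assume "v \<in> carrier_vec (dim_row ?B)" "v \<noteq> 0\<^sub>v (dim_row ?B)"
  then have v: "v \<in> carrier_vec ?d" "v \<noteq> 0\<^sub>v ?d" using carrier_matD(1)[OF B] by simp_all
  obtain x1 x2 x3 x4 where x: "v = stk n m x1 x2 x3 x4" using vec_as_stk[OF v(1)] .
  have nn: "scalar_prod y (Q *\<^sub>v y) \<ge> 0" if "y \<in> carrier_vec n" "Q \<in> carrier_mat n n"
    "\<And>x. x \<in> carrier_vec n \<Longrightarrow> x \<noteq> 0\<^sub>v n \<Longrightarrow> scalar_prod x (Q *\<^sub>v x) > 0" for Q :: "real mat" and y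
    using that by (cases "y = 0\<^sub>v n") (auto intro: less_imp_le)
  have t: "scalar_prod (vec n x1) (P1 *\<^sub>v vec n x1) \<ge> 0" "scalar_prod (vec n x2) (P2 *\<^sub>v vec n x2) \<ge> 0"
    by (rule nn[OF vec_carrier P1 pos(1)], assumption+, rule nn[OF vec_carrier P2 pos(2)], assumption+)
  have u: "k3 * (\<Sum>i<m. x3 i * x3 i) \<ge> 0" "k4 * (\<Sum>i<m. x4 i * x4 i) \<ge> 0" using k by (auto simp: power2_eq_square[symmetric] intro!: mult_nonneg_nonneg sum_nonneg)
  have vz: "vec n x = 0\<^sub>v n \<longleftrightarrow> (\<forall>i<n. x i = 0)" for x :: "nat \<Rightarrow> real"
    unfolding zero_vec_eq by (metis index_vec vec_eq_cong)
  have sz: "(\<Sum>i<m. x i * x i) > 0" if "i < m" "x i \<noteq> 0" for x :: "nat \<Rightarrow> real" and i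
    using that by (intro sum_pos2[of _ i]) (auto simp: zero_less_mult_iff linorder_neq_iff)
  have "(\<exists>i<n. x1 i \<noteq> 0) \<or> (\<exists>i<n. x2 i \<noteq> 0) \<or> (\<exists>i<m. x3 i \<noteq> 0) \<or> (\<exists>i<m. x4 i \<noteq> 0)"
    using v(2) unfolding x stk_eq_0 by blast
  then show "scalar_prod v (?B *\<^sub>v v) > 0"
    unfolding x blockP_form[OF P1 P2]
  proof (elim disjE)
    assume "\<exists>i<n. x1 i \<noteq> 0"
    then have "scalar_prod (vec n x1) (P1 *\<^sub>v vec n x1) > 0" by (intro pos) (auto simp: vz)
    then show "0 < scalar_prod (vec n x1) (P1 *\<^sub>v vec n x1) + scalar_prod (vec n x2) (P2 *\<^sub>v vec n x2)
        + k3 * (\<Sum>i<m. x3 i * x3 i) + k4 * (\<Sum>i<m. x4 i * x4 i)" using t u by simp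
  next
    assume "\<exists>i<n. x2 i \<noteq> 0"
    then have "scalar_prod (vec n x2) (P2 *\<^sub>v vec n x2) > 0" by (intro pos) (auto simp: vz)
    then show "0 < scalar_prod (vec n x1) (P1 *\<^sub>v vec n x1) + scalar_prod (vec n x2) (P2 *\<^sub>v vec n x2)
        + k3 * (\<Sum>i<m. x3 i * x3 i) + k4 * (\<Sum>i<m. x4 i * x4 i)" using t u by simp
  next
    assume "\<exists>i<m. x3 i \<noteq> 0"
    then have "k3 * (\<Sum>i<m. x3 i * x3 i) > 0" using sz k by auto
    then show "0 < scalar_prod (vec n x1) (P1 *\<^sub>v vec n x1) + scalar_prod (vec n x2) (P2 *\<^sub>v vec n x2)
        + k3 * (\<Sum>i<m. x3 i * x3 i) + k4 * (\<Sum>i<m. x4 i * x4 i)" using t u by simp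
  next
    assume "\<exists>i<m. x4 i \<noteq> 0"
    then have "k4 * (\<Sum>i<m. x4 i * x4 i) > 0" using sz k by auto
    then show "0 < scalar_prod (vec n x1) (P1 *\<^sub>v vec n x1) + scalar_prod (vec n x2) (P2 *\<^sub>v vec n x2)
        + k3 * (\<Sum>i<m. x3 i * x3 i) + k4 * (\<Sum>i<m. x4 i * x4 i)" using t u by simp
  qed
qed

section \<open>Choice of the weights and of \<open>N\<close>\<close>

context sturm_liouville begin

lemma lam_mono:
  assumes "1 \<le> m" "m \<le> n" shows "lam m \<le> lam n"
  using assms(2)
proof (induction n rule: dec_induct)
  case (step n) then show ?case using lam_less_Suc[of n] assms(1) by simp
qed simp

abbreviation "bet \<equiv> beta_n p th2 phi"
abbreviation "ac n \<equiv> ip (a_fun p qt th2) (phi n)"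
abbreviation "bc n \<equiv> ip (b_fun th2) (phi n)"

text \<open>By \<open>coeff_a\<close> the quotient is a combination of the square summable
  coefficients of \<open>a\<close> and \<open>b\<close> with bounded factors.\<close>

lemma beta_over_lam_summable: "summable (\<lambda>n. (bet (Suc n) / lam (Suc n))^2)"
proof (rule summable_comparison_test')
  let ?c = "1 / lam 1" and ?d = "1 + \<bar>qc\<bar> / lam 1"
  show "summable (\<lambda>n. 2 * (?c^2 * (ac (Suc n))^2) + 2 * (?d^2 * (bc (Suc n))^2))"
    by (intro summable_add summable_mult bessel_summable a_fun_L2 b_fun_L2)
  fix n
  have l1: "lam 1 > 0" and ln: "lam (Suc n) \<ge> lam 1" using lam_pos[of 1] lam_mono[of 1 "Suc n"] by auto
  have e: "bet (Suc n) / lam (Suc n) = ac (Suc n) / lam (Suc n) + (qc / lam (Suc n) - 1) * bc (Suc n)"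
    using coeff_a[of "Suc n"] l1 ln by (simp add: field_simps)
  have "\<bar>qc / lam (Suc n) - 1\<bar> \<le> \<bar>qc / lam (Suc n)\<bar> + 1" by linarith
  also have "\<bar>qc / lam (Suc n)\<bar> \<le> \<bar>qc\<bar> / lam 1" using l1 ln by (simp add: frac_le)
  finally have q: "\<bar>qc / lam (Suc n) - 1\<bar> \<le> ?d" by simp
  have q2: "((qc / lam (Suc n) - 1) * bc (Suc n))^2 \<le> ?d^2 * (bc (Suc n))^2"
    unfolding power_mult_distrib using q by (intro mult_right_mono) (auto simp: abs_le_square_iff[symmetric])
  have a2: "(ac (Suc n) / lam (Suc n))^2 \<le> ?c^2 * (ac (Suc n))^2"
  proof -
    have "1 / lam (Suc n) \<le> ?c" using l1 ln by (intro frac_le) auto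
    then have "(1 / lam (Suc n))^2 \<le> ?c^2" using l1 ln by (intro power_mono) auto
    then have "(1 / lam (Suc n))^2 * (ac (Suc n))^2 \<le> ?c^2 * (ac (Suc n))^2" by (rule mult_right_mono) simp
    then show ?thesis by (simp add: power_divide)
  qed
  show "norm ((bet (Suc n) / lam (Suc n))^2) \<le> 2 * (?c^2 * (ac (Suc n))^2) + 2 * (?d^2 * (bc (Suc n))^2)"
    using square_add_le[of "ac (Suc n) / lam (Suc n)" "(qc / lam (Suc n) - 1) * bc (Suc n)"] a2 q2 unfolding e by simp
qed

lemma RN_tendsto_0: "L2 f \<Longrightarrow> (\<lambda>N. RN_norm_sq phi N f) \<longlonglongrightarrow> 0"
  unfolding RN_norm_sq_def using suminf_tail_tendsto_0[OF bessel_summable] by simp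

theorem LMI_eventually_feasible:
  assumes \<delta>: "\<delta> > 0" and N0: "N0 \<ge> 1" and gap: "\<forall>n\<ge>N0+1. - lam n + qc < - \<delta>"
    and K: "K \<in> carrier_mat 1 N0" and L: "L \<in> carrier_mat N0 1"
    and hurK: "eigs_below (A0m lam qc N0 + B0m bet N0 * K) (- \<delta>)"
    and hurL: "eigs_below (A0m lam qc N0 - L * C0m phi N0) (- \<delta>)"
  shows "\<exists>N1. \<forall>N\<ge>N1. LMI_feasible p qt th2 lam phi qc \<delta> N0 N h K L"
proof -
  \<comment> \<open>An instance with \<open>N = N0\<close>, for the dimensions of matrices that do
    not involve \<open>N\<close>.\<close>
  interpret c0: controller lam bet phi qc h N0 N0 K L by unfold_locales (use K L in auto)
  have A1: "A0m lam qc N0 + B0m bet N0 * K \<in> carrier_mat N0 N0" and A2: "A0m lam qc N0 - L * C0m phi N0 \<in> carrier_mat N0 N0"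
    using mult_carrier_mat[OF c0.carriers(3) K] mult_carrier_mat[OF L c0.carriers(4)] c0.carriers(1) by (auto intro: minus_carrier_mat)
  have n0: "N0 > 0" using N0 by simp
  obtain P1 where P1: "P1 \<in> carrier_mat N0 N0" "P1\<^sup>T = P1"
    "\<And>x. x \<in> carrier_vec N0 \<Longrightarrow> x \<noteq> 0\<^sub>v N0 \<Longrightarrow> scalar_prod x (P1 *\<^sub>v x) > 0"
    "\<And>x. x \<in> carrier_vec N0 \<Longrightarrow> 2 * scalar_prod ((A0m lam qc N0 + B0m bet N0 * K) *\<^sub>v x) (P1 *\<^sub>v x) + 2 * \<delta> * scalar_prod x (P1 *\<^sub>v x) \<le> - scalar_prod x x"
    using lyapunov_exists[OF A1 n0 hurK] by metis
  obtain P2 where P2: "P2 \<in> carrier_mat N0 N0" "P2\<^sup>T = P2"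
    "\<And>x. x \<in> carrier_vec N0 \<Longrightarrow> x \<noteq> 0\<^sub>v N0 \<Longrightarrow> scalar_prod x (P2 *\<^sub>v x) > 0"
    "\<And>x. x \<in> carrier_vec N0 \<Longrightarrow> 2 * scalar_prod ((A0m lam qc N0 - L * C0m phi N0) *\<^sub>v x) (P2 *\<^sub>v x) + 2 * \<delta> * scalar_prod x (P2 *\<^sub>v x) \<le> - scalar_prod x x"
    using lyapunov_exists[OF A2 n0 hurL] by metis
  define \<eta> where "\<eta> = lam (N0 + 1) - qc - \<delta>"
  have \<eta>: "\<eta> > 0" "\<And>n. n \<ge> N0 + 1 \<Longrightarrow> - lam n + qc + \<delta> \<le> - \<eta>"
    using gap lam_mono[of "N0 + 1"] by (force simp: \<eta>_def)+
  define Cp where "Cp = (\<Sum>n. (phi (Suc n) 0)^2 / lam (Suc n))"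
  define Cb where "Cb = (\<Sum>n. (bet (Suc n) / lam (Suc n))^2)"
  have pn: "(phi (Suc n) 0)^2 / lam (Suc n) \<ge> 0" for n using lam_pos[of "Suc n"] by simp
  have Cp: "Cp \<ge> 0" and Cb: "Cb \<ge> 0" unfolding Cp_def Cb_def
    by (intro suminf_nonneg point_weights_summable beta_over_lam_summable pn zero_le_power2)+
  have Cp': "(\<Sum>j<N-N0. (phi (N0+j+1) 0)^2 / lam (N0+j+1)) \<le> Cp"
    and Cb': "(\<Sum>j<N-N0. (bet (N0+j+1) / lam (N0+j+1))^2) \<le> Cb" for N
    using shifted_sum_le_suminf[OF point_weights_summable pn, of N0 "N - N0"] shifted_sum_le_suminf[OF beta_over_lam_summable, of N0 "N - N0"]
    by (simp_all add: Cp_def Cb_def)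
  have lam1: "\<And>n. n \<ge> 1 \<Longrightarrow> lam n > 0" by (rule lam_pos)
  \<comment> \<open>The weights must be found before \<open>N\<close>, because
    \<open>\<epsilon>\<close> and \<open>D\<close> decide how large \<open>N\<close> has to
    be.\<close>
  have "\<exists>\<epsilon> D k2 k3 k4. (\<forall>N\<ge>N0. controller.dissipative lam bet phi qc h N0 N K L \<delta> (blockP N0 (N - N0) P1 (k2 \<cdot>\<^sub>m P2) k3 k4) \<epsilon> D)
    \<and> \<epsilon> > 0 \<and> D > 0 \<and> k2 > 0 \<and> k3 > 0 \<and> k4 > 0"
  proof -
    have ctrl: "controller N0 N K L" if "N \<ge> N0" for N by unfold_locales (use K L that in auto)
    note dis = controller.dissipative_blockP[OF ctrl P1(1,2) P2(1,2) P1(4) P2(4) \<eta> lam1 Cp' Cp Cb' Cb]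
    note d0 = dis[OF order_refl]
    show ?thesis
      apply (rule exI)+
      apply (intro conjI)
      apply (intro allI impI)
      apply (rule dis(1))
      apply assumption+
      apply (rule d0(5), assumption+)
      apply (rule d0(6), assumption+)
      apply (rule d0(2), assumption+)
      apply (rule d0(3), assumption+)
      apply (rule d0(4), assumption+)
      done
  qed
  then obtain \<epsilon> D k2 k3 k4 where pos: "\<epsilon> > 0" "D > 0" "k2 > 0" "k3 > 0" "k4 > 0"
    and dis: "\<And>N. N \<ge> N0 \<Longrightarrow> controller.dissipative lam bet phi qc h N0 N K L \<delta> (blockP N0 (N - N0) P1 (k2 \<cdot>\<^sub>m P2) k3 k4) \<epsilon> D"
    by blast
  \<comment> \<open>Compensates the factor \<open>exp (- 2 * \<delta> * h)\<close>. The other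
    choices are \<open>\<alpha> = 2\<close> and \<open>\<gamma> = 1\<close>: squared remainder norms
    below \<open>\<epsilon> / 2\<close> then suffice, and the second condition becomes \<open>- lam
    (N + 1) + 2 * (qc + \<delta>) + \<beta> * M_phi \<le> 0\<close>.\<close>
  define \<beta> where "\<beta> = D * exp (2 * \<delta> * h)"
  have \<beta>: "\<beta> > 0" "- \<beta> * exp (- 2 * \<delta> * h) = - D" using pos by (simp_all add: \<beta>_def exp_minus)
  have "\<forall>\<^sub>F N in sequentially. RN_norm_sq phi N (a_fun p qt th2) < \<epsilon> / 2"
    using order_tendstoD(2)[OF RN_tendsto_0[OF a_fun_L2], of "\<epsilon> / 2"] pos by simp
  moreover have "\<forall>\<^sub>F N in sequentially. RN_norm_sq phi N (b_fun th2) < \<epsilon> / 2"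
    using order_tendstoD(2)[OF RN_tendsto_0[OF b_fun_L2], of "\<epsilon> / 2"] pos by simp
  moreover have "\<forall>\<^sub>F N in sequentially. lam (Suc N) \<ge> 2 * (qc + \<delta>) + \<beta> * Cp"
    using lam_at_top unfolding filterlim_at_top by (subst eventually_sequentially_Suc) auto
  moreover have "\<forall>\<^sub>F N in sequentially. N \<ge> N0" by (rule eventually_ge_at_top)
  ultimately have "\<forall>\<^sub>F N in sequentially. LMI_feasible p qt th2 lam phi qc \<delta> N0 N h K L"
  proof eventually_elim
    case (elim N)
    interpret c: controller lam bet phi qc h N0 N K L by unfold_locales (use K L elim in auto)
    let ?P = "blockP N0 (N - N0) P1 (k2 \<cdot>\<^sub>m P2) k3 k4"
    have kP2: "k2 \<cdot>\<^sub>m P2 \<in> carrier_mat N0 N0" "(k2 \<cdot>\<^sub>m P2)\<^sup>T = k2 \<cdot>\<^sub>m P2"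
      using P2(1,2) by (simp_all add: transpose_smult_mat)
    have kpos: "scalar_prod x ((k2 \<cdot>\<^sub>m P2) *\<^sub>v x) > 0" if "x \<in> carrier_vec N0" "x \<noteq> 0\<^sub>v N0" for x
      using P2(3)[OF that] pos smult_mat_mult_vec[OF P2(1) that(1)] scalar_prod_smult_distrib[OF that(1) mult_mat_vec_carrier[OF P2(1) that(1)]] by simp
    have Pc: "?P \<in> carrier_mat c.DD c.DD" and PT: "?P\<^sup>T = ?P"
      by (rule blockP_carrier[OF P1(1) kP2(1)], rule blockP_transpose[OF P1(1) kP2(1) P1(2) kP2(2)])
    have "neg_semidef (Theta1 p qt th2 lam phi qc \<delta> N0 N h K L ?P 2 \<beta> 1)" (is "neg_semidef ?T")
      unfolding neg_semidef_def
    proof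
      have Tc: "?T \<in> carrier_mat (c.DD + 1) (c.DD + 1)" by (rule c.Theta1_carrier[OF Pc refl])
      fix v :: "real vec" assume "v \<in> carrier_vec (dim_row ?T)"
      then have v: "v \<in> carrier_vec (c.DD + 1)" using carrier_matD(1)[OF Tc] by (simp only:)
      obtain x1 x2 x3 x4 \<zeta> where x: "v = stk N0 (N - N0) x1 x2 x3 x4 @\<^sub>v vec 1 (\<lambda>_. \<zeta>)"
        using vec_as_stk_append[OF v] .
      have ra: "2 * RN_norm_sq phi N (a_fun p qt th2) * (c.gain x1)^2 \<le> \<epsilon> * (c.gain x1)^2"
        using elim by (intro mult_right_mono) auto
      have rb: "2 * RN_norm_sq phi N (b_fun th2) * (c.gain (c.d1 x1 x2 x4 \<zeta>))^2 \<le> \<epsilon> * (c.gain (c.d1 x1 x2 x4 \<zeta>))^2"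
        using elim by (intro mult_right_mono) auto
      show "scalar_prod v (?T *\<^sub>v v) \<le> 0"
        unfolding x c.Theta1_form[OF Pc PT refl]
        using dis[OF elim(4), unfolded c.dissipative_def, rule_format, of x1 x2 x4 \<zeta> x3] ra rb \<beta>(2)
        by simp
    qed
    moreover have "Theta2 lam phi qc \<delta> N 2 \<beta> 1 \<le> 0"
    proof -
      have "M_phi lam phi N \<le> Cp"
        using suminf_tail_le[OF point_weights_summable pn, of N] by (simp add: M_phi_def Cp_def)
      then have "\<beta> * M_phi lam phi N \<le> \<beta> * Cp" using \<beta> by (intro mult_left_mono) auto
      then show ?thesis using elim(3) by (simp add: Theta2_def)
    qed
    moreover have "pos_def ?P" by (rule blockP_pos_def[OF P1(1) kP2(1) P1(3) kpos pos(4,5)])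
    moreover have "?P \<in> carrier_mat (2 * N) (2 * N)" using Pc unfolding c.DD_eq .
    ultimately show ?case unfolding LMI_feasible_def using PT \<beta>(1)
      by (intro exI[of _ ?P] exI[of _ 2] exI[of _ \<beta>] exI[of _ 1]) auto
  qed
  then show ?thesis by (simp add: eventually_sequentially)
qed

end

section \<open>Modal coordinates of the closed loop\<close>

text \<open>An integrating factor for \<open>f + d / c\<close>. The rate \<open>c\<close> may have
  either sign: it is positive in the growth estimates and \<open>- 2 * \<delta>\<close> for the
  Lyapunov functional. A derivative is asked for in the open interval only, since trajectories are
  differentiable at positive times.\<close>

lemma gronwall_derivative:
  fixes f f' :: "real \<Rightarrow> real"
  assumes cont: "continuous_on {a..b} f" and der: "\<And>t. a < t \<Longrightarrow> t < b \<Longrightarrow> (f has_real_derivative f' t) (at t)"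
    and le: "\<And>t. a < t \<Longrightarrow> t < b \<Longrightarrow> f' t \<le> c * f t + d" and c: "c \<noteq> 0" and t: "a \<le> t" "t \<le> b"
  shows "f t + d / c \<le> (f a + d / c) * exp (c * (t - a))"
proof -
  let ?g = "\<lambda>t. (f t + d / c) * exp (- c * (t - a))"
  have "?g t \<le> ?g a"
  proof (rule DERIV_nonpos_imp_decreasing_open[OF t(1)])
    fix x assume x: "a < x" "x < t"
    then have d: "(f has_real_derivative f' x) (at x)" using t by (intro der) auto
    have "(?g has_real_derivative f' x * exp (- c * (x - a)) + (f x + d / c) * (exp (- c * (x - a)) * (- c))) (at x)"
      by (auto intro!: derivative_eq_intros d)
    moreover have "f' x * exp (- c * (x - a)) + (f x + d / c) * (exp (- c * (x - a)) * (- c)) = (f' x - (c * f x + d)) * exp (- c * (x - a))"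
      using c by (simp add: field_simps)
    moreover have "(f' x - (c * f x + d)) * exp (- c * (x - a)) \<le> 0"
      using le[of x] x t by (intro mult_nonpos_nonneg) auto
    ultimately show "\<exists>y. (?g has_real_derivative y) (at x) \<and> y \<le> 0" by metis
  next
    show "continuous_on {a..t} ?g"
      using t by (intro continuous_intros continuous_on_subset[OF cont]) auto
  qed
  then have "(f t + d / c) * exp (- c * (t - a)) * exp (c * (t - a)) \<le> (f a + d / c) * exp (c * (t - a))"
    by (intro mult_right_mono) auto
  then show ?thesis by (simp add: mult.assoc exp_add[symmetric])
qed

text \<open>With \<open>k = kap n\<close> this is the input history inside the predictor, with
  \<open>k = - 2 * \<delta>\<close> the delay term of the Lyapunov functional.\<close>

definition delay_int :: "real \<Rightarrow> real \<Rightarrow> (real \<Rightarrow> real) \<Rightarrow> real \<Rightarrow> real" where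
  "delay_int k h g t = (LINT s:{t-h..t}|lborel. exp (k * (t - s)) * g s)"

lemma LINT_primitive:
  fixes g :: "real \<Rightarrow> real"
  assumes "continuous_on UNIV g"
  obtains G where "\<And>t. (G has_real_derivative g t) (at t)"
    "\<And>a b. a \<le> b \<Longrightarrow> (LINT s:{a..b}|lborel. g s) = G b - G a"
proof -
  define G where "G t = (LBINT s=ereal 0..ereal t. g s)" for t :: real
  have cg: "continuous_on A g" for A by (rule continuous_on_subset[OF assms]) simp
  have G: "(G has_real_derivative g t) (at t)" for t
  proof -
    \<comment> \<open>An interval with both 0 and \<open>t\<close> in its interior, so that the
      derivative within it is the two-sided one.\<close>
    let ?a = "min t 0 - 1" and ?b = "max t 0 + 1"
    have "((\<lambda>u. LBINT s=ereal 0..ereal u. g s) has_vector_derivative g t) (at t within {?a..?b})"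
      by (rule interval_integral_FTC2[OF _ _ cg]) auto
    then have "(G has_vector_derivative g t) (at t within {?a..?b})" unfolding G_def .
    moreover have "at t within {?a..?b} = at t" by (rule at_within_interior) auto
    ultimately show ?thesis by (simp add: has_real_derivative_iff_has_vector_derivative)
  qed
  show thesis
  proof (rule that[OF G])
    fix a b :: real assume "a \<le> b"
    then show "(LINT s:{a..b}|lborel. g s) = G b - G a"
      unfolding set_lebesgue_integral_def
      by (intro integral_FTC_atLeastAtMost cg)
        (simp_all add: has_real_derivative_iff_has_vector_derivative[symmetric] has_field_derivative_at_within[OF G])
  qed
qed

text \<open>Factoring \<open>exp (k * t)\<close> out of the kernel leaves the difference of a
  primitive at \<open>t\<close> and at \<open>t - h\<close>, which avoids differentiating under the
  integral.\<close>

lemma delay_int_deriv: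
  assumes g: "continuous_on UNIV g" and h: "h \<ge> 0"
  shows "(delay_int k h g has_real_derivative (k * delay_int k h g t + g t - exp (k * h) * g (t - h))) (at t)"
proof -
  have "continuous_on UNIV (\<lambda>s. exp (- k * s) * g s)" by (intro continuous_intros g)
  then obtain G where G: "\<And>t. (G has_real_derivative exp (- k * t) * g t) (at t)"
    and I: "\<And>a b. a \<le> b \<Longrightarrow> (LINT s:{a..b}|lborel. exp (- k * s) * g s) = G b - G a"
    using LINT_primitive[of "\<lambda>s. exp (- k * s) * g s"] by auto
  have D: "delay_int k h g t = exp (k * t) * (G t - G (t - h))" for t
  proof -
    have "delay_int k h g t = (LINT s:{t-h..t}|lborel. exp (k * t) * (exp (- k * s) * g s))"
      unfolding delay_int_def by (simp add: right_diff_distrib exp_diff exp_minus field_simps)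
    also have "\<dots> = exp (k * t) * (LINT s:{t-h..t}|lborel. exp (- k * s) * g s)" by (rule set_integral_mult_right)
    finally show ?thesis using I[of "t - h" t] h by simp
  qed
  have G': "((\<lambda>t. G (t - h)) has_real_derivative exp (- k * (t - h)) * g (t - h)) (at t)"
  proof -
    have "((\<lambda>t. t - h) has_real_derivative 1) (at t)" by (auto intro!: derivative_eq_intros)
    from DERIV_chain2[OF G this] show ?thesis by simp
  qed
  have d: "((\<lambda>t. exp (k * t) * (G t - G (t - h))) has_real_derivative
      (exp (k * t) * k) * (G t - G (t - h)) + exp (k * t) * (exp (- k * t) * g t - exp (- k * (t - h)) * g (t - h))) (at t)"
    by (auto intro!: derivative_eq_intros G G')
  have e: "(exp (k * t) * k) * (G t - G (t - h)) + exp (k * t) * (exp (- k * t) * g t - exp (- k * (t - h)) * g (t - h))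
      = k * delay_int k h g t + g t - exp (k * h) * g (t - h)"
  proof -
    have "exp (k * t) * exp (- k * t) = 1" "exp (k * t) * exp (- k * (t - h)) = exp (k * h)"
      by (simp_all add: exp_add[symmetric] algebra_simps)
    then show ?thesis unfolding D by (simp add: right_diff_distrib mult.assoc[symmetric])
  qed
  have "((\<lambda>t. exp (k * t) * (G t - G (t - h))) has_real_derivative (k * delay_int k h g t + g t - exp (k * h) * g (t - h))) (at t)"
    by (rule DERIV_cong[OF d e])
  moreover have "(\<lambda>t. exp (k * t) * (G t - G (t - h))) = delay_int k h g" using D by auto
  ultimately show ?thesis by (simp only:)
qed

lemma delay_int_bound:
  assumes g: "continuous_on UNIV g" and h: "h \<ge> 0" and B: "\<And>s. t - h \<le> s \<Longrightarrow> s \<le> t \<Longrightarrow> \<bar>g s\<bar> \<le> B"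
  shows "\<bar>delay_int k h g t\<bar> \<le> h * exp (\<bar>k\<bar> * h) * B"
proof -
  have c: "continuous_on A (\<lambda>s. exp (k * (t - s)) * g s)" for A
    by (intro continuous_intros continuous_on_subset[OF g]) auto
  have i: "set_integrable lborel {t-h..t} (\<lambda>s. exp (k * (t - s)) * g s)" by (rule borel_integrable_atLeastAtMost'[OF c])
  have B0: "B \<ge> 0" using B[of t] h by auto
  have "\<bar>delay_int k h g t\<bar> \<le> (LINT s:{t-h..t}|lborel. \<bar>exp (k * (t - s)) * g s\<bar>)"
    unfolding delay_int_def using set_integral_norm_bound[OF i] by simp
  also have "\<dots> \<le> (LINT s:{t-h..t}|lborel. exp (\<bar>k\<bar> * h) * B)"
  proof (rule set_integral_mono)
    show "set_integrable lborel {t-h..t} (\<lambda>s. \<bar>exp (k * (t - s)) * g s\<bar>)" using i by (rule set_integrable_abs)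
    show "set_integrable lborel {t-h..t} (\<lambda>s. exp (\<bar>k\<bar> * h) * B)" by (rule borel_integrable_atLeastAtMost') simp
    fix s assume s: "s \<in> {t-h..t}"
    have "k * (t - s) \<le> \<bar>k\<bar> * (t - s)" using s by (intro mult_right_mono) auto
    also have "\<dots> \<le> \<bar>k\<bar> * h" using s by (intro mult_left_mono) auto
    finally have "k * (t - s) \<le> \<bar>k\<bar> * h" .
    then show "\<bar>exp (k * (t - s)) * g s\<bar> \<le> exp (\<bar>k\<bar> * h) * B"
      using B[of s] s unfolding abs_mult by (intro mult_mono) auto
  qed
  also have "\<dots> = h * exp (\<bar>k\<bar> * h) * B" using h by (simp add: set_lebesgue_integral_def)
  finally show ?thesis .
qed

text \<open>\<open>C\<close> is fixed before the solution, the forcing and its bound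
  \<open>F\<close>. This uniformity is what makes the final constant independent of the
  trajectory.\<close>

definition linear_ode_const :: "nat set \<Rightarrow> real \<Rightarrow> (nat \<Rightarrow> nat \<Rightarrow> real) \<Rightarrow> real \<Rightarrow> bool" where
  "linear_ode_const I h m C \<longleftrightarrow> C \<ge> 0 \<and> (\<forall>x f F. (\<forall>n\<in>I. continuous_on {0..h} (x n)) \<longrightarrow>
    (\<forall>n\<in>I. \<forall>t. 0 < t \<longrightarrow> t < h \<longrightarrow> (x n has_real_derivative ((\<Sum>k\<in>I. m n k * x k t) + f n t)) (at t)) \<longrightarrow>
    (\<forall>n\<in>I. \<forall>t. 0 < t \<longrightarrow> t < h \<longrightarrow> \<bar>f n t\<bar> \<le> F) \<longrightarrow> (\<forall>n\<in>I. \<bar>x n 0\<bar> \<le> F) \<longrightarrow>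
    (\<forall>n\<in>I. \<forall>t. 0 \<le> t \<longrightarrow> t \<le> h \<longrightarrow> \<bar>x n t\<bar> \<le> C * F))"

lemma linear_ode_constD:
  assumes "linear_ode_const I h m C" "\<And>n. n \<in> I \<Longrightarrow> continuous_on {0..h} (x n)"
    "\<And>n t. n \<in> I \<Longrightarrow> 0 < t \<Longrightarrow> t < h \<Longrightarrow> (x n has_real_derivative ((\<Sum>k\<in>I. m n k * x k t) + f n t)) (at t)"
    "\<And>n t. n \<in> I \<Longrightarrow> 0 < t \<Longrightarrow> t < h \<Longrightarrow> \<bar>f n t\<bar> \<le> F" "\<And>n. n \<in> I \<Longrightarrow> \<bar>x n 0\<bar> \<le> F"
    "0 \<le> t" "t \<le> h" "n \<in> I"
  shows "\<bar>x n t\<bar> \<le> C * F"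
  using assms(1)[unfolded linear_ode_const_def, THEN conjunct2, rule_format, of x f F n t] assms(2-) by blast

text \<open>Gronwall's inequality for the sum of squares: the coupling contributes
  \<open>2 * M\<close> to the rate, and the forcing, split by
  \<open>2 * x * f \<le> x^2 + F^2\<close>, contributes 1.\<close>

lemma linear_ode_const_exists:
  fixes m :: "nat \<Rightarrow> nat \<Rightarrow> real" and I :: "nat set"
  assumes fin: "finite I"
  shows "\<exists>C. linear_ode_const I h m C"
proof -
  define M where "M = (\<Sum>n\<in>I. \<Sum>k\<in>I. \<bar>m n k\<bar>)"
  have M: "M \<ge> 0" by (simp add: M_def sum_nonneg)
  let ?c = "2 * M + 1" and ?N = "real (card I)"
  let ?C = "sqrt (2 * ?N * exp (?c * \<bar>h\<bar>))"
  show ?thesis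
    unfolding linear_ode_const_def
  proof (intro exI[of _ ?C] conjI allI impI ballI)
    show "?C \<ge> 0" by simp
    fix x f :: "nat \<Rightarrow> real \<Rightarrow> real" and F t n
    assume cont': "\<forall>n\<in>I. continuous_on {0..h} (x n)"
      and der': "\<forall>n\<in>I. \<forall>t. 0 < t \<longrightarrow> t < h \<longrightarrow> (x n has_real_derivative ((\<Sum>k\<in>I. m n k * x k t) + f n t)) (at t)"
      and f': "\<forall>n\<in>I. \<forall>t. 0 < t \<longrightarrow> t < h \<longrightarrow> \<bar>f n t\<bar> \<le> F" and x0': "\<forall>n\<in>I. \<bar>x n 0\<bar> \<le> F"
      and t: "0 \<le> t" "t \<le> h" and n: "n \<in> I"
    note cont = cont'[rule_format] and der = der'[rule_format] and f = f'[rule_format] and x0 = x0'[rule_format]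
    define S where "S t = (\<Sum>n\<in>I. (x n t)^2)" for t
    have F: "F \<ge> 0" using x0[OF n] by (meson abs_ge_zero order_trans)
    have xS: "(x k t)^2 \<le> S t" if "k \<in> I" for k t
      unfolding S_def by (rule member_le_sum[OF that _ fin]) simp
    have S0: "S t \<ge> 0" for t by (simp add: S_def sum_nonneg)
    have sq: "a^2 \<le> F^2" if "\<bar>a\<bar> \<le> F" for a using that by (metis abs_ge_zero power2_abs power_mono)
    have "S t + ?N * F^2 / ?c \<le> (S 0 + ?N * F^2 / ?c) * exp (?c * (t - 0))"
    proof (rule gronwall_derivative[where f = S])
      show "continuous_on {0..h} S" unfolding S_def by (intro continuous_intros cont)
      fix s assume s: "0 < s" "s < h"
      show "(S has_real_derivative (\<Sum>n\<in>I. 2 * x n s * ((\<Sum>k\<in>I. m n k * x k s) + f n s))) (at s)"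
        unfolding S_def
      proof (rule DERIV_sum)
        fix n assume "n \<in> I"
        from DERIV_power[OF der[OF this s], of 2]
        show "((\<lambda>t. (x n t)^2) has_real_derivative 2 * x n s * ((\<Sum>k\<in>I. m n k * x k s) + f n s)) (at s)"
          by (simp add: mult_ac)
      qed
      have "2 * x n s * ((\<Sum>k\<in>I. m n k * x k s) + f n s) \<le> (\<Sum>k\<in>I. \<bar>m n k\<bar>) * (2 * S s) + (x n s)^2 + F^2" if n: "n \<in> I" for n
      proof -
        have "2 * x n s * (m n k * x k s) \<le> \<bar>m n k\<bar> * (2 * S s)" if k: "k \<in> I" for k
        proof -
          have "2 * x n s * (m n k * x k s) \<le> \<bar>m n k\<bar> * (2 * \<bar>x n s\<bar> * \<bar>x k s\<bar>)"
            using abs_ge_self[of "2 * x n s * (m n k * x k s)"] by (simp add: abs_mult mult_ac)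
          also have "2 * \<bar>x n s\<bar> * \<bar>x k s\<bar> \<le> 2 * S s"
            using sum_squares_bound[of "\<bar>x n s\<bar>" "\<bar>x k s\<bar>"] xS[OF n, of s] xS[OF k, of s] by simp
          finally show ?thesis by (simp add: mult_left_mono)
        qed
        then have "(\<Sum>k\<in>I. 2 * x n s * (m n k * x k s)) \<le> (\<Sum>k\<in>I. \<bar>m n k\<bar> * (2 * S s))" by (rule sum_mono)
        moreover have "2 * x n s * f n s \<le> (x n s)^2 + F^2"
          using sum_squares_bound[of "x n s" "f n s"] sq[OF f[OF n s]] by simp
        ultimately show ?thesis by (simp add: distrib_left sum_distrib_left sum_distrib_right)
      qed
      then have "(\<Sum>n\<in>I. 2 * x n s * ((\<Sum>k\<in>I. m n k * x k s) + f n s)) \<le> (\<Sum>n\<in>I. (\<Sum>k\<in>I. \<bar>m n k\<bar>) * (2 * S s) + (x n s)^2 + F^2)"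
        by (rule sum_mono)
      also have "\<dots> = ?c * S s + ?N * F^2"
      proof -
        have "(\<Sum>n\<in>I. (\<Sum>k\<in>I. \<bar>m n k\<bar>) * (2 * S s)) = M * (2 * S s)" unfolding M_def sum_distrib_right ..
        then show ?thesis by (simp add: sum.distrib S_def[symmetric] algebra_simps)
      qed
      finally show "(\<Sum>n\<in>I. 2 * x n s * ((\<Sum>k\<in>I. m n k * x k s) + f n s)) \<le> ?c * S s + ?N * F^2" .
    qed (use M t in auto)
    also have "\<dots> \<le> (?N * F^2 + ?N * F^2) * exp (?c * \<bar>h\<bar>)"
    proof (rule mult_mono)
      have "S 0 \<le> (\<Sum>n\<in>I. F^2)" unfolding S_def by (intro sum_mono sq x0)
      moreover have "?N * F^2 / ?c \<le> ?N * F^2 / 1" using M by (intro divide_left_mono) auto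
      ultimately show "S 0 + ?N * F^2 / ?c \<le> ?N * F^2 + ?N * F^2" by simp
    qed (use t M S0 in \<open>auto intro!: mult_left_mono\<close>)
    also have "\<dots> = (?C * F)^2" by (simp add: power_mult_distrib)
    finally have "S t + ?N * F^2 / ?c \<le> (?C * F)^2" .
    moreover have "0 \<le> ?N * F^2 / ?c" using M by simp
    ultimately have "S t \<le> (?C * F)^2" by linarith
    then have "(x n t)^2 \<le> (?C * F)^2" using xS[OF n, of t] by simp
    then show "\<bar>x n t\<bar> \<le> ?C * F" using F by (simp add: abs_le_square_iff[symmetric])
  qed
qed

text \<open>In place of a smallest eigenvalue: \<open>x $ i\<close> is the inner product, in the
  form \<open>P\<close>, of \<open>x\<close> with the \<open>i\<close>-th column of the inverse
  \<open>Q\<close>, and Cauchy-Schwarz for this form bounds it.\<close>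

lemma pos_def_coordinate_bound:
  fixes P :: "real mat"
  assumes P: "P \<in> carrier_mat n n" and PT: "P\<^sup>T = P" and pos: "pos_def P"
  obtains c where "c \<ge> 0" "\<And>x i. x \<in> carrier_vec n \<Longrightarrow> i < n \<Longrightarrow> (x $ i)^2 \<le> c * scalar_prod x (P *\<^sub>v x)"
    "\<And>x. x \<in> carrier_vec n \<Longrightarrow> 0 \<le> scalar_prod x (P *\<^sub>v x)"
proof -
  have pos': "scalar_prod x (P *\<^sub>v x) > 0" if "x \<in> carrier_vec n" "x \<noteq> 0\<^sub>v n" for x
    using pos that carrier_matD(1)[OF P] by (auto simp: pos_def_def)
  have nn: "scalar_prod x (P *\<^sub>v x) \<ge> 0" if x: "x \<in> carrier_vec n" for x
    using pos'[OF x] x P by (cases "x = 0\<^sub>v n") (auto intro: less_imp_le)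
  have sym: "scalar_prod y (P *\<^sub>v x) = scalar_prod x (P *\<^sub>v y)" if "x \<in> carrier_vec n" "y \<in> carrier_vec n" for x y
    using transpose_scalar[OF P that(2) that(1)] comm_scalar_prod[OF mult_mat_vec_carrier[OF P that(2)] that(1)] unfolding PT by simp
  have CS: "(scalar_prod y (P *\<^sub>v x))^2 \<le> scalar_prod y (P *\<^sub>v y) * scalar_prod x (P *\<^sub>v x)"
    if x: "x \<in> carrier_vec n" and y: "y \<in> carrier_vec n" for x y
  proof (cases "x = 0\<^sub>v n")
    case True
    then have "scalar_prod y (P *\<^sub>v x) = 0" using sym[OF x y] mult_mat_vec_carrier[OF P y] by simp
    then show ?thesis using nn[OF x] nn[OF y] by simp
  next
    case False
    let ?a = "scalar_prod x (P *\<^sub>v x)" and ?b = "scalar_prod y (P *\<^sub>v x)" and ?d = "scalar_prod y (P *\<^sub>v y)"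
    have a: "?a > 0" by (rule pos'[OF x False])
    let ?t = "- ?b / ?a"
    have tx: "?t \<cdot>\<^sub>v x \<in> carrier_vec n" using x by simp
    have "P *\<^sub>v (y + ?t \<cdot>\<^sub>v x) = P *\<^sub>v y + ?t \<cdot>\<^sub>v (P *\<^sub>v x)"
      using mult_add_distrib_mat_vec[OF P y tx] mult_mat_vec[OF P x] by simp
    then have "scalar_prod (y + ?t \<cdot>\<^sub>v x) (P *\<^sub>v (y + ?t \<cdot>\<^sub>v x)) = ?d + 2 * ?t * ?b + ?t^2 * ?a"
      using x y tx P sym[OF x y]
      by (simp add: add_scalar_prod_distrib[of _ n] scalar_prod_add_distrib[of _ n] power2_eq_square algebra_simps)
    also have "\<dots> = ?d - ?b^2 / ?a" using a by (simp add: power2_eq_square field_simps)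
    finally have "0 \<le> ?d - ?b^2 / ?a" using nn[of "y + ?t \<cdot>\<^sub>v x"] x y by simp
    then show ?thesis using a by (simp add: field_simps)
  qed
  have "det P \<noteq> 0"
  proof
    assume "det P = 0"
    then obtain v where "v \<in> carrier_vec n" "v \<noteq> 0\<^sub>v n" "P *\<^sub>v v = 0\<^sub>v n" using det_0_iff_vec_prod_zero[OF P] by auto
    then show False using pos'[of v] by simp
  qed
  then have "P \<in> Units (ring_mat TYPE(real) n ())" by (rule det_non_zero_imp_unit[OF P])
  then obtain Q where Q: "Q \<in> carrier_mat n n" and PQ: "P * Q = 1\<^sub>m n"
    by (auto simp: Units_def ring_mat_def)
  define c where "c = (\<Sum>i<n. scalar_prod (col Q i) (P *\<^sub>v col Q i))"
  have cQ: "col Q i \<in> carrier_vec n" for i by (rule carrier_vecI) (simp add: carrier_matD(1)[OF Q])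
  show thesis
  proof (rule that)
    show "c \<ge> 0" unfolding c_def by (intro sum_nonneg nn cQ)
    fix x :: "real vec" assume x: "x \<in> carrier_vec n"
    show "0 \<le> scalar_prod x (P *\<^sub>v x)" by (rule nn[OF x])
    fix i assume i: "i < n"
    have "P *\<^sub>v col Q i = unit_vec n i"
      using col_mult2[OF P Q i] i unfolding PQ by simp
    then have "x $ i = scalar_prod x (P *\<^sub>v col Q i)" using x i by simp
    also have "\<dots> = scalar_prod (col Q i) (P *\<^sub>v x)" by (rule sym[OF cQ x])
    finally have "(x $ i)^2 \<le> scalar_prod (col Q i) (P *\<^sub>v col Q i) * scalar_prod x (P *\<^sub>v x)" using CS[OF x cQ] by simp
    also have "\<dots> \<le> c * scalar_prod x (P *\<^sub>v x)"
      unfolding c_def using i by (intro mult_right_mono member_le_sum nn x cQ) simp_all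
    finally show "(x $ i)^2 \<le> c * scalar_prod x (P *\<^sub>v x)" .
  qed
qed

lemma abs_sum_mult_le:
  fixes c x :: "nat \<Rightarrow> real"
  assumes "\<And>k. k \<in> I \<Longrightarrow> \<bar>x k\<bar> \<le> B" shows "\<bar>\<Sum>k\<in>I. c k * x k\<bar> \<le> (\<Sum>k\<in>I. \<bar>c k\<bar>) * B"
proof -
  have "\<bar>\<Sum>k\<in>I. c k * x k\<bar> \<le> (\<Sum>k\<in>I. \<bar>c k\<bar> * B)"
    by (rule order_trans[OF sum_abs sum_mono]) (simp add: abs_mult assms mult_left_mono)
  then show ?thesis by (simp add: sum_distrib_right)
qed

lemma sum_if_le_reindex:
  fixes g :: "nat \<Rightarrow> real"
  assumes "n \<le> N" shows "(\<Sum>k=1..N. if k \<le> n then g k else 0) = (\<Sum>i<n. g (i+1))"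
proof -
  have "(\<Sum>k=1..N. if k \<le> n then g k else 0) = (\<Sum>k\<in>{1..n}. g k)"
    using assms by (subst sum.inter_filter[symmetric]) (auto intro!: sum.cong)
  then show ?thesis by (simp add: sum.atLeast1_atMost_eq)
qed

text \<open>Here the differential operator is reduced to sequences: \<open>a\<close> and
  \<open>b\<close> stand for the modal coefficients of the two functions produced by the lift, tied
  to \<open>beta\<close> as in \<open>coeff_a\<close>.\<close>

locale modal = controller +
  fixes a b :: "nat \<Rightarrow> real"
  assumes h: "h > 0" and lam_pos: "\<And>n. n \<ge> 1 \<Longrightarrow> lam n > 0"
    and lam_mono: "\<And>m n. 1 \<le> m \<Longrightarrow> m \<le> n \<Longrightarrow> lam m \<le> lam n"
    and a_eq: "\<And>n. n \<ge> 1 \<Longrightarrow> a n = beta n + (lam n - qc) * b n"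
    and a_summable: "summable (\<lambda>n. (a (Suc n))^2)" and b_summable: "summable (\<lambda>n. (b (Suc n))^2)"
    and phi_summable: "summable (\<lambda>n. (phi (Suc n) 0)^2 / lam (Suc n))"
begin

text \<open>Extending the output gain by zero gives one equation for all observer modes up to
  \<open>N\<close>; \<open>n - 1\<close> translates modes to matrix rows.\<close>

definition gL :: "nat \<Rightarrow> real" where "gL n = (if n \<le> N0 then L $$ (n - 1, 0) else 0)"

definition innovation :: "(nat \<Rightarrow> real \<Rightarrow> real) \<Rightarrow> (real \<Rightarrow> real) \<Rightarrow> real \<Rightarrow> (real \<Rightarrow> real) \<Rightarrow> real \<Rightarrow> real" where
  "innovation zh u u0 ym t = (\<Sum>k=1..N. (zh k t + b k * uext u u0 (t - h)) * phi k 0) - ym t"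

text \<open>Formed for every mode up to \<open>N\<close>: the first \<open>N0\<close> enter the
  control, the others make up the third block of the state.\<close>

definition pred :: "(nat \<Rightarrow> real \<Rightarrow> real) \<Rightarrow> (real \<Rightarrow> real) \<Rightarrow> real \<Rightarrow> nat \<Rightarrow> real \<Rightarrow> real" where
  "pred zh u u0 n t = exp (kap n * h) * zh n t + delay_int (kap n) h (\<lambda>s. beta n * uext u u0 s) t"

text \<open>The right-hand side of the predictor equation (Artstein's reduction): it contains the
  current input where the observer equation has the delayed one.\<close>

definition pred' :: "(nat \<Rightarrow> real \<Rightarrow> real) \<Rightarrow> (real \<Rightarrow> real) \<Rightarrow> real \<Rightarrow> (real \<Rightarrow> real) \<Rightarrow> nat \<Rightarrow> real \<Rightarrow> real" where
  "pred' zh u u0 ym n t = kap n * pred zh u u0 n t + beta n * u t - exp (kap n * h) * gL n * innovation zh u u0 ym t"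

definition u' :: "(nat \<Rightarrow> real \<Rightarrow> real) \<Rightarrow> (real \<Rightarrow> real) \<Rightarrow> real \<Rightarrow> (real \<Rightarrow> real) \<Rightarrow> real \<Rightarrow> real" where
  "u' zh u u0 ym t = gain (\<lambda>i. pred' zh u u0 ym (i+1) t)"

lemma pred_eq_ZA: "pred zh u u0 n t = ZA lam beta qc h zh u u0 n t"
  by (simp add: pred_def ZA_def delay_int_def kap_def mult.assoc)

lemma Kpred_eq: "Kpred K N0 lam beta qc h zh u u0 t = gain (\<lambda>i. pred zh u u0 (i+1) t)"
  by (simp add: Kpred_def gain_def pred_eq_ZA)

end

text \<open>A trajectory in modal form: \<open>zn\<close> are the coefficients of the plant,
  \<open>y\<close> is its trace at 0, and \<open>ym\<close> is the measurement, which equals the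
  delayed trace from time \<open>h\<close> on and is bounded by \<open>Y\<close> before.\<close>

locale closed_loop = modal +
  fixes zn zh :: "nat \<Rightarrow> real \<Rightarrow> real" and u :: "real \<Rightarrow> real" and u0 :: real and y ym :: "real \<Rightarrow> real" and Y :: real
  assumes zn_cont: "\<And>n. n \<ge> 1 \<Longrightarrow> continuous_on {0..} (zn n)"
    and zn_deriv: "\<And>n t. n \<ge> 1 \<Longrightarrow> t > 0 \<Longrightarrow> (zn n has_real_derivative (kap n * zn n t + beta n * u t)) (at t)"
    and u_cont: "continuous_on {0..} u" and u_0: "u 0 = u0"
    and u_pred: "\<And>t. t \<ge> 0 \<Longrightarrow> u t = gain (\<lambda>i. pred zh u u0 (i+1) t)"
    and energy_summable: "\<And>t. t \<ge> 0 \<Longrightarrow> summable (\<lambda>n. lam (Suc n) * (zn (Suc n) t + b (Suc n) * u t)^2)"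
    and y_sums: "\<And>t. t \<ge> 0 \<Longrightarrow> (\<lambda>n. (zn (Suc n) t + b (Suc n) * u t) * phi (Suc n) 0) sums y t"
    and zh_cont: "\<And>n. 1 \<le> n \<Longrightarrow> n \<le> N \<Longrightarrow> continuous_on {0..} (zh n)"
    and zh_deriv: "\<And>n t. 1 \<le> n \<Longrightarrow> n \<le> N \<Longrightarrow> t > 0 \<Longrightarrow> (zh n has_real_derivative
        (kap n * zh n t + beta n * uext u u0 (t - h) - gL n * innovation zh u u0 ym t)) (at t)"
    and ym_late: "\<And>t. t \<ge> h \<Longrightarrow> ym t = y (t - h)"
    and ym_early: "\<And>t. 0 \<le> t \<Longrightarrow> t < h \<Longrightarrow> \<bar>ym t\<bar> \<le> Y"
begin

abbreviation "ue \<equiv> uext u u0"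
abbreviation "v \<equiv> innovation zh u u0 ym"
abbreviation "Z \<equiv> pred zh u u0"
abbreviation "Z' \<equiv> pred' zh u u0 ym"
abbreviation "ud \<equiv> u' zh u u0 ym"
abbreviation "w n t \<equiv> zn n t + b n * u t"

text \<open>The extension to negative times is continuous because \<open>u0 = u 0\<close>, as the
  differentiation of the delay integrals requires.\<close>

lemma ue_max: "ue s = u (max 0 s)"
  using u_0 by (auto simp: uext_def)

lemma ue_cont: "continuous_on UNIV ue"
  unfolding ue_max[abs_def]
  by (rule continuous_on_compose2[OF u_cont]) (auto intro!: continuous_intros)

text \<open>The delayed input of the observer equation cancels against the contribution of the lower
  limit of the delay integral.\<close>

lemma Z_deriv:
  assumes "1 \<le> n" "n \<le> N" "t > 0" shows "(Z n has_real_derivative Z' n t) (at t)"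
proof -
  have g: "continuous_on UNIV (\<lambda>s. beta n * ue s)" by (intro continuous_intros ue_cont)
  have "((\<lambda>t. exp (kap n * h) * zh n t + delay_int (kap n) h (\<lambda>s. beta n * ue s) t) has_real_derivative
     exp (kap n * h) * (kap n * zh n t + beta n * ue (t - h) - gL n * v t)
      + (kap n * delay_int (kap n) h (\<lambda>s. beta n * ue s) t + beta n * ue t - exp (kap n * h) * (beta n * ue (t - h)))) (at t)"
    by (intro DERIV_add DERIV_cmult zh_deriv assms delay_int_deriv[OF g] less_imp_le[OF h])
  moreover have "ue t = u t" using assms by (simp add: uext_def)
  ultimately show ?thesis unfolding pred'_def pred_def[abs_def]
    by (elim DERIV_cong) (simp add: algebra_simps)
qed

lemma Z_cont: assumes "1 \<le> n" "n \<le> N" shows "continuous_on {0..} (Z n)"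
proof -
  have g: "continuous_on UNIV (\<lambda>s. beta n * ue s)" by (intro continuous_intros ue_cont)
  have "continuous_on {0..} (delay_int (kap n) h (\<lambda>s. beta n * ue s))"
    by (rule DERIV_continuous_on) (rule has_field_derivative_at_within[OF delay_int_deriv[OF g less_imp_le[OF h]]])
  then show ?thesis unfolding pred_def[abs_def] by (intro continuous_intros zh_cont assms)
qed

lemma u_deriv: assumes "t > 0" shows "(u has_real_derivative ud t) (at t)"
proof -
  have "((\<lambda>t. gain (\<lambda>i. Z (i+1) t)) has_real_derivative ud t) (at t)"
    unfolding gain_def u'_def using NN assms by (intro DERIV_sum DERIV_cmult Z_deriv) auto
  moreover have "open {0::real<..}" "t \<in> {0::real<..}" using assms by auto
  ultimately show ?thesis
    by (rule has_field_derivative_transform_within_open) (simp add: u_pred)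
qed

text \<open>By \<open>a_eq\<close> the lift trades the coefficient \<open>beta n\<close> for the
  square summable \<open>a n\<close> and \<open>b n\<close>; the second multiplies the derivative of
  the control.\<close>

lemma w_deriv: assumes "n \<ge> 1" "t > 0" shows "(w n has_real_derivative (kap n * w n t + a n * u t + b n * ud t)) (at t)"
proof -
  have "((\<lambda>t. w n t) has_real_derivative (kap n * zn n t + beta n * u t + b n * ud t)) (at t)"
    by (intro DERIV_add DERIV_cmult zn_deriv u_deriv assms)
  then show ?thesis by (elim DERIV_cong) (simp add: a_eq[OF assms(1)] kap_def algebra_simps)
qed

lemma w_cont: "n \<ge> 1 \<Longrightarrow> continuous_on {0..} (w n)"
  by (intro continuous_intros zn_cont u_cont)

text \<open>\<open>k = 1\<close> gives the energy of the modes up to \<open>m\<close>, and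
  \<open>k = N + 1\<close> that of the tail unseen by the observer.\<close>

definition En :: "nat \<Rightarrow> nat \<Rightarrow> real \<Rightarrow> real" where "En k m t = (\<Sum>n=k..m. lam n * (w n t)^2)"

lemma En_cont: "k \<ge> 1 \<Longrightarrow> continuous_on {0..} (En k m)"
  unfolding En_def by (intro continuous_intros w_cont) auto

lemma lam_nonneg: "n \<ge> 1 \<Longrightarrow> lam n \<ge> 0" using lam_pos[of n] by simp

lemma En_nonneg: "k \<ge> 1 \<Longrightarrow> En k m t \<ge> 0"
  unfolding En_def
proof (rule sum_nonneg)
  fix n assume "k \<ge> 1" "n \<in> {k..m}"
  then show "0 \<le> lam n * (w n t)^2" using lam_nonneg[of n] by (intro mult_nonneg_nonneg zero_le_power2) simp
qed

lemma En_deriv: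
  assumes "k \<ge> 1" "t > 0"
  shows "(En k m has_real_derivative (\<Sum>n=k..m. 2 * lam n * w n t * (kap n * w n t + a n * u t + b n * ud t))) (at t)"
  unfolding En_def
proof (rule DERIV_sum)
  fix n assume "n \<in> {k..m}"
  then have "n \<ge> 1" using assms by auto
  show "((\<lambda>t. lam n * (w n t)^2) has_real_derivative 2 * lam n * w n t * (kap n * w n t + a n * u t + b n * ud t)) (at t)"
    by (rule DERIV_cong[OF DERIV_cmult[OF DERIV_power[OF w_deriv[OF \<open>n \<ge> 1\<close> assms(2)], of 2], of "lam n"]])
      (simp add: algebra_simps)
qed

lemma sum_a_le: "k \<ge> 1 \<Longrightarrow> (\<Sum>n=k..m. (a n)^2) \<le> (\<Sum>n. (a (n + k))^2)"
  and sum_b_le: "k \<ge> 1 \<Longrightarrow> (\<Sum>n=k..m. (b n)^2) \<le> (\<Sum>n. (b (n + k))^2)"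
  and sum_phi_le: "k \<ge> 1 \<Longrightarrow> (\<Sum>n=k..m. (phi n 0)^2 / lam n) \<le> (\<Sum>n. (phi (n + k) 0)^2 / lam (n + k))"
proof -
  have gen: "(\<Sum>n=k..m. g n) \<le> (\<Sum>n. g (n + k))"
    if k: "k \<ge> 1" and g: "summable (\<lambda>n. g (Suc n))" "\<And>n. n \<ge> 1 \<Longrightarrow> g n \<ge> 0" for g :: "nat \<Rightarrow> real"
  proof (cases "k \<le> m")
    case True
    have "(\<Sum>n=k..m. g n) = (\<Sum>n\<le>m - k. g (n + k))"
      using True sum.shift_bounds_cl_nat_ivl[of g 0 k "m - k"] by (simp add: atLeast0AtMost)
    also have "\<dots> \<le> (\<Sum>n. g (n + k))"
    proof (rule sum_le_suminf)
      show "summable (\<lambda>n. g (n + k))"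
        using summable_ignore_initial_segment[OF g(1), of "k - 1"] k by simp
    qed (use g(2) k in auto)
    finally show ?thesis .
  next
    case False
    have "summable (\<lambda>n. g (n + k))"
      using summable_ignore_initial_segment[OF g(1), of "k - 1"] k by simp
    then have "0 \<le> (\<Sum>n. g (n + k))" using g(2) k by (intro suminf_nonneg) auto
    then show ?thesis using False by simp
  qed
  show "k \<ge> 1 \<Longrightarrow> (\<Sum>n=k..m. (a n)^2) \<le> (\<Sum>n. (a (n + k))^2)" by (rule gen) (auto simp: a_summable)
  show "k \<ge> 1 \<Longrightarrow> (\<Sum>n=k..m. (b n)^2) \<le> (\<Sum>n. (b (n + k))^2)" by (rule gen) (auto simp: b_summable)
  show "k \<ge> 1 \<Longrightarrow> (\<Sum>n=k..m. (phi n 0)^2 / lam n) \<le> (\<Sum>n. (phi (n + k) 0)^2 / lam (n + k))"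
    using lam_pos by (intro gen) (auto simp: phi_summable less_imp_le)
qed

definition dd :: real where "dd = (\<Sum>n. (a (n + 1))^2) + (\<Sum>n. (b (n + 1))^2)"

text \<open>The dissipation \<open>- 2 * (lam n * w n s)^2\<close> of each mode is shared equally
  between the two inputs, which leaves the rate \<open>2 * \<bar>qc\<bar>\<close> and the square
  summable \<open>a\<close> and \<open>b\<close>. So the bound is uniform in \<open>m\<close>. The 1
  added to the rate makes it nonzero, as \<open>gronwall_derivative\<close> requires.\<close>

lemma energy_growth:
  assumes T: "t \<ge> 0" "t \<le> T" and u: "\<And>s. 0 < s \<Longrightarrow> s < T \<Longrightarrow> \<bar>u s\<bar> \<le> U" "\<And>s. 0 < s \<Longrightarrow> s < T \<Longrightarrow> \<bar>ud s\<bar> \<le> U"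
  shows "En 1 m t \<le> (En 1 m 0 + dd * U^2) * exp ((2 * \<bar>qc\<bar> + 1) * T)"
proof -
  let ?c = "2 * \<bar>qc\<bar> + 1"
  have dd: "dd \<ge> 0" unfolding dd_def using a_summable b_summable by (intro add_nonneg_nonneg suminf_nonneg) auto
  have "En 1 m t + dd * U^2 / ?c \<le> (En 1 m 0 + dd * U^2 / ?c) * exp (?c * (t - 0))"
  proof (rule gronwall_derivative[OF _ En_deriv])
    show "continuous_on {0..T} (En 1 m)" by (rule continuous_on_subset[OF En_cont]) auto
    fix s assume s: "0 < s" "s < T"
    have sq: "(u s)^2 \<le> U^2" "(ud s)^2 \<le> U^2"
      using u[OF s] by (metis abs_ge_zero power2_abs power_mono)+
    have "2 * lam n * w n s * (kap n * w n s + a n * u s + b n * ud s) \<le> 2 * \<bar>qc\<bar> * (lam n * (w n s)^2) + (a n)^2 * U^2 + (b n)^2 * U^2"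
      if "n \<ge> 1" for n
    proof -
      let ?x = "lam n * w n s"
      have "2 * lam n * w n s * (kap n * w n s + a n * u s + b n * ud s)
        = 2 * qc * (lam n * (w n s)^2) + (2 * ?x * (a n * u s) - ?x^2) + (2 * ?x * (b n * ud s) - ?x^2)"
        by (simp add: kap_def power2_eq_square algebra_simps)
      also have "2 * ?x * (a n * u s) - ?x^2 \<le> (a n * u s)^2" using sum_squares_bound[of ?x "a n * u s"] by simp
      also have "2 * ?x * (b n * ud s) - ?x^2 \<le> (b n * ud s)^2" using sum_squares_bound[of ?x "b n * ud s"] by simp
      also have "(a n * u s)^2 \<le> (a n)^2 * U^2" unfolding power_mult_distrib by (rule mult_left_mono[OF sq(1)]) simp
      also have "(b n * ud s)^2 \<le> (b n)^2 * U^2" unfolding power_mult_distrib by (rule mult_left_mono[OF sq(2)]) simp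
      also have "2 * qc * (lam n * (w n s)^2) \<le> 2 * \<bar>qc\<bar> * (lam n * (w n s)^2)"
        using lam_pos[OF that] by (intro mult_right_mono) auto
      finally show ?thesis by simp
    qed
    then have "(\<Sum>n=1..m. 2 * lam n * w n s * (kap n * w n s + a n * u s + b n * ud s))
        \<le> (\<Sum>n=1..m. 2 * \<bar>qc\<bar> * (lam n * (w n s)^2) + (a n)^2 * U^2 + (b n)^2 * U^2)"
      by (intro sum_mono) auto
    also have "\<dots> = 2 * \<bar>qc\<bar> * En 1 m s + ((\<Sum>n=1..m. (a n)^2) + (\<Sum>n=1..m. (b n)^2)) * U^2"
      by (simp only: En_def sum.distrib sum_distrib_left sum_distrib_right distrib_right)
    also have "\<dots> \<le> ?c * En 1 m s + dd * U^2"
    proof (rule add_mono)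
      show "2 * \<bar>qc\<bar> * En 1 m s \<le> ?c * En 1 m s" using En_nonneg[of 1 m s] by (intro mult_right_mono) auto
      show "((\<Sum>n=1..m. (a n)^2) + (\<Sum>n=1..m. (b n)^2)) * U^2 \<le> dd * U^2"
        unfolding dd_def using sum_a_le[of 1 m] sum_b_le[of 1 m] by (intro mult_right_mono add_mono) auto
    qed
    finally show "(\<Sum>n=1..m. 2 * lam n * w n s * (kap n * w n s + a n * u s + b n * ud s)) \<le> ?c * En 1 m s + dd * U^2" .
  qed (use T in auto)
  moreover have "dd * U^2 / ?c \<le> dd * U^2 / 1" using dd by (intro divide_left_mono) auto
  moreover have "0 \<le> dd * U^2 / ?c" using dd by simp
  moreover have "(En 1 m 0 + dd * U^2 / ?c) * exp (?c * (t - 0)) \<le> (En 1 m 0 + dd * U^2) * exp (?c * T)"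
    using T dd En_nonneg[of 1 m 0] calculation(2) by (intro mult_mono) (auto intro!: mult_left_mono)
  ultimately show ?thesis by linarith
qed

end

lemma sum_from_1: "(\<Sum>n=1..m. g n) = (\<Sum>n<m. g (Suc n))"
  by (simp add: sum.atLeast1_atMost_eq)

section \<open>Point evaluation and local boundedness\<close>

context closed_loop begin

text \<open>Moving a factor \<open>sqrt (lam n)\<close> from the point values to the coefficients
  before applying Cauchy-Schwarz makes the energy appear.\<close>

lemma point_sum_CS:
  assumes "k \<ge> 1"
  shows "(\<Sum>n=k..m. w n t * phi n 0)^2 \<le> (\<Sum>n. (phi (n + k) 0)^2 / lam (n + k)) * En k m t"
proof -
  have l: "lam n > 0" if "n \<in> {k..m}" for n using lam_pos[of n] that assms by simp
  have "(\<Sum>n=k..m. w n t * phi n 0) = (\<Sum>n=k..m. (phi n 0 / sqrt (lam n)) * (sqrt (lam n) * w n t))"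
    by (intro sum.cong refl) (use l in \<open>fastforce\<close>)
  also have "\<dots>^2 \<le> (\<Sum>n=k..m. (phi n 0 / sqrt (lam n))^2) * (\<Sum>n=k..m. (sqrt (lam n) * w n t)^2)"
    by (rule Cauchy_Schwarz_ineq_sum)
  also have "(\<Sum>n=k..m. (phi n 0 / sqrt (lam n))^2) = (\<Sum>n=k..m. (phi n 0)^2 / lam n)"
    using l by (intro sum.cong refl) (simp add: power_divide less_imp_le)
  also have "(\<Sum>n=k..m. (sqrt (lam n) * w n t)^2) = En k m t"
    unfolding En_def using l by (intro sum.cong refl) (simp add: power_mult_distrib less_imp_le)
  also have "(\<Sum>n=k..m. (phi n 0)^2 / lam n) * En k m t \<le> (\<Sum>n. (phi (n + k) 0)^2 / lam (n + k)) * En k m t"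
    by (intro mult_right_mono sum_phi_le En_nonneg assms)
  finally show ?thesis .
qed

lemma En_le_En_1: "k \<ge> 1 \<Longrightarrow> En k m t \<le> En 1 m t"
  unfolding En_def by (rule sum_mono2) (use lam_nonneg in auto)

lemma point_weights_tail_nonneg: "k \<ge> 1 \<Longrightarrow> 0 \<le> (\<Sum>n. (phi (n + k) 0)^2 / lam (n + k))"
  using sum_phi_le[of k 0] by simp

text \<open>The trace is known only as the limit of its modal series, so the estimate is proved for
  finite sections and passed to the limit.\<close>

lemma y_tail_bound:
  assumes t: "t \<ge> 0" and B: "\<And>m. En 1 m t \<le> B"
  shows "(y t - (\<Sum>n=1..k. w n t * phi n 0))^2 \<le> (\<Sum>n. (phi (n + (k + 1)) 0)^2 / lam (n + (k + 1))) * B"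
proof -
  let ?s = "\<lambda>m. \<Sum>n=1..m. w n t * phi n 0"
  have "?s \<longlonglongrightarrow> y t" using y_sums[OF t] unfolding sums_def sum_from_1 .
  then have lim: "(\<lambda>m. (?s m - ?s k)^2) \<longlonglongrightarrow> (y t - ?s k)^2" by (intro tendsto_intros)
  have "(?s m - ?s k)^2 \<le> (\<Sum>n. (phi (n + (k + 1)) 0)^2 / lam (n + (k + 1))) * B" if "m \<ge> k" for m
  proof -
    have "?s m - ?s k = (\<Sum>n=k+1..m. w n t * phi n 0)"
      using sum.ub_add_nat[of 1 k "\<lambda>n. w n t * phi n 0" "m - k"] that by simp
    also have "\<dots>^2 \<le> (\<Sum>n. (phi (n + (k + 1)) 0)^2 / lam (n + (k + 1))) * En (k + 1) m t" by (rule point_sum_CS) simp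
    also have "\<dots> \<le> (\<Sum>n. (phi (n + (k + 1)) 0)^2 / lam (n + (k + 1))) * B"
      by (intro mult_left_mono point_weights_tail_nonneg order_trans[OF En_le_En_1 B]) simp_all
    finally show ?thesis .
  qed
  then show ?thesis by (intro LIMSEQ_le_const2[OF lim]) blast
qed

lemma y_bound:
  assumes "t \<ge> 0" "\<And>m. En 1 m t \<le> B"
  shows "(y t)^2 \<le> (\<Sum>n. (phi (n + 1) 0)^2 / lam (n + 1)) * B"
  using y_tail_bound[OF assms, of 0] by simp

lemma En_le_energy: "t \<ge> 0 \<Longrightarrow> En 1 m t \<le> (\<Sum>n. lam (Suc n) * (w (Suc n) t)^2)"
  unfolding En_def sum_from_1
  using lam_nonneg by (intro sum_le_suminf energy_summable) auto

lemma innovation_bound: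
  assumes "\<And>k. 1 \<le> k \<Longrightarrow> k \<le> N \<Longrightarrow> \<bar>zh k t\<bar> \<le> B" "\<bar>ue (t - h)\<bar> \<le> B" "\<bar>ym t\<bar> \<le> B"
  shows "\<bar>v t\<bar> \<le> ((\<Sum>k=1..N. \<bar>phi k 0\<bar>) + (\<Sum>k=1..N. \<bar>b k * phi k 0\<bar>) + 1) * B"
proof -
  have "v t = (\<Sum>k=1..N. phi k 0 * zh k t) + (\<Sum>k=1..N. b k * phi k 0 * ue (t - h)) - ym t"
    by (simp add: innovation_def algebra_simps sum.distrib)
  moreover have "\<bar>\<Sum>k=1..N. phi k 0 * zh k t\<bar> \<le> (\<Sum>k=1..N. \<bar>phi k 0\<bar>) * B"
    by (rule abs_sum_mult_le) (use assms in auto)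
  moreover have "\<bar>\<Sum>k=1..N. b k * phi k 0 * ue (t - h)\<bar> \<le> (\<Sum>k=1..N. \<bar>b k * phi k 0\<bar>) * B"
    by (rule abs_sum_mult_le) (use assms in auto)
  ultimately show ?thesis using assms(3) by (simp add: distrib_right)
qed

lemma gain_bound:
  assumes "\<And>i. i < N0 \<Longrightarrow> \<bar>x i\<bar> \<le> B" shows "\<bar>gain x\<bar> \<le> (\<Sum>j<N0. \<bar>K $$ (0,j)\<bar>) * B"
  unfolding gain_def by (rule abs_sum_mult_le) (use assms in auto)

definition cud :: real where
  "cud = (\<Sum>j<N0. \<bar>K $$ (0,j)\<bar>) * (\<Sum>n=1..N. \<bar>kap n\<bar> + \<bar>beta n\<bar> + \<bar>exp (kap n * h) * gL n\<bar>)"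

lemma cud_nonneg: "cud \<ge> 0" unfolding cud_def by (intro mult_nonneg_nonneg sum_nonneg) auto

lemma ud_bound:
  assumes "\<And>n. 1 \<le> n \<Longrightarrow> n \<le> N \<Longrightarrow> \<bar>Z n t\<bar> \<le> B" "\<bar>u t\<bar> \<le> B" "\<bar>v t\<bar> \<le> B"
  shows "\<bar>ud t\<bar> \<le> cud * B"
proof -
  have B: "B \<ge> 0" using assms(3) by linarith
  have "\<bar>Z' n t\<bar> \<le> (\<Sum>n=1..N. \<bar>kap n\<bar> + \<bar>beta n\<bar> + \<bar>exp (kap n * h) * gL n\<bar>) * B" if n: "1 \<le> n" "n \<le> N" for n
  proof -
    have "\<bar>Z' n t\<bar> \<le> \<bar>kap n * Z n t\<bar> + \<bar>beta n * u t\<bar> + \<bar>exp (kap n * h) * gL n * v t\<bar>"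
      unfolding pred'_def by linarith
    also have "\<dots> \<le> \<bar>kap n\<bar> * B + \<bar>beta n\<bar> * B + \<bar>exp (kap n * h) * gL n\<bar> * B"
      unfolding abs_mult[of _ "Z n t"] abs_mult[of _ "u t"] abs_mult[of _ "v t"] using assms n
      by (intro add_mono mult_left_mono) auto
    also have "\<dots> = (\<bar>kap n\<bar> + \<bar>beta n\<bar> + \<bar>exp (kap n * h) * gL n\<bar>) * B" by (simp add: distrib_right)
    also have "\<dots> \<le> (\<Sum>n=1..N. \<bar>kap n\<bar> + \<bar>beta n\<bar> + \<bar>exp (kap n * h) * gL n\<bar>) * B"
      using n B by (intro mult_right_mono member_le_sum[of n "{1..N}" "\<lambda>n. \<bar>kap n\<bar> + \<bar>beta n\<bar> + \<bar>exp (kap n * h) * gL n\<bar>"]) auto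
    finally show ?thesis .
  qed
  then show ?thesis unfolding u'_def cud_def mult.assoc using NN by (intro gain_bound) auto
qed

lemma Z_bound:
  assumes "\<bar>zh n t\<bar> \<le> B" "\<And>s. t - h \<le> s \<Longrightarrow> s \<le> t \<Longrightarrow> \<bar>ue s\<bar> \<le> B"
  shows "\<bar>Z n t\<bar> \<le> (exp (kap n * h) + h * exp (\<bar>kap n\<bar> * h) * \<bar>beta n\<bar>) * B"
proof -
  have g: "continuous_on UNIV (\<lambda>s. beta n * ue s)" by (intro continuous_intros ue_cont)
  have "\<bar>delay_int (kap n) h (\<lambda>s. beta n * ue s) t\<bar> \<le> h * exp (\<bar>kap n\<bar> * h) * (\<bar>beta n\<bar> * B)"
    by (rule delay_int_bound[OF g less_imp_le[OF h]]) (simp add: abs_mult assms mult_left_mono)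
  moreover have "\<bar>exp (kap n * h) * zh n t\<bar> \<le> exp (kap n * h) * B"
    using assms by (simp add: abs_mult)
  ultimately show ?thesis unfolding pred_def by (simp add: distrib_right mult.assoc)
qed

text \<open>No regularity in time is assumed for the trace \<open>y\<close>, so its boundedness is propagated over
  intervals of length \<open>h\<close>: on \<open>[0, (k+1)h]\<close> the controller only sees \<open>y\<close> on \<open>[0, kh]\<close>.\<close>
lemma energy_locally_bounded: "\<exists>B. \<forall>t m. 0 \<le> t \<longrightarrow> t \<le> T \<longrightarrow> En 1 m t \<le> B"
proof -
  have "\<exists>B. \<forall>t m. 0 \<le> t \<longrightarrow> t \<le> real k * h \<longrightarrow> En 1 m t \<le> B" for k
  proof (induction k)
    case 0
    show ?case using En_le_energy[of 0] by (intro exI[of _ "\<Sum>n. lam (Suc n) * (w (Suc n) 0)^2"]) auto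
  next
    case (Suc k)
    then obtain B where B: "\<And>t m. 0 \<le> t \<Longrightarrow> t \<le> real k * h \<Longrightarrow> En 1 m t \<le> B" by blast
    let ?T = "real (Suc k) * h"
    have T: "?T \<ge> 0" using h by simp
    have bounded: "\<exists>c. \<forall>t. 0 \<le> t \<longrightarrow> t \<le> ?T \<longrightarrow> \<bar>g t\<bar> \<le> c" if "continuous_on {0..} g" for g :: "real \<Rightarrow> real"
    proof -
      have "continuous_on {0..?T} g" by (rule continuous_on_subset[OF that]) auto
      from compact_imp_bounded[OF compact_continuous_image[OF this compact_Icc]]
      obtain c where "\<forall>x\<in>g ` {0..?T}. norm x \<le> c" unfolding bounded_iff by blast
      then show ?thesis by (intro exI[of _ c]) auto
    qed
    have "\<exists>c. \<forall>n\<in>{1..N}. \<forall>t. 0 \<le> t \<longrightarrow> t \<le> ?T \<longrightarrow> \<bar>zh n t\<bar> \<le> c n"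
      by (rule bchoice) (use bounded[OF zh_cont] in auto)
    then obtain c1 where c1: "\<And>n t. n \<in> {1..N} \<Longrightarrow> 0 \<le> t \<Longrightarrow> t \<le> ?T \<Longrightarrow> \<bar>zh n t\<bar> \<le> c1 n" by blast
    have "\<exists>c. \<forall>n\<in>{1..N}. \<forall>t. 0 \<le> t \<longrightarrow> t \<le> ?T \<longrightarrow> \<bar>Z n t\<bar> \<le> c n"
      by (rule bchoice) (use bounded[OF Z_cont] in auto)
    then obtain c2 where c2: "\<And>n t. n \<in> {1..N} \<Longrightarrow> 0 \<le> t \<Longrightarrow> t \<le> ?T \<Longrightarrow> \<bar>Z n t\<bar> \<le> c2 n" by blast
    obtain c3 where c3: "\<And>t. 0 \<le> t \<Longrightarrow> t \<le> ?T \<Longrightarrow> \<bar>u t\<bar> \<le> c3" using bounded[OF u_cont] by blast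
    let ?yb = "sqrt ((\<Sum>n. (phi (n + 1) 0)^2 / lam (n + 1)) * B)"
    \<comment> \<open>One number that bounds observer, predictors and control on the new interval,
      the trace on the preceding one, and the history.\<close>
    define D where "D = (\<Sum>n=1..N. \<bar>c1 n\<bar>) + (\<Sum>n=1..N. \<bar>c2 n\<bar>) + \<bar>c3\<bar> + \<bar>?yb\<bar> + \<bar>Y\<bar>"
    have le: "\<bar>c1 n\<bar> \<le> D" "\<bar>c2 n\<bar> \<le> D" if "n \<in> {1..N}" for n
      using member_le_sum[OF that, of "\<lambda>n. \<bar>c1 n\<bar>"] member_le_sum[OF that, of "\<lambda>n. \<bar>c2 n\<bar>"]
        sum_nonneg[of "{1..N}" "\<lambda>n. \<bar>c1 n\<bar>"] sum_nonneg[of "{1..N}" "\<lambda>n. \<bar>c2 n\<bar>"] by (auto simp: D_def)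
    have D: "\<bar>c3\<bar> \<le> D" "\<bar>?yb\<bar> \<le> D" "\<bar>Y\<bar> \<le> D" "0 \<le> D"
      using sum_nonneg[of "{1..N}" "\<lambda>n. \<bar>c1 n\<bar>"] sum_nonneg[of "{1..N}" "\<lambda>n. \<bar>c2 n\<bar>"] by (auto simp: D_def)
    define cv where "cv = (\<Sum>k=1..N. \<bar>phi k 0\<bar>) + (\<Sum>k=1..N. \<bar>b k * phi k 0\<bar>) + 1"
    have cv: "cv \<ge> 1" unfolding cv_def by (simp add: sum_nonneg)
    have ub: "\<bar>u s\<bar> \<le> D" if "0 \<le> s" "s \<le> ?T" for s using c3[OF that] D by linarith
    have zb: "\<bar>zh n s\<bar> \<le> D" "\<bar>Z n s\<bar> \<le> D" if "1 \<le> n" "n \<le> N" "0 \<le> s" "s \<le> ?T" for n s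
      using c1[of n s] c2[of n s] le[of n] that by force+
    have ymb: "\<bar>ym s\<bar> \<le> D" if s: "0 < s" "s < ?T" for s
    proof (cases "s < h")
      case True
      then show ?thesis using ym_early[of s] s D by simp
    next
      case False
      then have s': "0 \<le> s - h" "s - h \<le> real k * h" using s by (auto simp: algebra_simps)
      have "\<bar>y (s - h)\<bar> \<le> ?yb" using y_bound[OF s'(1) B[OF s']] by (rule real_le_rsqrt[of "\<bar>y (s - h)\<bar>", simplified])
      then show ?thesis using ym_late[of s] False D by simp
    qed
    have vb: "\<bar>v s\<bar> \<le> cv * D" if s: "0 < s" "s < ?T" for s
      unfolding cv_def
    proof (rule innovation_bound)
      show "\<bar>ue (s - h)\<bar> \<le> D" unfolding ue_max using s h T by (intro ub) auto
    qed (use zb s ymb in auto)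
    have cvD: "D \<le> cv * D" using cv D by (simp add: mult_le_cancel_right1)
    have udb: "\<bar>ud s\<bar> \<le> cud * (cv * D)" if s: "0 < s" "s < ?T" for s
      using zb[of _ s] ub[of s] vb[OF s] s cvD by (intro ud_bound) force+
    define U where "U = D + cud * (cv * D)"
    have U: "D \<le> U" "cud * (cv * D) \<le> U" unfolding U_def using D cud_nonneg cv by auto
    let ?S0 = "\<Sum>n. lam (Suc n) * (w (Suc n) 0)^2"
    show ?case
    proof (intro exI allI impI)
      fix t m assume t: "0 \<le> t" "t \<le> ?T"
      have "En 1 m t \<le> (En 1 m 0 + dd * U^2) * exp ((2 * \<bar>qc\<bar> + 1) * ?T)"
      proof (rule energy_growth[OF t])
        fix s assume s: "0 < s" "s < ?T"
        show "\<bar>u s\<bar> \<le> U" using ub[of s] s U by simp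
        show "\<bar>ud s\<bar> \<le> U" using udb[OF s] U by simp
      qed
      also have "\<dots> \<le> (?S0 + dd * U^2) * exp ((2 * \<bar>qc\<bar> + 1) * ?T)"
        using En_le_energy[of 0 m] by (intro mult_right_mono) auto
      finally show "En 1 m t \<le> (?S0 + dd * U^2) * exp ((2 * \<bar>qc\<bar> + 1) * ?T)" .
    qed
  qed
  moreover obtain k :: nat where "T \<le> real k * h"
    using reals_Archimedean3[OF h] by (meson less_imp_le)
  ultimately show ?thesis by (meson order_trans)
qed

end

section \<open>The initial interval \<open>[0, h]\<close>\<close>

context modal begin

text \<open>Before time \<open>h\<close> the delayed input is the constant \<open>u0\<close> and the
  measurement comes from the history. So the observer is a linear system with bounded forcing,
  decoupled from plant and control. Its innovation then forces a second linear system for the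
  predictors, in which the feedback is part of the matrix.\<close>

lemma initial_phase_bound:
  "\<exists>C\<ge>0. \<forall>zn zh u u0 y ym Y R. closed_loop lam beta phi qc h N0 N K L a b zn zh u u0 y ym Y \<longrightarrow>
     \<bar>u0\<bar> \<le> R \<longrightarrow> Y \<le> R \<longrightarrow> (\<forall>n\<in>{1..N}. \<bar>zh n 0\<bar> \<le> R) \<longrightarrow>
     (\<forall>t. 0 \<le> t \<longrightarrow> t \<le> h \<longrightarrow> (\<forall>n\<in>{1..N}. \<bar>zh n t\<bar> \<le> C * R \<and> \<bar>pred zh u u0 n t\<bar> \<le> C * R) \<and> \<bar>u t\<bar> \<le> C * R) \<and>
     (\<forall>t. 0 < t \<longrightarrow> t < h \<longrightarrow> \<bar>u' zh u u0 ym t\<bar> \<le> C * R)"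
proof -
  let ?I = "{1..N}"
  \<comment> \<open>\<open>Kx\<close> extends the feedback gain by zero to all \<open>N\<close>
    modes. The matrix \<open>m1\<close> contains the output injection of the observer and
    \<open>m2\<close> the feedback; \<open>u0 * sb\<close> is the output caused by the constant
    input through the lift.\<close>
  define Kx where "Kx k = (if k \<le> N0 then K $$ (0, k - 1) else 0)" for k
  define m1 where "m1 n k = (if n = k then kap n else 0) - gL n * phi k 0" for n k
  define m2 where "m2 n k = (if n = k then kap n else 0) + beta n * Kx k" for n k
  define sb where "sb = (\<Sum>k=1..N. b k * phi k 0)"
  define c1 where "c1 = 1 + (\<Sum>n=1..N. \<bar>beta n\<bar> + \<bar>gL n\<bar> * (\<bar>sb\<bar> + 1))"
  define cv where "cv = (\<Sum>k=1..N. \<bar>phi k 0\<bar>) + (\<Sum>k=1..N. \<bar>b k * phi k 0\<bar>) + 1"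
  obtain C1 where L1: "linear_ode_const ?I h m1 C1" using linear_ode_const_exists[of ?I] by auto
  obtain C2 where L2: "linear_ode_const ?I h m2 C2" using linear_ode_const_exists[of ?I] by auto
  have C1: "C1 \<ge> 0" and C2: "C2 \<ge> 0" using L1 L2 unfolding linear_ode_const_def by blast+
  have c1: "c1 \<ge> 1" unfolding c1_def by (simp add: sum_nonneg)
  have cv: "cv \<ge> 1" unfolding cv_def by (simp add: sum_nonneg)
  \<comment> \<open>The added 1 makes \<open>z1 * R\<close> dominate \<open>R\<close> as well, which
    bounds the input and the measurement.\<close>
  define z1 where "z1 = C1 * c1 + 1"
  have z1: "z1 \<ge> 1" using C1 c1 by (simp add: z1_def)
  define c2 where "c2 = (\<Sum>n=1..N. \<bar>exp (kap n * h) * gL n\<bar> * (cv * z1) + (exp (kap n * h) + h * exp (\<bar>kap n\<bar> * h) * \<bar>beta n\<bar>))"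
  have c2: "c2 \<ge> 0" unfolding c2_def using cv z1 h by (intro sum_nonneg add_nonneg_nonneg mult_nonneg_nonneg) auto
  define sK where "sK = (\<Sum>j<N0. \<bar>K $$ (0,j)\<bar>)"
  have sK: "sK \<ge> 0" by (simp add: sK_def sum_nonneg)
  define cu where "cu = (\<Sum>j<N0. \<bar>K $$ (0,j)\<bar>) * (\<Sum>n=1..N. \<bar>kap n\<bar> + \<bar>beta n\<bar> + \<bar>exp (kap n * h) * gL n\<bar>)"
  have cu: "cu \<ge> 0" unfolding cu_def by (intro mult_nonneg_nonneg sum_nonneg) auto
  define D where "D = z1 + C2 * c2 + sK * (C2 * c2) + cv * z1"
  have D: "z1 \<le> D" "C2 * c2 \<le> D" "sK * (C2 * c2) \<le> D" "cv * z1 \<le> D" "0 \<le> D"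
    unfolding D_def using z1 C2 c2 sK cv by (auto intro!: add_nonneg_nonneg mult_nonneg_nonneg simp: add_increasing add_increasing2)
  show ?thesis
  proof (intro exI[of _ "D + cu * D"] conjI allI impI)
    show "D + cu * D \<ge> 0" using D cu by simp
    fix zn zh u u0 y ym Y R
    assume cl: "closed_loop lam beta phi qc h N0 N K L a b zn zh u u0 y ym Y"
      and R: "\<bar>u0\<bar> \<le> R" "Y \<le> R" "\<forall>n\<in>{1..N}. \<bar>zh n 0\<bar> \<le> R"
    interpret c: closed_loop lam beta phi qc h N0 N K L a b zn zh u u0 y ym Y by (rule cl)
    have R0: "R \<ge> 0" using R(1) by linarith
    have ue0: "c.ue (t - h) = u0" if "t \<le> h" for t using that by (simp add: uext_def)
    have ymR: "\<bar>ym t\<bar> \<le> R" if "0 < t" "t < h" for t using c.ym_early[of t] that R by simp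
    have zh1: "\<bar>zh n t\<bar> \<le> z1 * R" if "0 \<le> t" "t \<le> h" "n \<in> ?I" for n t
    proof -
      have "\<bar>zh n t\<bar> \<le> C1 * (c1 * R)"
      proof (rule linear_ode_constD[OF L1, where x=zh and n=n and t=t and f="\<lambda>n t. beta n * u0 - gL n * (u0 * sb - ym t)"])
        show "continuous_on {0..h} (zh n)" if "n \<in> ?I" for n
          using that by (intro continuous_on_subset[OF c.zh_cont]) auto
        show "\<bar>zh n 0\<bar> \<le> c1 * R" if "n \<in> ?I" for n
          using R(3) that mult_right_mono[OF c1 R0] by fastforce
        fix n t assume n: "n \<in> ?I" and t: "0 < t" "t < h"
        have "\<bar>u0 * sb - ym t\<bar> \<le> (\<bar>sb\<bar> + 1) * R"
        proof -
          have "\<bar>u0 * sb\<bar> \<le> R * \<bar>sb\<bar>" unfolding abs_mult using R(1) by (intro mult_right_mono) auto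
          then show ?thesis using ymR[OF t] by (simp add: algebra_simps)
        qed
        then have "\<bar>gL n * (u0 * sb - ym t)\<bar> \<le> \<bar>gL n\<bar> * ((\<bar>sb\<bar> + 1) * R)" unfolding abs_mult by (intro mult_left_mono) auto
        moreover have "\<bar>beta n * u0\<bar> \<le> \<bar>beta n\<bar> * R" unfolding abs_mult using R(1) by (intro mult_left_mono) auto
        ultimately have "\<bar>beta n * u0 - gL n * (u0 * sb - ym t)\<bar> \<le> (\<bar>beta n\<bar> + \<bar>gL n\<bar> * (\<bar>sb\<bar> + 1)) * R"
          by (simp add: distrib_right mult.assoc)
        also have "\<dots> \<le> c1 * R"
        proof (rule mult_right_mono[OF _ R0])
          have "\<bar>beta n\<bar> + \<bar>gL n\<bar> * (\<bar>sb\<bar> + 1) \<le> (\<Sum>n=1..N. \<bar>beta n\<bar> + \<bar>gL n\<bar> * (\<bar>sb\<bar> + 1))"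
            by (rule member_le_sum[OF n]) auto
          then show "\<bar>beta n\<bar> + \<bar>gL n\<bar> * (\<bar>sb\<bar> + 1) \<le> c1" by (simp add: c1_def)
        qed
        finally show "\<bar>beta n * u0 - gL n * (u0 * sb - ym t)\<bar> \<le> c1 * R" .
        have "(zh n has_real_derivative (kap n * zh n t + beta n * c.ue (t - h) - gL n * c.v t)) (at t)"
          using n t by (intro c.zh_deriv) auto
        moreover have vE: "c.v t = (\<Sum>k\<in>?I. phi k 0 * zh k t) + u0 * sb - ym t"
        proof -
          have "c.v t = (\<Sum>k\<in>?I. phi k 0 * zh k t + u0 * (b k * phi k 0)) - ym t"
            unfolding innovation_def ue0[OF less_imp_le[OF t(2)]] by (simp add: algebra_simps)
          then show ?thesis by (simp only: sum.distrib sb_def sum_distrib_left)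
        qed
        moreover have mE: "(\<Sum>k\<in>?I. m1 n k * zh k t) = kap n * zh n t - gL n * (\<Sum>k\<in>?I. phi k 0 * zh k t)"
        proof -
          have "(\<Sum>k\<in>?I. m1 n k * zh k t) = (\<Sum>k\<in>?I. (if n = k then kap n * zh k t else 0) - gL n * (phi k 0 * zh k t))"
            by (rule sum.cong) (auto simp: m1_def algebra_simps)
          then show ?thesis using n by (simp add: sum_subtractf sum_distrib_left)
        qed
        ultimately show "(zh n has_real_derivative ((\<Sum>k\<in>?I. m1 n k * zh k t) + (beta n * u0 - gL n * (u0 * sb - ym t)))) (at t)"
          by (elim DERIV_cong) (simp only: vE mE ue0[OF less_imp_le[OF t(2)]], simp add: algebra_simps)
      qed (use that in auto)
      also have "\<dots> \<le> z1 * R" using R0 by (simp add: z1_def distrib_right)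
      finally show ?thesis .
    qed
    have Rz: "R \<le> z1 * R" using mult_right_mono[OF z1 R0] by simp
    have v1: "\<bar>c.v t\<bar> \<le> cv * (z1 * R)" if t: "0 < t" "t < h" for t
      unfolding cv_def
    proof (rule c.innovation_bound)
      show "\<bar>zh k t\<bar> \<le> z1 * R" if "1 \<le> k" "k \<le> N" for k using zh1[of t k] t that by auto
      show "\<bar>c.ue (t - h)\<bar> \<le> z1 * R" using ue0[of t] t R(1) Rz by simp
      show "\<bar>ym t\<bar> \<le> z1 * R" using ymR[OF t] Rz by simp
    qed
    have u_sum: "u t = (\<Sum>k\<in>?I. Kx k * c.Z k t)" if "t \<ge> 0" for t
    proof -
      have "(\<Sum>k\<in>?I. Kx k * c.Z k t) = (\<Sum>k=1..N. if k \<le> N0 then K $$ (0, k - 1) * c.Z k t else 0)"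
        by (rule sum.cong) (auto simp: Kx_def)
      also have "\<dots> = gain (\<lambda>i. c.Z (i+1) t)" unfolding sum_if_le_reindex[OF NN] gain_def by simp
      finally show ?thesis using c.u_pred[OF that] by simp
    qed
    have Z1: "\<bar>c.Z n t\<bar> \<le> C2 * c2 * R" if "0 \<le> t" "t \<le> h" "n \<in> ?I" for n t
    proof -
      have "\<bar>c.Z n t\<bar> \<le> C2 * (c2 * R)"
      proof (rule linear_ode_constD[OF L2, where x="c.Z" and n=n and t=t and f="\<lambda>n t. - (exp (kap n * h) * gL n * c.v t)"])
        have mem: "\<bar>exp (kap n * h) * gL n\<bar> * (cv * z1) + (exp (kap n * h) + h * exp (\<bar>kap n\<bar> * h) * \<bar>beta n\<bar>) \<le> c2" if "n \<in> ?I" for n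
          unfolding c2_def using cv z1 h by (intro member_le_sum[OF that]) (auto intro!: add_nonneg_nonneg mult_nonneg_nonneg)
        show "continuous_on {0..h} (c.Z n)" if "n \<in> ?I" for n
          using that by (intro continuous_on_subset[OF c.Z_cont]) auto
        show "\<bar>c.Z n 0\<bar> \<le> c2 * R" if n: "n \<in> ?I" for n
        proof -
          have "\<bar>c.Z n 0\<bar> \<le> (exp (kap n * h) + h * exp (\<bar>kap n\<bar> * h) * \<bar>beta n\<bar>) * R"
            by (rule c.Z_bound) (use R n in \<open>auto simp: uext_def\<close>)
          also have "\<dots> \<le> c2 * R"
          proof (rule mult_right_mono[OF order_trans[OF _ mem[OF n]] R0])
            have "0 \<le> \<bar>exp (kap n * h) * gL n\<bar> * (cv * z1)" using cv z1 by (intro mult_nonneg_nonneg) auto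
            then show "exp (kap n * h) + h * exp (\<bar>kap n\<bar> * h) * \<bar>beta n\<bar>
              \<le> \<bar>exp (kap n * h) * gL n\<bar> * (cv * z1) + (exp (kap n * h) + h * exp (\<bar>kap n\<bar> * h) * \<bar>beta n\<bar>)" by simp
          qed
          finally show ?thesis .
        qed
        fix n t assume n: "n \<in> ?I" and t: "0 < t" "t < h"
        have "\<bar>- (exp (kap n * h) * gL n * c.v t)\<bar> \<le> \<bar>exp (kap n * h) * gL n\<bar> * (cv * (z1 * R))"
          unfolding abs_minus abs_mult[of _ "c.v t"] by (rule mult_left_mono[OF v1[OF t]]) simp
        also have "\<dots> = \<bar>exp (kap n * h) * gL n\<bar> * (cv * z1) * R" by simp
        also have "\<dots> \<le> c2 * R"
        proof (rule mult_right_mono[OF order_trans[OF _ mem[OF n]] R0])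
          have "0 \<le> exp (kap n * h) + h * exp (\<bar>kap n\<bar> * h) * \<bar>beta n\<bar>" using h by (intro add_nonneg_nonneg mult_nonneg_nonneg) auto
          then show "\<bar>exp (kap n * h) * gL n\<bar> * (cv * z1)
              \<le> \<bar>exp (kap n * h) * gL n\<bar> * (cv * z1) + (exp (kap n * h) + h * exp (\<bar>kap n\<bar> * h) * \<bar>beta n\<bar>)" by simp
        qed
        finally show "\<bar>- (exp (kap n * h) * gL n * c.v t)\<bar> \<le> c2 * R" .
        have "(c.Z n has_real_derivative c.Z' n t) (at t)" using n t by (intro c.Z_deriv) auto
        moreover have "(\<Sum>k\<in>?I. m2 n k * c.Z k t) = kap n * c.Z n t + beta n * u t"
        proof -
          have "(\<Sum>k\<in>?I. m2 n k * c.Z k t) = (\<Sum>k\<in>?I. (if n = k then kap n * c.Z k t else 0) + beta n * (Kx k * c.Z k t))"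
            by (rule sum.cong) (auto simp: m2_def algebra_simps)
          then show ?thesis using n t by (simp add: sum.distrib sum_distrib_left[symmetric] u_sum)
        qed
        ultimately show "(c.Z n has_real_derivative ((\<Sum>k\<in>?I. m2 n k * c.Z k t) + - (exp (kap n * h) * gL n * c.v t))) (at t)"
          by (elim DERIV_cong) (simp add: pred'_def)
      qed (use that in auto)
      then show ?thesis by simp
    qed
    have u1: "\<bar>u t\<bar> \<le> sK * (C2 * c2) * R" if "0 \<le> t" "t \<le> h" for t
    proof -
      have "\<bar>gain (\<lambda>i. c.Z (i+1) t)\<bar> \<le> sK * (C2 * c2 * R)"
        unfolding sK_def using NN that by (intro c.gain_bound Z1) auto
      then show ?thesis using c.u_pred[OF that(1)] by simp
    qed
    have DR: "z1 * R \<le> D * R" "C2 * c2 * R \<le> D * R" "sK * (C2 * c2) * R \<le> D * R" "cv * z1 * R \<le> D * R" "D * R \<le> (D + cu * D) * R" "cu * (D * R) \<le> (D + cu * D) * R"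
      using D cu R0 by (auto intro!: mult_right_mono simp: distrib_right)
    {
      fix t assume t: "0 \<le> t" "t \<le> h"
      show "\<forall>n\<in>{1..N}. \<bar>zh n t\<bar> \<le> (D + cu * D) * R \<and> \<bar>pred zh u u0 n t\<bar> \<le> (D + cu * D) * R"
        using zh1[OF t] Z1[OF t] DR by (meson order_trans)
      show "\<bar>u t\<bar> \<le> (D + cu * D) * R" using u1[OF t] DR by linarith
    }
    fix t assume t: "0 < t" "t < h"
    have "\<bar>c.ud t\<bar> \<le> cu * (D * R)"
      unfolding cu_def c.cud_def[symmetric]
    proof (rule c.ud_bound)
      show "\<bar>c.Z n t\<bar> \<le> D * R" if "1 \<le> n" "n \<le> N" for n using Z1[of t n] that t DR by simp
      show "\<bar>u t\<bar> \<le> D * R" using u1[of t] t DR by simp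
      show "\<bar>c.v t\<bar> \<le> D * R" using v1[OF t] DR by simp
    qed
    then show "\<bar>u' zh u u0 ym t\<bar> \<le> (D + cu * D) * R" using DR by linarith
  qed
qed

end

section \<open>The state vector, its derivative and the tail of the trace\<close>

lemma stk_index:
  "i < (n + n) + (m + m) \<Longrightarrow> stk n m x1 x2 x3 x4 $ i = (if i < n then x1 i else if i < n + n then x2 (i - n)
     else if i < n + n + m then x3 (i - (n + n)) else x4 (i - (n + n + m)))"
  unfolding stk_def by (auto simp: not_less)

lemma stk_index_deriv:
  assumes "\<And>i. i < n \<Longrightarrow> (x1 i has_real_derivative x1' i) (at t)" "\<And>i. i < n \<Longrightarrow> (x2 i has_real_derivative x2' i) (at t)"
    "\<And>i. i < m \<Longrightarrow> (x3 i has_real_derivative x3' i) (at t)" "\<And>i. i < m \<Longrightarrow> (x4 i has_real_derivative x4' i) (at t)"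
    and i: "i < (n + n) + (m + m)"
  shows "((\<lambda>s. stk n m (\<lambda>i. x1 i s) (\<lambda>i. x2 i s) (\<lambda>i. x3 i s) (\<lambda>i. x4 i s) $ i) has_real_derivative stk n m x1' x2' x3' x4' $ i) (at t)"
  unfolding stk_index[OF i] using i assms(1)[of i] assms(2)[of "i - n"] assms(3)[of "i - (n + n)"] assms(4)[of "i - (n + n + m)"]
  by simp

lemma stk_index_cont:
  assumes "\<And>i. i < n \<Longrightarrow> continuous_on A (x1 i)" "\<And>i. i < n \<Longrightarrow> continuous_on A (x2 i)"
    "\<And>i. i < m \<Longrightarrow> continuous_on A (x3 i)" "\<And>i. i < m \<Longrightarrow> continuous_on A (x4 i)"
    and i: "i < (n + n) + (m + m)"
  shows "continuous_on A (\<lambda>s. stk n m (\<lambda>i. x1 i s) (\<lambda>i. x2 i s) (\<lambda>i. x3 i s) (\<lambda>i. x4 i s) $ i)"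
  unfolding stk_index[OF i] using i assms(1)[of i] assms(2)[of "i - n"] assms(3)[of "i - (n + n)"] assms(4)[of "i - (n + n + m)"]
  by (cases "i < n"; cases "i < n + n"; cases "i < n + n + m") auto

lemma quadratic_form_deriv:
  fixes P :: "real mat" and X :: "real \<Rightarrow> real vec" and X' :: "real vec"
  assumes P: "P \<in> carrier_mat n n" "P\<^sup>T = P" and X: "\<And>s. X s \<in> carrier_vec n" and X': "X' \<in> carrier_vec n"
    and d: "\<And>i. i < n \<Longrightarrow> ((\<lambda>s. X s $ i) has_real_derivative X' $ i) (at t)"
  shows "((\<lambda>s. scalar_prod (X s) (P *\<^sub>v X s)) has_real_derivative 2 * scalar_prod X' (P *\<^sub>v X t)) (at t)"
proof -
  have "((\<lambda>s. \<Sum>i<n. \<Sum>j<n. X s $ i * P $$ (i,j) * X s $ j) has_real_derivative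
      (\<Sum>i<n. \<Sum>j<n. X' $ i * P $$ (i,j) * X t $ j + X t $ i * P $$ (i,j) * X' $ j)) (at t)"
  proof (intro DERIV_sum)
    fix i j assume "i \<in> {..<n}" "j \<in> {..<n}"
    then have "((\<lambda>s. X s $ i * P $$ (i,j)) has_real_derivative X' $ i * P $$ (i,j)) (at t)" "((\<lambda>s. X s $ j) has_real_derivative X' $ j) (at t)"
      using d by (auto intro!: DERIV_cmult_right)
    from DERIV_mult[OF this]
    show "((\<lambda>s. X s $ i * P $$ (i,j) * X s $ j) has_real_derivative X' $ i * P $$ (i,j) * X t $ j + X t $ i * P $$ (i,j) * X' $ j) (at t)"
      by (simp add: mult_ac add_ac)
  qed
  moreover have "(\<Sum>i<n. \<Sum>j<n. X' $ i * P $$ (i,j) * X t $ j + X t $ i * P $$ (i,j) * X' $ j)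
      = scalar_prod X' (P *\<^sub>v X t) + scalar_prod (X t) (P *\<^sub>v X')"
    unfolding bilinear_sum[OF P(1) X X'] bilinear_sum[OF P(1) X' X] by (simp only: sum.distrib)
  moreover have "scalar_prod (X t) (P *\<^sub>v X') = scalar_prod X' (P *\<^sub>v X t)"
    using transpose_scalar[OF P(1) X X'] comm_scalar_prod[OF mult_mat_vec_carrier[OF P(1) X] X'] unfolding P(2) by simp
  ultimately show ?thesis unfolding bilinear_sum[OF P(1) X X] by simp
qed

lemma quadratic_form_cont:
  fixes P :: "real mat" and X :: "real \<Rightarrow> real vec"
  assumes P: "P \<in> carrier_mat n n" and X: "\<And>s. X s \<in> carrier_vec n"
    and c: "\<And>i. i < n \<Longrightarrow> continuous_on A (\<lambda>s. X s $ i)"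
  shows "continuous_on A (\<lambda>s. scalar_prod (X s) (P *\<^sub>v X s))"
  unfolding bilinear_sum[OF P X X] by (intro continuous_intros c) auto

lemma delay_int_nonneg: "(\<And>s. g s \<ge> 0) \<Longrightarrow> delay_int k h g t \<ge> 0"
  unfolding delay_int_def set_lebesgue_integral_def by (rule Bochner_Integration.integral_nonneg) simp

context closed_loop begin

abbreviation "e n t \<equiv> zn n (t - h) - zh n t"

text \<open>Predictors above \<open>N0\<close> are divided by \<open>lam\<close> because
  \<open>beta n / lam n\<close> is square summable. Errors above \<open>N0\<close> are multiplied by
  \<open>sqrt lam\<close>, which turns their output weights into the square summable
  \<open>phi n 0 / sqrt (lam n)\<close>. Both scalings keep the constants of the feasibility proof
  independent of \<open>N\<close>.\<close>

definition X :: "real \<Rightarrow> real vec" where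
  "X t = stk N0 MM (\<lambda>i. Z (i+1) t) (\<lambda>i. e (i+1) t) (\<lambda>i. Z (N0+i+1) t / lam (N0+i+1)) (\<lambda>i. sqrt (lam (N0+i+1)) * e (N0+i+1) t)"

definition \<zeta> :: "real \<Rightarrow> real" where "\<zeta> t = y (t - h) - (\<Sum>n=1..N. w n (t - h) * phi n 0)"

definition X' :: "real \<Rightarrow> real vec" where
  "X' t = stk N0 MM (d1 (\<lambda>i. Z (i+1) t) (\<lambda>i. e (i+1) t) (\<lambda>i. sqrt (lam (N0+i+1)) * e (N0+i+1) t) (\<zeta> t))
     (d2 (\<lambda>i. e (i+1) t) (\<lambda>i. sqrt (lam (N0+i+1)) * e (N0+i+1) t) (\<zeta> t))
     (d3 (\<lambda>i. Z (i+1) t) (\<lambda>i. Z (N0+i+1) t / lam (N0+i+1))) (d4 (\<lambda>i. sqrt (lam (N0+i+1)) * e (N0+i+1) t))"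

lemma X_carrier: "X t \<in> carrier_vec DD" and X'_carrier: "X' t \<in> carrier_vec DD"
  unfolding X_def X'_def by (rule stk_carrier)+

lemma sum_split_N0: "(\<Sum>n=1..N. g n) = (\<Sum>i<N0. g (i+1)) + (\<Sum>i<MM. g (N0+i+1))" for g :: "nat \<Rightarrow> real"
proof -
  have "(\<Sum>n=1..N. g n) = (\<Sum>i<N0 + MM. g (Suc i))" using NN by (simp add: sum_from_1[simplified])
  also have "(\<Sum>i<N0 + k. g (Suc i)) = (\<Sum>i<N0. g (Suc i)) + (\<Sum>i<k. g (Suc (N0 + i)))" for k
    by (induction k) simp_all
  finally show ?thesis by simp
qed

lemma ue_late: "t \<ge> h \<Longrightarrow> ue (t - h) = u (t - h)"
  unfolding ue_max by simp

text \<open>The signs are opposite because the errors are plant minus estimate and the innovation is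
  estimate minus measurement. From time \<open>h\<close> on the measurement is the delayed trace,
  and the lift terms match since both use \<open>u (t - h)\<close>.\<close>

lemma innov_eq:
  assumes "t \<ge> h"
  shows "innov (\<lambda>i. e (i+1) t) (\<lambda>i. sqrt (lam (N0+i+1)) * e (N0+i+1) t) (\<zeta> t) = - v t"
proof -
  have l: "sqrt (lam (N0+j+1)) > 0" for j using lam_pos[of "N0+j+1"] by simp
  have "(\<Sum>j<MM. phi (N0+j+1) 0 / sqrt (lam (N0+j+1)) * (sqrt (lam (N0+j+1)) * e (N0+j+1) t)) = (\<Sum>j<MM. phi (N0+j+1) 0 * e (N0+j+1) t)"
    by (intro sum.cong refl) (use l in \<open>simp add: less_imp_neq[THEN not_sym]\<close>)
  then have "innov (\<lambda>i. e (i+1) t) (\<lambda>i. sqrt (lam (N0+i+1)) * e (N0+i+1) t) (\<zeta> t) = (\<Sum>n=1..N. phi n 0 * e n t) + \<zeta> t"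
    unfolding innov_def sum_split_N0[of "\<lambda>n. phi n 0 * e n t"] by simp
  also have "\<dots> = y (t - h) - (\<Sum>n=1..N. (zh n t + b n * ue (t - h)) * phi n 0)"
  proof -
    have "(\<Sum>n=1..N. phi n 0 * e n t) - (\<Sum>n=1..N. w n (t - h) * phi n 0) = - (\<Sum>n=1..N. (zh n t + b n * ue (t - h)) * phi n 0)"
      unfolding sum_subtractf[symmetric] sum_negf[symmetric] ue_late[OF assms] by (rule sum.cong) (simp_all add: algebra_simps)
    then show ?thesis by (simp add: \<zeta>_def)
  qed
  also have "\<dots> = - v t" unfolding innovation_def ym_late[OF assms] by simp
  finally show ?thesis .
qed

lemma gain_X: "t \<ge> 0 \<Longrightarrow> gain (\<lambda>i. Z (i+1) t) = u t"
  using u_pred by simp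

lemma Z'_d1:
  assumes t: "t \<ge> h" and i: "i < N0"
  shows "Z' (i+1) t = d1 (\<lambda>i. Z (i+1) t) (\<lambda>i. e (i+1) t) (\<lambda>i. sqrt (lam (N0+i+1)) * e (N0+i+1) t) (\<zeta> t) i"
  unfolding pred'_def d1_def innov_eq[OF t] using gain_X[of t] t h i by (simp add: gL_def)

lemma ud_d1:
  assumes t: "t \<ge> h"
  shows "gain (d1 (\<lambda>i. Z (i+1) t) (\<lambda>i. e (i+1) t) (\<lambda>i. sqrt (lam (N0+i+1)) * e (N0+i+1) t) (\<zeta> t)) = ud t"
  unfolding u'_def gain_def by (rule sum.cong) (use Z'_d1[OF t] in auto)

text \<open>The delayed plant and the observer are driven by the same input, which cancels. The time
  must exceed \<open>h\<close> because the plant equation is available at positive times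
  only.\<close>

lemma e_deriv:
  assumes n: "1 \<le> n" "n \<le> N" and t: "t > h"
  shows "(e n has_real_derivative (kap n * e n t + gL n * v t)) (at t)"
proof -
  have "((\<lambda>t. t - h) has_real_derivative 1) (at t)" by (auto intro!: derivative_eq_intros)
  from DERIV_chain2[OF zn_deriv[of n "t - h"] this]
  have "((\<lambda>t. zn n (t - h)) has_real_derivative (kap n * zn n (t - h) + beta n * u (t - h))) (at t)" using n t by simp
  moreover have "(zh n has_real_derivative (kap n * zh n t + beta n * ue (t - h) - gL n * v t)) (at t)"
    using n t h by (intro zh_deriv) auto
  ultimately have "(e n has_real_derivative (kap n * zn n (t - h) + beta n * u (t - h)) - (kap n * zh n t + beta n * ue (t - h) - gL n * v t)) (at t)"
    by (rule DERIV_diff)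
  then show ?thesis by (elim DERIV_cong) (simp add: ue_late[OF less_imp_le[OF t]] algebra_simps)
qed

lemma X_deriv:
  assumes t: "t > h" and i: "i < DD"
  shows "((\<lambda>s. X s $ i) has_real_derivative X' t $ i) (at t)"
  unfolding X_def X'_def
proof (rule stk_index_deriv[OF _ _ _ _ i])
  have t0: "t > 0" "t \<ge> h" using t h by auto
  fix i
  show "(Z (i+1) has_real_derivative d1 (\<lambda>i. Z (i+1) t) (\<lambda>i. e (i+1) t) (\<lambda>i. sqrt (lam (N0+i+1)) * e (N0+i+1) t) (\<zeta> t) i) (at t)" if "i < N0"
    using Z_deriv[of "i+1" t] that NN t0 Z'_d1[OF t0(2) that] by simp
  show "(e (i+1) has_real_derivative d2 (\<lambda>i. e (i+1) t) (\<lambda>i. sqrt (lam (N0+i+1)) * e (N0+i+1) t) (\<zeta> t) i) (at t)" if "i < N0"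
    unfolding d2_def innov_eq[OF t0(2)] using that NN by (intro DERIV_cong[OF e_deriv[OF _ _ t]]) (auto simp: gL_def)
  show "((\<lambda>s. Z (N0+i+1) s / lam (N0+i+1)) has_real_derivative d3 (\<lambda>i. Z (i+1) t) (\<lambda>i. Z (N0+i+1) t / lam (N0+i+1)) i) (at t)" if "i < MM"
    unfolding d3_def gain_X[OF less_imp_le[OF t0(1)]] using that t0
    by (intro DERIV_cong[OF DERIV_cdivide[OF Z_deriv]]) (auto simp: pred'_def gL_def add_divide_distrib)
  show "((\<lambda>s. sqrt (lam (N0+i+1)) * e (N0+i+1) s) has_real_derivative d4 (\<lambda>i. sqrt (lam (N0+i+1)) * e (N0+i+1) t) i) (at t)" if "i < MM"
    unfolding d4_def using that by (intro DERIV_cong[OF DERIV_cmult[OF e_deriv[OF _ _ t]]]) (auto simp: gL_def)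
qed

lemma X_cont:
  assumes i: "i < DD" shows "continuous_on {h..} (\<lambda>s. X s $ i)"
proof -
  have Zc: "continuous_on {h..} (Z n)" if "1 \<le> n" "n \<le> N" for n
    by (rule continuous_on_subset[OF Z_cont[OF that]]) (use h in auto)
  have ec: "continuous_on {h..} (e n)" if "1 \<le> n" "n \<le> N" for n
  proof (intro continuous_on_diff)
    show "continuous_on {h..} (\<lambda>t. zn n (t - h))"
      by (rule continuous_on_compose2[OF zn_cont[OF that(1)]]) (auto intro!: continuous_intros)
    show "continuous_on {h..} (zh n)" by (rule continuous_on_subset[OF zh_cont[OF that]]) (use h in auto)
  qed
  show ?thesis unfolding X_def
    using NN lam_pos by (intro stk_index_cont[OF _ _ _ _ i] continuous_intros Zc ec) (auto simp: less_imp_neq[THEN not_sym])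
qed

text \<open>The trace of the tail is split at a second index \<open>m\<close>. The truncated energy
  controls the modes up to \<open>m\<close>; the rest and the cross term are controlled by
  \<open>B\<close> and the weight \<open>\<mu> m\<close>, which vanishes as \<open>m\<close>
  grows.\<close>

lemma zeta_bound:
  assumes t: "t \<ge> h" and m: "m \<ge> N" and B: "\<And>m. En 1 m (t - h) \<le> B"
  defines "\<mu> \<equiv> \<lambda>k. \<Sum>n. (phi (n + (k + 1)) 0)^2 / lam (n + (k + 1))"
  shows "(\<zeta> t)^2 \<le> \<mu> N * En (N+1) m (t - h) + (2 * sqrt (\<mu> N * B) * sqrt (\<mu> m * B) + \<mu> m * B)"
proof -
  have s: "t - h \<ge> 0" using t by simp
  define r where "r = y (t - h) - (\<Sum>n=1..m. w n (t - h) * phi n 0)"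
  define f where "f = (\<Sum>n=N+1..m. w n (t - h) * phi n 0)"
  have B0: "B \<ge> 0" using B[of 0] by (simp add: En_def)
  have \<mu>: "\<mu> k \<ge> 0" for k unfolding \<mu>_def by (rule point_weights_tail_nonneg) simp
  have "(\<Sum>n=1..m. w n (t - h) * phi n 0) = (\<Sum>n=1..N. w n (t - h) * phi n 0) + f"
    using sum.ub_add_nat[of 1 N "\<lambda>n. w n (t - h) * phi n 0" "m - N"] m by (simp add: f_def)
  then have \<zeta>: "\<zeta> t = f + r" by (simp add: \<zeta>_def r_def)
  have f: "f^2 \<le> \<mu> N * En (N+1) m (t - h)" unfolding f_def \<mu>_def by (rule point_sum_CS) simp
  also have "\<dots> \<le> \<mu> N * B" by (intro mult_left_mono \<mu> order_trans[OF En_le_En_1 B]) simp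
  finally have f': "\<bar>f\<bar> \<le> sqrt (\<mu> N * B)" by (rule real_le_rsqrt[of "\<bar>f\<bar>", simplified])
  have r: "r^2 \<le> \<mu> m * B" unfolding r_def \<mu>_def by (rule y_tail_bound[OF s B])
  then have r': "\<bar>r\<bar> \<le> sqrt (\<mu> m * B)" by (rule real_le_rsqrt[of "\<bar>r\<bar>", simplified])
  have "f * r \<le> \<bar>f\<bar> * \<bar>r\<bar>" by (metis abs_ge_self abs_mult)
  also have "\<dots> \<le> sqrt (\<mu> N * B) * sqrt (\<mu> m * B)" using f' r' \<mu> B0 by (intro mult_mono) auto
  finally show ?thesis using f r unfolding \<zeta> by (simp add: power2_sum)
qed

lemma tail_weights_tendsto_0: "(\<lambda>k. \<Sum>n. (phi (n + (k + 1)) 0)^2 / lam (n + (k + 1))) \<longlonglongrightarrow> 0"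
proof -
  let ?f = "\<lambda>n. (phi (Suc n) 0)^2 / lam (Suc n)"
  have "(\<lambda>N. suminf ?f - (\<Sum>i<N. ?f i)) \<longlonglongrightarrow> suminf ?f - suminf ?f"
    by (intro tendsto_intros summable_LIMSEQ phi_summable)
  then show ?thesis by (simp add: suminf_minus_initial_segment[OF phi_summable])
qed

end

section \<open>The Lyapunov functional\<close>

context closed_loop begin

text \<open>Young's inequality spends the share \<open>1 / \<alpha>\<close> of the dissipation
  \<open>2 * (lam n * w n t)^2\<close> on the two inputs. The remaining share
  \<open>1 - 1 / \<alpha>\<close> is bounded below by \<open>lam (N+1)\<close> times the energy,
  since the eigenvalues increase.\<close>

lemma tail_energy_derivative_le:
  assumes \<alpha>: "\<alpha> > 1"
  shows "(\<Sum>n=N+1..m. 2 * lam n * w n t * (kap n * w n t + a n * u t + b n * ud t)) + 2 * \<delta> * En (N+1) m t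
    \<le> 2 * (- (1 - 1 / \<alpha>) * lam (N+1) + qc + \<delta>) * En (N+1) m t
      + \<alpha> * (\<Sum>n. (a (n + (N+1)))^2) * (u t)^2 + \<alpha> * (\<Sum>n. (b (n + (N+1)))^2) * (ud t)^2"
proof -
  let ?c = "2 * (- (1 - 1 / \<alpha>) * lam (N+1) + qc + \<delta>)"
  have "2 * lam n * w n t * (kap n * w n t + a n * u t + b n * ud t) + 2 * \<delta> * (lam n * (w n t)^2)
      \<le> ?c * (lam n * (w n t)^2) + (\<alpha> * (a n)^2 * (u t)^2 + \<alpha> * (b n)^2 * (ud t)^2)" if n: "n \<in> {N+1..m}" for n
  proof -
    let ?x = "lam n * w n t"
    have l: "lam n > 0" "lam (N+1) \<le> lam n" using n lam_pos[of n] lam_mono[of "N+1" n] by auto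
    have young': "2 * ?x * r \<le> ?x^2 / \<alpha> + \<alpha> * r^2" for r
      using young[of "1 / \<alpha>" ?x r] \<alpha> by (simp add: mult.commute)
    have "(1 - 1 / \<alpha>) * (lam (N+1) * (lam n * (w n t)^2)) \<le> (1 - 1 / \<alpha>) * (lam n * (lam n * (w n t)^2))"
      using \<alpha> l by (intro mult_left_mono mult_right_mono) auto
    moreover have "lam n * (lam n * (w n t)^2) = ?x^2" by (simp add: power2_eq_square)
    ultimately have q: "(1 - 1 / \<alpha>) * (lam (N+1) * (lam n * (w n t)^2)) \<le> (1 - 1 / \<alpha>) * ?x^2" by simp
    have "2 * lam n * w n t * (kap n * w n t + a n * u t + b n * ud t) + 2 * \<delta> * (lam n * (w n t)^2)
      = 2 * (qc + \<delta>) * (lam n * (w n t)^2) - 2 * ?x^2 + 2 * ?x * (a n * u t) + 2 * ?x * (b n * ud t)"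
      by (simp add: kap_def power2_eq_square algebra_simps)
    also have "\<dots> \<le> 2 * (qc + \<delta>) * (lam n * (w n t)^2) - 2 * ((1 - 1 / \<alpha>) * ?x^2) + \<alpha> * (a n * u t)^2 + \<alpha> * (b n * ud t)^2"
      using young'[of "a n * u t"] young'[of "b n * ud t"] by (simp add: left_diff_distrib)
    also have "\<dots> \<le> 2 * (qc + \<delta>) * (lam n * (w n t)^2) - 2 * ((1 - 1 / \<alpha>) * (lam (N+1) * (lam n * (w n t)^2))) + \<alpha> * (a n * u t)^2 + \<alpha> * (b n * ud t)^2"
      using q by simp
    also have "\<dots> = ?c * (lam n * (w n t)^2) + (\<alpha> * (a n)^2 * (u t)^2 + \<alpha> * (b n)^2 * (ud t)^2)"
      unfolding power_mult_distrib[of "a n"] power_mult_distrib[of "b n"] by (simp add: distrib_right left_diff_distrib mult.assoc)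
    finally show ?thesis .
  qed
  then have "(\<Sum>n=N+1..m. 2 * lam n * w n t * (kap n * w n t + a n * u t + b n * ud t) + 2 * \<delta> * (lam n * (w n t)^2))
      \<le> (\<Sum>n=N+1..m. ?c * (lam n * (w n t)^2) + (\<alpha> * (a n)^2 * (u t)^2 + \<alpha> * (b n)^2 * (ud t)^2))" by (rule sum_mono)
  then have "(\<Sum>n=N+1..m. 2 * lam n * w n t * (kap n * w n t + a n * u t + b n * ud t)) + 2 * \<delta> * En (N+1) m t
      \<le> ?c * En (N+1) m t + (\<alpha> * (\<Sum>n=N+1..m. (a n)^2) * (u t)^2 + \<alpha> * (\<Sum>n=N+1..m. (b n)^2) * (ud t)^2)"
    by (simp only: En_def sum.distrib sum_distrib_left[symmetric] sum_distrib_right[symmetric])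
  moreover have "\<alpha> * (\<Sum>n=N+1..m. (a n)^2) * (u t)^2 \<le> \<alpha> * (\<Sum>n. (a (n + (N+1)))^2) * (u t)^2"
    using \<alpha> by (intro mult_right_mono mult_left_mono sum_a_le) auto
  moreover have "\<alpha> * (\<Sum>n=N+1..m. (b n)^2) * (ud t)^2 \<le> \<alpha> * (\<Sum>n. (b (n + (N+1)))^2) * (ud t)^2"
    using \<alpha> by (intro mult_right_mono mult_left_mono sum_b_le) auto
  ultimately show ?thesis by linarith
qed

text \<open>The infinite tail of the energy is truncated at \<open>m\<close>, and the delay term of the Lyapunov functional is the
  integral of the truncated energy instead of \<open>\<zeta>\<^sup>2\<close>; this keeps every term differentiable. The price is the
  error in \<open>zeta_bound\<close>, which is uniform on compact time intervals and vanishes as \<open>m \<rightarrow> \<infinity>\<close>.\<close>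
lemma lyapunov_decay:
  fixes P :: "real mat" and \<alpha> \<beta> \<gamma> \<delta> W :: real
  assumes P: "P \<in> carrier_mat DD DD" "P\<^sup>T = P" and pos: "\<delta> > 0" "\<alpha> > 1" "\<beta> > 0" "\<gamma> > 0"
    and \<Theta>1: "\<And>x1 x2 x3 x4 z. 2 * scalar_prod (stk N0 MM (d1 x1 x2 x4 z) (d2 x2 x4 z) (d3 x1 x3) (d4 x4)) (P *\<^sub>v stk N0 MM x1 x2 x3 x4)
      + 2 * \<delta> * scalar_prod (stk N0 MM x1 x2 x3 x4) (P *\<^sub>v stk N0 MM x1 x2 x3 x4)
      + \<alpha> * \<gamma> * (\<Sum>n. (a (n + (N+1)))^2) * (gain x1)^2 - \<beta> * exp (- 2 * \<delta> * h) * z^2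
      + \<alpha> * \<gamma> * (\<Sum>n. (b (n + (N+1)))^2) * (gain (d1 x1 x2 x4 z))^2 \<le> 0"
    and \<Theta>2: "2 * \<gamma> * (- (1 - 1 / \<alpha>) * lam (N+1) + qc + \<delta>) + \<beta> * (\<Sum>n. (phi (n + (N+1)) 0)^2 / lam (n + (N+1))) \<le> 0"
    and W: "\<And>m. scalar_prod (X h) (P *\<^sub>v X h) + \<gamma> * En (N+1) m h
      + \<beta> * (\<Sum>n. (phi (n + (N+1)) 0)^2 / lam (n + (N+1))) * delay_int (- 2 * \<delta>) h (\<lambda>s. En (N+1) m (max 0 s)) h \<le> W"
    and t: "t \<ge> h"
  shows "scalar_prod (X t) (P *\<^sub>v X t) + \<gamma> * En (N+1) k t \<le> W * exp (- 2 * \<delta> * (t - h))"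
proof -
  define \<mu> where "\<mu> = (\<lambda>k. \<Sum>n. (phi (n + (k+1)) 0)^2 / lam (n + (k+1)))"
  \<comment> \<open>\<open>max 0\<close> extends the energy continuously to negative times, because
    \<open>delay_int_deriv\<close> asks for continuity on the whole line.\<close>
  define g where "g m s = En (N+1) m (max 0 s)" for m s
  define V where "V m s = scalar_prod (X s) (P *\<^sub>v X s) + \<gamma> * En (N+1) m s + \<beta> * \<mu> N * delay_int (- 2 * \<delta>) h (g m) s" for m s
  obtain B where B: "\<And>s m. 0 \<le> s \<Longrightarrow> s \<le> t \<Longrightarrow> En 1 m s \<le> B" using energy_locally_bounded[of t] by blast
  define \<epsilon> where "\<epsilon> m = 2 * sqrt (\<mu> N * B) * sqrt (\<mu> m * B) + \<mu> m * B" for m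
  define x where "x = exp (- 2 * \<delta> * h)"
  have x: "x > 0" by (simp add: x_def)
  have \<mu>: "\<mu> m \<ge> 0" for m unfolding \<mu>_def by (rule point_weights_tail_nonneg) simp
  have B0: "B \<ge> 0" using B[of 0 0] t h by (simp add: En_def)
  have \<epsilon>: "\<epsilon> m \<ge> 0" for m unfolding \<epsilon>_def using \<mu> B0 by simp
  have gc: "continuous_on UNIV (g m)" for m
    unfolding g_def[abs_def] by (rule continuous_on_compose2[OF En_cont]) (auto intro!: continuous_intros)
  have g0: "g m s \<ge> 0" for m s unfolding g_def by (rule En_nonneg) simp
  have V_le: "V m t \<le> W * exp (- 2 * \<delta> * (t - h)) + \<beta> * x * \<epsilon> m / (2 * \<delta>)" if m: "m \<ge> N" for m
  proof -
    let ?V' = "\<lambda>s. 2 * scalar_prod (X' s) (P *\<^sub>v X s)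
      + \<gamma> * (\<Sum>n=N+1..m. 2 * lam n * w n s * (kap n * w n s + a n * u s + b n * ud s))
      + \<beta> * \<mu> N * (- 2 * \<delta> * delay_int (- 2 * \<delta>) h (g m) s + g m s - x * g m (s - h))"
    let ?d = "\<beta> * x * \<epsilon> m"
    have "V m t + ?d / (- 2 * \<delta>) \<le> (V m h + ?d / (- 2 * \<delta>)) * exp (- 2 * \<delta> * (t - h))"
    proof (rule gronwall_derivative[where f = "V m" and f' = ?V'])
      show "continuous_on {h..t} (V m)"
        unfolding V_def[abs_def]
      proof (intro continuous_on_add continuous_on_mult_left)
        show "continuous_on {h..t} (\<lambda>s. scalar_prod (X s) (P *\<^sub>v X s))"
          by (intro quadratic_form_cont[OF P(1) X_carrier] continuous_on_subset[OF X_cont]) auto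
        show "continuous_on {h..t} (En (N+1) m)" by (rule continuous_on_subset[OF En_cont]) (use h in auto)
        show "continuous_on {h..t} (delay_int (- 2 * \<delta>) h (g m))"
          by (rule DERIV_continuous_on) (rule has_field_derivative_at_within[OF delay_int_deriv[OF gc less_imp_le[OF h]]])
      qed
      fix s assume s: "h < s" "s < t"
      show "(V m has_real_derivative ?V' s) (at s)"
        unfolding V_def[abs_def] x_def
        by (intro DERIV_add DERIV_cmult quadratic_form_deriv[OF P X_carrier X'_carrier] X_deriv s En_deriv delay_int_deriv[OF gc less_imp_le[OF h]])
          (use s h in auto)
      have sh: "s \<ge> h" "s - h \<ge> 0" "s \<ge> 0" "s - h \<le> t" using s h by auto
      have gs: "g m s = En (N+1) m s" "g m (s - h) = En (N+1) m (s - h)" using sh by (simp_all add: g_def)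
      define A where "A = 2 * scalar_prod (X' s) (P *\<^sub>v X s) + 2 * \<delta> * scalar_prod (X s) (P *\<^sub>v X s)"
      define S where "S = (\<Sum>n=N+1..m. 2 * lam n * w n s * (kap n * w n s + a n * u s + b n * ud s))"
      define c where "c = - (1 - 1 / \<alpha>) * lam (N+1) + qc + \<delta>"
      define Ra where "Ra = \<alpha> * (\<Sum>n. (a (n + (N+1)))^2) * (u s)^2"
      define Rb where "Rb = \<alpha> * (\<Sum>n. (b (n + (N+1)))^2) * (ud s)^2"
      define E1 where "E1 = En (N+1) m s"
      define E2 where "E2 = En (N+1) m (s - h)"
      have E1: "E1 \<ge> 0" unfolding E1_def by (rule En_nonneg) simp
      \<comment> \<open>Up to the factor \<open>\<beta> * \<mu> N\<close>, the delay term
        contributes \<open>E1\<close> at the current time and \<open>- x * E2\<close> at time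
        \<open>s - h\<close>. The condition on \<open>\<Theta>\<^sub>2\<close> absorbs the former
        into the decay of the tail (\<open>i3\<close>). The latter compensates, up to
        \<open>\<epsilon> m\<close>, the square of \<open>\<zeta> s\<close> that the matrix
        inequality leaves (\<open>i4\<close>).\<close>
      have i1: "A + \<gamma> * Ra - \<beta> * x * (\<zeta> s)^2 + \<gamma> * Rb \<le> 0"
        using \<Theta>1[of "\<lambda>i. Z (i+1) s" "\<lambda>i. e (i+1) s" "\<lambda>i. sqrt (lam (N0+i+1)) * e (N0+i+1) s" "\<zeta> s" "\<lambda>i. Z (N0+i+1) s / lam (N0+i+1)"]
          unfolding X_def[symmetric] X'_def[symmetric] ud_d1[OF sh(1)] gain_X[OF sh(3)] A_def Ra_def Rb_def x_def by (simp add: mult_ac)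
      have i2: "\<gamma> * (S + 2 * \<delta> * E1) \<le> \<gamma> * (2 * c * E1 + Ra + Rb)"
        using tail_energy_derivative_le[OF pos(2), where m=m and t=s and \<delta>=\<delta>] pos
        unfolding S_def E1_def Ra_def Rb_def c_def by (intro mult_left_mono) auto
      have i3: "(2 * \<gamma> * c + \<beta> * \<mu> N) * E1 \<le> 0"
        using \<Theta>2 E1 unfolding c_def \<mu>_def by (intro mult_nonpos_nonneg) auto
      have i4: "\<beta> * x * (\<zeta> s)^2 \<le> \<beta> * x * (\<mu> N * E2 + \<epsilon> m)"
      proof (rule mult_left_mono)
        show "(\<zeta> s)^2 \<le> \<mu> N * E2 + \<epsilon> m"
          using zeta_bound[OF sh(1) m B[OF sh(2) sh(4)]] unfolding E2_def \<epsilon>_def \<mu>_def .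
      qed (use pos x in simp)
      have "A + \<gamma> * (S + 2 * \<delta> * E1) + \<beta> * \<mu> N * (E1 - x * E2) \<le> ?d"
        using i1 i2 i3 i4 by (simp add: algebra_simps)
      then show "?V' s \<le> - 2 * \<delta> * V m s + ?d"
        unfolding gs E1_def[symmetric] E2_def[symmetric] S_def[symmetric] V_def A_def by (simp add: algebra_simps)
    qed (use pos t in auto)
    then have "V m t \<le> V m h * exp (- 2 * \<delta> * (t - h)) + (?d / (2 * \<delta>)) * (1 - exp (- 2 * \<delta> * (t - h)))"
      using pos by (simp add: algebra_simps)
    also have "V m h * exp (- 2 * \<delta> * (t - h)) \<le> W * exp (- 2 * \<delta> * (t - h))"
      using W[of m] unfolding V_def g_def[abs_def] \<mu>_def by (intro mult_right_mono) auto
    also have "(?d / (2 * \<delta>)) * (1 - exp (- 2 * \<delta> * (t - h))) \<le> ?d / (2 * \<delta>) * 1"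
      using pos x \<epsilon>[of m] by (intro mult_left_mono) auto
    finally show ?thesis by simp
  qed
  have lim: "(\<lambda>m. W * exp (- 2 * \<delta> * (t - h)) + \<beta> * x * \<epsilon> m / (2 * \<delta>)) \<longlonglongrightarrow> W * exp (- 2 * \<delta> * (t - h)) + \<beta> * x * 0 / (2 * \<delta>)"
  proof -
    have "\<epsilon> \<longlonglongrightarrow> 2 * sqrt (\<mu> N * B) * sqrt (0 * B) + 0 * B"
      unfolding \<epsilon>_def[abs_def] \<mu>_def by (intro tendsto_intros tail_weights_tendsto_0)
    then show ?thesis using pos by (intro tendsto_intros) auto
  qed
  \<comment> \<open>Only now does \<open>m\<close> tend to infinity: the part truncated at the fixed
    index \<open>k\<close> is below \<open>V m t\<close> for every larger \<open>m\<close>.\<close>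
  have "scalar_prod (X t) (P *\<^sub>v X t) + \<gamma> * En (N+1) k t \<le> W * exp (- 2 * \<delta> * (t - h)) + \<beta> * x * 0 / (2 * \<delta>)"
  proof (rule LIMSEQ_le_const[OF lim], intro exI allI impI)
    fix m assume m: "max N k \<le> m"
    have "En (N+1) k t \<le> En (N+1) m t" unfolding En_def by (rule sum_mono2) (use m lam_nonneg in auto)
    then have "\<gamma> * En (N+1) k t \<le> \<gamma> * En (N+1) m t" using pos by (intro mult_left_mono) auto
    moreover have "0 \<le> \<beta> * \<mu> N * delay_int (- 2 * \<delta>) h (g m) t"
      using pos \<mu> by (intro mult_nonneg_nonneg delay_int_nonneg g0) auto
    ultimately show "scalar_prod (X t) (P *\<^sub>v X t) + \<gamma> * En (N+1) k t \<le> W * exp (- 2 * \<delta> * (t - h)) + \<beta> * x * \<epsilon> m / (2 * \<delta>)"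
      using V_le[of m] m unfolding V_def by simp
  qed
  then show ?thesis by simp
qed

end

section \<open>From the functional to all modes and all times\<close>

lemma bilinear_bound:
  fixes P :: "real mat" and x :: "real vec"
  assumes P: "P \<in> carrier_mat n n" and x: "x \<in> carrier_vec n" and B: "\<And>i. i < n \<Longrightarrow> \<bar>x $ i\<bar> \<le> B"
  shows "scalar_prod x (P *\<^sub>v x) \<le> (\<Sum>i<n. \<Sum>j<n. \<bar>P $$ (i,j)\<bar>) * B^2"
proof -
  have "scalar_prod x (P *\<^sub>v x) \<le> (\<Sum>i<n. \<Sum>j<n. \<bar>P $$ (i,j)\<bar> * B^2)"
    unfolding bilinear_sum[OF P x x]
  proof (intro sum_mono)
    fix i j assume ij: "i \<in> {..<n}" "j \<in> {..<n}"
    have "x $ i * P $$ (i,j) * x $ j \<le> \<bar>P $$ (i,j)\<bar> * (\<bar>x $ i\<bar> * \<bar>x $ j\<bar>)"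
      using abs_ge_self[of "x $ i * P $$ (i,j) * x $ j"] by (simp add: abs_mult mult_ac)
    also have "\<bar>x $ i\<bar> * \<bar>x $ j\<bar> \<le> B * B"
    proof (rule mult_mono)
      show "0 \<le> B" using B[of i] ij by (meson abs_ge_zero lessThan_iff order_trans)
    qed (use B ij in auto)
    finally show "x $ i * P $$ (i,j) * x $ j \<le> \<bar>P $$ (i,j)\<bar> * B^2"
      by (simp add: power2_eq_square mult_left_mono)
  qed
  then show ?thesis by (simp add: sum_distrib_right)
qed

context modal begin

text \<open>\<open>R\<close> bounds the initial data, and everything is compared with
  \<open>R * exp (- \<delta> * t)\<close>. The initial phase settles \<open>[0, h]\<close> and
  bounds the functional at \<open>h\<close>; its decay then bounds the state vector. The observer is
  recovered by inverting the predictor, the first \<open>N\<close> modes of the plant from error and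
  observer at the later time \<open>t + h\<close>, and the higher modes from the tail
  energy.\<close>

lemma decay_estimate:
  fixes P :: "real mat" and \<alpha> \<beta> \<gamma> \<delta> :: real
  assumes P: "P \<in> carrier_mat DD DD" "P\<^sup>T = P" "pos_def P" and pos: "\<delta> > 0" "\<alpha> > 1" "\<beta> > 0" "\<gamma> > 0"
    and \<Theta>1: "\<And>x1 x2 x3 x4 z. 2 * scalar_prod (stk N0 MM (d1 x1 x2 x4 z) (d2 x2 x4 z) (d3 x1 x3) (d4 x4)) (P *\<^sub>v stk N0 MM x1 x2 x3 x4)
      + 2 * \<delta> * scalar_prod (stk N0 MM x1 x2 x3 x4) (P *\<^sub>v stk N0 MM x1 x2 x3 x4)
      + \<alpha> * \<gamma> * (\<Sum>n. (a (n + (N+1)))^2) * (gain x1)^2 - \<beta> * exp (- 2 * \<delta> * h) * z^2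
      + \<alpha> * \<gamma> * (\<Sum>n. (b (n + (N+1)))^2) * (gain (d1 x1 x2 x4 z))^2 \<le> 0"
    and \<Theta>2: "2 * \<gamma> * (- (1 - 1 / \<alpha>) * lam (N+1) + qc + \<delta>) + \<beta> * (\<Sum>n. (phi (n + (N+1)) 0)^2 / lam (n + (N+1))) \<le> 0"
  shows "\<exists>C\<ge>0. \<forall>zn zh u u0 y ym Y R. closed_loop lam beta phi qc h N0 N K L a b zn zh u u0 y ym Y \<longrightarrow>
     \<bar>u0\<bar> \<le> R \<longrightarrow> Y \<le> R \<longrightarrow> (\<forall>n\<in>{1..N}. \<bar>zh n 0\<bar> \<le> R) \<longrightarrow>
     (\<Sum>n. lam (Suc n) * (zn (Suc n) 0 + b (Suc n) * u 0)^2) \<le> R^2 \<longrightarrow>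
     (\<forall>t\<ge>0. (\<forall>m. (\<Sum>n=1..m. lam n * (zn n t + b n * u t)^2) \<le> C * (R * exp (- \<delta> * t))^2) \<and>
        (\<forall>n\<in>{1..N}. \<bar>zh n t\<bar> \<le> C * (R * exp (- \<delta> * t))) \<and> \<bar>u t\<bar> \<le> C * (R * exp (- \<delta> * t)))"
proof -
  obtain C0 where C0: "C0 \<ge> 0" and init: "\<And>zn zh u u0 y ym Y R. closed_loop lam beta phi qc h N0 N K L a b zn zh u u0 y ym Y \<Longrightarrow>
     \<bar>u0\<bar> \<le> R \<Longrightarrow> Y \<le> R \<Longrightarrow> (\<forall>n\<in>{1..N}. \<bar>zh n 0\<bar> \<le> R) \<Longrightarrow>
     (\<forall>t. 0 \<le> t \<longrightarrow> t \<le> h \<longrightarrow> (\<forall>n\<in>{1..N}. \<bar>zh n t\<bar> \<le> C0 * R \<and> \<bar>pred zh u u0 n t\<bar> \<le> C0 * R) \<and> \<bar>u t\<bar> \<le> C0 * R) \<and>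
     (\<forall>t. 0 < t \<longrightarrow> t < h \<longrightarrow> \<bar>u' zh u u0 ym t\<bar> \<le> C0 * R)"
    using initial_phase_bound by blast
  obtain cP where cP: "cP \<ge> 0" "\<And>x i. x \<in> carrier_vec DD \<Longrightarrow> i < DD \<Longrightarrow> (x $ i)^2 \<le> cP * scalar_prod x (P *\<^sub>v x)"
    "\<And>x. x \<in> carrier_vec DD \<Longrightarrow> 0 \<le> scalar_prod x (P *\<^sub>v x)"
    using pos_def_coordinate_bound[OF P] by blast
  define dd where "dd = (\<Sum>n. (a (n + 1))^2) + (\<Sum>n. (b (n + 1))^2)"
  define G where "G = (1 + dd * C0^2) * exp ((2 * \<bar>qc\<bar> + 1) * h)"
  \<comment> \<open>Sums over the modes up to \<open>N\<close> serve as common upper bounds for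
    their terms.\<close>
  define sl where "sl = (\<Sum>n=1..N. sqrt (lam n))"
  define il where "il = (\<Sum>n=1..N. 1 / sqrt (lam n))"
  define l1 where "l1 = (\<Sum>n=1..N. lam n)"
  define i1 where "i1 = (\<Sum>n=1..N. 1 / lam n)"
  define sb where "sb = (\<Sum>n=1..N. \<bar>b n\<bar>)"
  define cE where "cE = il + sb + C0"
  define cX where "cX = C0 + cE + i1 * C0 + sl * cE"
  define \<mu> where "\<mu> = (\<Sum>n. (phi (n + (N+1)) 0)^2 / lam (n + (N+1)))"
  define W0 where "W0 = (\<Sum>i<DD. \<Sum>j<DD. \<bar>P $$ (i,j)\<bar>) * cX^2 + \<gamma> * G + \<beta> * \<mu> * (h * exp (2 * \<delta> * h) * G)"
  define W1 where "W1 = W0 * exp (2 * \<delta> * h)"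
  define sK where "sK = (\<Sum>j<N0. \<bar>K $$ (0,j)\<bar>)"
  define q where "q = sqrt (cP * W1)"
  define x1 where "x1 = exp (\<delta> * h)"
  define cu where "cu = sK * q + C0 * x1"
  \<comment> \<open>The factors \<open>1 + l1\<close> and \<open>1 + il\<close> cover both kinds of
    modes: those up to \<open>N0\<close>, which are unscaled in \<open>X\<close>, and those above,
    which are scaled by \<open>1 / lam\<close> and \<open>sqrt lam\<close>.\<close>
  define cz where "cz = q * (1 + l1)"
  define ce where "ce = q * (1 + il)"
  define ch where "ch = (\<Sum>n=1..N. exp (- kap n * h) * (cz + h * exp (\<bar>kap n\<bar> * h) * (\<bar>beta n\<bar> * (cu * x1)))) + C0 * x1"
  define cl where "cl = (\<Sum>n=1..N. lam n * (ce + ch + \<bar>b n\<bar> * cu)^2)"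
  define C where "C = cl + W1 / \<gamma> + G * x1^2 + ch + cu"
  have mem: "f n \<le> (\<Sum>n=1..N. f n)" if "n \<in> {1..N}" "\<And>n. n \<in> {1..N} \<Longrightarrow> f n \<ge> 0" for f :: "nat \<Rightarrow> real" and n
    using that by (intro member_le_sum) auto
  have lp: "lam n > 0" if "n \<in> {1..N}" for n using lam_pos[of n] that by simp
  have dd: "dd \<ge> 0" unfolding dd_def using a_summable b_summable by (intro add_nonneg_nonneg suminf_nonneg) auto
  have G: "G \<ge> 0" using dd by (simp add: G_def)
  have nn: "sl \<ge> 0" "il \<ge> 0" "l1 \<ge> 0" "i1 \<ge> 0" "sb \<ge> 0" "sK \<ge> 0"
    unfolding sl_def il_def l1_def i1_def sb_def sK_def using lp by (auto intro!: sum_nonneg simp: less_imp_le)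
  have cE: "cE \<ge> 0" and cX: "cX \<ge> 0" using nn C0 by (auto simp: cE_def cX_def)
  have \<mu>: "\<mu> \<ge> 0"
    unfolding \<mu>_def using summable_ignore_initial_segment[OF phi_summable, of N] lam_pos
    by (intro suminf_nonneg) (auto simp: less_imp_le)
  have W0: "W0 \<ge> 0" unfolding W0_def using pos \<mu> G h by (intro add_nonneg_nonneg mult_nonneg_nonneg sum_nonneg) auto
  have W1: "W1 \<ge> 0" using W0 by (simp add: W1_def)
  have q: "q \<ge> 0" using cP W1 by (simp add: q_def)
  have x1: "x1 \<ge> 1" using pos h by (simp add: x1_def)
  have cu: "cu \<ge> 0" and cz: "cz \<ge> 0" and ce: "ce \<ge> 0" using nn q C0 x1 by (auto simp: cu_def cz_def ce_def)
  have cht: "exp (- kap n * h) * (cz + h * exp (\<bar>kap n\<bar> * h) * (\<bar>beta n\<bar> * (cu * x1))) \<ge> 0" for n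
    using cz cu x1 h by (intro mult_nonneg_nonneg add_nonneg_nonneg) auto
  have ch: "ch \<ge> 0" unfolding ch_def using cht C0 x1 by (intro add_nonneg_nonneg sum_nonneg) auto
  have cl: "cl \<ge> 0" unfolding cl_def using lp by (intro sum_nonneg mult_nonneg_nonneg) (auto simp: less_imp_le)
  have C: "cl + W1 / \<gamma> + G * x1^2 \<le> C" "ch \<le> C" "cu \<le> C" "C \<ge> 0"
    using cl W1 pos G ch cu by (auto simp: C_def)
  show ?thesis
  proof (intro exI[of _ C] conjI allI impI ballI)
    show "C \<ge> 0" by (rule C)
    fix zn zh u u0 y ym Y R t
    assume cl': "closed_loop lam beta phi qc h N0 N K L a b zn zh u u0 y ym Y"
      and R: "\<bar>u0\<bar> \<le> R" "Y \<le> R" "\<forall>n\<in>{1..N}. \<bar>zh n 0\<bar> \<le> R"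
      and E0: "(\<Sum>n. lam (Suc n) * (zn (Suc n) 0 + b (Suc n) * u 0)^2) \<le> R^2"
      and t: "(0::real) \<le> t"
    interpret c: closed_loop lam beta phi qc h N0 N K L a b zn zh u u0 y ym Y by (rule cl')
    define \<rho> where "\<rho> t = R * exp (- \<delta> * t)" for t
    have R0: "R \<ge> 0" using R(1) by linarith
    have \<rho>0: "\<rho> s \<ge> 0" for s using R0 by (simp add: \<rho>_def)
    have \<rho>mono: "\<rho> s \<le> \<rho> r" if "r \<le> s" for r s unfolding \<rho>_def using R0 pos that by (intro mult_left_mono) auto
    \<comment> \<open>\<open>x1 = exp (\<delta> * h)\<close> is the price of a delay
      \<open>h\<close>; it also turns a bound by \<open>R\<close> on \<open>[0, h]\<close> into one
      by the decaying profile.\<close>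
    have \<rho>h: "\<rho> (s - h) = x1 * \<rho> s" for s
      unfolding \<rho>_def x1_def by (simp add: exp_add[symmetric] algebra_simps)
    have \<rho>early: "R \<le> x1 * \<rho> s" if "0 \<le> s" "s \<le> h" for s
      unfolding \<rho>h[of s, symmetric] using \<rho>mono[of "s - h" 0] that by (simp add: \<rho>_def)
    have I: "\<bar>zh n s\<bar> \<le> C0 * R" "\<bar>c.Z n s\<bar> \<le> C0 * R" "\<bar>u s\<bar> \<le> C0 * R" if "0 \<le> s" "s \<le> h" "n \<in> {1..N}" for n s
      using init[OF cl' R] that by auto
    have I3: "\<bar>u s\<bar> \<le> C0 * R" if "0 \<le> s" "s \<le> h" for s using init[OF cl' R] that by auto
    have I4: "\<bar>c.ud s\<bar> \<le> C0 * R" if "0 < s" "s < h" for s using init[OF cl' R] that by auto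
    have En0: "c.En 1 m 0 \<le> R^2" for m using c.En_le_energy[of 0 m] E0 by simp
    have Ee: "c.En 1 m s \<le> G * R^2" if s: "0 \<le> s" "s \<le> h" for m s
    proof -
      have "c.En 1 m s \<le> (c.En 1 m 0 + c.dd * (C0 * R)^2) * exp ((2 * \<bar>qc\<bar> + 1) * h)"
        by (rule c.energy_growth[OF s]) (auto intro: I3 I4)
      also have "\<dots> \<le> (R^2 + dd * (C0 * R)^2) * exp ((2 * \<bar>qc\<bar> + 1) * h)"
        using En0[of m] by (intro mult_right_mono) (auto simp: dd_def c.dd_def)
      also have "\<dots> = G * R^2" by (simp add: G_def power_mult_distrib algebra_simps)
      finally show ?thesis .
    qed
    have wz: "\<bar>zn n 0 + b n * u 0\<bar> \<le> (1 / sqrt (lam n)) * R" if n: "n \<in> {1..N}" for n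
    proof -
      have "lam n * (zn n 0 + b n * u 0)^2 \<le> c.En 1 N 0"
        unfolding c.En_def using lp by (intro mem[OF n]) (auto simp: less_imp_le)
      then have "lam n * (zn n 0 + b n * u 0)^2 \<le> R^2" using En0[of N] by linarith
      then have "(sqrt (lam n) * \<bar>zn n 0 + b n * u 0\<bar>)^2 \<le> R^2" using lp[OF n] by (simp add: power_mult_distrib)
      then have "sqrt (lam n) * \<bar>zn n 0 + b n * u 0\<bar> \<le> R" using R0 by (rule power2_le_imp_le)
      then show ?thesis using lp[OF n] by (simp add: field_simps)
    qed
    \<comment> \<open>At time \<open>h\<close> the error involves the plant at time 0, which the
      initial energy controls through \<open>wz\<close>.\<close>
    have eh: "\<bar>c.e n h\<bar> \<le> cE * R" if n: "n \<in> {1..N}" for n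
    proof -
      have "\<bar>zn n 0\<bar> \<le> \<bar>zn n 0 + b n * u 0\<bar> + \<bar>b n\<bar> * R"
        using R(1) c.u_0 mult_left_mono[of "\<bar>u 0\<bar>" R "\<bar>b n\<bar>"] abs_mult[of "b n" "u 0"] by linarith
      also have "\<dots> \<le> il * R + sb * R"
        using wz[OF n] mem[of n "\<lambda>n. 1 / sqrt (lam n)", OF n] mem[of n "\<lambda>n. \<bar>b n\<bar>", OF n] lp R0
        by (intro add_mono order_trans[OF wz[OF n]] mult_right_mono) (auto simp: il_def sb_def less_imp_le)
      finally show ?thesis using I(1)[of h n] n h by (simp add: cE_def distrib_right)
    qed
    have Xh: "\<bar>c.X h $ i\<bar> \<le> cX * R" if i: "i < DD" for i
    proof -
      have le: "C0 * R \<le> cX * R" "cE * R \<le> cX * R" "i1 * (C0 * R) \<le> cX * R" "sl * (cE * R) \<le> cX * R"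
        unfolding cX_def using nn C0 cE R0 by (auto simp: distrib_right mult.assoc intro!: add_nonneg_nonneg mult_nonneg_nonneg)
      have h0: "0 \<le> h" using h by simp
      have 3: "\<bar>c.Z n h / lam n\<bar> \<le> i1 * (C0 * R)" if n: "n \<in> {1..N}" for n
      proof -
        have "\<bar>c.Z n h / lam n\<bar> = (1 / lam n) * \<bar>c.Z n h\<bar>" using lp[OF n] by simp
        also have "\<dots> \<le> i1 * (C0 * R)"
          using I(2)[OF h0 order_refl n] mem[of n "\<lambda>n. 1 / lam n", OF n] lp nn by (intro mult_mono) (auto simp: i1_def less_imp_le)
        finally show ?thesis .
      qed
      have 4: "\<bar>sqrt (lam n) * c.e n h\<bar> \<le> sl * (cE * R)" if n: "n \<in> {1..N}" for n
      proof -
        have "\<bar>sqrt (lam n) * c.e n h\<bar> = sqrt (lam n) * \<bar>c.e n h\<bar>" using lp[OF n] by (simp add: abs_mult)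
        also have "\<dots> \<le> sl * (cE * R)"
          using eh[OF n] mem[of n "\<lambda>n. sqrt (lam n)", OF n] lp nn by (intro mult_mono) (auto simp: sl_def less_imp_le)
        finally show ?thesis .
      qed
      have A: "\<bar>c.Z (i + 1) h\<bar> \<le> cX * R" if "i < N0"
        by (rule order_trans[OF I(2)[OF h0 order_refl] le(1)]) (use that NN in auto)
      have B: "\<bar>c.e (i - N0 + 1) h\<bar> \<le> cX * R" if "i < N0 + N0"
        by (rule order_trans[OF eh le(2)]) (use that NN in auto)
      have C: "\<bar>c.Z (N0 + (i - (N0 + N0)) + 1) h / lam (N0 + (i - (N0 + N0)) + 1)\<bar> \<le> cX * R" if "\<not> i < N0 + N0" "i < N0 + N0 + MM"
        by (rule order_trans[OF 3 le(3)]) (use that NN in auto)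
      have D: "\<bar>sqrt (lam (N0 + (i - (N0 + N0 + MM)) + 1)) * c.e (N0 + (i - (N0 + N0 + MM)) + 1) h\<bar> \<le> cX * R"
        if "\<not> i < N0 + N0 + MM"
        by (rule order_trans[OF 4 le(4)]) (use that i NN in auto)
      show ?thesis
        unfolding c.X_def stk_index[OF i] using A B C D by (auto simp only: split: if_split)
    qed
    have W: "scalar_prod (c.X h) (P *\<^sub>v c.X h) + \<gamma> * c.En (N+1) m h
      + \<beta> * (\<Sum>n. (phi (n + (N+1)) 0)^2 / lam (n + (N+1))) * delay_int (- 2 * \<delta>) h (\<lambda>s. c.En (N+1) m (max 0 s)) h \<le> W0 * R^2" for m
    proof -
      have "scalar_prod (c.X h) (P *\<^sub>v c.X h) \<le> (\<Sum>i<DD. \<Sum>j<DD. \<bar>P $$ (i,j)\<bar>) * (cX * R)^2"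
        by (rule bilinear_bound[OF P(1) c.X_carrier Xh])
      moreover have "\<gamma> * c.En (N+1) m h \<le> \<gamma> * (G * R^2)"
        using pos h order_trans[OF c.En_le_En_1 Ee, of "N+1" h m] by (intro mult_left_mono) auto
      moreover have "\<beta> * \<mu> * delay_int (- 2 * \<delta>) h (\<lambda>s. c.En (N+1) m (max 0 s)) h \<le> \<beta> * \<mu> * (h * exp (2 * \<delta> * h) * (G * R^2))"
      proof (rule mult_left_mono)
        have "\<bar>delay_int (- 2 * \<delta>) h (\<lambda>s. c.En (N+1) m (max 0 s)) h\<bar> \<le> h * exp (\<bar>- 2 * \<delta>\<bar> * h) * (G * R^2)"
        proof (rule delay_int_bound)
          show "continuous_on UNIV (\<lambda>s. c.En (N+1) m (max 0 s))"
            by (rule continuous_on_compose2[OF c.En_cont]) (auto intro!: continuous_intros)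
          fix s assume s: "h - h \<le> s" "s \<le> h"
          then show "\<bar>c.En (N+1) m (max 0 s)\<bar> \<le> G * R^2"
            using order_trans[OF c.En_le_En_1 Ee, of "N+1" s m] c.En_nonneg[of "N+1" m s] by simp
        qed (use h in auto)
        then show "delay_int (- 2 * \<delta>) h (\<lambda>s. c.En (N+1) m (max 0 s)) h \<le> h * exp (2 * \<delta> * h) * (G * R^2)"
          using pos by simp
      qed (use pos \<mu> in auto)
      ultimately show ?thesis
        unfolding \<mu>_def[symmetric] W0_def by (simp add: power_mult_distrib algebra_simps)
    qed
    have decay: "scalar_prod (c.X s) (P *\<^sub>v c.X s) + \<gamma> * c.En (N+1) k s \<le> W1 * (\<rho> s)^2" if "s \<ge> h" for s k
    proof -
      have "W0 * R^2 * exp (- 2 * \<delta> * (s - h)) = W1 * (\<rho> s)^2"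
      proof -
        have "exp (- 2 * \<delta> * (s - h)) = exp (2 * \<delta> * h) * (exp (- \<delta> * s))^2"
          by (simp add: power2_eq_square exp_add[symmetric] algebra_simps)
        then show ?thesis by (simp add: W1_def \<rho>_def power_mult_distrib)
      qed
      then show ?thesis using c.lyapunov_decay[OF P(1,2) pos \<Theta>1 \<Theta>2 W that, of k] by simp
    qed
    have Xs: "\<bar>c.X s $ i\<bar> \<le> q * \<rho> s" if s: "s \<ge> h" and i: "i < DD" for s i
    proof -
      have "scalar_prod (c.X s) (P *\<^sub>v c.X s) \<le> W1 * (\<rho> s)^2"
        using decay[OF s, of 0] by (simp add: c.En_def)
      then have "cP * scalar_prod (c.X s) (P *\<^sub>v c.X s) \<le> cP * (W1 * (\<rho> s)^2)" using cP(1) by (rule mult_left_mono)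
      then have "(c.X s $ i)^2 \<le> cP * W1 * (\<rho> s)^2" using cP(2)[OF c.X_carrier[of s] i] by simp
      also have "\<dots> = (q * \<rho> s)^2" using cP W1 by (simp add: q_def power_mult_distrib)
      finally show ?thesis using q \<rho>0 by (simp add: abs_le_square_iff[symmetric])
    qed
    have qm: "q * \<rho> s \<le> q * (1 + r) * \<rho> s" if "r \<ge> 0" for r s
      using that q \<rho>0[of s] by (intro mult_right_mono) (auto simp: distrib_left)
    have Zs: "\<bar>c.Z n s\<bar> \<le> cz * \<rho> s" "\<bar>c.e n s\<bar> \<le> ce * \<rho> s" if s: "s \<ge> h" and n: "n \<in> {1..N}" for n s
    proof -
      consider "n \<le> N0" | "N0 < n" by linarith
      then have "\<bar>c.Z n s\<bar> \<le> cz * \<rho> s \<and> \<bar>c.e n s\<bar> \<le> ce * \<rho> s"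
      proof cases
        case 1
        have "c.X s $ (n - 1) = c.Z n s" "c.X s $ (N0 + (n - 1)) = c.e n s"
          using 1 n unfolding c.X_def by (auto simp: stk_index)
        moreover have "n - 1 < DD" "N0 + (n - 1) < DD" using 1 n by auto
        ultimately have b: "\<bar>c.Z n s\<bar> \<le> q * \<rho> s" "\<bar>c.e n s\<bar> \<le> q * \<rho> s"
          using Xs[OF s, of "n - 1"] Xs[OF s, of "N0 + (n - 1)"] by simp_all
        show ?thesis
          unfolding cz_def ce_def using order_trans[OF b(1) qm[OF nn(3)]] order_trans[OF b(2) qm[OF nn(2)]] by blast
      next
        case 2
        have l: "lam n > 0" by (rule lp[OF n])
        have X3: "c.X s $ (N0 + N0 + (n - N0 - 1)) = c.Z n s / lam n" and X4: "c.X s $ (N0 + N0 + MM + (n - N0 - 1)) = sqrt (lam n) * c.e n s"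
          using 2 n unfolding c.X_def by (auto simp: stk_index)
        have b3: "\<bar>c.Z n s / lam n\<bar> \<le> q * \<rho> s" and b4: "\<bar>sqrt (lam n) * c.e n s\<bar> \<le> q * \<rho> s"
          using Xs[OF s, of "N0 + N0 + (n - N0 - 1)"] Xs[OF s, of "N0 + N0 + MM + (n - N0 - 1)"] 2 n unfolding X3 X4 by auto
        have "\<bar>c.Z n s\<bar> \<le> lam n * (q * \<rho> s)" using b3 l by (simp add: field_simps)
        also have "\<dots> \<le> (1 + l1) * (q * \<rho> s)"
          using mem[of n lam, OF n] lp q \<rho>0 by (intro mult_right_mono) (auto simp: l1_def less_imp_le add_increasing)
        finally have 1: "\<bar>c.Z n s\<bar> \<le> cz * \<rho> s" by (simp add: cz_def mult_ac)
        have "\<bar>c.e n s\<bar> \<le> (1 / sqrt (lam n)) * (q * \<rho> s)" using b4 l unfolding abs_mult by (simp add: pos_le_divide_eq mult.commute)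
        also have "\<dots> \<le> (1 + il) * (q * \<rho> s)"
          using mem[of n "\<lambda>n. 1 / sqrt (lam n)", OF n] lp q \<rho>0 by (intro mult_right_mono) (auto simp: il_def less_imp_le add_increasing)
        finally have 2: "\<bar>c.e n s\<bar> \<le> ce * \<rho> s" by (simp add: ce_def mult_ac)
        show ?thesis using 1 2 by simp
      qed
      then show "\<bar>c.Z n s\<bar> \<le> cz * \<rho> s" "\<bar>c.e n s\<bar> \<le> ce * \<rho> s" by auto
    qed
    have us: "\<bar>u s\<bar> \<le> cu * \<rho> s" if s: "s \<ge> 0" for s
    proof (cases "s \<le> h")
      case True
      have "\<bar>u s\<bar> \<le> C0 * (x1 * \<rho> s)"
        using I3[OF s True] mult_left_mono[OF \<rho>early[OF s True] C0] by linarith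
      moreover have "0 \<le> sK * q * \<rho> s" using nn q \<rho>0 by auto
      ultimately show ?thesis by (simp add: cu_def distrib_right mult.assoc)
    next
      case False
      have "\<bar>gain (\<lambda>i. c.Z (i+1) s)\<bar> \<le> sK * (q * \<rho> s)"
        unfolding sK_def
      proof (rule c.gain_bound)
        fix i assume "i < N0"
        moreover from this have "c.X s $ i = c.Z (i+1) s" unfolding c.X_def by (simp add: stk_index)
        ultimately show "\<bar>c.Z (i+1) s\<bar> \<le> q * \<rho> s" using Xs[of s i] False by simp
      qed
      moreover have "0 \<le> C0 * x1 * \<rho> s" using C0 x1 \<rho>0 by auto
      ultimately show ?thesis using c.u_pred[OF s] by (simp add: cu_def distrib_right mult.assoc)
    qed
    have zhs: "\<bar>zh n s\<bar> \<le> ch * \<rho> s" if s: "s \<ge> 0" and n: "n \<in> {1..N}" for n s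
    proof (cases "s \<le> h")
      case True
      have "\<bar>zh n s\<bar> \<le> C0 * (x1 * \<rho> s)"
        using I(1)[OF s True n] mult_left_mono[OF \<rho>early[OF s True] C0] by linarith
      also have "\<dots> = C0 * x1 * \<rho> s" by simp
      also have "\<dots> \<le> ch * \<rho> s"
        unfolding ch_def using cht \<rho>0[of s] by (intro mult_right_mono) (auto intro!: sum_nonneg simp del: exp_minus)
      finally show ?thesis .
    next
      case False
      then have s: "s \<ge> h" by simp
      let ?D = "delay_int (kap n) h (\<lambda>s. beta n * c.ue s) s"
      have "\<bar>?D\<bar> \<le> h * exp (\<bar>kap n\<bar> * h) * (\<bar>beta n\<bar> * (cu * (x1 * \<rho> s)))"
      proof (rule delay_int_bound)
        show "continuous_on UNIV (\<lambda>s. beta n * c.ue s)" by (intro continuous_intros c.ue_cont)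
        fix r assume r: "s - h \<le> r" "r \<le> s"
        then have "\<bar>c.ue r\<bar> \<le> cu * \<rho> r" unfolding c.ue_max using s us[of r] by simp
        also have "\<dots> \<le> cu * (x1 * \<rho> s)" using \<rho>mono[OF r(1)] cu unfolding \<rho>h by (intro mult_left_mono) auto
        finally show "\<bar>beta n * c.ue r\<bar> \<le> \<bar>beta n\<bar> * (cu * (x1 * \<rho> s))" by (simp add: abs_mult mult_left_mono)
      qed (use h in auto)
      moreover have "\<bar>c.Z n s\<bar> \<le> cz * \<rho> s" by (rule Zs(1)[OF s n])
      \<comment> \<open>The definition of the predictor solved for the observer state.\<close>
      moreover have "zh n s = exp (- kap n * h) * (c.Z n s - ?D)"
        by (simp add: pred_def exp_minus)
      ultimately have "\<bar>zh n s\<bar> \<le> exp (- kap n * h) * (cz * \<rho> s + h * exp (\<bar>kap n\<bar> * h) * (\<bar>beta n\<bar> * (cu * (x1 * \<rho> s))))"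
        by (simp add: abs_mult)
      also have "\<dots> = exp (- kap n * h) * (cz + h * exp (\<bar>kap n\<bar> * h) * (\<bar>beta n\<bar> * (cu * x1))) * \<rho> s" by (simp add: algebra_simps)
      also have "\<dots> \<le> ch * \<rho> s"
        using mem[of n "\<lambda>n. exp (- kap n * h) * (cz + h * exp (\<bar>kap n\<bar> * h) * (\<bar>beta n\<bar> * (cu * x1)))", OF n cht] C0 x1 \<rho>0[of s]
        by (intro mult_right_mono) (auto simp: ch_def add_increasing2)
      finally show ?thesis .
    qed
    show "\<bar>u t\<bar> \<le> C * (R * exp (- \<delta> * t))" using us[OF t] mult_right_mono[OF C(3) \<rho>0[of t]] by (simp add: \<rho>_def)
    show "\<bar>zh n t\<bar> \<le> C * (R * exp (- \<delta> * t))" if "n \<in> {1..N}" for n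
      using zhs[OF t that] mult_right_mono[OF C(2) \<rho>0[of t]] by (simp add: \<rho>_def)
    have low: "lam n * (zn n t + b n * u t)^2 \<le> lam n * (ce + ch + \<bar>b n\<bar> * cu)^2 * (\<rho> t)^2" if n: "n \<in> {1..N}" for n
    proof -
      \<comment> \<open>The error at \<open>t + h\<close>, where the estimates for times beyond
        \<open>h\<close> apply, contains the plant at time \<open>t\<close>.\<close>
      have "zn n t = c.e n (t + h) + zh n (t + h)" by simp
      then have "\<bar>zn n t\<bar> \<le> ce * \<rho> (t + h) + ch * \<rho> (t + h)"
        using Zs(2)[of "t + h" n] zhs[of "t + h" n] t h n by linarith
      also have "\<dots> \<le> ce * \<rho> t + ch * \<rho> t"
        using \<rho>mono[of t "t + h"] h ce ch by (intro add_mono mult_left_mono) auto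
      finally have "\<bar>zn n t\<bar> \<le> (ce + ch) * \<rho> t" by (simp add: distrib_right)
      moreover have "\<bar>b n * u t\<bar> \<le> \<bar>b n\<bar> * (cu * \<rho> t)" unfolding abs_mult by (rule mult_left_mono[OF us[OF t]]) simp
      ultimately have "\<bar>zn n t + b n * u t\<bar> \<le> (ce + ch + \<bar>b n\<bar> * cu) * \<rho> t"
        using abs_triangle_ineq[of "zn n t" "b n * u t"] by (simp add: distrib_right mult.assoc)
      then have "(zn n t + b n * u t)^2 \<le> ((ce + ch + \<bar>b n\<bar> * cu) * \<rho> t)^2"
        by (metis abs_ge_zero power2_abs power_mono)
      then show ?thesis using lp[OF n] by (simp add: power_mult_distrib mult.assoc)
    qed
    have high: "c.En (N+1) m t \<le> (W1 / \<gamma> + G * x1^2) * (\<rho> t)^2" for m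
    proof (cases "t \<le> h")
      case True
      have "c.En (N+1) m t \<le> G * R^2" using order_trans[OF c.En_le_En_1 Ee[OF t True]] by simp
      also have "\<dots> \<le> G * (x1 * \<rho> t)^2" using \<rho>early[OF t True] R0 G by (intro mult_left_mono power_mono) auto
      finally have "c.En (N+1) m t \<le> G * x1^2 * (\<rho> t)^2" by (simp add: power_mult_distrib)
      moreover have "0 \<le> W1 / \<gamma> * (\<rho> t)^2" using W1 pos by simp
      ultimately show ?thesis by (simp add: distrib_right)
    next
      case False
      then have "\<gamma> * c.En (N+1) m t \<le> W1 * (\<rho> t)^2"
        using decay[of t m] cP(3)[OF c.X_carrier[of t]] by simp
      then have "c.En (N+1) m t \<le> W1 / \<gamma> * (\<rho> t)^2" using pos by (simp add: field_simps)
      moreover have "0 \<le> G * x1^2 * (\<rho> t)^2" using G by simp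
      ultimately show ?thesis by (simp add: distrib_right)
    qed
    fix m
    \<comment> \<open>Enlarging the range to \<open>N + m\<close> allows the split at
      \<open>N\<close> for every \<open>m\<close>.\<close>
    have "(\<Sum>n=1..m. lam n * (zn n t + b n * u t)^2) \<le> (\<Sum>n=1..N + m. lam n * (zn n t + b n * u t)^2)"
      using c.lam_nonneg by (intro sum_mono2) auto
    also have "\<dots> = (\<Sum>n=1..N. lam n * (zn n t + b n * u t)^2) + c.En (N+1) (N + m) t"
      unfolding c.En_def by (rule sum.ub_add_nat) simp
    also have "\<dots> \<le> cl * (\<rho> t)^2 + (W1 / \<gamma> + G * x1^2) * (\<rho> t)^2"
      unfolding cl_def sum_distrib_right by (intro add_mono sum_mono low high)
    also have "\<dots> \<le> C * (\<rho> t)^2" using mult_right_mono[OF C(1) zero_le_power2[of "\<rho> t"]] by (simp add: distrib_right)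
    finally show "(\<Sum>n=1..m. lam n * (zn n t + b n * u t)^2) \<le> C * (R * exp (- \<delta> * t))^2" by (simp only: \<rho>_def)
  qed
qed

end

section \<open>Decay of the H1 norm\<close>

lemma H2_L2: "H2 f \<Longrightarrow> L2 f" by (auto simp: H2_def dest: H2_witD)

lemma ip_tendsto_0:
  assumes ev: "\<forall>\<^sub>F s in F. L2 (g s)" and k: "L2 k"
    and lim: "((\<lambda>s. LINT x:{0..1}|lborel. (g s x)^2) \<longlongrightarrow> 0) F"
  shows "((\<lambda>s. ip (g s) k) \<longlongrightarrow> 0) F"
proof -
  have "((\<lambda>s. sqrt (ip (g s) (g s) * ip k k)) \<longlongrightarrow> sqrt (0 * ip k k)) F"
    using lim unfolding ip_self[symmetric] by (intro tendsto_intros)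
  then have lim': "((\<lambda>s. sqrt (ip (g s) (g s) * ip k k)) \<longlongrightarrow> 0) F" by simp
  have "\<forall>\<^sub>F s in F. norm (ip (g s) k) \<le> sqrt (ip (g s) (g s) * ip k k)"
    using ev
  proof eventually_elim
    case (elim s) show ?case using ip_Cauchy_Schwarz[OF elim k] real_le_rsqrt[of "\<bar>ip (g s) k\<bar>"] by simp
  qed
  then show ?thesis by (rule Lim_null_comparison[OF _ lim'])
qed

lemma ip_continuous:
  fixes z :: "real \<Rightarrow> real \<Rightarrow> real"
  assumes L: "\<And>t. t \<ge> 0 \<Longrightarrow> L2 (z t)" "L2 k"
    and lim: "\<And>t. t \<ge> 0 \<Longrightarrow> ((\<lambda>s. LINT x:{0..1}|lborel. (z s x - z t x)^2) \<longlongrightarrow> 0) (at t within {0..})"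
  shows "continuous_on {0..} (\<lambda>t. ip (z t) k)"
  unfolding continuous_on_def
proof
  fix t :: real assume "t \<in> {0..}"
  then have t: "t \<ge> 0" by simp
  have ev: "\<forall>\<^sub>F s in at t within {0..}. s \<ge> 0" by (simp add: eventually_at_filter)
  have "((\<lambda>s. ip (\<lambda>x. z s x - z t x) k) \<longlongrightarrow> 0) (at t within {0..})"
  proof (rule ip_tendsto_0[OF _ L(2) lim[OF t]])
    show "\<forall>\<^sub>F s in at t within {0..}. L2 (\<lambda>x. z s x - z t x)"
      using ev by eventually_elim (intro L2_diff L t)
  qed
  moreover have "\<forall>\<^sub>F s in at t within {0..}. ip (\<lambda>x. z s x - z t x) k = ip (z s) k - ip (z t) k"
    using ev by eventually_elim (intro ip_diff L t)
  ultimately have "((\<lambda>s. ip (z s) k - ip (z t) k) \<longlongrightarrow> 0) (at t within {0..})"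
    by (rule Lim_transform_eventually)
  then show "((\<lambda>s. ip (z s) k) \<longlongrightarrow> ip (z t) k) (at t within {0..})" by (rule LIM_zero_cancel)
qed

text \<open>Mean square convergence of the difference quotients passes to inner products by
  Cauchy-Schwarz, so each modal coefficient is differentiable in the ordinary sense.\<close>

lemma ip_derivative:
  fixes z :: "real \<Rightarrow> real \<Rightarrow> real"
  assumes L: "\<And>t. t \<ge> 0 \<Longrightarrow> L2 (z t)" "L2 k" "L2 zt" and t: "t > 0"
    and lim: "((\<lambda>s. LINT x:{0..1}|lborel. ((z s x - z t x) / (s - t) - zt x)^2) \<longlongrightarrow> 0) (at t)"
  shows "((\<lambda>t. ip (z t) k) has_real_derivative ip zt k) (at t)"
proof -
  have ev: "\<forall>\<^sub>F s in at t. 0 < s" by (rule order_tendstoD(1)[OF tendsto_ident_at t])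
  have L': "L2 (\<lambda>x. (z s x - z t x) / (s - t))" if "s > 0" for s
    using L2_scale[OF L2_diff[OF L(1)[of s] L(1)[of t]], of "1 / (s - t)"] that t by simp
  have "((\<lambda>s. ip (\<lambda>x. (z s x - z t x) / (s - t) - zt x) k) \<longlongrightarrow> 0) (at t)"
  proof (rule ip_tendsto_0[OF _ L(2) lim])
    show "\<forall>\<^sub>F s in at t. L2 (\<lambda>x. (z s x - z t x) / (s - t) - zt x)"
      using ev by eventually_elim (intro L2_diff L' L)
  qed
  moreover have "\<forall>\<^sub>F s in at t. ip (\<lambda>x. (z s x - z t x) / (s - t) - zt x) k = (ip (z s) k - ip (z t) k) / (s - t) - ip zt k"
    using ev
  proof eventually_elim
    case (elim s)
    have "ip (\<lambda>x. (z s x - z t x) / (s - t)) k = 1 / (s - t) * (ip (z s) k - ip (z t) k)"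
      using ip_scale[of "1 / (s - t)" "\<lambda>x. z s x - z t x" k] ip_diff[OF L(1)[of s] L(1)[of t] L(2)] elim t by simp
    then show ?case using ip_diff[OF L'[OF elim] L(3,2)] by simp
  qed
  ultimately have "((\<lambda>s. (ip (z s) k - ip (z t) k) / (s - t) - ip zt k) \<longlongrightarrow> 0) (at t)"
    by (rule Lim_transform_eventually)
  then show ?thesis unfolding has_field_derivative_iff by (rule LIM_zero_cancel)
qed

lemma lipschitz_le_SUP:
  fixes f :: "real \<Rightarrow> real"
  assumes f: "C-lipschitz_on {a..b} f" and s: "s \<in> {a..b}" shows "\<bar>f s\<bar> \<le> (SUP s\<in>{a..b}. \<bar>f s\<bar>)"
proof (rule cSUP_upper[OF s])
  have "continuous_on {a..b} (\<lambda>s. \<bar>f s\<bar>)"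
    by (intro continuous_intros lipschitz_on_continuous_on[OF f])
  then show "bdd_above ((\<lambda>s. \<bar>f s\<bar>) ` {a..b})"
    by (intro bounded_imp_bdd_above compact_imp_bounded compact_continuous_image) auto
qed

context sturm_liouville begin

lemma coeff_lift:
  assumes "L2 z" "n \<ge> 1" shows "ip (\<lambda>x. z x + u * b_fun th2 x) (phi n) = ip z (phi n) + bc n * u"
  using ip_add[OF assms(1) L2_scale[OF b_fun_L2] phi_L2[OF assms(2)], of u] by (simp add: ip_scale)

text \<open>Testing the equation with \<open>phi n\<close> gives the modal equations. The lift lies
  in the operator domain at every time and supplies the energy and trace series, and the Lipschitz
  history is bounded by its supremum.\<close>

lemma closed_loop_modal:
  assumes m: "modal lam bet phi qc h N0 N K L ac bc"
    and z0: "H2 z0" and u0: "u0 = cos th2 * z0 1 + sin th2 * dx z0 1"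
    and y0: "C-lipschitz_on {-h..0} y0"
    and sol: "closed_loop_sol th1 th2 p qt lam phi qc N0 N h K L z0 y0 u0 z zh u"
  shows "closed_loop lam bet phi qc h N0 N K L ac bc (\<lambda>n t. ip (z t) (phi n)) zh u u0
    (\<lambda>t. z t 0) (yD h z y0) (SUP s\<in>{-h..0}. \<bar>y0 s\<bar>)"
proof -
  interpret m: modal lam bet phi qc h N0 N K L ac bc by (rule m)
  have S: "\<forall>x\<in>{0..1}. z 0 x = z0 x" "\<forall>t\<ge>0. H2 (z t)"
    "\<forall>t\<ge>0. ((\<lambda>s. LINT x:{0..1}|lborel. (z s x - z t x)^2) \<longlongrightarrow> 0) (at t within {0..})"
    "\<forall>t>0. \<exists>zt. L2 zt \<and>
        ((\<lambda>s. LINT x:{0..1}|lborel. ((z s x - z t x) / (s - t) - zt x)^2) \<longlongrightarrow> 0) (at t) \<and>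
        (\<exists>g w. H2_wit (z t) g w \<and>
           (AE x in lborel. x \<in> {0..1} \<longrightarrow> zt x = dx p x * g x + p x * w x - qt x * z t x))"
    "\<forall>t\<ge>0. cos th1 * z t 0 - sin th1 * dx (z t) 0 = 0"
    "\<forall>t\<ge>0. cos th2 * z t 1 + sin th2 * dx (z t) 1 = u t"
    "continuous_on {0..} u"
    "\<forall>t\<ge>0. u t = Kpred K N0 lam bet qc h zh u u0 t"
    "\<forall>n\<in>{1..N}. continuous_on {0..} (zh n)"
    "\<forall>n\<in>{1..N0}. \<forall>t>0. (zh n has_real_derivative
         ((- lam n + qc) * zh n t + bet n * uext u u0 (t - h)
          - L $$ (n - 1, 0) * ((\<Sum>k=1..N. (zh k t + bc k * uext u u0 (t - h)) * phi k 0) - yD h z y0 t))) (at t)"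
    "\<forall>n\<in>{N0+1..N}. \<forall>t>0. (zh n has_real_derivative
         ((- lam n + qc) * zh n t + bet n * uext u u0 (t - h))) (at t)"
    using sol unfolding closed_loop_sol_def Let_def by - (elim conjE, assumption)+
  have L: "\<And>t. t \<ge> 0 \<Longrightarrow> L2 (z t)" using S(2) H2_L2 by blast
  have DA: "in_DA th1 th2 (\<lambda>x. z t x + u t * b_fun th2 x)" if "t \<ge> 0" for t
    using S(2,5,6) that by (intro lift_DA) auto
  show ?thesis
  proof (intro closed_loop.intro closed_loop_axioms.intro m)
    fix n :: nat assume n: "n \<ge> 1"
    show "continuous_on {0..} (\<lambda>t. ip (z t) (phi n))"
      using S(3) by (intro ip_continuous L phi_L2[OF n]) auto
    fix t :: real assume t: "t > 0"
    obtain zt g w where zt: "L2 zt" "((\<lambda>s. LINT x:{0..1}|lborel. ((z s x - z t x) / (s - t) - zt x)^2) \<longlongrightarrow> 0) (at t)"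
      and H: "H2_wit (z t) g w" and ae: "AE x in lborel. x \<in> {0..1} \<longrightarrow> zt x = dx p x * g x + p x * w x - qt x * z t x"
      using S(4) t by blast
    have t0: "t \<ge> 0" using t by simp
    have g: "dx (z t) 0 = g 0" "dx (z t) 1 = g 1" using H2_witD(6)[OF H] by auto
    \<comment> \<open>The equation holds almost everywhere in space, which is enough for inner
      products.\<close>
    have "ip zt (phi n) = ip (\<lambda>x. dx p x * g x + p x * w x - qt x * z t x) (phi n)"
      by (rule ip_cong_AE[OF zt(1) _ phi_L2[OF n] ae]) (intro L2_diff div_L2[OF H] L2_mult_continuous qt L t0)
    also have "\<dots> = (- lam n + qc) * ip (z t) (phi n) + bet n * u t"
      using S(5,6) t0 g by (intro coeff_dynamics[OF n H]) auto
    finally show "((\<lambda>t. ip (z t) (phi n)) has_real_derivative (m.kap n * ip (z t) (phi n) + bet n * u t)) (at t)"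
      using ip_derivative[OF L phi_L2[OF n] zt(1) t zt(2)] by (simp add: m.kap_def)
  next
    show "continuous_on {0..} u" by (rule S(7))
    obtain w where w: "H2_wit z0 (dx z0) w" using z0 by (rule H2_obtain)
    have "H2_wit (z 0) (dx z0) w" by (rule H1_norm_sq_cong(1)[OF _ w]) (simp add: S(1))
    then have "dx (z 0) 1 = dx z0 1" "z 0 1 = z0 1" using H2_witD(6) S(1) by auto
    then show "u 0 = u0" using S(6)[rule_format, of 0] unfolding u0 by simp
  next
    fix t :: real assume t: "t \<ge> 0"
    show "u t = m.gain (\<lambda>i. m.pred zh u u0 (i + 1) t)" using S(8) t unfolding m.Kpred_eq by blast
    show "summable (\<lambda>n. lam (Suc n) * (ip (z t) (phi (Suc n)) + bc (Suc n) * u t)^2)"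
      using energy_sums[OF DA[OF t]] by (simp add: coeff_lift[OF L[OF t]] sums_iff)
    \<comment> \<open>\<open>b\<close> vanishes at 0, so \<open>z\<close> and its lift have the same
      trace there.\<close>
    show "(\<lambda>n. (ip (z t) (phi (Suc n)) + bc (Suc n) * u t) * phi (Suc n) 0) sums z t 0"
      using point_value_sums[OF DA[OF t]] by (simp add: coeff_lift[OF L[OF t]] b_fun_0)
  next
    fix n assume n: "1 \<le> n" "n \<le> N"
    show "continuous_on {0..} (zh n)" using S(9) n by auto
    fix t :: real assume t: "t > 0"
    show "(zh n has_real_derivative (m.kap n * zh n t + bet n * uext u u0 (t - h)
        - m.gL n * m.innovation zh u u0 (yD h z y0) t)) (at t)"
    proof (cases "n \<le> N0")
      case True
      then show ?thesis
        using S(10)[rule_format, of n t] n t by (simp add: m.kap_def m.gL_def m.innovation_def)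
    next
      case False
      then show ?thesis
        using S(11)[rule_format, of n t] n t by (simp add: m.kap_def m.gL_def)
    qed
  next
    show "yD h z y0 t = z (t - h) 0" if "t \<ge> h" for t using that by (simp add: yD_def)
    show "\<bar>yD h z y0 t\<bar> \<le> (SUP s\<in>{-h..0}. \<bar>y0 s\<bar>)" if "0 \<le> t" "t < h" for t
      using lipschitz_le_SUP[OF y0, of "t - h"] that by (simp add: yD_def)
  qed
qed

text \<open>The modal decay estimate is translated at both ends: the energy of the lift is
  equivalent to its squared \<open>H1\<close> norm, and the lift differs from the state by the
  multiple \<open>u\<close> of \<open>b\<close>, for which a separate bound is available.\<close>

theorem LMI_imp_decay:
  assumes \<delta>: "\<delta> > 0" and h: "h > 0" and NN: "N \<ge> N0 + 1"
    and K: "K \<in> carrier_mat 1 N0" and Lc: "L \<in> carrier_mat N0 1"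
    and feas: "LMI_feasible p qt th2 lam phi qc \<delta> N0 N h K L"
  obtains M where "M > 0"
    "\<And>z0 y0 z zh u u0 C t. u0 = cos th2 * z0 1 + sin th2 * dx z0 1 \<Longrightarrow> H2 z0 \<Longrightarrow> C-lipschitz_on {-h..0} y0 \<Longrightarrow>
      closed_loop_sol th1 th2 p qt lam phi qc N0 N h K L z0 y0 u0 z zh u \<Longrightarrow> t \<ge> 0 \<Longrightarrow>
      H1_norm_sq (z t) + (\<Sum>n=1..N. (zh n t)^2) \<le> M * exp (- 2 * \<delta> * t) *
        (H1_norm_sq z0 + (\<Sum>n=1..N. (zh n 0)^2) + u0^2 + (SUP s\<in>{-h..0}. \<bar>y0 s\<bar>)^2)"
proof -
  obtain P \<alpha> \<beta> \<gamma> where P: "P \<in> carrier_mat (2 * N) (2 * N)" "P\<^sup>T = P" "pos_def P"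
    and pos: "\<alpha> > 1" "\<beta> > 0" "\<gamma> > 0"
    and T1: "neg_semidef (Theta1 p qt th2 lam phi qc \<delta> N0 N h K L P \<alpha> \<beta> \<gamma>)"
    and T2: "Theta2 lam phi qc \<delta> N \<alpha> \<beta> \<gamma> \<le> 0"
    using feas unfolding LMI_feasible_def by blast
  interpret m: modal lam bet phi qc h N0 N K L ac bc
  proof
    show "N0 \<le> N" using NN by simp
    show "lam n > 0" if "n \<ge> 1" for n using that by (rule lam_pos)
    show "lam k \<le> lam n" if "1 \<le> k" "k \<le> n" for k n using that by (rule lam_mono)
    show "ac n = bet n + (lam n - qc) * bc n" if "n \<ge> 1" for n using that by (rule coeff_a)
  qed (intro K Lc h bessel_summable a_fun_L2 b_fun_L2 point_weights_summable)+
  have Pc: "P \<in> carrier_mat m.DD m.DD" using P(1) unfolding m.DD_eq .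
  have RN: "RN_norm_sq phi N f = (\<Sum>n. (ip f (phi (n + (N+1))))^2)" for f by (simp add: RN_norm_sq_def)
  have \<Theta>1: "2 * scalar_prod (stk N0 m.MM (m.d1 x1 x2 x4 \<zeta>) (m.d2 x2 x4 \<zeta>) (m.d3 x1 x3) (m.d4 x4)) (P *\<^sub>v stk N0 m.MM x1 x2 x3 x4)
      + 2 * \<delta> * scalar_prod (stk N0 m.MM x1 x2 x3 x4) (P *\<^sub>v stk N0 m.MM x1 x2 x3 x4)
      + \<alpha> * \<gamma> * (\<Sum>n. (ac (n + (N+1)))^2) * (m.gain x1)^2 - \<beta> * exp (- 2 * \<delta> * h) * \<zeta>^2
      + \<alpha> * \<gamma> * (\<Sum>n. (bc (n + (N+1)))^2) * (m.gain (m.d1 x1 x2 x4 \<zeta>))^2 \<le> 0" for x1 x2 x3 x4 \<zeta>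
  proof -
    let ?v = "stk N0 m.MM x1 x2 x3 x4 @\<^sub>v vec 1 (\<lambda>_. \<zeta>)"
    have v: "?v \<in> carrier_vec (m.DD + 1)" by (intro append_carrier_vec stk_carrier vec_carrier)
    have dim: "dim_row (Theta1 p qt th2 lam phi qc \<delta> N0 N h K L P \<alpha> \<beta> \<gamma>) = m.DD + 1"
      by (rule carrier_matD(1)[OF m.Theta1_carrier[OF Pc refl]])
    show ?thesis
      using T1[unfolded neg_semidef_def dim, rule_format, OF v]
      unfolding m.Theta1_form[OF Pc P(2) refl] RN .
  qed
  have \<Theta>2: "2 * \<gamma> * (- (1 - 1 / \<alpha>) * lam (N+1) + qc + \<delta>) + \<beta> * (\<Sum>n. (phi (n + (N+1)) 0)^2 / lam (n + (N+1))) \<le> 0"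
    using T2 by (simp add: Theta2_def M_phi_def)
  obtain C where C: "C \<ge> 0" and dec: "\<And>zn zh u u0 y ym Y R. closed_loop lam bet phi qc h N0 N K L ac bc zn zh u u0 y ym Y \<Longrightarrow>
     \<bar>u0\<bar> \<le> R \<Longrightarrow> Y \<le> R \<Longrightarrow> (\<forall>n\<in>{1..N}. \<bar>zh n 0\<bar> \<le> R) \<Longrightarrow>
     (\<Sum>n. lam (Suc n) * (zn (Suc n) 0 + bc (Suc n) * u 0)^2) \<le> R^2 \<Longrightarrow>
     (\<forall>t\<ge>0. (\<forall>m. (\<Sum>n=1..m. lam n * (zn n t + bc n * u t)^2) \<le> C * (R * exp (- \<delta> * t))^2) \<and>
        (\<forall>n\<in>{1..N}. \<bar>zh n t\<bar> \<le> C * (R * exp (- \<delta> * t))) \<and> \<bar>u t\<bar> \<le> C * (R * exp (- \<delta> * t)))"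
    using m.decay_estimate[OF Pc P(2,3) \<delta> pos \<Theta>1 \<Theta>2] by blast
  obtain c1 C1 where c1: "c1 > 0" "C1 > 0"
    "\<And>f. in_DA th1 th2 f \<Longrightarrow> c1 * H1_norm_sq f \<le> energy f \<and> energy f \<le> C1 * H1_norm_sq f"
    using energy_bounds by blast
  obtain C2 where C2: "C2 > 0"
    "\<And>z u. H2 z \<Longrightarrow> H1_norm_sq (\<lambda>x. z x + u * b_fun th2 x) \<le> C2 * (H1_norm_sq z + u^2)
       \<and> H1_norm_sq z \<le> C2 * (H1_norm_sq (\<lambda>x. z x + u * b_fun th2 x) + u^2)"
    using lift_norm_bounds by blast
  \<comment> \<open>\<open>R^2 = \<kappa> * S\<close> has to dominate the initial data
    \<open>S\<close> and also the initial energy, which is at most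
    \<open>C1 * C2 * S\<close>.\<close>
  define \<kappa> where "\<kappa> = 1 + C1 * C2"
  define D where "D = C2 * (C / c1 + C^2) + real N * C^2"
  have \<kappa>: "\<kappa> \<ge> 1" and D: "D \<ge> 0" using C c1 C2 by (auto simp: \<kappa>_def D_def)
  \<comment> \<open>The added 1 makes the constant strictly positive, as \<open>D\<close> is only
    known to be nonnegative.\<close>
  have M: "D * \<kappa> + 1 > 0" using \<kappa> D by (intro add_nonneg_pos mult_nonneg_nonneg) auto
  show thesis
  proof (rule that[OF M])
    fix z0 y0 z zh u u0 B and t :: real
    assume u0: "u0 = cos th2 * z0 1 + sin th2 * dx z0 1" and z0: "H2 z0" and y0: "B-lipschitz_on {-h..0} y0"
      and sol: "closed_loop_sol th1 th2 p qt lam phi qc N0 N h K L z0 y0 u0 z zh u" and t: "t \<ge> 0"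
    let ?Y = "SUP s\<in>{-h..0}. \<bar>y0 s\<bar>"
    define S where "S = H1_norm_sq z0 + (\<Sum>n=1..N. (zh n 0)^2) + u0^2 + ?Y^2"
    define R where "R = sqrt (\<kappa> * S)"
    define \<rho> where "\<rho> = R * exp (- \<delta> * t)"
    have cl: "closed_loop lam bet phi qc h N0 N K L ac bc (\<lambda>n t. ip (z t) (phi n)) zh u u0 (\<lambda>t. z t 0) (yD h z y0) ?Y"
      by (rule closed_loop_modal[OF m.modal_axioms z0 u0 y0 sol])
    interpret c: closed_loop lam bet phi qc h N0 N K L ac bc "\<lambda>n t. ip (z t) (phi n)" zh u u0 "\<lambda>t. z t 0" "yD h z y0" ?Y
      by (rule cl)
    have s1: "\<forall>x\<in>{0..1}. z 0 x = z0 x" and s2: "\<forall>t\<ge>0. H2 (z t)"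
      and s3: "\<forall>t\<ge>0. cos th1 * z t 0 - sin th1 * dx (z t) 0 = 0"
      and s4: "\<forall>t\<ge>0. cos th2 * z t 1 + sin th2 * dx (z t) 1 = u t"
      using sol unfolding closed_loop_sol_def Let_def by - (elim conjE, assumption)+
    let ?w = "\<lambda>t x. z t x + u t * b_fun th2 x"
    have DA: "in_DA th1 th2 (?w t)" if "t \<ge> 0" for t using s2 s3 s4 that by (intro lift_DA) auto
    have en: "energy (?w t) = (\<Sum>n. lam (Suc n) * (ip (z t) (phi (Suc n)) + bc (Suc n) * u t)^2)" if "t \<ge> 0" for t
      unfolding energy_def using s2 that by (simp add: coeff_lift H2_L2)
    have nn: "H1_norm_sq z0 \<ge> 0" "(\<Sum>n=1..N. (zh n 0)^2) \<ge> 0" "u0^2 \<ge> 0" "?Y^2 \<ge> 0"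
      by (rule H1_norm_sq_nonneg, rule sum_nonneg, simp_all)
    have S0: "S \<ge> 0" using nn by (simp add: S_def)
    have R: "R \<ge> 0" "R^2 = \<kappa> * S" using \<kappa> S0 by (auto simp: R_def)
    have SR: "S \<le> R^2" unfolding R(2) using mult_right_mono[OF \<kappa> S0] by simp
    have le: "\<bar>x\<bar> \<le> R" if "x^2 \<le> S" for x
    proof (rule power2_le_imp_le[OF _ R(1)])
      show "\<bar>x\<bar>^2 \<le> R^2" unfolding power2_abs using that SR by linarith
    qed
    have d: "(\<forall>m. (\<Sum>n=1..m. lam n * (ip (z t) (phi n) + bc n * u t)^2) \<le> C * \<rho>^2) \<and>
        (\<forall>n\<in>{1..N}. \<bar>zh n t\<bar> \<le> C * \<rho>) \<and> \<bar>u t\<bar> \<le> C * \<rho>"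
      unfolding \<rho>_def
    proof (rule dec[OF cl, rule_format, OF _ _ _ _ t])
      show "\<bar>u0\<bar> \<le> R" using nn by (intro le) (simp add: S_def)
      have "\<bar>?Y\<bar> \<le> R" using nn by (intro le) (simp add: S_def)
      then show "?Y \<le> R" by simp
      fix n assume "n \<in> {1..N}"
      then have "(zh n 0)^2 \<le> (\<Sum>n=1..N. (zh n 0)^2)" by (intro member_le_sum) auto
      then show "\<bar>zh n 0\<bar> \<le> R" using nn by (intro le) (unfold S_def, linarith)
    next
      obtain w where w: "H2_wit z0 (dx z0) w" using z0 by (rule H2_obtain)
      have z00: "H1_norm_sq (z 0) = H1_norm_sq z0" by (rule H1_norm_sq_cong(2)[OF _ w]) (simp add: s1)
      have "energy (?w 0) \<le> C1 * H1_norm_sq (?w 0)" using c1(3)[OF DA[of 0]] by simp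
      also have "\<dots> \<le> C1 * (C2 * (H1_norm_sq z0 + u0^2))"
        using C2(2)[of "z 0" "u 0"] s2 c1(2) unfolding z00 c.u_0 by (intro mult_left_mono) auto
      also have "\<dots> \<le> C1 * (C2 * S)" using c1(2) C2(1) nn by (intro mult_left_mono) (auto simp: S_def)
      also have "\<dots> \<le> R^2" unfolding R(2) \<kappa>_def using S0 by (simp add: distrib_right)
      finally show "(\<Sum>n. lam (Suc n) * (ip (z 0) (phi (Suc n)) + bc (Suc n) * u 0)^2) \<le> R^2" by (simp add: en)
    qed
    have "energy (?w t) \<le> C * \<rho>^2"
      unfolding en[OF t]
    proof (rule suminf_le_const[OF c.energy_summable[OF t]])
      show "(\<Sum>n<k. lam (Suc n) * (ip (z t) (phi (Suc n)) + bc (Suc n) * u t)^2) \<le> C * \<rho>^2" for k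
        using d by (simp add: sum.atLeast1_atMost_eq)
    qed
    then have "c1 * H1_norm_sq (?w t) \<le> C * \<rho>^2" using c1(3)[OF DA[OF t]] by simp
    then have w: "H1_norm_sq (?w t) \<le> C / c1 * \<rho>^2" using c1(1) by (simp add: field_simps)
    have sq: "x^2 \<le> C^2 * \<rho>^2" if "\<bar>x\<bar> \<le> C * \<rho>" for x
      using power_mono[OF that, of 2] by (simp add: power_mult_distrib)
    have "H1_norm_sq (z t) \<le> C2 * (H1_norm_sq (?w t) + (u t)^2)" using C2(2)[of "z t" "u t"] s2 t by simp
    also have "\<dots> \<le> C2 * (C / c1 * \<rho>^2 + C^2 * \<rho>^2)"
      using w sq d C2(1) by (intro mult_left_mono add_mono) auto
    finally have 1: "H1_norm_sq (z t) \<le> C2 * (C / c1 + C^2) * \<rho>^2" by (simp add: distrib_right mult.assoc)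
    have "(\<Sum>n=1..N. (zh n t)^2) \<le> (\<Sum>n=1..N. C^2 * \<rho>^2)" using sq d by (intro sum_mono) blast
    then have 2: "(\<Sum>n=1..N. (zh n t)^2) \<le> real N * C^2 * \<rho>^2" by simp
    have "\<rho>^2 = exp (- 2 * \<delta> * t) * (\<kappa> * S)"
      unfolding \<rho>_def power_mult_distrib R(2) by (simp add: power2_eq_square exp_add[symmetric])
    then have "H1_norm_sq (z t) + (\<Sum>n=1..N. (zh n t)^2) \<le> D * (exp (- 2 * \<delta> * t) * (\<kappa> * S))"
      using 1 2 by (simp add: D_def distrib_right)
    also have "\<dots> \<le> D * (exp (- 2 * \<delta> * t) * (\<kappa> * S)) + exp (- 2 * \<delta> * t) * S" using S0 by simp
    also have "\<dots> = (D * \<kappa> + 1) * exp (- 2 * \<delta> * t) * S" by (simp add: algebra_simps)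
    finally show "H1_norm_sq (z t) + (\<Sum>n=1..N. (zh n t)^2) \<le> (D * \<kappa> + 1) * exp (- 2 * \<delta> * t) *
        (H1_norm_sq z0 + (\<Sum>n=1..N. (zh n 0)^2) + u0^2 + ?Y^2)" by (simp only: S_def)
  qed
qed

end

theorem theorem1:
  fixes th1 th2 qc \<delta> :: real and p qt q :: "real \<Rightarrow> real"
    and lam :: "nat \<Rightarrow> real" and phi :: "nat \<Rightarrow> real \<Rightarrow> real"
    and N0 :: nat and K L :: "real mat"
  assumes th1: "0 < th1" "th1 \<le> pi / 2" and th2: "0 \<le> th2" "th2 \<le> pi / 2"
    and p: "C2_on01 p" "\<forall>x\<in>{0..1}. p x > 0"
    and qt: "continuous_on {0..1} qt" and q: "continuous_on {0..1} q"
    and qtq: "\<forall>x\<in>{0..1}. qt x = q x - qc" and qpos: "\<forall>x\<in>{0..1}. q x > 0"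
    and eig: "SL_eigenbasis p q th1 th2 lam phi"
    and \<delta>: "\<delta> > 0" and N0: "N0 \<ge> 1" and gap: "\<forall>n\<ge>N0+1. - lam n + qc < - \<delta>"
    and K: "K \<in> carrier_mat 1 N0" "K \<noteq> 0\<^sub>m 1 N0" and L: "L \<in> carrier_mat N0 1"
    and hurK: "eigs_below (A0m lam qc N0 + B0m (beta_n p th2 phi) N0 * K) (- \<delta>)"
    and hurL: "eigs_below (A0m lam qc N0 - L * C0m phi N0) (- \<delta>)"
  shows
    "(\<forall>h N. h > 0 \<longrightarrow> N \<ge> N0 + 1 \<longrightarrow> LMI_feasible p qt th2 lam phi qc \<delta> N0 N h K L \<longrightarrow>
       (\<exists>M>0. \<forall>z0 y0 z zh u.
          let u0 = cos th2 * z0 1 + sin th2 * dx z0 1 in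
          H2 z0 \<longrightarrow> cos th1 * z0 0 - sin th1 * dx z0 0 = 0 \<longrightarrow>
          u0 = Kpred K N0 lam (beta_n p th2 phi) qc h zh u u0 0 \<longrightarrow>
          (\<exists>C. C-lipschitz_on {-h..0} y0) \<longrightarrow> y0 0 = z0 0 \<longrightarrow>
          closed_loop_sol th1 th2 p qt lam phi qc N0 N h K L z0 y0 u0 z zh u \<longrightarrow>
          (\<forall>t\<ge>0. H1_norm_sq (z t) + (\<Sum>n=1..N. (zh n t)^2)
             \<le> M * exp (- 2 * \<delta> * t) *
                (H1_norm_sq z0 + (\<Sum>n=1..N. (zh n 0)^2) + u0^2 + (SUP s\<in>{-h..0}. \<bar>y0 s\<bar>)^2))))
     \<and> (\<forall>h>0. \<exists>N1. \<forall>N\<ge>N1. LMI_feasible p qt th2 lam phi qc \<delta> N0 N h K L)"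
proof -
  interpret sturm_liouville th1 th2 qc p qt q lam phi
    by (rule sturm_liouville.intro[OF th1 th2 p qt q qtq qpos eig])
  show ?thesis
  proof (intro conjI allI impI)
    fix h :: real and N
    assume h: "h > 0" and N: "N \<ge> N0 + 1" and feas: "LMI_feasible p qt th2 lam phi qc \<delta> N0 N h K L"
    show "\<exists>M>0. \<forall>z0 y0 z zh u.
          let u0 = cos th2 * z0 1 + sin th2 * dx z0 1 in
          H2 z0 \<longrightarrow> cos th1 * z0 0 - sin th1 * dx z0 0 = 0 \<longrightarrow>
          u0 = Kpred K N0 lam (beta_n p th2 phi) qc h zh u u0 0 \<longrightarrow>
          (\<exists>C. C-lipschitz_on {-h..0} y0) \<longrightarrow> y0 0 = z0 0 \<longrightarrow>
          closed_loop_sol th1 th2 p qt lam phi qc N0 N h K L z0 y0 u0 z zh u \<longrightarrow>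
          (\<forall>t\<ge>0. H1_norm_sq (z t) + (\<Sum>n=1..N. (zh n t)^2)
             \<le> M * exp (- 2 * \<delta> * t) *
                (H1_norm_sq z0 + (\<Sum>n=1..N. (zh n 0)^2) + u0^2 + (SUP s\<in>{-h..0}. \<bar>y0 s\<bar>)^2))"
    proof (rule LMI_imp_decay[OF \<delta> h N K(1) L feas])
      fix M :: real
      assume M: "M > 0" and D: "\<And>z0 y0 z zh u u0 C t. u0 = cos th2 * z0 1 + sin th2 * dx z0 1 \<Longrightarrow> H2 z0 \<Longrightarrow> C-lipschitz_on {-h..0} y0 \<Longrightarrow>
      closed_loop_sol th1 th2 p qt lam phi qc N0 N h K L z0 y0 u0 z zh u \<Longrightarrow> t \<ge> 0 \<Longrightarrow>
      H1_norm_sq (z t) + (\<Sum>n=1..N. (zh n t)^2) \<le> M * exp (- 2 * \<delta> * t) *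
        (H1_norm_sq z0 + (\<Sum>n=1..N. (zh n 0)^2) + u0^2 + (SUP s\<in>{-h..0}. \<bar>y0 s\<bar>)^2)"
      show ?thesis
        unfolding Let_def
      proof (intro exI[of _ M] conjI M allI impI, goal_cases)
        case (1 z0 y0 z zh u t)
        \<comment> \<open>The Lipschitz constant is obtained after \<open>M\<close> is fixed: the
          bound sees the history only through its supremum.\<close>
        from 1(4) obtain C where C: "C-lipschitz_on {-h..0} y0" by (rule exE)
        show ?case by (rule D[OF refl 1(1) C 1(6,7)])
      qed
    qed
  next
    show "\<exists>N1. \<forall>N\<ge>N1. LMI_feasible p qt th2 lam phi qc \<delta> N0 N h K L" for h
      by (rule LMI_eventually_feasible[OF \<delta> N0 gap K(1) L hurK hurL])
  qed
qed

end
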